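(* Let $q\in\mathbb{C}^*$ not be a root of unity, let $\dot z\in\mathbb{C}^*$, and let $\xi=q^{\mathbb{Z}}$. Then: (1) For any $n\in\mathbb{Z}$, the Verma module $\Delta(q^n,\dot z)$ is simple. (2) For any $n\in\mathbb{Z}$, the modules $\Delta(q^n,\dot z)$ and $\Delta(q^{-n-3},\dot z)$ are simple objects in $\mathcal{O}[q^{\mathbb{Z}},\tilde c_{q^n},\dot z]$. (3) For any $n\in\mathbb{Z}$, the block $\mathcal{O}[q^{\mathbb{Z}},\tilde c_{q^n},\dot z]$ is equivalent to $\mathbb{C}\oplus\mathbb{C}$-mod, the category of finite dimensional modules over the algebra $\mathbb{C}\oplus\mathbb{C}$.
   Context: $U_q(\mathfrak{s})$ (the quantum Schrödinger algebra) is the unital associative $\mathbb{C}$-algebra generated by $E,F,K,K^{-1},X,Y,Z$ with relations: $KK^{-1}=K^{-1}K=1$, $Z$ central, $EF-FE=\frac{K-K^{-1}}{q-q^{-1}}$, $KEK^{-1}=q^2E$, $KFK^{-1}=q^{-2}F$, $KXK^{-1}=qX$, $KYK^{-1}=q^{-1}Y$, $qYX-XY=Z$, $EX=qXE$, $EY=X+q^{-1}YE$, $FX=YK^{-1}+XF$, $FY=YF$. A $U_q(\mathfrak{s})$-module $V$ is a weight module if $V=\bigoplus_{\lambda\in\mathbb{C}^*}V_\lambda$, $V_\lambda=\{v: Kv=\lambda v\}$; $\mathrm{supp}(V)=\{\lambda:V_\lambda\neq0\}$. The category $\mathcal{O}$ is the full subcategory of left $U_q(\mathfrak{s})$-modules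 that are finitely generated, weight, and on which the subalgebra generated by $E,X$ acts locally finitely. For $\lambda\in\mathbb{C}^*$, the Verma module $\Delta(\lambda,\dot z)$ is the universal module generated by a vector $v_\lambda$ with $Ev_\lambda=Xv_\lambda=0$, $Kv_\lambda=\lambda v_\lambda$, $Zv_\lambda=\dot zv_\lambda$ (it has basis $Y^kF^lv_\lambda$, $k,l\ge0$), and $L(\lambda,\dot z)$ is its unique simple quotient. Let $C=FE+\frac{qK+q^{-1}K^{-1}}{(q-q^{-1})^2}$ and $$\tilde C=Z\big((1+q^{-1})C+\tfrac{1}{q^2-1}K^{-1}\big)+X^2F-Y^2EK^{-1}+XY(q^{-1}FE-qEF),$$ which is a central element of $U_q(\mathfrak{s})$. The scalar $\tilde c_\lambda$ is the one by which $\tilde C$ acts on the highest weight vector of $L(\lambda,\dot z)$, namely $\tilde c_\lambda=\frac{\dot z}{(q-q^{-1})^2}\big((q+q^2)\lambda+(q^{-1}+q^{-2})\lambda^{-1}\big)$. For a coset $\xi\in\mathbb{C}^*/q^{\mathbb{Z}}$ and $\dot c\in\mathbb{C}$, $\mathcal{O}[\xi,\dot c,\dot z]$ denotes the full subcategory of $\mathcal{O}$ of modules $M$ with $\mathrm{supp}(M)\subset\xi$ which are annihilated by some power of the maximal ideal $\langle\tilde C-\dot c,\,Z-\dot z\rangle$ of $\mathbb{C}[Z,\tilde C]$.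
   Formalization: In (3) the block is replaced by its full subcategory of modules on which Z acts as the scalar ż; (3) is false for the whole block, which contains nonsplit self-extensions of Verma modules where Z−ż is nilpotent but nonzero. *)

theory Defs
  imports
    Complex_Main
    "HOL-Algebra.Algebra"
    "HOL-Algebra.Chinese_Remainder"
    "HOL-Algebra.Algebraic_Closure_Type"
    "HOL-Library.Poly_Mapping"
begin

section \<open>Categories and equivalences\<close>

text \<open>\<open>Cmp C A B D g f\<close> is the composite of \<open>f : A \<rightarrow> B\<close> and \<open>g : B \<rightarrow> D\<close>.\<close>

record ('o, 'm) category =
  Obj :: "'o set"
  Hom :: "'o \<Rightarrow> 'o \<Rightarrow> 'm set"
  Idn :: "'o \<Rightarrow> 'm"
  Cmp :: "'o \<Rightarrow> 'o \<Rightarrow> 'o \<Rightarrow> 'm \<Rightarrow> 'm \<Rightarrow> 'm"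

definition is_category :: "('o, 'm) category \<Rightarrow> bool" where
  "is_category C \<longleftrightarrow>
     (\<forall>A\<in>Obj C. Idn C A \<in> Hom C A A) \<and>
     (\<forall>A\<in>Obj C. \<forall>B\<in>Obj C. \<forall>D\<in>Obj C. \<forall>f\<in>Hom C A B. \<forall>g\<in>Hom C B D.
        Cmp C A B D g f \<in> Hom C A D) \<and>
     (\<forall>A\<in>Obj C. \<forall>B\<in>Obj C. \<forall>f\<in>Hom C A B.
        Cmp C A A B f (Idn C A) = f \<and> Cmp C A B B (Idn C B) f = f) \<and>
     (\<forall>A\<in>Obj C. \<forall>B\<in>Obj C. \<forall>D\<in>Obj C. \<forall>E\<in>Obj C.
        \<forall>f\<in>Hom C A B. \<forall>g\<in>Hom C B D. \<forall>h\<in>Hom C D E.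
        Cmp C A D E h (Cmp C A B D g f) = Cmp C A B E (Cmp C B D E h g) f)"

definition iso_arrow :: "('o, 'm) category \<Rightarrow> 'o \<Rightarrow> 'o \<Rightarrow> 'm \<Rightarrow> bool" where
  "iso_arrow C A B f \<longleftrightarrow> f \<in> Hom C A B \<and>
     (\<exists>g\<in>Hom C B A. Cmp C A B A g f = Idn C A \<and> Cmp C B A B f g = Idn C B)"

definition mono_arrow :: "('o, 'm) category \<Rightarrow> 'o \<Rightarrow> 'o \<Rightarrow> 'm \<Rightarrow> bool" where
  "mono_arrow C A B f \<longleftrightarrow> f \<in> Hom C A B \<and>
     (\<forall>D\<in>Obj C. \<forall>g\<in>Hom C D A. \<forall>h\<in>Hom C D A.
        Cmp C D A B f g = Cmp C D A B f h \<longrightarrow> g = h)"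

definition zero_object :: "('o, 'm) category \<Rightarrow> 'o \<Rightarrow> bool" where
  "zero_object C A \<longleftrightarrow> A \<in> Obj C \<and>
     (\<forall>B\<in>Obj C. (\<exists>!f. f \<in> Hom C A B) \<and> (\<exists>!f. f \<in> Hom C B A))"

text \<open>A nonzero object whose only subobjects are zero and itself.\<close>

definition simple_object :: "('o, 'm) category \<Rightarrow> 'o \<Rightarrow> bool" where
  "simple_object C S \<longleftrightarrow> S \<in> Obj C \<and> \<not> zero_object C S \<and>
     (\<forall>A\<in>Obj C. \<forall>f. mono_arrow C A S f \<longrightarrow> zero_object C A \<or> iso_arrow C A S f)"

record ('o, 'm, 'p, 'n) cfunctor =
  fob :: "'o \<Rightarrow> 'p"
  far :: "'o \<Rightarrow> 'o \<Rightarrow> 'm \<Rightarrow> 'n"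

definition is_functor ::
    "('o, 'm) category \<Rightarrow> ('p, 'n) category \<Rightarrow> ('o, 'm, 'p, 'n) cfunctor \<Rightarrow> bool" where
  "is_functor C D F \<longleftrightarrow>
     (\<forall>A\<in>Obj C. fob F A \<in> Obj D \<and> far F A A (Idn C A) = Idn D (fob F A)) \<and>
     (\<forall>A\<in>Obj C. \<forall>B\<in>Obj C. \<forall>f\<in>Hom C A B. far F A B f \<in> Hom D (fob F A) (fob F B)) \<and>
     (\<forall>A\<in>Obj C. \<forall>B\<in>Obj C. \<forall>E\<in>Obj C. \<forall>f\<in>Hom C A B. \<forall>g\<in>Hom C B E.
        far F A E (Cmp C A B E g f) =
          Cmp D (fob F A) (fob F B) (fob F E) (far F B E g) (far F A B f))"

definition id_functor :: "('o, 'm, 'o, 'm) cfunctor" where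
  "id_functor = \<lparr>fob = (\<lambda>A. A), far = (\<lambda>A B f. f)\<rparr>"

definition comp_functor ::
    "('p, 'n, 's, 't) cfunctor \<Rightarrow> ('o, 'm, 'p, 'n) cfunctor \<Rightarrow> ('o, 'm, 's, 't) cfunctor" where
  "comp_functor G F =
     \<lparr>fob = (\<lambda>A. fob G (fob F A)),
      far = (\<lambda>A B f. far G (fob F A) (fob F B) (far F A B f))\<rparr>"

definition natural_iso ::
    "('o, 'm) category \<Rightarrow> ('p, 'n) category \<Rightarrow> ('o, 'm, 'p, 'n) cfunctor \<Rightarrow>
     ('o, 'm, 'p, 'n) cfunctor \<Rightarrow> ('o \<Rightarrow> 'n) \<Rightarrow> bool" where
  "natural_iso C D F G \<eta> \<longleftrightarrow>
     (\<forall>A\<in>Obj C. iso_arrow D (fob F A) (fob G A) (\<eta> A)) \<and>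
     (\<forall>A\<in>Obj C. \<forall>B\<in>Obj C. \<forall>f\<in>Hom C A B.
        Cmp D (fob F A) (fob F B) (fob G B) (\<eta> B) (far F A B f) =
        Cmp D (fob F A) (fob G A) (fob G B) (far G A B f) (\<eta> A))"

definition equivalent_categories ::
    "('o, 'm) category \<Rightarrow> ('p, 'n) category \<Rightarrow> bool" where
  "equivalent_categories C D \<longleftrightarrow>
     (\<exists>F G \<eta> \<epsilon>. is_functor C D F \<and> is_functor D C G \<and>
        natural_iso C C id_functor (comp_functor G F) \<eta> \<and>
        natural_iso D D (comp_functor F G) id_functor \<epsilon>)"

section \<open>Left modules over a not necessarily commutative ring\<close>

text \<open>The library's \<open>module\<close> locale insists on a commutative ring of scalars. Its record type
  is reused here; that record extends \<open>ring\<close>, and its \<open>mult\<close> and \<open>one\<close> fields carry no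
  meaning for a module.\<close>

locale left_module = R?: ring R + M?: abelian_group M
  for R :: "'r ring" and M :: "('r, 'a) module" (structure) +
  assumes smult_closed:
      "\<lbrakk>a \<in> carrier R; x \<in> carrier M\<rbrakk> \<Longrightarrow> a \<odot>\<^bsub>M\<^esub> x \<in> carrier M"
    and smult_l_distr:
      "\<lbrakk>a \<in> carrier R; b \<in> carrier R; x \<in> carrier M\<rbrakk> \<Longrightarrow>
       (a \<oplus>\<^bsub>R\<^esub> b) \<odot>\<^bsub>M\<^esub> x = a \<odot>\<^bsub>M\<^esub> x \<oplus>\<^bsub>M\<^esub> b \<odot>\<^bsub>M\<^esub> x"
    and smult_r_distr:
      "\<lbrakk>a \<in> carrier R; x \<in> carrier M; y \<in> carrier M\<rbrakk> \<Longrightarrow>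
       a \<odot>\<^bsub>M\<^esub> (x \<oplus>\<^bsub>M\<^esub> y) = a \<odot>\<^bsub>M\<^esub> x \<oplus>\<^bsub>M\<^esub> a \<odot>\<^bsub>M\<^esub> y"
    and smult_assoc:
      "\<lbrakk>a \<in> carrier R; b \<in> carrier R; x \<in> carrier M\<rbrakk> \<Longrightarrow>
       (a \<otimes>\<^bsub>R\<^esub> b) \<odot>\<^bsub>M\<^esub> x = a \<odot>\<^bsub>M\<^esub> (b \<odot>\<^bsub>M\<^esub> x)"
    and smult_one:
      "x \<in> carrier M \<Longrightarrow> \<one>\<^bsub>R\<^esub> \<odot>\<^bsub>M\<^esub> x = x"

definition left_hom :: "'r ring \<Rightarrow> ('r, 'a) module \<Rightarrow> ('r, 'b) module \<Rightarrow> ('a \<Rightarrow> 'b) set" where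
  "left_hom R M N =
     {f \<in> carrier M \<rightarrow>\<^sub>E carrier N.
        (\<forall>x\<in>carrier M. \<forall>y\<in>carrier M. f (x \<oplus>\<^bsub>M\<^esub> y) = f x \<oplus>\<^bsub>N\<^esub> f y) \<and>
        (\<forall>a\<in>carrier R. \<forall>x\<in>carrier M. f (a \<odot>\<^bsub>M\<^esub> x) = a \<odot>\<^bsub>N\<^esub> f x)}"

text \<open>The full subcategory of the left \<open>R\<close>-modules satisfying \<open>P\<close>; the carriers of the modules
  range over the subsets of the type \<open>'a\<close>. The rings of interest have the cardinality of the
  continuum, so as soon as the complex numbers inject into \<open>'a\<close>, every finitely generated
  module over them is isomorphic to one with carrier in \<open>'a\<close>.\<close>

definition left_mod_cat ::
    "'r ring \<Rightarrow> (('r, 'a) module \<Rightarrow> bool) \<Rightarrow> (('r, 'a) module, 'a \<Rightarrow> 'a) category" where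
  "left_mod_cat R P =
     \<lparr>Obj = {M. left_module R M \<and> P M},
      Hom = left_hom R,
      Idn = (\<lambda>M. \<lambda>x\<in>carrier M. x),
      Cmp = (\<lambda>L M N g f. compose (carrier L) g f)\<rparr>"

lemma left_mod_cat_is_category: "is_category (left_mod_cat R P)"
proof -
  have 1: "(\<lambda>x\<in>carrier M. x) \<in> left_hom R M M" if "left_module R M" for M
  proof -
    interpret left_module R M by fact
    show ?thesis by (auto simp: left_hom_def smult_closed)
  qed
  have 2: "compose (carrier L) g f \<in> left_hom R L N"
    if "left_module R L" "f \<in> left_hom R L M" "g \<in> left_hom R M N" for L M N f g
  proof -
    interpret L: left_module R L by fact
    from that show ?thesis
      by (auto simp: left_hom_def compose_def PiE_iff L.smult_closed)
  qed
  have 3: "compose (carrier L) f (\<lambda>x\<in>carrier L. x) = f \<and>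
      compose (carrier L) (\<lambda>x\<in>carrier M. x) f = f" if "f \<in> left_hom R L M" for L M f
    using that by (auto simp: left_hom_def compose_def PiE_iff fun_eq_iff extensional_def)
  have 4: "compose (carrier L) h (compose (carrier L) g f) =
      compose (carrier L) (compose (carrier M) h g) f" if "f \<in> left_hom R L M" for L M f g h
    using that by (auto simp: left_hom_def compose_def PiE_iff fun_eq_iff)
  show ?thesis
    unfolding is_category_def left_mod_cat_def
    by (simp add: 1 3) (use 2 4 in blast)
qed

definition simple_left_module :: "'r ring \<Rightarrow> ('r, 'a) module \<Rightarrow> bool" where
  "simple_left_module R M \<longleftrightarrow> left_module R M \<and> carrier M \<noteq> {\<zero>\<^bsub>M\<^esub>} \<and>
     (\<forall>N. submodule N R M \<longrightarrow> N = {\<zero>\<^bsub>M\<^esub>} \<or> N = carrier M)"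

definition submodule_gen :: "'r ring \<Rightarrow> ('r, 'a) module \<Rightarrow> 'a set \<Rightarrow> 'a set" where
  "submodule_gen R M S = \<Inter>{N. submodule N R M \<and> S \<subseteq> N}"

definition fin_generated :: "'r ring \<Rightarrow> ('r, 'a) module \<Rightarrow> bool" where
  "fin_generated R M \<longleftrightarrow>
     (\<exists>S. finite S \<and> S \<subseteq> carrier M \<and> submodule_gen R M S = carrier M)"

definition left_regular :: "'r ring \<Rightarrow> ('r, 'r) module" where
  "left_regular R =
     \<lparr>carrier = carrier R, monoid.mult = monoid.mult R, one = \<one>\<^bsub>R\<^esub>, ring.zero = \<zero>\<^bsub>R\<^esub>, add = add R,
      module.smult = monoid.mult R\<rparr>"

lemma left_regular_left_module:
  assumes "ring R"
  shows "left_module R (left_regular R)"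
proof -
  interpret ring R by fact
  have "abelian_group (left_regular R)"
    by (rule abelian_groupI)
       (auto simp: left_regular_def a_ac intro: l_neg a_inv_closed)
  then show ?thesis
    by (simp add: left_module_def left_module_axioms_def ring_axioms)
       (auto simp: left_regular_def l_distr r_distr m_assoc)
qed

lemma (in left_module) submodule_gen_submodule:
  assumes "S \<subseteq> carrier M"
  shows "submodule (submodule_gen R M S) R M"
proof -
  have c: "submodule (carrier M) R M"
    using M.add.subgroup_self smult_closed
    by (auto simp: submodule_def submodule_axioms_def)
  have "subgroup (submodule_gen R M S) (add_monoid M)"
    unfolding submodule_gen_def
    by (rule M.add.subgroups_Inter) (use c assms in \<open>auto simp: submodule_def\<close>)
  then show ?thesis
    by (auto simp: submodule_def submodule_axioms_def submodule_gen_def)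
qed

definition quotient_module :: "('r, 'a) module \<Rightarrow> 'a set \<Rightarrow> ('r, 'a set) module" where
  "quotient_module M N =
     \<lparr>carrier = a_rcosets\<^bsub>M\<^esub> N, monoid.mult = undefined, one = undefined,
      ring.zero = N, add = set_add M,
      module.smult = (\<lambda>r A. \<Union>a\<in>A. N +>\<^bsub>M\<^esub> (r \<odot>\<^bsub>M\<^esub> a))\<rparr>"

lemma (in left_module) quotient_smult:
  assumes N: "submodule N R M" and r: "r \<in> carrier R" and x: "x \<in> carrier M"
  shows "r \<odot>\<^bsub>quotient_module M N\<^esub> (N +>\<^bsub>M\<^esub> x) = N +>\<^bsub>M\<^esub> (r \<odot>\<^bsub>M\<^esub> x)"
proof -
  interpret N: abelian_subgroup N M
    using N by (intro abelian_subgroupI3) (auto simp: additive_subgroup_def submodule_def M.abelian_group_axioms)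
  have "N +>\<^bsub>M\<^esub> (r \<odot>\<^bsub>M\<^esub> (n \<oplus>\<^bsub>M\<^esub> x)) = N +>\<^bsub>M\<^esub> (r \<odot>\<^bsub>M\<^esub> x)" if "n \<in> N" for n
  proof -
    have n: "n \<in> carrier M" "r \<odot>\<^bsub>M\<^esub> n \<in> N"
      using that r N by (auto simp: submodule_def submodule_axioms_def N.a_Hcarr)
    have "N +>\<^bsub>M\<^esub> (r \<odot>\<^bsub>M\<^esub> n \<oplus>\<^bsub>M\<^esub> r \<odot>\<^bsub>M\<^esub> x) = N +>\<^bsub>M\<^esub> (r \<odot>\<^bsub>M\<^esub> x)"
      using n r x N.a_subset smult_closed
      by (metis M.a_coset_add_assoc N.a_rcos_const smult_closed)
    with n r x show ?thesis by (simp add: smult_r_distr)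
  qed
  moreover have "N \<noteq> {}" using N.zero_closed by blast
  ultimately show ?thesis
    by (auto simp: quotient_module_def a_r_coset_def' )
qed

text \<open>For an algebra \<open>R\<close> over the complex numbers with structure map \<open>\<iota>\<close> into \<open>R\<close>:
  \<open>W\<close> is a finite dimensional complex subspace of the \<open>R\<close>-module \<open>M\<close>.\<close>

definition fin_dim :: "(complex \<Rightarrow> 'r) \<Rightarrow> ('r, 'a) module \<Rightarrow> 'a set \<Rightarrow> bool" where
  "fin_dim \<iota> M W \<longleftrightarrow>
     (\<exists>B. finite B \<and> B \<subseteq> carrier M \<and> B \<subseteq> W \<and>
        W = {(\<Oplus>\<^bsub>M\<^esub>b\<in>B. \<iota> (c b) \<odot>\<^bsub>M\<^esub> b) | c. True})"

definition fd_left_mod_cat ::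
    "'r ring \<Rightarrow> (complex \<Rightarrow> 'r) \<Rightarrow> (('r, 'a) module, 'a \<Rightarrow> 'a) category" where
  "fd_left_mod_cat R \<iota> = left_mod_cat R (\<lambda>M. fin_dim \<iota> M (carrier M))"

section \<open>The quantum Schroedinger algebra\<close>

datatype gen = gen_E | gen_F | gen_K | gen_Kinv | gen_X | gen_Y | gen_Z

datatype gword = GWord "gen list"

text \<open>Words form a monoid under concatenation, written additively so that the convolution
  product on \<open>gword \<Rightarrow>\<^sub>0 complex\<close> is the product of the free algebra on \<open>gen\<close>.\<close>

instantiation gword :: monoid_add
begin

definition zero_gword :: gword where
  "zero_gword = GWord []"

fun plus_gword :: "gword \<Rightarrow> gword \<Rightarrow> gword" where
  "plus_gword (GWord u) (GWord v) = GWord (u @ v)"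

instance
proof
  fix a b c :: gword
  show "a + b + c = a + (b + c)" by (cases a; cases b; cases c) simp
  show "0 + a = a" by (cases a) (simp add: zero_gword_def)
  show "a + 0 = a" by (cases a) (simp add: zero_gword_def)
qed

end

type_synonym free_alg = "gword \<Rightarrow>\<^sub>0 complex"
type_synonym uq = "free_alg set"

definition const :: "complex \<Rightarrow> free_alg" where
  "const c = Poly_Mapping.single 0 c"

definition gvar :: "gen \<Rightarrow> free_alg" where
  "gvar g = Poly_Mapping.single (GWord [g]) 1"

abbreviation "fE \<equiv> gvar gen_E"
abbreviation "fF \<equiv> gvar gen_F"
abbreviation "fK \<equiv> gvar gen_K"
abbreviation "fKinv \<equiv> gvar gen_Kinv"
abbreviation "fX \<equiv> gvar gen_X"
abbreviation "fY \<equiv> gvar gen_Y"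
abbreviation "fZ \<equiv> gvar gen_Z"

definition relators :: "complex \<Rightarrow> free_alg set" where
  "relators q =
     {fK * fKinv - 1, fKinv * fK - 1} \<union>
     {fZ * gvar g - gvar g * fZ | g. True} \<union>
     {fE * fF - fF * fE - const (1 / (q - 1 / q)) * (fK - fKinv),
      fK * fE * fKinv - const (q\<^sup>2) * fE,
      fK * fF * fKinv - const (1 / q\<^sup>2) * fF,
      fK * fX * fKinv - const q * fX,
      fK * fY * fKinv - const (1 / q) * fY,
      const q * fY * fX - fX * fY - fZ,
      fE * fX - const q * fX * fE,
      fE * fY - (fX + const (1 / q) * fY * fE),
      fF * fX - (fY * fKinv + fX * fF),
      fF * fY - fY * fF}"

abbreviation free_ring :: "free_alg ring" where
  "free_ring \<equiv> ring_of_type_algebra"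

definition rel_ideal :: "complex \<Rightarrow> free_alg set" where
  "rel_ideal q = Idl\<^bsub>free_ring\<^esub> (relators q)"

definition Uq :: "complex \<Rightarrow> uq ring" where
  "Uq q = free_ring Quot (rel_ideal q)"

definition cls :: "complex \<Rightarrow> free_alg \<Rightarrow> uq" where
  "cls q a = rel_ideal q +>\<^bsub>free_ring\<^esub> a"

definition scal :: "complex \<Rightarrow> complex \<Rightarrow> uq" where
  "scal q c = cls q (const c)"

lemma free_ring_ring: "ring free_ring"
proof -
  have "\<exists>y. x + y = 0" for x :: free_alg
    using add.right_inverse by blast
  thus ?thesis
    unfolding ring_of_type_algebra_def using add.right_inverse
    by unfold_locales (auto simp: algebra_simps Units_def)
qed

lemma rel_ideal_ideal: "ideal (rel_ideal q) free_ring"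
  unfolding rel_ideal_def
  by (rule ring.genideal_ideal[OF free_ring_ring]) (simp add: ring_of_type_algebra_def)

lemma Uq_ring: "ring (Uq q)"
  unfolding Uq_def by (rule ideal.quotient_is_ring[OF rel_ideal_ideal])

definition fC :: "complex \<Rightarrow> free_alg" where
  "fC q = fF * fE + const (1 / (q - 1 / q)\<^sup>2) * (const q * fK + const (1 / q) * fKinv)"

definition fCtilde :: "complex \<Rightarrow> free_alg" where
  "fCtilde q =
     fZ * (const (1 + 1 / q) * fC q + const (1 / (q\<^sup>2 - 1)) * fKinv)
     + fX ^ 2 * fF - fY ^ 2 * fE * fKinv
     + fX * fY * (const (1 / q) * fF * fE - const q * fE * fF)"

text \<open>The scalar by which \<open>fCtilde\<close> acts on a highest weight vector of weight \<open>\<mu>\<close> and central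
  charge \<open>z\<close>.\<close>

definition ctilde :: "complex \<Rightarrow> complex \<Rightarrow> complex \<Rightarrow> complex" where
  "ctilde q z \<mu> =
     z / (q - 1 / q)\<^sup>2 * ((q + q\<^sup>2) * \<mu> + (1 / q + 1 / q\<^sup>2) * (1 / \<mu>))"

text \<open>The universal highest weight module, realised as the quotient of the algebra by the left
  ideal generated by \<open>E\<close>, \<open>X\<close>, \<open>K - \<mu>\<close>, \<open>Z - z\<close>; the highest weight vector is the class of
  the unit.\<close>

definition verma :: "complex \<Rightarrow> complex \<Rightarrow> complex \<Rightarrow> (uq, uq set) module" where
  "verma q \<mu> z =
     quotient_module (left_regular (Uq q))
       (submodule_gen (Uq q) (left_regular (Uq q))
          {cls q fE, cls q fX, cls q (fK - const \<mu>), cls q (fZ - const z)})"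

section \<open>Category O\<close>

definition weight_space :: "complex \<Rightarrow> (uq, 'a) module \<Rightarrow> complex \<Rightarrow> 'a set" where
  "weight_space q M \<mu> = {v \<in> carrier M. cls q fK \<odot>\<^bsub>M\<^esub> v = scal q \<mu> \<odot>\<^bsub>M\<^esub> v}"

text \<open>Every vector is, in exactly one way, a finite sum of weight vectors of distinct nonzero
  weights.\<close>

definition weight_module :: "complex \<Rightarrow> (uq, 'a) module \<Rightarrow> bool" where
  "weight_module q M \<longleftrightarrow>
     (\<forall>v\<in>carrier M. \<exists>!f :: complex \<Rightarrow> 'a.
        (\<forall>\<mu>. \<mu> \<noteq> 0 \<longrightarrow> f \<mu> \<in> weight_space q M \<mu>) \<and> f 0 = \<zero>\<^bsub>M\<^esub> \<and>
        finite {\<mu>. f \<mu> \<noteq> \<zero>\<^bsub>M\<^esub>} \<and>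
        v = (\<Oplus>\<^bsub>M\<^esub>\<mu>\<in>{\<mu>. f \<mu> \<noteq> \<zero>\<^bsub>M\<^esub>}. f \<mu>))"

definition supp :: "complex \<Rightarrow> (uq, 'a) module \<Rightarrow> complex set" where
  "supp q M = {\<mu>. \<mu> \<noteq> 0 \<and> weight_space q M \<mu> \<noteq> {\<zero>\<^bsub>M\<^esub>}}"

text \<open>The complex subalgebra with unit generated by \<open>S\<close>.\<close>

definition subalg_gen :: "complex \<Rightarrow> uq set \<Rightarrow> uq set" where
  "subalg_gen q S = generate_ring (Uq q) (range (scal q) \<union> S)"

definition in_cat_O :: "complex \<Rightarrow> (uq, 'a) module \<Rightarrow> bool" where
  "in_cat_O q M \<longleftrightarrow>
     left_module (Uq q) M \<and> fin_generated (Uq q) M \<and> weight_module q M \<and>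
     (\<forall>v\<in>carrier M.
        fin_dim (scal q) M ((\<lambda>u. u \<odot>\<^bsub>M\<^esub> v) ` subalg_gen q {cls q fE, cls q fX}))"

definition ZC_ring :: "complex \<Rightarrow> uq ring" where
  "ZC_ring q = (Uq q)\<lparr>carrier := subalg_gen q {cls q fZ, cls q (fCtilde q)}\<rparr>"

definition ZC_ideal :: "complex \<Rightarrow> complex \<Rightarrow> complex \<Rightarrow> uq set" where
  "ZC_ideal q c z =
     Idl\<^bsub>ZC_ring q\<^esub> {cls q (fCtilde q - const c), cls q (fZ - const z)}"

text \<open>The ideals of a ring form a monoid \<open>ideals_set\<close> under the product of ideals.\<close>

definition in_O_block ::
    "complex \<Rightarrow> complex set \<Rightarrow> complex \<Rightarrow> complex \<Rightarrow> (uq, 'a) module \<Rightarrow> bool" where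
  "in_O_block q \<xi> c z M \<longleftrightarrow> in_cat_O q M \<and> supp q M \<subseteq> \<xi> \<and>
     (\<exists>k::nat. \<forall>a \<in> ZC_ideal q c z [^]\<^bsub>ideals_set (ZC_ring q)\<^esub> k.
        \<forall>v\<in>carrier M. a \<odot>\<^bsub>M\<^esub> v = \<zero>\<^bsub>M\<^esub>)"

definition O_block ::
    "complex \<Rightarrow> complex set \<Rightarrow> complex \<Rightarrow> complex \<Rightarrow>
     ((uq, 'a) module, 'a \<Rightarrow> 'a) category" where
  "O_block q \<xi> c z = left_mod_cat (Uq q) (in_O_block q \<xi> c z)"

definition central_charge :: "complex \<Rightarrow> complex \<Rightarrow> (uq, 'a) module \<Rightarrow> bool" where
  "central_charge q z M \<longleftrightarrow>
     (\<forall>v\<in>carrier M. cls q fZ \<odot>\<^bsub>M\<^esub> v = scal q z \<odot>\<^bsub>M\<^esub> v)"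

text \<open>The part of \<open>O_block\<close> of central charge \<open>z\<close>. Annihilation by a power of the ideal only
  forces \<open>Z - z\<close> to be nilpotent, and \<open>O_block\<close> contains nonsplit self-extensions of Verma modules
  on which \<open>Z\<close> is not semisimple: the quotient of the algebra by the left ideal generated by
  \<open>E\<close>, \<open>X\<close>, \<open>K - \<mu>\<close>, \<open>(Z - z)\<^sup>2\<close> is one. So \<open>O_block\<close> itself is not semisimple; the
  full subcategory on which \<open>Z\<close> acts as the scalar \<open>z\<close> is the one to compare with
  modules over a semisimple algebra.\<close>

definition O_block_charge ::
    "complex \<Rightarrow> complex set \<Rightarrow> complex \<Rightarrow> complex \<Rightarrow>
     ((uq, 'a) module, 'a \<Rightarrow> 'a) category" where
  "O_block_charge q \<xi> c z =
     left_mod_cat (Uq q) (\<lambda>M. in_O_block q \<xi> c z M \<and> central_charge q z M)"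

definition qpowers :: "complex \<Rightarrow> complex set" where
  "qpowers q = range (\<lambda>k::int. q powi k)"

definition CC :: "(complex \<times> complex) ring" where
  "CC = RDirProd (ring_of_type_algebra :: complex ring) (ring_of_type_algebra :: complex ring)"

definition CC_scal :: "complex \<Rightarrow> complex \<times> complex" where
  "CC_scal c = (c, c)"

end

theory Submission
  imports Defs "HOL-Library.Function_Algebras" "HOL-Analysis.Abstract_Topology_2"
begin

text \<open>For central charge \<open>z \<noteq> 0\<close> the element \<open>F' = F - Y^2 K^{-1} / ((1 + q) z)\<close> preserves the kernel
  of \<open>X\<close>, and there \<open>E F' - F' E = (q K - K^{-1}) / (q^2 - 1)\<close>. So \<open>E F'^j v\<close> is, for a highest weight
  vector \<open>v\<close> of weight \<open>\<mu>\<close>, a multiple of \<open>F'^{j-1} v\<close>, and the factor vanishes for no \<open>j > 0\<close> if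
  \<open>\<mu>\<close> is an integral power of \<open>q\<close>. Hence the module with basis \<open>Y^k F'^j v\<close> has no highest
  weight vectors besides the multiples of \<open>v\<close> and is simple. The same computation shows that a
  module in the block on which \<open>Z\<close> acts as \<open>z\<close> is freely generated by a basis of its highest weight
  vectors, whose weights can only be \<open>q^n\<close> and \<open>q^{-n-3}\<close> because the central element determines them.
  It is thus a finite direct sum of the two simple modules, and morphisms are block matrices, exactly
  as for modules over the sum of two copies of the complex numbers.\<close>

section \<open>Categories presented by a set of representatives\<close>

text \<open>The correction in \<open>F'\<close> is forced: if \<open>X v = 0\<close> and
  \<open>K v = \<mu> v\<close>, then \<open>X F v = - \<mu>^{-1} Y v\<close> and
  \<open>X Y^2 v = - (1 + q) z Y v\<close>, so exactly the multiple \<open>1 / ((1 + q) z)\<close>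
  of \<open>Y^2 K^{-1}\<close> cancels. A vanishing factor at \<open>\<mu> = q^n\<close> would mean
  \<open>q^{3 + 2n - 2j} = 1\<close>, which parity excludes; parity also keeps \<open>n\<close> and
  \<open>-n - 3\<close> apart. Independence of the vectors \<open>Y^k F'^j v\<close> in a Verma
  module, a statement of PBW type, comes from writing the operators down on formal combinations and
  checking the relations there. Two formal obstacles shape the rest. Carriers are sets in arbitrary
  types, so every module is first embedded into a space of complex-valued functions, where the
  theory of \<open>vector_space\<close> applies. The block and the modules over \<open>CC\<close>
  live in unrelated types, so each is compared with one category \<open>mat_cat\<close> of block
  matrices between words in two letters, and the two comparisons are combined. The equivalence
  concerns the modules on which \<open>Z\<close> acts as \<open>z\<close>, whereas simplicity of an
  object is tested against monomorphisms from the whole block.\<close>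

lemma category_cmp:
  "\<lbrakk>is_category C; A \<in> Obj C; B \<in> Obj C; D \<in> Obj C; f \<in> Hom C A B; g \<in> Hom C B D\<rbrakk>
    \<Longrightarrow> Cmp C A B D g f \<in> Hom C A D"
  by (simp add: is_category_def)

lemma category_id: "\<lbrakk>is_category C; A \<in> Obj C\<rbrakk> \<Longrightarrow> Idn C A \<in> Hom C A A"
  by (simp add: is_category_def)

lemma category_id_right:
  "\<lbrakk>is_category C; A \<in> Obj C; B \<in> Obj C; f \<in> Hom C A B\<rbrakk> \<Longrightarrow> Cmp C A A B f (Idn C A) = f"
  by (simp add: is_category_def)

lemma category_id_left:
  "\<lbrakk>is_category C; A \<in> Obj C; B \<in> Obj C; f \<in> Hom C A B\<rbrakk> \<Longrightarrow> Cmp C A B B (Idn C B) f = f"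
  by (simp add: is_category_def)

lemma category_assoc:
  "\<lbrakk>is_category C; A \<in> Obj C; B \<in> Obj C; D \<in> Obj C; E \<in> Obj C;
    f \<in> Hom C A B; g \<in> Hom C B D; h \<in> Hom C D E\<rbrakk>
    \<Longrightarrow> Cmp C A D E h (Cmp C A B D g f) = Cmp C A B E (Cmp C B D E h g) f"
  by (simp add: is_category_def)

lemma iso_arrow_comp:
  assumes C: "is_category C" "A \<in> Obj C" "B \<in> Obj C" "D \<in> Obj C"
    and f: "iso_arrow C A B f" and g: "iso_arrow C B D g"
  shows "iso_arrow C A D (Cmp C A B D g f)"
proof -
  obtain f' where f': "f \<in> Hom C A B" "f' \<in> Hom C B A"
      "Cmp C A B A f' f = Idn C A" "Cmp C B A B f f' = Idn C B"
    using f by (auto simp: iso_arrow_def)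
  obtain g' where g': "g \<in> Hom C B D" "g' \<in> Hom C D B"
      "Cmp C B D B g' g = Idn C B" "Cmp C D B D g g' = Idn C D"
    using g by (auto simp: iso_arrow_def)
  note [simp] = category_cmp[OF C(1)] category_id[OF C(1)] category_id_left[OF C(1)]
    category_id_right[OF C(1)] C f' g'
  have "Cmp C A D A (Cmp C D B A f' g') (Cmp C A B D g f)
      = Cmp C A B A f' (Cmp C A D B g' (Cmp C A B D g f))"
    by (subst category_assoc[OF C(1), of A D B A]) simp_all
  also have "Cmp C A D B g' (Cmp C A B D g f) = f"
    by (subst category_assoc[OF C(1), of A B D B]) simp_all
  finally have 1: "Cmp C A D A (Cmp C D B A f' g') (Cmp C A B D g f) = Idn C A" by simp
  have "Cmp C D A D (Cmp C A B D g f) (Cmp C D B A f' g')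
      = Cmp C D B D g (Cmp C D A B f (Cmp C D B A f' g'))"
    by (subst category_assoc[OF C(1), of D A B D]) simp_all
  also have "Cmp C D A B f (Cmp C D B A f' g') = g'"
    by (subst category_assoc[OF C(1), of D B A B]) simp_all
  finally have 2: "Cmp C D A D (Cmp C A B D g f) (Cmp C D B A f' g') = Idn C D" by simp
  show ?thesis
    unfolding iso_arrow_def using 1 2 by (auto intro!: bexI[of _ "Cmp C D B A f' g'"])
qed

text \<open>Inverses of the components are again natural. The symmetric construction below yields
  for both composites a transformation out of the identity, whereas an equivalence asks for one into
  the identity on the side of \<open>D\<close>.\<close>

lemma natural_iso_sym:
  assumes D: "is_category D"
    and F: "is_functor C D F" and G: "is_functor C D G" and \<eta>: "natural_iso C D F G \<eta>"
  shows "\<exists>\<epsilon>. natural_iso C D G F \<epsilon>"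
proof -
  define \<epsilon> where "\<epsilon> = (\<lambda>A. SOME g. g \<in> Hom D (fob G A) (fob F A) \<and>
      Cmp D (fob F A) (fob G A) (fob F A) g (\<eta> A) = Idn D (fob F A) \<and>
      Cmp D (fob G A) (fob F A) (fob G A) (\<eta> A) g = Idn D (fob G A))"
  have \<epsilon>: "\<epsilon> A \<in> Hom D (fob G A) (fob F A)"
      "Cmp D (fob F A) (fob G A) (fob F A) (\<epsilon> A) (\<eta> A) = Idn D (fob F A)"
      "Cmp D (fob G A) (fob F A) (fob G A) (\<eta> A) (\<epsilon> A) = Idn D (fob G A)"
      "\<eta> A \<in> Hom D (fob F A) (fob G A)" if "A \<in> Obj C" for A
  proof -
    have "\<exists>g. g \<in> Hom D (fob G A) (fob F A) \<and>
      Cmp D (fob F A) (fob G A) (fob F A) g (\<eta> A) = Idn D (fob F A) \<and>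
      Cmp D (fob G A) (fob F A) (fob G A) (\<eta> A) g = Idn D (fob G A)"
      using \<eta> that by (auto simp: natural_iso_def iso_arrow_def)
    from someI_ex[OF this] show "\<epsilon> A \<in> Hom D (fob G A) (fob F A)"
      "Cmp D (fob F A) (fob G A) (fob F A) (\<epsilon> A) (\<eta> A) = Idn D (fob F A)"
      "Cmp D (fob G A) (fob F A) (fob G A) (\<eta> A) (\<epsilon> A) = Idn D (fob G A)"
      by (auto simp: \<epsilon>_def)
    show "\<eta> A \<in> Hom D (fob F A) (fob G A)"
      using \<eta> that by (auto simp: natural_iso_def iso_arrow_def)
  qed
  have ob: "fob F A \<in> Obj D" "fob G A \<in> Obj D" if "A \<in> Obj C" for A
    using F G that by (auto simp: is_functor_def)
  have ar: "far F A B f \<in> Hom D (fob F A) (fob F B)" "far G A B f \<in> Hom D (fob G A) (fob G B)"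
    if "A \<in> Obj C" "B \<in> Obj C" "f \<in> Hom C A B" for A B f
    using F G that by (auto simp: is_functor_def)
  note [simp] = category_cmp[OF D] category_id[OF D] category_id_left[OF D]
    category_id_right[OF D] \<epsilon> ob ar
  have "Cmp D (fob G A) (fob G B) (fob F B) (\<epsilon> B) (far G A B f) =
        Cmp D (fob G A) (fob F A) (fob F B) (far F A B f) (\<epsilon> A)"
    if [simp]: "A \<in> Obj C" "B \<in> Obj C" "f \<in> Hom C A B" for A B f
  proof -
    have nat: "Cmp D (fob F A) (fob F B) (fob G B) (\<eta> B) (far F A B f) =
        Cmp D (fob F A) (fob G A) (fob G B) (far G A B f) (\<eta> A)"
      using \<eta> by (simp add: natural_iso_def)
    have "far G A B f = Cmp D (fob G A) (fob F A) (fob G B)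
        (Cmp D (fob F A) (fob G A) (fob G B) (far G A B f) (\<eta> A)) (\<epsilon> A)"
      by (subst category_assoc[OF D, symmetric]) simp_all
    also have "\<dots> = Cmp D (fob G A) (fob F B) (fob G B) (\<eta> B)
        (Cmp D (fob G A) (fob F A) (fob F B) (far F A B f) (\<epsilon> A))"
      unfolding nat[symmetric] by (subst category_assoc[OF D]) simp_all
    finally have "far G A B f = \<dots>" .
    then show ?thesis
      by (simp add: category_assoc[OF D, of "fob G A" "fob F B" "fob G B" "fob F B"])
  qed
  then have "natural_iso C D G F \<epsilon>"
    unfolding natural_iso_def iso_arrow_def using \<epsilon> by blast
  then show ?thesis by blast
qed

text \<open>An equivalence from \<open>C\<close> to \<open>K\<close>, unpacked: \<open>S\<close> picks objects of \<open>C\<close>, \<open>a\<close> identifies every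
  object with a picked one, and \<open>\<Phi>\<close> identifies the morphisms between picked objects.\<close>

locale presentation =
  fixes K :: "('i, 'k) category" and C :: "('o, 'm) category"
    and S :: "'i \<Rightarrow> 'o" and \<Phi> :: "'i \<Rightarrow> 'i \<Rightarrow> 'm \<Rightarrow> 'k"
    and ob :: "'o \<Rightarrow> 'i" and a a' :: "'o \<Rightarrow> 'm"
  assumes catK: "is_category K" and catC: "is_category C"
    and S [simp]: "i \<in> Obj K \<Longrightarrow> S i \<in> Obj C"
    and ob [simp]: "A \<in> Obj C \<Longrightarrow> ob A \<in> Obj K"
    and a [simp]: "A \<in> Obj C \<Longrightarrow> a A \<in> Hom C A (S (ob A))"
    and a' [simp]: "A \<in> Obj C \<Longrightarrow> a' A \<in> Hom C (S (ob A)) A"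
    and a'a [simp]: "A \<in> Obj C \<Longrightarrow> Cmp C A (S (ob A)) A (a' A) (a A) = Idn C A"
    and aa' [simp]: "A \<in> Obj C \<Longrightarrow> Cmp C (S (ob A)) A (S (ob A)) (a A) (a' A) = Idn C (S (ob A))"
    and \<Phi>_bij: "\<lbrakk>i \<in> Obj K; j \<in> Obj K\<rbrakk> \<Longrightarrow> bij_betw (\<Phi> i j) (Hom C (S i) (S j)) (Hom K i j)"
    and \<Phi>_id [simp]: "i \<in> Obj K \<Longrightarrow> \<Phi> i i (Idn C (S i)) = Idn K i"
    and \<Phi>_cmp: "\<lbrakk>i \<in> Obj K; j \<in> Obj K; k \<in> Obj K; f \<in> Hom C (S i) (S j); g \<in> Hom C (S j) (S k)\<rbrakk>
        \<Longrightarrow> \<Phi> i k (Cmp C (S i) (S j) (S k) g f) = Cmp K i j k (\<Phi> j k g) (\<Phi> i j f)"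
begin

lemmas catC_rules [simp] = category_cmp[OF catC] category_id[OF catC] category_id_left[OF catC]
  category_id_right[OF catC]
lemmas catK_rules [simp] = category_cmp[OF catK] category_id[OF catK] category_id_left[OF catK]
  category_id_right[OF catK]

text \<open>\<open>ob\<close> with \<open>P\<close> is a functor from \<open>C\<close> to
  \<open>K\<close>: a morphism is conjugated by the chosen isomorphisms and then read in
  \<open>K\<close>. \<open>S\<close> with \<open>Q\<close> is a quasi-inverse.\<close>

definition P where
  "P A B f = \<Phi> (ob A) (ob B)
     (Cmp C (S (ob A)) A (S (ob B)) (Cmp C A B (S (ob B)) (a B) f) (a' A))"

definition Q where "Q i j u = inv_into (Hom C (S i) (S j)) (\<Phi> i j) u"

lemma \<Phi>_closed [simp]:
  "\<lbrakk>i \<in> Obj K; j \<in> Obj K; f \<in> Hom C (S i) (S j)\<rbrakk> \<Longrightarrow> \<Phi> i j f \<in> Hom K i j"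
  using \<Phi>_bij bij_betwE by blast

lemma Q_closed [simp]:
  "\<lbrakk>i \<in> Obj K; j \<in> Obj K; u \<in> Hom K i j\<rbrakk> \<Longrightarrow> Q i j u \<in> Hom C (S i) (S j)"
  unfolding Q_def using \<Phi>_bij by (metis bij_betw_imp_surj_on inv_into_into)

lemma \<Phi>_Q [simp]: "\<lbrakk>i \<in> Obj K; j \<in> Obj K; u \<in> Hom K i j\<rbrakk> \<Longrightarrow> \<Phi> i j (Q i j u) = u"
  unfolding Q_def using \<Phi>_bij by (metis bij_betw_inv_into_right)

lemma Q_\<Phi> [simp]: "\<lbrakk>i \<in> Obj K; j \<in> Obj K; f \<in> Hom C (S i) (S j)\<rbrakk> \<Longrightarrow> Q i j (\<Phi> i j f) = f"
  unfolding Q_def using \<Phi>_bij by (metis bij_betw_inv_into_left)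

lemma Q_id [simp]: "i \<in> Obj K \<Longrightarrow> Q i i (Idn K i) = Idn C (S i)"
  using Q_\<Phi>[of i i "Idn C (S i)"] by simp

lemma Q_cmp:
  assumes [simp]: "i \<in> Obj K" "j \<in> Obj K" "k \<in> Obj K" "u \<in> Hom K i j" "v \<in> Hom K j k"
  shows "Q i k (Cmp K i j k v u) = Cmp C (S i) (S j) (S k) (Q j k v) (Q i j u)"
  using Q_\<Phi>[of i k "Cmp C (S i) (S j) (S k) (Q j k v) (Q i j u)"] by (simp add: \<Phi>_cmp)

lemma P_closed [simp]:
  "\<lbrakk>A \<in> Obj C; B \<in> Obj C; f \<in> Hom C A B\<rbrakk> \<Longrightarrow> P A B f \<in> Hom K (ob A) (ob B)"
  unfolding P_def by simp

lemma P_id [simp]: "A \<in> Obj C \<Longrightarrow> P A A (Idn C A) = Idn K (ob A)"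
  unfolding P_def by simp

text \<open>The square saying that \<open>a\<close> is natural from the identity to the composite of
  \<open>P\<close> and \<open>Q\<close>. Functoriality of \<open>P\<close> and the naturality
  arguments below rest on it.\<close>

lemma Q_P:
  assumes [simp]: "A \<in> Obj C" "B \<in> Obj C" "f \<in> Hom C A B"
  shows "Cmp C A (S (ob A)) (S (ob B)) (Q (ob A) (ob B) (P A B f)) (a A)
       = Cmp C A B (S (ob B)) (a B) f"
  unfolding P_def by (simp add: category_assoc[OF catC, symmetric])

lemma P_cmp:
  assumes [simp]: "A \<in> Obj C" "B \<in> Obj C" "D \<in> Obj C" "f \<in> Hom C A B" "g \<in> Hom C B D"
  shows "P A D (Cmp C A B D g f) = Cmp K (ob A) (ob B) (ob D) (P B D g) (P A B f)"
proof -
  have "Cmp C A (S (ob A)) (S (ob D)) (Cmp C (S (ob A)) (S (ob B)) (S (ob D))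
      (Q (ob B) (ob D) (P B D g)) (Q (ob A) (ob B) (P A B f))) (a A)
      = Cmp C A B (S (ob D)) (Cmp C B (S (ob B)) (S (ob D)) (Q (ob B) (ob D) (P B D g)) (a B)) f"
    by (simp add: category_assoc[OF catC, of A "S (ob A)" "S (ob B)" "S (ob D)", symmetric] Q_P
        category_assoc[OF catC, of A B "S (ob B)" "S (ob D)"])
  also have "\<dots> = Cmp C A D (S (ob D)) (a D) (Cmp C A B D g f)"
    by (simp add: Q_P category_assoc[OF catC])
  finally have e: "Cmp C A (S (ob A)) (S (ob D)) (Cmp C (S (ob A)) (S (ob B)) (S (ob D))
      (Q (ob B) (ob D) (P B D g)) (Q (ob A) (ob B) (P A B f))) (a A)
      = Cmp C A D (S (ob D)) (a D) (Cmp C A B D g f)" .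
  have "P A D (Cmp C A B D g f) = \<Phi> (ob A) (ob D) (Cmp C (S (ob A)) (S (ob B)) (S (ob D))
      (Q (ob B) (ob D) (P B D g)) (Q (ob A) (ob B) (P A B f)))"
    unfolding P_def[of A D] e[symmetric]
    by (simp add: category_assoc[OF catC, of "S (ob A)" A "S (ob A)" "S (ob D)", symmetric])
  then show ?thesis by (simp add: \<Phi>_cmp)
qed

end

text \<open>Both functors pass through \<open>K\<close>: \<open>F\<close> is \<open>P\<close> of the
  first presentation followed by \<open>Q\<close> of the second, and \<open>G\<close> is the
  reverse. The roles of \<open>C\<close> and \<open>D\<close> are symmetric, so treating one
  composite covers the other.\<close>

lemma presentation_natural_iso:
  assumes "presentation K C S1 \<Phi>1 ob1 a1 a1'" and "presentation K D S2 \<Phi>2 ob2 a2 a2'"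
  defines "F \<equiv> \<lparr>fob = (\<lambda>A. S2 (ob1 A)), far = (\<lambda>A B f. presentation.Q D S2 \<Phi>2 (ob1 A) (ob1 B)
                 (presentation.P C S1 \<Phi>1 ob1 a1 a1' A B f))\<rparr>"
    and "G \<equiv> \<lparr>fob = (\<lambda>A. S1 (ob2 A)), far = (\<lambda>A B f. presentation.Q C S1 \<Phi>1 (ob2 A) (ob2 B)
                 (presentation.P D S2 \<Phi>2 ob2 a2 a2' A B f))\<rparr>"
  shows "is_functor C D F"
    and "\<exists>\<eta>. natural_iso C C id_functor (comp_functor G F) \<eta>"
proof -
  interpret p1: presentation K C S1 \<Phi>1 ob1 a1 a1' by fact
  interpret p2: presentation K D S2 \<Phi>2 ob2 a2 a2' by fact
  show "is_functor C D F"
    unfolding is_functor_def F_def by (simp add: p1.P_cmp p2.Q_cmp)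
  \<comment> \<open>\<open>ob2 (S2 i)\<close> need not be \<open>i\<close>; the isomorphism between
    them in \<open>K\<close> is the image of \<open>a2 (S2 i)\<close>. It is what
    \<open>\<eta>\<close> has to add to \<open>a1\<close>.\<close>
  define \<beta> where "\<beta> i = \<Phi>2 i (ob2 (S2 i)) (a2 (S2 i))" for i
  define \<beta>' where "\<beta>' i = \<Phi>2 (ob2 (S2 i)) i (a2' (S2 i))" for i
  have \<beta>: "\<beta> i \<in> Hom K i (ob2 (S2 i))" "\<beta>' i \<in> Hom K (ob2 (S2 i)) i"
      "Cmp K i (ob2 (S2 i)) i (\<beta>' i) (\<beta> i) = Idn K i"
      "Cmp K (ob2 (S2 i)) i (ob2 (S2 i)) (\<beta> i) (\<beta>' i) = Idn K (ob2 (S2 i))"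
    if "i \<in> Obj K" for i
    unfolding \<beta>_def \<beta>'_def using that by (simp_all flip: p2.\<Phi>_cmp)
  have \<beta>n: "Cmp K i (ob2 (S2 i)) (ob2 (S2 j)) (p2.P (S2 i) (S2 j) (p2.Q i j u)) (\<beta> i)
        = Cmp K i j (ob2 (S2 j)) (\<beta> j) u"
    if [simp]: "i \<in> Obj K" "j \<in> Obj K" "u \<in> Hom K i j" for i j u
  proof -
    have "Cmp K i (ob2 (S2 i)) (ob2 (S2 j)) (p2.P (S2 i) (S2 j) (p2.Q i j u)) (\<beta> i)
      = \<Phi>2 i (ob2 (S2 j)) (Cmp D (S2 i) (S2 (ob2 (S2 i))) (S2 (ob2 (S2 j)))
          (p2.Q (ob2 (S2 i)) (ob2 (S2 j)) (p2.P (S2 i) (S2 j) (p2.Q i j u))) (a2 (S2 i)))"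
      unfolding \<beta>_def by (simp add: p2.\<Phi>_cmp)
    also have "\<dots> = Cmp K i j (ob2 (S2 j)) (\<beta> j) u"
      unfolding p2.Q_P[OF p2.S[OF that(1)] p2.S[OF that(2)] p2.Q_closed[OF that]] \<beta>_def
      by (simp add: p2.\<Phi>_cmp)
    finally show ?thesis .
  qed
  define \<eta> where "\<eta> A = Cmp C A (S1 (ob1 A)) (S1 (ob2 (S2 (ob1 A))))
     (p1.Q (ob1 A) (ob2 (S2 (ob1 A))) (\<beta> (ob1 A))) (a1 A)" for A
  have iso: "iso_arrow C A (S1 (ob2 (S2 (ob1 A)))) (\<eta> A)" if [simp]: "A \<in> Obj C" for A
    unfolding \<eta>_def
  proof (rule iso_arrow_comp[OF p1.catC])
    show "iso_arrow C A (S1 (ob1 A)) (a1 A)"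
      unfolding iso_arrow_def by (auto intro!: bexI[of _ "a1' A"])
    show "iso_arrow C (S1 (ob1 A)) (S1 (ob2 (S2 (ob1 A))))
        (p1.Q (ob1 A) (ob2 (S2 (ob1 A))) (\<beta> (ob1 A)))"
      unfolding iso_arrow_def
      by (auto intro!: bexI[of _ "p1.Q (ob2 (S2 (ob1 A))) (ob1 A) (\<beta>' (ob1 A))"]
          simp: \<beta> simp flip: p1.Q_cmp)
  qed simp_all
  have nat: "Cmp C A B (S1 (ob2 (S2 (ob1 B)))) (\<eta> B) f =
      Cmp C A (S1 (ob2 (S2 (ob1 A)))) (S1 (ob2 (S2 (ob1 B))))
        (p1.Q (ob2 (S2 (ob1 A))) (ob2 (S2 (ob1 B)))
          (p2.P (S2 (ob1 A)) (S2 (ob1 B)) (p2.Q (ob1 A) (ob1 B) (p1.P A B f)))) (\<eta> A)"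
    (is "?l = Cmp C A ?A' ?B' (p1.Q _ _ ?w) _")
    if [simp]: "A \<in> Obj C" "B \<in> Obj C" "f \<in> Hom C A B" for A B f
  proof -
    note [simp] = \<beta>
    have "Cmp C A ?A' ?B' (p1.Q (ob2 (S2 (ob1 A))) (ob2 (S2 (ob1 B))) ?w) (\<eta> A)
      = Cmp C A (S1 (ob1 A)) ?B' (p1.Q (ob1 A) (ob2 (S2 (ob1 B)))
          (Cmp K (ob1 A) (ob2 (S2 (ob1 A))) (ob2 (S2 (ob1 B))) ?w (\<beta> (ob1 A)))) (a1 A)"
      unfolding \<eta>_def by (simp add: category_assoc[OF p1.catC] p1.Q_cmp)
    also have "\<dots> = Cmp C A (S1 (ob1 B)) ?B' (p1.Q (ob1 B) (ob2 (S2 (ob1 B))) (\<beta> (ob1 B)))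
        (Cmp C A (S1 (ob1 A)) (S1 (ob1 B)) (p1.Q (ob1 A) (ob1 B) (p1.P A B f)) (a1 A))"
      by (simp add: \<beta>n p1.Q_cmp category_assoc[OF p1.catC])
    also have "\<dots> = ?l"
      by (simp add: p1.Q_P \<eta>_def category_assoc[OF p1.catC])
    finally show ?thesis by simp
  qed
  have "natural_iso C C id_functor (comp_functor G F) \<eta>"
    unfolding natural_iso_def by (simp add: id_functor_def comp_functor_def F_def G_def iso nat)
  then show "\<exists>\<eta>. natural_iso C C id_functor (comp_functor G F) \<eta>" by blast
qed

lemma presentation_equivalent:
  assumes p: "presentation K C S1 \<Phi>1 ob1 a1 a1'" "presentation K D S2 \<Phi>2 ob2 a2 a2'"
  shows "equivalent_categories C D"
proof -
  note FG = presentation_natural_iso[OF p] and GF = presentation_natural_iso[OF p(2,1)]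
  have fid: "is_functor D D id_functor" by (simp add: is_functor_def id_functor_def)
  have fc: "is_functor D D (comp_functor F G)" if "is_functor C D F" "is_functor D C G" for F G
    using that by (simp add: is_functor_def comp_functor_def)
  show ?thesis
    unfolding equivalent_categories_def
    using FG GF natural_iso_sym[OF presentation.catC[OF p(2)] fid fc[OF FG(1) GF(1)]]
    by blast
qed

definition presented_by :: "('i, 'k) category \<Rightarrow> ('o, 'm) category \<Rightarrow> bool" where
  "presented_by K C \<longleftrightarrow> (\<exists>S \<Phi> ob a a'. presentation K C S \<Phi> ob a a')"

text \<open>Essential surjectivity and full faithfulness on the representatives; the identifying
  isomorphisms and their inverses are picked by choice.\<close>

lemma presented_byI:
  assumes "is_category K" "is_category C"
    and "\<And>i. i \<in> Obj K \<Longrightarrow> S i \<in> Obj C"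
    and ex: "\<And>A. A \<in> Obj C \<Longrightarrow> \<exists>i\<in>Obj K. \<exists>f. iso_arrow C A (S i) f"
    and "\<And>i j. \<lbrakk>i \<in> Obj K; j \<in> Obj K\<rbrakk> \<Longrightarrow> bij_betw (\<Phi> i j) (Hom C (S i) (S j)) (Hom K i j)"
    and "\<And>i. i \<in> Obj K \<Longrightarrow> \<Phi> i i (Idn C (S i)) = Idn K i"
    and "\<And>i j k f g. \<lbrakk>i \<in> Obj K; j \<in> Obj K; k \<in> Obj K; f \<in> Hom C (S i) (S j); g \<in> Hom C (S j) (S k)\<rbrakk>
        \<Longrightarrow> \<Phi> i k (Cmp C (S i) (S j) (S k) g f) = Cmp K i j k (\<Phi> j k g) (\<Phi> i j f)"
  shows "presented_by K C"
proof -
  have "\<forall>A. \<exists>i f g. A \<in> Obj C \<longrightarrow> i \<in> Obj K \<and> f \<in> Hom C A (S i) \<and> g \<in> Hom C (S i) A \<and>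
      Cmp C A (S i) A g f = Idn C A \<and> Cmp C (S i) A (S i) f g = Idn C (S i)"
    using ex unfolding iso_arrow_def by meson
  then obtain ob a a' where "\<And>A. A \<in> Obj C \<Longrightarrow> ob A \<in> Obj K \<and> a A \<in> Hom C A (S (ob A)) \<and>
      a' A \<in> Hom C (S (ob A)) A \<and>
      Cmp C A (S (ob A)) A (a' A) (a A) = Idn C A \<and>
      Cmp C (S (ob A)) A (S (ob A)) (a A) (a' A) = Idn C (S (ob A))"
    by metis
  then have "presentation K C S \<Phi> ob a a'"
    using assms by unfold_locales auto
  then show ?thesis unfolding presented_by_def by blast
qed

lemma presented_by_equivalent:
  "\<lbrakk>presented_by K C; presented_by K D\<rbrakk> \<Longrightarrow> equivalent_categories C D"
  unfolding presented_by_def using presentation_equivalent by metis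

section \<open>Embedding modules into function spaces\<close>

definition fscale :: "complex \<Rightarrow> ('x \<Rightarrow> complex) \<Rightarrow> 'x \<Rightarrow> complex" where
  "fscale c f = (\<lambda>x. c * f x)"

lemma fscale_apply [simp]: "fscale c f x = c * f x"
  by (simp add: fscale_def)

interpretation fspace: vector_space fscale
  by unfold_locales (auto simp: fun_eq_iff algebra_simps)

definition delta :: "'x \<Rightarrow> 'x \<Rightarrow> complex" where
  "delta m = (\<lambda>x. if x = m then 1 else 0)"

lemma sum_fun_apply: "(\<Sum>i\<in>A. f i) x = (\<Sum>i\<in>A. f i (x :: 'x) :: complex)"
  by (induction A rule: infinite_finite_induct) auto

text \<open>Here vectors form a set with operations from a record, out of reach of the type-based
  theory of spans and bases. The locale collects what is needed to move such a space into a type of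
  functions.\<close>

locale complex_space = abelian_group M for M (structure) +
  fixes sm :: "complex \<Rightarrow> 'a \<Rightarrow> 'a"
  assumes sm_closed [simp]: "x \<in> carrier M \<Longrightarrow> sm c x \<in> carrier M"
    and sm_l_distr: "x \<in> carrier M \<Longrightarrow> sm (c + d) x = sm c x \<oplus> sm d x"
    and sm_r_distr: "\<lbrakk>x \<in> carrier M; y \<in> carrier M\<rbrakk> \<Longrightarrow> sm c (x \<oplus> y) = sm c x \<oplus> sm c y"
    and sm_assoc: "x \<in> carrier M \<Longrightarrow> sm (c * d) x = sm c (sm d x)"
    and sm_one [simp]: "x \<in> carrier M \<Longrightarrow> sm 1 x = x"
begin

lemma sm_zero [simp]: "x \<in> carrier M \<Longrightarrow> sm 0 x = \<zero>"
  using sm_l_distr[of x 0 0] by (metis add_0 add.r_cancel_one' sm_closed)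

lemma sm_r_zero [simp]: "sm c \<zero> = \<zero>"
  using sm_r_distr[of \<zero> \<zero> c] by (metis add.r_cancel_one' l_zero sm_closed zero_closed)

lemma sm_finsum:
  assumes "finite A" "f \<in> A \<rightarrow> carrier M"
  shows "sm c (\<Oplus>m\<in>A. f m) = (\<Oplus>m\<in>A. sm c (f m))"
  using assms
proof (induction A rule: finite_induct)
  case (insert x A)
  then have [simp]: "f x \<in> carrier M" "f \<in> A \<rightarrow> carrier M" "(\<lambda>m. sm c (f m)) \<in> A \<rightarrow> carrier M"
    by (auto simp: Pi_iff)
  show ?case using insert by (simp add: sm_r_distr)
qed simp

text \<open>The canonical map from formal finite linear combinations of vectors to vectors;
  \<open>FS\<close> is its intended domain.\<close>

definition ev :: "('a \<Rightarrow> complex) \<Rightarrow> 'a" where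
  "ev x = (\<Oplus>m\<in>{m. x m \<noteq> 0}. sm (x m) m)"

definition FS :: "('a \<Rightarrow> complex) set" where
  "FS = {x. finite {m. x m \<noteq> 0} \<and> {m. x m \<noteq> 0} \<subseteq> carrier M}"

lemma ev_superset:
  assumes "finite A" "A \<subseteq> carrier M" "{m. x m \<noteq> 0} \<subseteq> A"
  shows "ev x = (\<Oplus>m\<in>A. sm (x m) m)"
  unfolding ev_def
  by (rule add.finprod_mono_neutral_cong_left) (use assms in \<open>auto simp: subset_iff\<close>)

lemma ev_closed: "x \<in> FS \<Longrightarrow> ev x \<in> carrier M"
  unfolding ev_def FS_def by (rule finsum_closed) auto

lemma ev_add:
  assumes "x \<in> FS" "y \<in> FS"
  shows "x + y \<in> FS" "ev (x + y) = ev x \<oplus> ev y"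
proof -
  let ?A = "{m. x m \<noteq> 0} \<union> {m. y m \<noteq> 0}"
  have A: "finite ?A" "?A \<subseteq> carrier M" "{m. (x + y) m \<noteq> 0} \<subseteq> ?A"
    using assms by (auto simp: FS_def)
  then show "x + y \<in> FS" unfolding FS_def using finite_subset by blast
  have "ev (x + y) = (\<Oplus>m\<in>?A. sm (x m) m \<oplus> sm (y m) m)"
    using A by (subst ev_superset[OF A]) (intro finsum_cong', auto simp: sm_l_distr)
  also have "\<dots> = (\<Oplus>m\<in>?A. sm (x m) m) \<oplus> (\<Oplus>m\<in>?A. sm (y m) m)"
    using A by (intro finsum_addf) auto
  finally show "ev (x + y) = ev x \<oplus> ev y"
    using ev_superset[OF A(1,2), of x] ev_superset[OF A(1,2), of y] by simp
qed

lemma ev_scale: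
  assumes "x \<in> FS"
  shows "fscale c x \<in> FS" "ev (fscale c x) = sm c (ev x)"
proof -
  let ?A = "{m. x m \<noteq> 0}"
  have A: "finite ?A" "?A \<subseteq> carrier M" "{m. fscale c x m \<noteq> 0} \<subseteq> ?A"
    using assms by (auto simp: FS_def)
  then show "fscale c x \<in> FS" unfolding FS_def using finite_subset by blast
  have "ev (fscale c x) = (\<Oplus>m\<in>?A. sm c (sm (x m) m))"
    using A by (subst ev_superset[OF A]) (intro finsum_cong', auto simp: sm_assoc)
  also have "\<dots> = sm c (ev x)"
    unfolding ev_def using A by (subst sm_finsum) auto
  finally show "ev (fscale c x) = sm c (ev x)" .
qed

lemma ev_delta:
  assumes "m \<in> carrier M" shows "delta m \<in> FS" "ev (delta m) = m"
proof -
  have [simp]: "{x. delta m x \<noteq> 0} = {m}" by (auto simp: delta_def)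
  show "delta m \<in> FS" using assms by (simp add: FS_def)
  show "ev (delta m) = m" unfolding ev_def using assms by (simp add: delta_def)
qed

lemma ev_diff:
  assumes "x \<in> FS" "y \<in> FS"
  shows "x - y \<in> FS" "ev (x - y) = \<zero> \<longleftrightarrow> ev x = ev y"
proof -
  have e: "x - y = x + fscale (-1) y" by (auto simp: fun_eq_iff)
  show F: "x - y \<in> FS" unfolding e by (intro ev_add ev_scale assms)
  have "ev x = ev (x - y) \<oplus> ev y"
    using ev_add(2)[OF F assms(2)] by simp
  then show "ev (x - y) = \<zero> \<longleftrightarrow> ev x = ev y"
    using ev_closed[OF F] ev_closed[OF assms(2)] by (metis add.r_cancel_one' l_zero)
qed

text \<open>The space is the quotient of the finitely supported functions by the kernel \<open>R\<close> of \<open>ev\<close>;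
  coordinates along a complement of \<open>R\<close> embed this quotient.\<close>

lemma function_space_embedding:
  "\<exists>\<phi> :: 'a \<Rightarrow> ('a \<Rightarrow> complex) \<Rightarrow> complex. inj_on \<phi> (carrier M) \<and>
     (\<forall>x\<in>carrier M. \<forall>y\<in>carrier M. \<phi> (x \<oplus> y) = \<phi> x + \<phi> y) \<and>
     (\<forall>c. \<forall>x\<in>carrier M. \<phi> (sm c x) = fscale c (\<phi> x))"
proof -
  define R where "R = {x \<in> FS. ev x = \<zero>}"
  have R: "fspace.subspace R"
    unfolding fspace.subspace_def R_def
    by (auto simp: ev_add ev_scale) (simp_all add: FS_def ev_def)
  obtain B where B: "B \<subseteq> R" "fspace.independent B" "R \<subseteq> fspace.span B"
    using fspace.maximal_independent_subset by blast
  define C where "C = fspace.extend_basis B"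
  have C: "fspace.independent C" "B \<subseteq> C" "x \<in> fspace.span C" for x
    using fspace.independent_extend_basis[OF B(2)] fspace.extend_basis_superset[OF B(2)]
      fspace.span_extend_basis[OF B(2)] by (auto simp: C_def)
  \<comment> \<open>Coordinates along \<open>C - B\<close>, indexed by the basis vectors themselves;
    this is why the embedding takes values in functions on functions. They vanish exactly on
    \<open>span B\<close>, which is \<open>R\<close>.\<close>
  define L where "L x c = (if c \<in> C - B then fspace.representation C x c else 0)" for x c
  have L_add: "L (x + y) = L x + L y" for x y
    using fspace.representation_add[OF C(1) C(3) C(3), of y x] by (auto simp: L_def fun_eq_iff add.commute)
  have L_scale: "L (fscale d x) = fscale d (L x)" for d x
    using fspace.representation_scale[OF C(1) C(3), of d x] by (auto simp: L_def fun_eq_iff)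
  have L_diff: "L (x - y) = L x - L y" for x y
    using L_add[of "x - y" y] by (simp add: algebra_simps)
  have RB: "R = fspace.span B"
    using B R by (metis fspace.span_minimal subset_antisym)
  have L0: "L x = 0 \<longleftrightarrow> x \<in> R" for x
  proof
    assume "x \<in> R"
    then have "fspace.representation C x = fspace.representation B x"
      using C B(2) RB fspace.representation_extend by metis
    then show "L x = 0"
      using fspace.representation_ne_zero[of B x] by (auto simp: L_def fun_eq_iff)
  next
    assume L: "L x = 0"
    have "c \<in> B" if "fspace.representation C x c \<noteq> 0" for c
      using L that fspace.representation_ne_zero[OF that]
      by (auto simp: L_def fun_eq_iff split: if_splits)
    then have "(\<Sum>b | fspace.representation C x b \<noteq> 0. fscale (fspace.representation C x b) b)
        \<in> fspace.span B"
      by (intro fspace.span_sum fspace.span_scale fspace.span_base) auto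
    then show "x \<in> R"
      using fspace.sum_nonzero_representation_eq[OF C(1) C(3)] RB by metis
  qed
  have LL: "L x = L y \<longleftrightarrow> ev x = ev y" if "x \<in> FS" "y \<in> FS" for x y
  proof -
    have "L x = L y \<longleftrightarrow> x - y \<in> R" unfolding L0[symmetric] L_diff by simp
    then show ?thesis using ev_diff[OF that] by (simp add: R_def)
  qed
  show ?thesis
  proof (intro exI[of _ "\<lambda>m. L (delta m)"] conjI ballI allI)
    show "inj_on (\<lambda>m. L (delta m)) (carrier M)"
      using LL ev_delta by (intro inj_onI) metis
    fix x y assume "x \<in> carrier M" "y \<in> carrier M"
    then show "L (delta (x \<oplus> y)) = L (delta x) + L (delta y)"
      unfolding L_add[symmetric] by (subst LL) (auto simp: ev_delta ev_add)
  next
    fix c x assume "x \<in> carrier M"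
    then show "L (delta (sm c x)) = fscale c (L (delta x))"
      unfolding L_scale[symmetric] by (subst LL) (auto simp: ev_delta ev_scale)
  qed
qed

end

section \<open>Representations of the quantum Schroedinger algebra\<close>

lemma free_alg_induct [case_names zero add]:
  fixes p :: "'w \<Rightarrow>\<^sub>0 complex"
  assumes "P 0" and step: "\<And>w c p. P p \<Longrightarrow> P (Poly_Mapping.single w c + p)"
  shows "P p"
proof (induction "card (Poly_Mapping.keys p)" arbitrary: p)
  case 0
  then show ?case using assms(1) by simp
next
  case (Suc n)
  then obtain w where w: "w \<in> Poly_Mapping.keys p" by fastforce
  let ?r = "p - Poly_Mapping.single w (Poly_Mapping.lookup p w)"
  have "Poly_Mapping.keys ?r = Poly_Mapping.keys p - {w}"
    by (auto simp: in_keys_iff lookup_minus lookup_single when_def split: if_splits)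
  then have "P ?r" using Suc w by (intro Suc) simp
  then have "P (Poly_Mapping.single w (Poly_Mapping.lookup p w) + ?r)" by (rule step)
  then show ?case by simp
qed

lemma free_ring_simps [simp]:
  "carrier free_ring = UNIV" "p \<otimes>\<^bsub>free_ring\<^esub> r = p * r" "p \<oplus>\<^bsub>free_ring\<^esub> r = p + r"
  "\<one>\<^bsub>free_ring\<^esub> = (1 :: free_alg)" "\<zero>\<^bsub>free_ring\<^esub> = (0 :: free_alg)"
  by (simp_all add: ring_of_type_algebra_def)

lemma free_ring_uminus: "\<ominus>\<^bsub>free_ring\<^esub> p = - p"
  using abelian_group.minus_equality[OF ring.is_abelian_group[OF free_ring_ring], of "- p" p] by simp

lemma Uq_carrier: "carrier (Uq q) = range (cls q)"
  by (auto simp: Uq_def cls_def FactRing_def A_RCOSETS_def')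

lemma cls_closed [simp]: "cls q p \<in> carrier (Uq q)"
  by (simp add: Uq_carrier)

lemma cls_hom: "cls q \<in> ring_hom free_ring (Uq q)"
  using ideal.rcos_ring_hom[OF rel_ideal_ideal, of q] by (simp add: cls_def[abs_def] Uq_def)

lemma cls_mult: "cls q p \<otimes>\<^bsub>Uq q\<^esub> cls q r = cls q (p * r)"
  and cls_add: "cls q p \<oplus>\<^bsub>Uq q\<^esub> cls q r = cls q (p + r)"
  and cls_one: "\<one>\<^bsub>Uq q\<^esub> = cls q 1"
  using cls_hom[of q] by (auto simp: ring_hom_def)

lemma rel_ideal_closed:
  "0 \<in> rel_ideal q" "\<lbrakk>p \<in> rel_ideal q; r \<in> rel_ideal q\<rbrakk> \<Longrightarrow> p + r \<in> rel_ideal q"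
  "p \<in> rel_ideal q \<Longrightarrow> - p \<in> rel_ideal q"
proof -
  interpret additive_subgroup "rel_ideal q" free_ring
    using rel_ideal_ideal by (rule ideal.axioms(1))
  show "0 \<in> rel_ideal q" "\<lbrakk>p \<in> rel_ideal q; r \<in> rel_ideal q\<rbrakk> \<Longrightarrow> p + r \<in> rel_ideal q"
    using local.zero_closed local.a_closed[of p r] by simp_all
  show "p \<in> rel_ideal q \<Longrightarrow> - p \<in> rel_ideal q"
    using a_inv_closed[of p] by (simp add: free_ring_uminus)
qed

lemma cls_eq_iff: "cls q p = cls q r \<longleftrightarrow> p - r \<in> rel_ideal q"
proof -
  have c: "cls q p = {i + p | i. i \<in> rel_ideal q}" for p
    unfolding cls_def a_r_coset_def' by auto
  show ?thesis
  proof
    assume "cls q p = cls q r"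
    moreover have "0 + p \<in> cls q p" unfolding c using rel_ideal_closed(1) by blast
    ultimately obtain i where "i \<in> rel_ideal q" "p = i + r" unfolding c by auto
    then show "p - r \<in> rel_ideal q" by simp
  next
    assume d: "p - r \<in> rel_ideal q"
    have "i + p = (i + (p - r)) + r" "i + r = (i + - (p - r)) + p" for i by (auto simp: algebra_simps)
    with d show "cls q p = cls q r"
      unfolding c by (auto; metis rel_ideal_closed)
  qed
qed

lemma relators_subset: "relators q \<subseteq> rel_ideal q"
  unfolding rel_ideal_def by (rule ring.genideal_self[OF free_ring_ring]) simp

fun letters :: "gword \<Rightarrow> gen list" where
  "letters (GWord w) = w"

lemma letters_add: "letters (u + v) = letters u @ letters v"
  by (cases u; cases v) simp

lemma letters_zero [simp]: "letters 0 = []"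
  by (simp add: zero_gword_def)

lemma scal_closed [simp]: "scal q c \<in> carrier (Uq q)"
  by (simp add: scal_def)

lemma const_simps:
  "const (c + d) = const c + const d" "const (c * d) = const c * const d" "const 1 = 1" "const 0 = 0"
  by (simp_all add: const_def single_add mult_single)

lemma cls_zero: "\<zero>\<^bsub>Uq q\<^esub> = cls q 0"
  using ring_hom_zero[OF cls_hom free_ring_ring Uq_ring, of q] by simp

text \<open>Linearity is demanded only on a set \<open>W\<close> of the ambient type: modules appear
  as images of embeddings, and nothing is known about the operators elsewhere.\<close>

locale operators = vector_space scale
  for scale :: "complex \<Rightarrow> 'v::ab_group_add \<Rightarrow> 'v" (infixr "*s" 75) +
  fixes W :: "'v set" and \<rho> :: "gen \<Rightarrow> 'v \<Rightarrow> 'v"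
  assumes subspace_W: "subspace W"
    and \<rho>_closed [simp]: "v \<in> W \<Longrightarrow> \<rho> g v \<in> W"
    and \<rho>_add: "\<lbrakk>v \<in> W; w \<in> W\<rbrakk> \<Longrightarrow> \<rho> g (v + w) = \<rho> g v + \<rho> g w"
    and \<rho>_scale: "v \<in> W \<Longrightarrow> \<rho> g (c *s v) = c *s \<rho> g v"
begin

lemma W_zero [simp]: "0 \<in> W"
  and W_add [simp]: "\<lbrakk>v \<in> W; w \<in> W\<rbrakk> \<Longrightarrow> v + w \<in> W"
  and W_scale [simp]: "v \<in> W \<Longrightarrow> c *s v \<in> W"
  using subspace_W by (auto simp: subspace_def)

lemma W_diff [simp]: "\<lbrakk>v \<in> W; w \<in> W\<rbrakk> \<Longrightarrow> v - w \<in> W"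
  and W_neg [simp]: "v \<in> W \<Longrightarrow> - v \<in> W"
  and W_sum [simp]: "(\<And>i. i \<in> A \<Longrightarrow> f i \<in> W) \<Longrightarrow> sum f A \<in> W"
  using subspace_W by (auto intro: subspace_diff subspace_neg subspace_sum)

lemma \<rho>_zero [simp]: "\<rho> g 0 = 0"
  using \<rho>_scale[of 0 g 0] by simp

lemma \<rho>_diff: "\<lbrakk>v \<in> W; w \<in> W\<rbrakk> \<Longrightarrow> \<rho> g (v - w) = \<rho> g v - \<rho> g w"
  using \<rho>_add[of "v - w" w g] by (simp add: algebra_simps)

lemma \<rho>_neg: "v \<in> W \<Longrightarrow> \<rho> g (- v) = - \<rho> g v"
  using \<rho>_diff[of 0 v g] by simp

lemma \<rho>_sum: "(\<And>i. i \<in> A \<Longrightarrow> f i \<in> W) \<Longrightarrow> \<rho> g (sum f A) = (\<Sum>i\<in>A. \<rho> g (f i))"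
  by (induction A rule: infinite_finite_induct) (simp_all add: \<rho>_add)

lemmas \<rho>_linear = \<rho>_add \<rho>_diff \<rho>_scale \<rho>_neg

text \<open>With \<open>foldr\<close> the last letter acts first, so that concatenation of words
  becomes composition of operators.\<close>

definition wact :: "gword \<Rightarrow> 'v \<Rightarrow> 'v" where
  "wact u v = foldr \<rho> (letters u) v"

definition act :: "free_alg \<Rightarrow> 'v \<Rightarrow> 'v" where
  "act p v = (\<Sum>u\<in>Poly_Mapping.keys p. Poly_Mapping.lookup p u *s wact u v)"

lemma foldr_closed: "v \<in> W \<Longrightarrow> foldr \<rho> gs v \<in> W"
  by (induction gs) auto

lemma foldr_add: "\<lbrakk>v \<in> W; w \<in> W\<rbrakk> \<Longrightarrow> foldr \<rho> gs (v + w) = foldr \<rho> gs v + foldr \<rho> gs w"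
  by (induction gs) (auto simp: \<rho>_add foldr_closed)

lemma foldr_scale: "v \<in> W \<Longrightarrow> foldr \<rho> gs (c *s v) = c *s foldr \<rho> gs v"
  by (induction gs) (auto simp: \<rho>_scale foldr_closed)

lemma wact_closed [simp]: "v \<in> W \<Longrightarrow> wact u v \<in> W"
  by (simp add: wact_def foldr_closed)

lemma wact_add: "\<lbrakk>v \<in> W; w \<in> W\<rbrakk> \<Longrightarrow> wact u (v + w) = wact u v + wact u w"
  by (simp add: wact_def foldr_add)

lemma wact_scale: "v \<in> W \<Longrightarrow> wact u (c *s v) = c *s wact u v"
  by (simp add: wact_def foldr_scale)

lemma wact_mult: "wact (u + u') v = wact u (wact u' v)"
  by (simp add: wact_def letters_add)

lemma act_superset: "\<lbrakk>finite A; Poly_Mapping.keys p \<subseteq> A\<rbrakk> \<Longrightarrow> act p v = (\<Sum>u\<in>A. Poly_Mapping.lookup p u *s wact u v)"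
  unfolding act_def by (rule sum.mono_neutral_left) (auto simp: in_keys_iff)

lemma act_add: "act (p + r) v = act p v + act r v"
proof -
  have "act (p + r) v = (\<Sum>u\<in>Poly_Mapping.keys p \<union> Poly_Mapping.keys r. Poly_Mapping.lookup (p + r) u *s wact u v)"
    by (rule act_superset) (auto simp: in_keys_iff lookup_add)
  also have "\<dots> = act p v + act r v"
    by (subst (1 2) act_superset[of "Poly_Mapping.keys p \<union> Poly_Mapping.keys r"])
       (auto simp: lookup_add scale_left_distrib sum.distrib)
  finally show ?thesis .
qed

lemma act_zero [simp]: "act 0 v = 0"
  by (simp add: act_def)

lemma act_diff: "act (p - r) v = act p v - act r v"
  using act_add[of "p - r" r v] by (simp add: algebra_simps)

lemma act_single: "act (Poly_Mapping.single u c) v = c *s wact u v"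
  by (cases "c = 0") (simp_all add: act_def)

lemma act_gvar [simp]: "act (gvar g) v = \<rho> g v"
  by (simp add: gvar_def act_single wact_def)

lemma act_const [simp]: "act (const c) v = c *s v"
  by (simp add: const_def act_single wact_def)

lemma act_one [simp]: "act 1 v = v"
  using act_const[of 1] by (simp add: const_simps)

lemma act_closed [simp]: "v \<in> W \<Longrightarrow> act p v \<in> W"
  by (simp add: act_def)

lemma act_add_right: "\<lbrakk>v \<in> W; w \<in> W\<rbrakk> \<Longrightarrow> act p (v + w) = act p v + act p w"
  by (simp add: act_def wact_add scale_right_distrib sum.distrib)

lemma act_scale_right: "v \<in> W \<Longrightarrow> act p (c *s v) = c *s act p v"
  by (simp add: act_def wact_scale scale_sum_right mult.commute)

lemma act_zero_right [simp]: "act p 0 = 0"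
  using act_scale_right[of 0 p 0] by simp

lemma act_mult: "v \<in> W \<Longrightarrow> act (p * r) v = act p (act r v)"
proof (induction p rule: free_alg_induct)
  case (add u c p)
  have "act (Poly_Mapping.single u c * r) v = c *s wact u (act r v)"
  proof (induction r rule: free_alg_induct)
    case zero
    have "wact u 0 = 0" using wact_scale[of 0 u 0] by simp
    then show ?case by simp
  next
    case (add u' d r)
    with \<open>v \<in> W\<close> show ?case
      by (simp add: distrib_left act_add mult_single act_single wact_add wact_scale wact_mult
          scale_right_distrib)
  qed
  with add show ?case by (simp add: distrib_right act_add act_single)
qed simp

lemmas act_simps = act_add act_diff act_mult

definition invariant :: "'v set \<Rightarrow> bool" where
  "invariant N \<longleftrightarrow> subspace N \<and> N \<subseteq> W \<and> (\<forall>g. \<forall>v\<in>N. \<rho> g v \<in> N)"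

lemma invariant_W: "invariant W"
  by (simp add: invariant_def subspace_W)

lemma invariant_operators: "invariant N \<Longrightarrow> operators scale N \<rho>"
  by unfold_locales (auto simp: invariant_def subset_iff \<rho>_add \<rho>_scale)

lemma invariant_act: "\<lbrakk>invariant N; v \<in> N\<rbrakk> \<Longrightarrow> act p v \<in> N"
proof (induction p rule: free_alg_induct)
  case zero
  then show ?case by (simp add: invariant_def subspace_0)
next
  case (add u c p)
  have "foldr \<rho> gs v \<in> N" for gs
    using add by (induction gs) (auto simp: invariant_def)
  with add show ?case
    by (auto simp: act_add act_single wact_def invariant_def subspace_add subspace_scale)
qed

end

text \<open>Commutation with the generators passes to words and by linearity to the free algebra. It
  serves for the central charge of Verma modules, for the canonical map out of a model and for
  matrices between models.\<close>

lemma act_intertwine: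
  assumes "operators s1 W1 \<rho>1" "operators s2 W2 \<rho>2"
    and T: "\<And>v. v \<in> W1 \<Longrightarrow> T v \<in> W2" "\<And>v w. \<lbrakk>v \<in> W1; w \<in> W1\<rbrakk> \<Longrightarrow> T (v + w) = T v + T w"
      "\<And>c v. v \<in> W1 \<Longrightarrow> T (s1 c v) = s2 c (T v)" "\<And>g v. v \<in> W1 \<Longrightarrow> T (\<rho>1 g v) = \<rho>2 g (T v)"
    and v: "v \<in> W1"
  shows "T (operators.act s1 \<rho>1 p v) = operators.act s2 \<rho>2 p (T v)"
proof -
  interpret o1: operators s1 W1 \<rho>1 by fact
  interpret o2: operators s2 W2 \<rho>2 by fact
  define Q where "Q p \<longleftrightarrow> T (o1.act p v) = o2.act p (T v)" for p
  have w: "T (foldr \<rho>1 gs v) = foldr \<rho>2 gs (T v)" for gs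
    by (induction gs) (simp_all add: T v o1.foldr_closed)
  have "T (s1 0 v) = s2 0 (T v)" using v by (rule T(3))
  then have T0: "T 0 = 0" by simp
  have "Q p"
  proof (induction p rule: free_alg_induct)
    case zero
    show ?case unfolding Q_def by (simp add: T0)
  next
    case (add u c p)
    then show ?case
      unfolding Q_def o1.act_add o2.act_add o1.act_single o2.act_single
      using v w by (simp add: T o1.wact_def o2.wact_def o1.foldr_closed)
  qed
  then show ?thesis by (simp add: Q_def)
qed

locale uq_rep = operators +
  fixes q :: complex
  assumes relators_zero: "\<lbrakk>r \<in> relators q; v \<in> W\<rbrakk> \<Longrightarrow> act r v = 0"
begin

text \<open>The elements acting as zero on all of \<open>W\<close> form a two-sided ideal; as it
  contains the relators, it contains the ideal that they generate.\<close>

lemma rel_ideal_zero: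
  assumes "p \<in> rel_ideal q" "v \<in> W" shows "act p v = 0"
proof -
  have "ideal {p. \<forall>v\<in>W. act p v = 0} free_ring"
  proof (rule idealI[OF free_ring_ring])
    show "subgroup {p. \<forall>v\<in>W. act p v = 0} (add_monoid free_ring)"
    proof (rule group.subgroupI)
      show "group (add_monoid free_ring)"
        using ring.is_abelian_group[OF free_ring_ring] by (rule abelian_group.a_group)
      show "{p. \<forall>v\<in>W. act p v = 0} \<noteq> {}" using act_zero by blast
      show "inv\<^bsub>add_monoid free_ring\<^esub> p \<in> {p. \<forall>v\<in>W. act p v = 0}" if "p \<in> {p. \<forall>v\<in>W. act p v = 0}" for p
        using that free_ring_uminus[of p] act_diff[of 0 p] by (simp add: a_inv_def)
    qed (auto simp: act_add)
  qed (auto simp: act_mult)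
  moreover have "relators q \<subseteq> {p. \<forall>v\<in>W. act p v = 0}"
    using relators_zero by auto
  ultimately have "rel_ideal q \<subseteq> {p. \<forall>v\<in>W. act p v = 0}"
    unfolding rel_ideal_def by (rule ring.genideal_minimal[OF free_ring_ring])
  with assms show ?thesis by blast
qed

text \<open>Elements of \<open>Uq q\<close> are cosets. An arbitrary representative is used; by
  \<open>rel_ideal_zero\<close> the choice is immaterial on \<open>W\<close>.\<close>

definition uact :: "uq \<Rightarrow> 'a \<Rightarrow> 'a" where
  "uact u v = act (SOME p. u = cls q p) v"

lemma uact_cls: "v \<in> W \<Longrightarrow> uact (cls q p) v = act p v"
proof -
  assume v: "v \<in> W"
  have "cls q p = cls q (SOME r. cls q p = cls q r)" by (rule someI) simp
  then have "act (p - (SOME r. cls q p = cls q r)) v = 0"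
    unfolding cls_eq_iff using v by (rule rel_ideal_zero)
  then show ?thesis by (simp add: uact_def act_diff)
qed

lemma invariant_uq_rep: "invariant N \<Longrightarrow> uq_rep scale N \<rho> q"
proof -
  assume N: "invariant N"
  interpret N: operators scale N \<rho> using N by (rule invariant_operators)
  from N show ?thesis
    by unfold_locales (auto simp: invariant_def intro: relators_zero)
qed

end

section \<open>Category O in terms of operators\<close>

lemma cls_uminus: "\<ominus>\<^bsub>Uq q\<^esub> cls q p = cls q (- p)"
  using abelian_group.minus_equality[OF ring.is_abelian_group[OF Uq_ring], of q "cls q (- p)" "cls q p"]
  by (simp add: cls_add cls_zero)

lemma subalg_closed:
  assumes "S \<subseteq> carrier (Uq q)" "u \<in> subalg_gen q S" shows "u \<in> carrier (Uq q)"
  using assms unfolding subalg_gen_def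
  by (intro ring.generate_ring_in_carrier[OF Uq_ring, of "range (scal q) \<union> S"]) auto

lemma (in vector_space) subspace_of_span_finite:
  assumes "subspace U" "U \<subseteq> span B" "finite B"
  obtains C where "finite C" "C \<subseteq> U" "U = span C" "independent C"
proof -
  obtain C where C: "C \<subseteq> U" "independent C" "U \<subseteq> span C"
    using maximal_independent_subset by blast
  then have "finite C"
    using independent_span_bound[OF assms(3) C(2)] assms(2) by blast
  moreover have "U = span C" using C assms(1) by (simp add: span_minimal subset_antisym)
  ultimately show ?thesis using that C by blast
qed

lemma ex_finite_subset_image:
  "(\<exists>S. finite S \<and> S \<subseteq> A \<and> P (f ` S)) \<longleftrightarrow> (\<exists>S'. finite S' \<and> S' \<subseteq> f ` A \<and> P S')"
proof
  assume "\<exists>S'. finite S' \<and> S' \<subseteq> f ` A \<and> P S'"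
  then obtain S' where S': "finite S'" "S' \<subseteq> f ` A" "P S'" by blast
  then obtain S where "S \<subseteq> A" "finite S" "S' = f ` S" using finite_subset_image by metis
  with S' show "\<exists>S. finite S \<and> S \<subseteq> A \<and> P (f ` S)" by auto
qed (metis finite_imageI image_mono)

section \<open>Weight vectors and finiteness conditions of a representation\<close>

context uq_rep
begin

definition wvec :: "complex \<Rightarrow> 'a \<Rightarrow> bool" where
  "wvec \<mu> v \<longleftrightarrow> v \<in> W \<and> \<rho> gen_K v = \<mu> *s v"

lemma wvec_W [dest]: "wvec \<mu> v \<Longrightarrow> v \<in> W"
  by (simp add: wvec_def)

lemma wvec_scale: "wvec \<mu> v \<Longrightarrow> wvec \<mu> (c *s v)"
  by (simp add: wvec_def \<rho>_scale scale_left_commute)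

lemma wvec_add: "\<lbrakk>wvec \<mu> v; wvec \<mu> w\<rbrakk> \<Longrightarrow> wvec \<mu> (v + w)"
  by (simp add: wvec_def \<rho>_add scale_right_distrib)

lemma wvec_diff: "\<lbrakk>wvec \<mu> v; wvec \<mu> w\<rbrakk> \<Longrightarrow> wvec \<mu> (v - w)"
  by (simp add: wvec_def \<rho>_diff scale_right_diff_distrib)

lemma wvec_0 [simp]: "wvec \<mu> 0"
  by (simp add: wvec_def)

lemma K_inv:
  "v \<in> W \<Longrightarrow> \<rho> gen_K (\<rho> gen_Kinv v) = v" "v \<in> W \<Longrightarrow> \<rho> gen_Kinv (\<rho> gen_K v) = v"
  using relators_zero[of "fK * fKinv - 1" v] relators_zero[of "fKinv * fK - 1" v]
  by (simp_all add: relators_def act_simps)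

lemma wvec_nonzero: "\<lbrakk>wvec \<mu> v; v \<noteq> 0\<rbrakk> \<Longrightarrow> \<mu> \<noteq> 0"
  using K_inv(2)[of v] by (auto simp: wvec_def)

text \<open>Applying \<open>K - a\<close> kills the component of weight \<open>a\<close> and
  multiplies the others by the nonzero numbers \<open>\<mu> - a\<close>; induction removes one
  weight at a time. For \<open>N = {0}\<close> this is the independence of the weight
  spaces.\<close>

lemma wvec_components:
  assumes "finite S" "subspace N" "\<And>v. v \<in> N \<Longrightarrow> \<rho> gen_K v \<in> N"
    and "\<And>\<mu>. \<mu> \<in> S \<Longrightarrow> wvec \<mu> (f \<mu>)" "(\<Sum>\<mu>\<in>S. f \<mu>) \<in> N"
  shows "\<forall>\<mu>\<in>S. f \<mu> \<in> N"
  using assms(1,4,5)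
proof (induction S arbitrary: f rule: finite_induct)
  case (insert a S)
  let ?s = "\<Sum>\<mu>\<in>insert a S. f \<mu>"
  have W: "f \<mu> \<in> W" "\<rho> gen_K (f \<mu>) = \<mu> *s f \<mu>" if "\<mu> \<in> insert a S" for \<mu>
    using insert.prems(1) that by (auto simp: wvec_def)
  have "\<rho> gen_K ?s = (\<Sum>\<mu>\<in>insert a S. \<rho> gen_K (f \<mu>))"
    using W(1) by (rule \<rho>_sum)
  also have "\<dots> = (\<Sum>\<mu>\<in>insert a S. \<mu> *s f \<mu>)"
    using W(2) by (intro sum.cong) auto
  finally have "\<rho> gen_K ?s - a *s ?s = (\<Sum>\<mu>\<in>insert a S. \<mu> *s f \<mu> - a *s f \<mu>)"
    by (simp only: scale_sum_right sum_subtractf)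
  also have "\<dots> = (\<Sum>\<mu>\<in>insert a S. (\<mu> - a) *s f \<mu>)"
    by (simp only: scale_left_diff_distrib)
  also have "\<dots> = (\<Sum>\<mu>\<in>S. (\<mu> - a) *s f \<mu>)"
    using insert.hyps by simp
  finally have "(\<Sum>\<mu>\<in>S. (\<mu> - a) *s f \<mu>) \<in> N"
    using subspace_diff[OF assms(2) assms(3)[OF insert.prems(2)] subspace_scale[OF assms(2) insert.prems(2), of a]]
    by (simp only:)
  then have N: "\<forall>\<mu>\<in>S. (\<mu> - a) *s f \<mu> \<in> N"
    using insert.prems(1) by (intro insert.IH) (simp_all add: wvec_scale)
  have S: "f \<mu> \<in> N" if "\<mu> \<in> S" for \<mu>
  proof -
    have "\<mu> - a \<noteq> 0" using that insert.hyps by auto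
    moreover have "(1 / (\<mu> - a)) *s ((\<mu> - a) *s f \<mu>) \<in> N"
      using N that subspace_scale[OF assms(2)] by blast
    ultimately show ?thesis by simp
  qed
  have "f a = ?s - (\<Sum>\<mu>\<in>S. f \<mu>)" using insert.hyps by simp
  also have "\<dots> \<in> N" by (rule subspace_diff[OF assms(2) insert.prems(2) subspace_sum[OF assms(2) S]])
  finally show ?case using S by blast
qed simp

text \<open>Spanning is enough: uniqueness of the decomposition into weight vectors is automatic, as
  \<open>weight_module_iff\<close> shows.\<close>

definition weighty :: bool where
  "weighty \<longleftrightarrow> W \<subseteq> span {v. \<exists>\<mu>. wvec \<mu> v}"

lemma span_wvec_sum:
  assumes "v \<in> span {v. \<exists>\<mu>. wvec \<mu> v}"
  shows "\<exists>f. (\<forall>\<mu>. wvec \<mu> (f \<mu>)) \<and> finite {\<mu>. f \<mu> \<noteq> 0} \<and> v = (\<Sum>\<mu> | f \<mu> \<noteq> 0. f \<mu>)"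
  using assms
proof (induction rule: span_induct_alt)
  case base
  show ?case by (rule exI[of _ "\<lambda>_. 0"]) simp
next
  case (step c x y)
  then obtain f \<nu> where f: "\<And>\<mu>. wvec \<mu> (f \<mu>)" "finite {\<mu>. f \<mu> \<noteq> 0}" "y = (\<Sum>\<mu> | f \<mu> \<noteq> 0. f \<mu>)"
    and x: "wvec \<nu> x" by auto
  define g where "g \<mu> = (if \<mu> = \<nu> then c *s x + f \<mu> else f \<mu>)" for \<mu>
  let ?A = "insert \<nu> {\<mu>. f \<mu> \<noteq> 0}"
  have "(\<Sum>\<mu> | g \<mu> \<noteq> 0. g \<mu>) = (\<Sum>\<mu>\<in>?A. g \<mu>)"
    using f(2) by (intro sum.mono_neutral_left) (auto simp: g_def)
  also have "\<dots> = (\<Sum>\<mu>\<in>?A. (if \<mu> = \<nu> then c *s x else 0) + f \<mu>)"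
    by (intro sum.cong) (auto simp: g_def)
  also have "\<dots> = c *s x + (\<Sum>\<mu>\<in>?A. f \<mu>)"
    unfolding sum.distrib using f(2) by (subst sum.delta) auto
  also have "(\<Sum>\<mu>\<in>?A. f \<mu>) = y"
    unfolding f(3) using f(2) by (intro sum.mono_neutral_right) auto
  finally have "(\<Sum>\<mu> | g \<mu> \<noteq> 0. g \<mu>) = c *s x + y" .
  moreover have "finite {\<mu>. g \<mu> \<noteq> 0}"
    by (rule finite_subset[of _ ?A]) (use f(2) in \<open>auto simp: g_def\<close>)
  moreover have "\<forall>\<mu>. wvec \<mu> (g \<mu>)" using f x by (auto simp: g_def wvec_add wvec_scale)
  ultimately show ?case by metis
qed

text \<open>Weight components of a vector of \<open>N\<close> stay in \<open>N\<close>, so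
  submodules of weight modules are weight modules.\<close>

lemma weighty_invariant:
  assumes "weighty" "invariant N" "v \<in> N"
  shows "v \<in> span {v. (\<exists>\<mu>. wvec \<mu> v) \<and> v \<in> N}"
proof -
  obtain f where f: "\<And>\<mu>. wvec \<mu> (f \<mu>)" "finite {\<mu>. f \<mu> \<noteq> 0}" "v = (\<Sum>\<mu> | f \<mu> \<noteq> 0. f \<mu>)"
    using assms span_wvec_sum[of v] by (auto simp: weighty_def invariant_def subset_iff)
  then have "\<forall>\<mu>\<in>{\<mu>. f \<mu> \<noteq> 0}. f \<mu> \<in> N"
    using assms by (intro wvec_components) (auto simp: invariant_def)
  then show ?thesis
    unfolding f(3) using f(1) by (intro span_sum span_base) auto
qed

definition fin_gen :: bool where
  "fin_gen \<longleftrightarrow> (\<exists>S. finite S \<and> S \<subseteq> W \<and> (\<forall>N. invariant N \<longrightarrow> S \<subseteq> N \<longrightarrow> N = W))"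

text \<open>Phrased with any finite spanning set whose span is stable under \<open>E\<close> and
  \<open>X\<close>, which is easier to exhibit than the exact orbit under the subalgebra.\<close>

definition loc_fin :: bool where
  "loc_fin \<longleftrightarrow> (\<forall>v\<in>W. \<exists>B. finite B \<and> B \<subseteq> W \<and> v \<in> span B \<and>
     (\<forall>x\<in>span B. \<rho> gen_E x \<in> span B \<and> \<rho> gen_X x \<in> span B))"

lemma span_subset_W: "B \<subseteq> W \<Longrightarrow> span B \<subseteq> W"
  using subspace_W by (simp add: span_minimal)

text \<open>A class has many representatives in the free algebra; one that preserves
  \<open>T\<close> is assembled along the generation of the subalgebra.\<close>

lemma subalg_act:
  assumes "subspace T" "T \<subseteq> W" "\<And>x. x \<in> T \<Longrightarrow> \<rho> gen_E x \<in> T" "\<And>x. x \<in> T \<Longrightarrow> \<rho> gen_X x \<in> T"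
    and "u \<in> subalg_gen q {cls q fE, cls q fX}"
  shows "\<exists>p. u = cls q p \<and> (\<forall>x\<in>T. act p x \<in> T)"
  using assms(5) unfolding subalg_gen_def
proof (induction rule: generate_ring.induct)
  case one
  show ?case by (rule exI[of _ 1]) (simp add: cls_one)
next
  case (incl h)
  then consider c where "h = cls q (const c)" | "h = cls q fE" | "h = cls q fX"
    by (auto simp: scal_def)
  then show ?case
  proof cases
    case 1
    then show ?thesis using assms(1) by (intro exI[of _ "const _"]) (auto intro: subspace_scale)
  next
    case 2
    then show ?thesis using assms(3) by (intro exI[of _ fE]) auto
  next
    case 3
    then show ?thesis using assms(4) by (intro exI[of _ fX]) auto
  qed
next
  case (a_inv h)
  then obtain p where "h = cls q p" "\<forall>x\<in>T. act p x \<in> T" by blast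
  then show ?case
    using act_diff[of 0 p] assms(1) by (intro exI[of _ "- p"]) (auto simp: cls_uminus subspace_neg)
next
  case (eng_add h1 h2)
  then obtain p r where "h1 = cls q p" "\<forall>x\<in>T. act p x \<in> T" "h2 = cls q r" "\<forall>x\<in>T. act r x \<in> T" by blast
  then show ?case
    using assms(1) by (intro exI[of _ "p + r"]) (auto simp: cls_add act_add subspace_add)
next
  case (eng_mult h1 h2)
  then obtain p r where "h1 = cls q p" "\<forall>x\<in>T. act p x \<in> T" "h2 = cls q r" "\<forall>x\<in>T. act r x \<in> T" by blast
  then show ?case
    using assms(2) by (intro exI[of _ "p * r"]) (auto simp: cls_mult act_mult subset_iff)
qed

end

text \<open>Links a module given as a record to operators on vectors of a type. The notions of
  category O are translated along \<open>\<phi>\<close> once; the mathematics then happens on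
  \<open>W\<close>.\<close>

locale uq_iso = uq_rep +
  fixes M :: "(uq, 'b) module" and \<phi> :: "'b \<Rightarrow> 'a"
  assumes left_module_M: "left_module (Uq q) M"
    and \<phi>_bij: "bij_betw \<phi> (carrier M) W"
    and \<phi>_add: "\<lbrakk>x \<in> carrier M; y \<in> carrier M\<rbrakk> \<Longrightarrow> \<phi> (x \<oplus>\<^bsub>M\<^esub> y) = \<phi> x + \<phi> y"
    and \<phi>_cls: "x \<in> carrier M \<Longrightarrow> \<phi> (cls q p \<odot>\<^bsub>M\<^esub> x) = act p (\<phi> x)"
begin

sublocale M: left_module "Uq q" M by (rule left_module_M)

lemma \<phi>_closed [simp]: "x \<in> carrier M \<Longrightarrow> \<phi> x \<in> W"
  using \<phi>_bij bij_betwE by blast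

lemma \<phi>_inj: "\<lbrakk>x \<in> carrier M; y \<in> carrier M\<rbrakk> \<Longrightarrow> \<phi> x = \<phi> y \<longleftrightarrow> x = y"
  using \<phi>_bij by (auto simp: bij_betw_def inj_on_eq_iff)

lemma \<phi>_surj: "v \<in> W \<Longrightarrow> \<exists>x\<in>carrier M. \<phi> x = v"
  using \<phi>_bij by (auto simp: bij_betw_def image_iff)

lemma smult_closed [simp]: "x \<in> carrier M \<Longrightarrow> cls q p \<odot>\<^bsub>M\<^esub> x \<in> carrier M"
  by (simp add: M.smult_closed)

lemma \<phi>_zero [simp]: "\<phi> \<zero>\<^bsub>M\<^esub> = 0"
  using \<phi>_add[of "\<zero>\<^bsub>M\<^esub>" "\<zero>\<^bsub>M\<^esub>"] by simp

lemma \<phi>_eq_0: "x \<in> carrier M \<Longrightarrow> \<phi> x = 0 \<longleftrightarrow> x = \<zero>\<^bsub>M\<^esub>"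
  using \<phi>_inj[of x "\<zero>\<^bsub>M\<^esub>"] by simp

lemma \<phi>_neg: "x \<in> carrier M \<Longrightarrow> \<phi> (\<ominus>\<^bsub>M\<^esub> x) = - \<phi> x"
  using \<phi>_add[of x "\<ominus>\<^bsub>M\<^esub> x"] by (simp add: M.r_neg eq_neg_iff_add_eq_0 add.commute)

lemma \<phi>_scal: "x \<in> carrier M \<Longrightarrow> \<phi> (scal q c \<odot>\<^bsub>M\<^esub> x) = c *s \<phi> x"
  by (simp add: scal_def \<phi>_cls)

lemma \<phi>_finsum:
  assumes "finite A" "f \<in> A \<rightarrow> carrier M"
  shows "\<phi> (\<Oplus>\<^bsub>M\<^esub>i\<in>A. f i) = (\<Sum>i\<in>A. \<phi> (f i))"
  using assms
proof (induction A rule: finite_induct)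
  case (insert x A)
  then have "f x \<in> carrier M" "f \<in> A \<rightarrow> carrier M" by auto
  with insert show ?case by (simp add: \<phi>_add)
qed simp

lemma submodule_invariant:
  assumes "submodule N (Uq q) M" shows "invariant (\<phi> ` N)"
proof -
  have N: "N \<subseteq> carrier M" "\<zero>\<^bsub>M\<^esub> \<in> N" "\<And>x y. \<lbrakk>x \<in> N; y \<in> N\<rbrakk> \<Longrightarrow> x \<oplus>\<^bsub>M\<^esub> y \<in> N"
    and s: "\<And>p x. x \<in> N \<Longrightarrow> cls q p \<odot>\<^bsub>M\<^esub> x \<in> N"
    using assms subgroup.subset[of N "add_monoid M"] subgroup.one_closed[of N "add_monoid M"]
      subgroup.m_closed[of N "add_monoid M"]
    by (auto simp: submodule_def submodule_axioms_def)
  have "\<phi> x + \<phi> y \<in> \<phi> ` N" if "x \<in> N" "y \<in> N" for x y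
    using N that \<phi>_add[of x y] by (metis image_eqI subsetD)
  moreover have "c *s \<phi> x \<in> \<phi> ` N" if "x \<in> N" for c x
    using N s[OF that, of "const c"] that \<phi>_cls[of x "const c"] by (metis image_eqI subsetD act_const)
  moreover have "\<rho> g (\<phi> x) \<in> \<phi> ` N" if "x \<in> N" for g x
    using N s[OF that, of "gvar g"] that \<phi>_cls[of x "gvar g"] by (metis image_eqI subsetD act_gvar)
  moreover have "0 \<in> \<phi> ` N" using N by (metis \<phi>_zero image_eqI)
  ultimately show ?thesis using N(1) by (auto simp: invariant_def subspace_def)
qed

lemma invariant_submodule:
  assumes "invariant N" shows "submodule {x \<in> carrier M. \<phi> x \<in> N} (Uq q) M"
proof -
  have "subspace N" using assms by (simp add: invariant_def)
  then have "subgroup {x \<in> carrier M. \<phi> x \<in> N} (add_monoid M)"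
    by (intro group.subgroupI[OF M.a_group])
       (auto simp: \<phi>_add \<phi>_neg subspace_def subspace_neg simp flip: a_inv_def intro: exI[of _ "\<zero>\<^bsub>M\<^esub>"])
  then show ?thesis
    using assms by (auto simp: submodule_def submodule_axioms_def Uq_carrier \<phi>_cls invariant_act)
qed

lemma fin_generated_iff: "fin_generated (Uq q) M \<longleftrightarrow> fin_gen"
proof -
  have gen: "submodule_gen (Uq q) M S = carrier M \<longleftrightarrow> (\<forall>N. invariant N \<longrightarrow> \<phi> ` S \<subseteq> N \<longrightarrow> N = W)"
    if S: "S \<subseteq> carrier M" for S
  proof
    assume g: "submodule_gen (Uq q) M S = carrier M"
    show "\<forall>N. invariant N \<longrightarrow> \<phi> ` S \<subseteq> N \<longrightarrow> N = W"
    proof (intro allI impI)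
      fix N assume N: "invariant N" "\<phi> ` S \<subseteq> N"
      then have "submodule_gen (Uq q) M S \<subseteq> {x \<in> carrier M. \<phi> x \<in> N}"
        unfolding submodule_gen_def using invariant_submodule[OF N(1)] S by (intro Inter_lower) auto
      with g have "\<phi> x \<in> N" if "x \<in> carrier M" for x using that by auto
      then have "W \<subseteq> N" using \<phi>_surj by blast
      with N(1) show "N = W" by (auto simp: invariant_def)
    qed
  next
    assume h: "\<forall>N. invariant N \<longrightarrow> \<phi> ` S \<subseteq> N \<longrightarrow> N = W"
    have "N = carrier M" if "submodule N (Uq q) M" "S \<subseteq> N" for N
    proof -
      have "N \<subseteq> carrier M"
        using that(1) subgroup.subset[of N "add_monoid M"] by (auto simp: submodule_def)
      moreover have "\<phi> ` N = \<phi> ` carrier M"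
        using h[rule_format, OF submodule_invariant[OF that(1)] image_mono[OF that(2)]]
        unfolding bij_betw_imp_surj_on[OF \<phi>_bij] .
      ultimately show ?thesis
        using \<phi>_bij inj_on_image_eq_iff[of \<phi> "carrier M" N "carrier M"] by (simp add: bij_betw_def)
    qed
    moreover have "submodule (carrier M) (Uq q) M"
    proof -
      have "{x \<in> carrier M. \<phi> x \<in> W} = carrier M" by auto
      then show ?thesis using invariant_submodule[OF invariant_W] by (simp only:)
    qed
    ultimately have "{N. submodule N (Uq q) M \<and> S \<subseteq> N} = {carrier M}"
      using S by blast
    then show "submodule_gen (Uq q) M S = carrier M"
      unfolding submodule_gen_def by (simp only: Inter_insert Inter_empty Int_UNIV_right)
  qed
  have "fin_generated (Uq q) M \<longleftrightarrow>
      (\<exists>S. finite S \<and> S \<subseteq> carrier M \<and> (\<forall>N. invariant N \<longrightarrow> \<phi> ` S \<subseteq> N \<longrightarrow> N = W))"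
    unfolding fin_generated_def by (intro ex_cong1 conj_cong refl gen)
  also have "\<dots> \<longleftrightarrow> fin_gen"
    unfolding fin_gen_def
    using ex_finite_subset_image[of "carrier M" "\<lambda>S. \<forall>N. invariant N \<longrightarrow> S \<subseteq> N \<longrightarrow> N = W" \<phi>]
    unfolding bij_betw_imp_surj_on[OF \<phi>_bij] .
  finally show ?thesis .
qed

lemma weight_space_iff: "x \<in> weight_space q M \<mu> \<longleftrightarrow> x \<in> carrier M \<and> wvec \<mu> (\<phi> x)"
proof (cases "x \<in> carrier M")
  case True
  then have "cls q fK \<odot>\<^bsub>M\<^esub> x = scal q \<mu> \<odot>\<^bsub>M\<^esub> x \<longleftrightarrow> \<phi> (cls q fK \<odot>\<^bsub>M\<^esub> x) = \<phi> (scal q \<mu> \<odot>\<^bsub>M\<^esub> x)"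
    by (subst \<phi>_inj) (simp_all add: scal_def)
  with True show ?thesis by (simp add: weight_space_def wvec_def \<phi>_cls \<phi>_scal)
qed (simp add: weight_space_def)

lemma supp_subset_iff: "supp q M \<subseteq> \<xi> \<longleftrightarrow> (\<forall>\<mu> v. wvec \<mu> v \<longrightarrow> v \<noteq> 0 \<longrightarrow> \<mu> \<in> \<xi>)"
proof -
  have z: "\<zero>\<^bsub>M\<^esub> \<in> weight_space q M \<mu>" for \<mu> by (simp add: weight_space_iff)
  have "\<mu> \<in> supp q M \<longleftrightarrow> (\<exists>v. wvec \<mu> v \<and> v \<noteq> 0)" for \<mu>
  proof
    assume "\<mu> \<in> supp q M"
    then obtain x where "x \<in> weight_space q M \<mu>" "x \<noteq> \<zero>\<^bsub>M\<^esub>" using z[of \<mu>] by (auto simp: supp_def)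
    then show "\<exists>v. wvec \<mu> v \<and> v \<noteq> 0" using \<phi>_eq_0 by (auto simp: weight_space_iff)
  next
    assume "\<exists>v. wvec \<mu> v \<and> v \<noteq> 0"
    then obtain v where v: "wvec \<mu> v" "v \<noteq> 0" by blast
    then obtain x where x: "x \<in> carrier M" "\<phi> x = v" using \<phi>_surj wvec_W by blast
    then have "x \<in> weight_space q M \<mu>" "x \<noteq> \<zero>\<^bsub>M\<^esub>" using v by (auto simp: weight_space_iff)
    then show "\<mu> \<in> supp q M" using wvec_nonzero[OF v] by (auto simp: supp_def)
  qed
  then show ?thesis by (auto simp: subset_iff)
qed

text \<open>Existence is the spanning property. For uniqueness, the difference of two decompositions
  is a vanishing sum of weight vectors of distinct weights, so \<open>wvec_components\<close> with
  the zero subspace applies.\<close>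

lemma weight_module_iff: "weight_module q M \<longleftrightarrow> weighty"
proof
  assume wm: "weight_module q M"
  show weighty
    unfolding weighty_def
  proof
    fix v assume "v \<in> W"
    then obtain x where x: "x \<in> carrier M" "\<phi> x = v" using \<phi>_surj by blast
    with wm obtain f where f: "\<forall>\<mu>. \<mu> \<noteq> 0 \<longrightarrow> f \<mu> \<in> weight_space q M \<mu>" "f 0 = \<zero>\<^bsub>M\<^esub>"
        "finite {\<mu>. f \<mu> \<noteq> \<zero>\<^bsub>M\<^esub>}" "x = (\<Oplus>\<^bsub>M\<^esub>\<mu>\<in>{\<mu>. f \<mu> \<noteq> \<zero>\<^bsub>M\<^esub>}. f \<mu>)"
      unfolding weight_module_def by blast
    have w: "f \<mu> \<in> carrier M \<and> wvec \<mu> (\<phi> (f \<mu>))" for \<mu>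
      using f(1,2) by (cases "\<mu> = 0") (auto simp: weight_space_iff)
    have "v = (\<Sum>\<mu> | f \<mu> \<noteq> \<zero>\<^bsub>M\<^esub>. \<phi> (f \<mu>))"
      unfolding x(2)[symmetric] f(4) using f(3) w by (subst \<phi>_finsum) auto
    also have "\<dots> \<in> span {v. \<exists>\<mu>. wvec \<mu> v}"
      using w by (intro span_sum span_base) blast
    finally show "v \<in> span {v. \<exists>\<mu>. wvec \<mu> v}" .
  qed
next
  assume weighty
  show "weight_module q M"
    unfolding weight_module_def
  proof
    fix x assume x: "x \<in> carrier M"
    obtain f where f: "\<And>\<mu>. wvec \<mu> (f \<mu>)" "finite {\<mu>. f \<mu> \<noteq> 0}" "\<phi> x = (\<Sum>\<mu> | f \<mu> \<noteq> 0. f \<mu>)"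
      using \<open>weighty\<close> span_wvec_sum[of "\<phi> x"] x by (auto simp: weighty_def subset_iff)
    have "\<forall>\<mu>. \<exists>y\<in>carrier M. \<phi> y = f \<mu>" using f(1) \<phi>_surj by blast
    then obtain g where g: "\<And>\<mu>. g \<mu> \<in> carrier M" "\<And>\<mu>. \<phi> (g \<mu>) = f \<mu>" by metis
    have g0: "g \<mu> \<noteq> \<zero>\<^bsub>M\<^esub> \<longleftrightarrow> f \<mu> \<noteq> 0" for \<mu> using g \<phi>_eq_0 by metis
    \<comment> \<open>\<open>K\<close> is invertible, so only the zero vector has weight zero; this
      agrees with the normalisation of \<open>f 0\<close> in \<open>weight_module\<close>.\<close>
    have f0: "f 0 = 0" using wvec_nonzero[OF f(1)] by blast
    have "\<phi> x = \<phi> (\<Oplus>\<^bsub>M\<^esub>\<mu>\<in>{\<mu>. g \<mu> \<noteq> \<zero>\<^bsub>M\<^esub>}. g \<mu>)"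
      using f g by (subst \<phi>_finsum) (auto simp: g0)
    then have gx: "x = (\<Oplus>\<^bsub>M\<^esub>\<mu>\<in>{\<mu>. g \<mu> \<noteq> \<zero>\<^bsub>M\<^esub>}. g \<mu>)"
      using x g by (subst (asm) \<phi>_inj) (auto intro: M.finsum_closed)
    show "\<exists>!f. (\<forall>\<mu>. \<mu> \<noteq> 0 \<longrightarrow> f \<mu> \<in> weight_space q M \<mu>) \<and> f 0 = \<zero>\<^bsub>M\<^esub> \<and>
        finite {\<mu>. f \<mu> \<noteq> \<zero>\<^bsub>M\<^esub>} \<and> x = (\<Oplus>\<^bsub>M\<^esub>\<mu>\<in>{\<mu>. f \<mu> \<noteq> \<zero>\<^bsub>M\<^esub>}. f \<mu>)"
    proof (rule ex1I[of _ g])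
      show "(\<forall>\<mu>. \<mu> \<noteq> 0 \<longrightarrow> g \<mu> \<in> weight_space q M \<mu>) \<and> g 0 = \<zero>\<^bsub>M\<^esub> \<and>
        finite {\<mu>. g \<mu> \<noteq> \<zero>\<^bsub>M\<^esub>} \<and> x = (\<Oplus>\<^bsub>M\<^esub>\<mu>\<in>{\<mu>. g \<mu> \<noteq> \<zero>\<^bsub>M\<^esub>}. g \<mu>)"
        using f g gx f0 g0 by (auto simp: weight_space_iff)
      fix h assume h: "(\<forall>\<mu>. \<mu> \<noteq> 0 \<longrightarrow> h \<mu> \<in> weight_space q M \<mu>) \<and> h 0 = \<zero>\<^bsub>M\<^esub> \<and>
        finite {\<mu>. h \<mu> \<noteq> \<zero>\<^bsub>M\<^esub>} \<and> x = (\<Oplus>\<^bsub>M\<^esub>\<mu>\<in>{\<mu>. h \<mu> \<noteq> \<zero>\<^bsub>M\<^esub>}. h \<mu>)"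
      have w: "h \<mu> \<in> carrier M \<and> wvec \<mu> (\<phi> (h \<mu>))" for \<mu>
        using h by (cases "\<mu> = 0") (auto simp: weight_space_iff)
      have e: "\<phi> x = (\<Sum>\<mu> | h \<mu> \<noteq> \<zero>\<^bsub>M\<^esub>. \<phi> (h \<mu>))"
      proof -
        have "\<phi> (\<Oplus>\<^bsub>M\<^esub>\<mu>\<in>{\<mu>. h \<mu> \<noteq> \<zero>\<^bsub>M\<^esub>}. h \<mu>) = (\<Sum>\<mu> | h \<mu> \<noteq> \<zero>\<^bsub>M\<^esub>. \<phi> (h \<mu>))"
          using h w by (intro \<phi>_finsum) auto
        moreover have "x = (\<Oplus>\<^bsub>M\<^esub>\<mu>\<in>{\<mu>. h \<mu> \<noteq> \<zero>\<^bsub>M\<^esub>}. h \<mu>)" using h by blast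
        ultimately show ?thesis by simp
      qed
      define A where "A = {\<mu>. h \<mu> \<noteq> \<zero>\<^bsub>M\<^esub>} \<union> {\<mu>. f \<mu> \<noteq> 0}"
      have A: "finite A" using f h by (simp add: A_def)
      have "(\<Sum>\<mu>\<in>A. \<phi> (h \<mu>) - f \<mu>) = (\<Sum>\<mu>\<in>A. \<phi> (h \<mu>)) - (\<Sum>\<mu>\<in>A. f \<mu>)"
        by (rule sum_subtractf)
      also have "(\<Sum>\<mu>\<in>A. \<phi> (h \<mu>)) = \<phi> x"
        unfolding e using A by (intro sum.mono_neutral_right) (auto simp: A_def)
      also have "(\<Sum>\<mu>\<in>A. f \<mu>) = \<phi> x"
        unfolding f(3) using A by (intro sum.mono_neutral_right) (auto simp: A_def)
      finally have "(\<Sum>\<mu>\<in>A. \<phi> (h \<mu>) - f \<mu>) \<in> {0}" by simp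
      then have "\<forall>\<mu>\<in>A. \<phi> (h \<mu>) - f \<mu> \<in> {0}"
        using A w f by (intro wvec_components) (auto intro: wvec_diff)
      then have "\<phi> (h \<mu>) = f \<mu>" for \<mu> by (cases "\<mu> \<in> A") (auto simp: A_def)
      then have "h \<mu> = g \<mu>" for \<mu> using g[of \<mu>] w[of \<mu>] \<phi>_inj[of "h \<mu>" "g \<mu>"] by simp
      then show "h = g" by (rule ext)
    qed
  qed
qed

lemma fin_dim_iff:
  assumes T: "T \<subseteq> carrier M"
  shows "fin_dim (scal q) M T \<longleftrightarrow> (\<exists>B. finite B \<and> B \<subseteq> \<phi> ` T \<and> \<phi> ` T = span B)"
proof -
  have e: "\<phi> ` {(\<Oplus>\<^bsub>M\<^esub>b\<in>B. scal q (c b) \<odot>\<^bsub>M\<^esub> b) | c. True} = span (\<phi> ` B)"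
    and c: "{(\<Oplus>\<^bsub>M\<^esub>b\<in>B. scal q (c b) \<odot>\<^bsub>M\<^esub> b) | c. True} \<subseteq> carrier M"
    if B: "finite B" "B \<subseteq> carrier M" for B
  proof -
    show "{(\<Oplus>\<^bsub>M\<^esub>b\<in>B. scal q (c b) \<odot>\<^bsub>M\<^esub> b) | c. True} \<subseteq> carrier M"
      using B by (auto intro!: M.finsum_closed simp: scal_def subset_iff)
    have inj: "inj_on \<phi> B" using B \<phi>_inj by (auto intro!: inj_onI)
    have "\<phi> (\<Oplus>\<^bsub>M\<^esub>b\<in>B. scal q (c b) \<odot>\<^bsub>M\<^esub> b) = (\<Sum>b\<in>B. c b *s \<phi> b)" for c
      using B by (subst \<phi>_finsum) (auto simp: scal_def \<phi>_cls subset_iff intro!: sum.cong)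
    then have "\<phi> ` {(\<Oplus>\<^bsub>M\<^esub>b\<in>B. scal q (c b) \<odot>\<^bsub>M\<^esub> b) | c. True} = range (\<lambda>c. \<Sum>b\<in>B. c b *s \<phi> b)"
      by (auto simp: image_iff) metis+
    also have "\<dots> = range (\<lambda>u. \<Sum>v\<in>\<phi> ` B. u v *s v)"
    proof (intro equalityI subsetI)
      fix y assume "y \<in> range (\<lambda>c. \<Sum>b\<in>B. c b *s \<phi> b)"
      then obtain c where "y = (\<Sum>b\<in>B. c b *s \<phi> b)" by blast
      then have "y = (\<Sum>v\<in>\<phi> ` B. c (inv_into B \<phi> v) *s v)"
        by (simp add: sum.reindex[OF inj] inv_into_f_f[OF inj])
      then show "y \<in> range (\<lambda>u. \<Sum>v\<in>\<phi> ` B. u v *s v)"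
        by (intro image_eqI[of _ _ "\<lambda>v. c (inv_into B \<phi> v)"]) simp_all
    next
      fix y assume "y \<in> range (\<lambda>u. \<Sum>v\<in>\<phi> ` B. u v *s v)"
      then obtain u where "y = (\<Sum>v\<in>\<phi> ` B. u v *s v)" by blast
      then have "y = (\<Sum>b\<in>B. (u \<circ> \<phi>) b *s \<phi> b)" by (simp add: sum.reindex[OF inj])
      then show "y \<in> range (\<lambda>c. \<Sum>b\<in>B. c b *s \<phi> b)" by blast
    qed
    also have "\<dots> = span (\<phi> ` B)" using B by (simp add: span_finite)
    finally show "\<phi> ` {(\<Oplus>\<^bsub>M\<^esub>b\<in>B. scal q (c b) \<odot>\<^bsub>M\<^esub> b) | c. True} = span (\<phi> ` B)" .
  qed
  have inj: "inj_on \<phi> (carrier M)" using \<phi>_bij by (simp add: bij_betw_def)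
  show ?thesis
  proof
    assume "fin_dim (scal q) M T"
    then obtain B where B: "finite B" "B \<subseteq> carrier M" "B \<subseteq> T"
        "T = {(\<Oplus>\<^bsub>M\<^esub>b\<in>B. scal q (c b) \<odot>\<^bsub>M\<^esub> b) | c. True}"
      unfolding fin_dim_def by blast
    have "\<phi> ` T = span (\<phi> ` B)" by (subst B(4)) (rule e[OF B(1,2)])
    then show "\<exists>B. finite B \<and> B \<subseteq> \<phi> ` T \<and> \<phi> ` T = span B"
      using B(1) image_mono[OF B(3), of \<phi>] by (intro exI[of _ "\<phi> ` B"] conjI) simp_all
  next
    assume "\<exists>B. finite B \<and> B \<subseteq> \<phi> ` T \<and> \<phi> ` T = span B"
    then obtain B where B: "finite B" "B \<subseteq> T" "\<phi> ` T = span (\<phi> ` B)"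
      by (metis finite_subset_image)
    have "\<phi> ` T = \<phi> ` {(\<Oplus>\<^bsub>M\<^esub>b\<in>B. scal q (c b) \<odot>\<^bsub>M\<^esub> b) | c. True}"
      unfolding e[OF B(1) order_trans[OF B(2) T]] by (rule B(3))
    then have "T = {(\<Oplus>\<^bsub>M\<^esub>b\<in>B. scal q (c b) \<odot>\<^bsub>M\<^esub> b) | c. True}"
      using inj_on_image_eq_iff[OF inj T c[OF B(1)]] B(2) T by blast
    then show "fin_dim (scal q) M T"
      unfolding fin_dim_def using B T by (intro exI[of _ B]) auto
  qed
qed

text \<open>The orbit of \<open>v\<close> is a subspace containing \<open>v\<close> and stable under
  \<open>E\<close> and \<open>X\<close>, and it lies in every other such subspace. So it has finite
  dimension as soon as one of them does.\<close>

lemma loc_fin_iff: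
  "(\<forall>v\<in>carrier M. fin_dim (scal q) M ((\<lambda>u. u \<odot>\<^bsub>M\<^esub> v) ` subalg_gen q {cls q fE, cls q fX})) \<longleftrightarrow> loc_fin"
proof -
  let ?A = "subalg_gen q {cls q fE, cls q fX}"
  let ?T = "\<lambda>v. (\<lambda>u. u \<odot>\<^bsub>M\<^esub> v) ` ?A"
  have Ac: "u \<in> carrier (Uq q)" if "u \<in> ?A" for u
    using that by (rule subalg_closed[rotated]) auto
  have T: "?T v \<subseteq> carrier M" if "v \<in> carrier M" for v
    using that Ac M.smult_closed by auto
  have A: "cls q 1 \<in> ?A" "cls q fE \<in> ?A" "cls q fX \<in> ?A" "scal q c \<in> ?A" for c
    unfolding subalg_gen_def by (auto intro: generate_ring.incl simp flip: cls_one intro: generate_ring.one)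
  have Am: "u \<otimes>\<^bsub>Uq q\<^esub> w \<in> ?A" and Aa: "u \<oplus>\<^bsub>Uq q\<^esub> w \<in> ?A" if "u \<in> ?A" "w \<in> ?A" for u w
    using that unfolding subalg_gen_def by (auto intro: generate_ring.intros)
  have mul: "\<phi> ((cls q p \<otimes>\<^bsub>Uq q\<^esub> u) \<odot>\<^bsub>M\<^esub> v) = act p (\<phi> (u \<odot>\<^bsub>M\<^esub> v))" if "u \<in> ?A" "v \<in> carrier M" for p u v
    using that Ac by (simp add: M.smult_assoc \<phi>_cls M.smult_closed)
  have EX: "act p y \<in> \<phi> ` ?T v" if a: "cls q p \<in> ?A" "v \<in> carrier M" "y \<in> \<phi> ` ?T v" for p v y
  proof -
    obtain u where u: "u \<in> ?A" "y = \<phi> (u \<odot>\<^bsub>M\<^esub> v)" using a(3) by blast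
    have "act p y = \<phi> ((cls q p \<otimes>\<^bsub>Uq q\<^esub> u) \<odot>\<^bsub>M\<^esub> v)" unfolding u(2) using mul[OF u(1) a(2)] by simp
    then show ?thesis using Am[OF a(1) u(1)] by blast
  qed
  have sub: "subspace (\<phi> ` ?T v)" if v: "v \<in> carrier M" for v
    unfolding subspace_def
  proof (intro conjI ballI allI)
    have "act 0 (\<phi> (cls q 1 \<odot>\<^bsub>M\<^esub> v)) \<in> \<phi> ` ?T v"
      using A(4)[of 0] by (intro EX v) (auto simp: scal_def const_simps A)
    then show "0 \<in> \<phi> ` ?T v" by simp
    show "c *s x \<in> \<phi> ` ?T v" if "x \<in> \<phi> ` ?T v" for c x
      using EX[of "const c" v x] A(4)[of c] that v by (simp add: scal_def)
    fix x y assume "x \<in> \<phi> ` ?T v" "y \<in> \<phi> ` ?T v"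
    then obtain u w where u: "u \<in> ?A" "w \<in> ?A" "x = \<phi> (u \<odot>\<^bsub>M\<^esub> v)" "y = \<phi> (w \<odot>\<^bsub>M\<^esub> v)" by blast
    then have "x + y = \<phi> ((u \<oplus>\<^bsub>Uq q\<^esub> w) \<odot>\<^bsub>M\<^esub> v)"
      using v Ac by (simp add: M.smult_l_distr \<phi>_add M.smult_closed)
    then show "x + y \<in> \<phi> ` ?T v" using u Aa by blast
  qed
  have one: "\<phi> v \<in> \<phi> ` ?T v" if "v \<in> carrier M" for v
    using A(1) that \<phi>_cls[of v 1] by (auto simp: image_iff intro!: bexI[of _ "cls q 1"])
  show ?thesis
  proof
    assume fd: "\<forall>v\<in>carrier M. fin_dim (scal q) M (?T v)"
    show loc_fin
      unfolding loc_fin_def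
    proof
      fix w assume "w \<in> W"
      then obtain v where v: "v \<in> carrier M" "w = \<phi> v" using \<phi>_surj by blast
      obtain B where B: "finite B" "B \<subseteq> \<phi> ` ?T v" "\<phi> ` ?T v = span B"
        using iffD1[OF fin_dim_iff[OF T[OF v(1)]] bspec[OF fd v(1)]] by blast
      have "B \<subseteq> W" using B(2) T[OF v(1)] by (auto simp: subset_iff)
      moreover have "w \<in> span B" using one[OF v(1)] B v by simp
      moreover have "\<forall>x\<in>span B. \<rho> gen_E x \<in> span B \<and> \<rho> gen_X x \<in> span B"
        using EX[OF A(2) v(1)] EX[OF A(3) v(1)] B(3) by simp
      ultimately show "\<exists>B. finite B \<and> B \<subseteq> W \<and> w \<in> span B \<and>
         (\<forall>x\<in>span B. \<rho> gen_E x \<in> span B \<and> \<rho> gen_X x \<in> span B)"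
        using B(1) by blast
    qed
  next
    assume loc_fin
    show "\<forall>v\<in>carrier M. fin_dim (scal q) M (?T v)"
    proof
      fix v assume v: "v \<in> carrier M"
      then obtain B where B: "finite B" "B \<subseteq> W" "\<phi> v \<in> span B"
         "\<forall>x\<in>span B. \<rho> gen_E x \<in> span B \<and> \<rho> gen_X x \<in> span B"
        using \<open>loc_fin\<close>[unfolded loc_fin_def, rule_format, OF \<phi>_closed[OF v]] by blast
      have sB: "\<phi> ` ?T v \<subseteq> span B"
      proof (clarify)
        fix u assume "u \<in> ?A"
        then obtain p where p: "u = cls q p" "\<forall>x\<in>span B. act p x \<in> span B"
          using subalg_act[of "span B" u] B span_subset_W[OF B(2)] by auto
        then show "\<phi> (u \<odot>\<^bsub>M\<^esub> v) \<in> span B" using B v by (simp add: \<phi>_cls)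
      qed
      obtain C where C: "finite C" "C \<subseteq> \<phi> ` ?T v" "\<phi> ` ?T v = span C"
        by (rule subspace_of_span_finite[OF sub[OF v] sB B(1)])
      then show "fin_dim (scal q) M (?T v)"
        by (intro iffD2[OF fin_dim_iff[OF T[OF v]]] exI[of _ C] conjI C)
    qed
  qed
qed

lemma in_cat_O_iff: "in_cat_O q M \<longleftrightarrow> fin_gen \<and> weighty \<and> loc_fin"
  unfolding in_cat_O_def
  by (simp add: left_module_M fin_generated_iff weight_module_iff loc_fin_iff)

lemma central_charge_iff: "central_charge q z M \<longleftrightarrow> (\<forall>v\<in>W. \<rho> gen_Z v = z *s v)"
proof -
  have "cls q fZ \<odot>\<^bsub>M\<^esub> v = scal q z \<odot>\<^bsub>M\<^esub> v \<longleftrightarrow> \<rho> gen_Z (\<phi> v) = z *s \<phi> v" if "v \<in> carrier M" for v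
    using \<phi>_inj[of "cls q fZ \<odot>\<^bsub>M\<^esub> v" "scal q z \<odot>\<^bsub>M\<^esub> v"] that
    by (simp add: \<phi>_scal \<phi>_cls) (simp add: scal_def)
  then show ?thesis
    unfolding central_charge_def using \<phi>_bij by (auto simp: bij_betw_def)
qed

end

section \<open>Modules as representations on function spaces, and representations as modules in a
  given type\<close>

lemma single_Cons: "Poly_Mapping.single (GWord (g # gs)) c = gvar g * Poly_Mapping.single (GWord gs) c"
  by (simp add: gvar_def mult_single)

lemma single_Nil: "Poly_Mapping.single (GWord []) c = const c"
  by (simp add: const_def zero_gword_def)

text \<open>\<open>\<phi>\<close> embeds the underlying complex space, and the generators act on its
  image by transport. That all classes then act correctly follows by induction over words and
  sums.\<close>

lemma left_module_uq_iso:
  fixes M :: "(uq, 'a) module"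
  assumes "left_module (Uq q) M"
  shows "\<exists>W \<rho> \<phi>. uq_iso (fscale :: complex \<Rightarrow> (('a \<Rightarrow> complex) \<Rightarrow> complex) \<Rightarrow> _) W \<rho> q M \<phi>"
proof -
  interpret left_module "Uq q" M by fact
  interpret sp: complex_space M "\<lambda>c x. scal q c \<odot>\<^bsub>M\<^esub> x"
  proof unfold_locales
    fix x c d assume x: "x \<in> carrier M"
    show "scal q c \<odot>\<^bsub>M\<^esub> x \<in> carrier M" using x by (simp add: smult_closed)
    show "scal q (c + d) \<odot>\<^bsub>M\<^esub> x = scal q c \<odot>\<^bsub>M\<^esub> x \<oplus>\<^bsub>M\<^esub> scal q d \<odot>\<^bsub>M\<^esub> x"
      using x smult_l_distr[of "scal q c" "scal q d" x] by (simp add: scal_def cls_add const_simps)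
    show "scal q (c * d) \<odot>\<^bsub>M\<^esub> x = scal q c \<odot>\<^bsub>M\<^esub> (scal q d \<odot>\<^bsub>M\<^esub> x)"
      using x smult_assoc[of "scal q c" "scal q d" x] by (simp add: scal_def cls_mult const_simps)
    show "scal q 1 \<odot>\<^bsub>M\<^esub> x = x"
      using x smult_one by (simp add: scal_def const_simps cls_one)
  qed (simp add: smult_r_distr)
  obtain \<phi> :: "'a \<Rightarrow> ('a \<Rightarrow> complex) \<Rightarrow> complex" where inj: "inj_on \<phi> (carrier M)"
    and \<phi>_add: "\<And>x y. \<lbrakk>x \<in> carrier M; y \<in> carrier M\<rbrakk> \<Longrightarrow> \<phi> (x \<oplus>\<^bsub>M\<^esub> y) = \<phi> x + \<phi> y"
    and scale: "\<And>c x. x \<in> carrier M \<Longrightarrow> \<phi> (scal q c \<odot>\<^bsub>M\<^esub> x) = fscale c (\<phi> x)"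
    using sp.function_space_embedding by blast
  define W where "W = \<phi> ` carrier M"
  define \<rho> where "\<rho> g v = \<phi> (cls q (gvar g) \<odot>\<^bsub>M\<^esub> inv_into (carrier M) \<phi> v)" for g v
  have \<rho>: "\<rho> g (\<phi> x) = \<phi> (cls q (gvar g) \<odot>\<^bsub>M\<^esub> x)" if "x \<in> carrier M" for g x
    using that inj by (simp add: \<rho>_def)
  have cl [simp]: "cls q p \<odot>\<^bsub>M\<^esub> x \<in> carrier M" if "x \<in> carrier M" for p x
    using that by (simp add: smult_closed)
  \<comment> \<open>Constants are central in the free algebra, so every class acts linearly over the
    complex numbers.\<close>
  have comm: "cls q p \<odot>\<^bsub>M\<^esub> (scal q c \<odot>\<^bsub>M\<^esub> x) = scal q c \<odot>\<^bsub>M\<^esub> (cls q p \<odot>\<^bsub>M\<^esub> x)"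
    if x: "x \<in> carrier M" for p c x
  proof -
    have "p * const c = const c * p"
    proof (induction p rule: free_alg_induct)
      case (add w d p)
      then show ?case by (simp add: const_def mult_single distrib_left distrib_right mult.commute)
    qed simp
    then show ?thesis
      using smult_assoc[of "cls q p" "scal q c" x] smult_assoc[of "scal q c" "cls q p" x] x
      by (simp add: scal_def cls_mult)
  qed
  interpret operators fscale W \<rho>
  proof
    show "fspace.subspace W"
      unfolding fspace.subspace_def W_def
    proof (intro conjI ballI allI)
      have "\<phi> \<zero>\<^bsub>M\<^esub> = 0" using \<phi>_add[of "\<zero>\<^bsub>M\<^esub>" "\<zero>\<^bsub>M\<^esub>"] by simp
      then show "0 \<in> \<phi> ` carrier M" by (metis M.zero_closed image_eqI)
    next
      fix x y assume "x \<in> \<phi> ` carrier M" "y \<in> \<phi> ` carrier M"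
      then show "x + y \<in> \<phi> ` carrier M" by (auto simp flip: \<phi>_add)
    next
      fix c x assume "x \<in> \<phi> ` carrier M"
      then show "fscale c x \<in> \<phi> ` carrier M" by (auto simp flip: scale)
    qed
  next
    fix v g assume "v \<in> W"
    then show "\<rho> g v \<in> W" by (auto simp: W_def \<rho>)
  next
    fix v w g assume "v \<in> W" "w \<in> W"
    then show "\<rho> g (v + w) = \<rho> g v + \<rho> g w"
      by (auto simp: W_def \<rho> simp flip: \<phi>_add) (simp add: \<rho> smult_r_distr)
  next
    fix v g c assume "v \<in> W"
    then show "\<rho> g (fscale c v) = fscale c (\<rho> g v)"
      by (auto simp: W_def \<rho> simp flip: scale) (simp add: \<rho> comm)
  qed
  have single: "\<phi> (cls q (Poly_Mapping.single (GWord gs) c) \<odot>\<^bsub>M\<^esub> x) = act (Poly_Mapping.single (GWord gs) c) (\<phi> x)"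
    if x: "x \<in> carrier M" for gs c x
  proof (induction gs)
    case Nil
    have "\<phi> (cls q (const c) \<odot>\<^bsub>M\<^esub> x) = act (const c) (\<phi> x)"
      using scale[OF x, of c] unfolding scal_def by simp
    then show ?case by (simp only: single_Nil)
  next
    case (Cons g gs)
    have "\<phi> x \<in> W" using x by (simp add: W_def)
    have "cls q (Poly_Mapping.single (GWord (g # gs)) c) \<odot>\<^bsub>M\<^esub> x
        = cls q (gvar g) \<odot>\<^bsub>M\<^esub> (cls q (Poly_Mapping.single (GWord gs) c) \<odot>\<^bsub>M\<^esub> x)"
      using smult_assoc[of "cls q (gvar g)" "cls q (Poly_Mapping.single (GWord gs) c)" x] x
      by (simp add: single_Cons cls_mult)
    then show ?case
      by (simp only: single_Cons act_mult[OF \<open>\<phi> x \<in> W\<close>] act_gvar \<rho>[OF cl[OF x], symmetric] Cons)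
  qed
  have cls: "\<phi> (cls q p \<odot>\<^bsub>M\<^esub> x) = act p (\<phi> x)" if x: "x \<in> carrier M" for p x
  proof (induction p rule: free_alg_induct)
    case zero
    have "\<phi> (cls q 0 \<odot>\<^bsub>M\<^esub> x) = fscale 0 (\<phi> x)"
      using scale[OF x, of 0] by (simp add: scal_def const_simps)
    then show ?case by (simp only: act_zero fspace.scale_zero_left)
  next
    case (add w c p)
    have "cls q (Poly_Mapping.single w c + p) \<odot>\<^bsub>M\<^esub> x
        = cls q (Poly_Mapping.single w c) \<odot>\<^bsub>M\<^esub> x \<oplus>\<^bsub>M\<^esub> cls q p \<odot>\<^bsub>M\<^esub> x"
      using smult_l_distr[of "cls q (Poly_Mapping.single w c)" "cls q p" x] x by (simp add: cls_add)
    moreover have "\<phi> (cls q (Poly_Mapping.single w c) \<odot>\<^bsub>M\<^esub> x) = act (Poly_Mapping.single w c) (\<phi> x)"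
      using single[OF x] by (cases w) simp
    ultimately show ?case
      by (simp only: act_add \<phi>_add[OF cl[OF x] cl[OF x]] add)
  qed
  have "uq_iso fscale W \<rho> q M \<phi>"
  proof
    fix r v assume r: "r \<in> relators q" "v \<in> W"
    then obtain x where x: "x \<in> carrier M" "v = \<phi> x" by (auto simp: W_def)
    have "cls q r = cls q 0" using r(1) relators_subset by (auto simp: cls_eq_iff)
    then show "act r v = 0" using cls[OF x(1), of r] cls[OF x(1), of 0] x(2) by simp
  next
    show "bij_betw \<phi> (carrier M) W" using inj by (simp add: bij_betw_def W_def)
  qed (simp_all add: assms \<phi>_add cls)
  then show ?thesis by blast
qed

lemma (in left_module) left_module_submodule:
  assumes "submodule N R M" shows "left_module R (M\<lparr>carrier := N\<rparr>)"
proof -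
  have N: "N \<subseteq> carrier M" "\<zero>\<^bsub>M\<^esub> \<in> N" "\<And>x y. \<lbrakk>x \<in> N; y \<in> N\<rbrakk> \<Longrightarrow> x \<oplus>\<^bsub>M\<^esub> y \<in> N"
      "\<And>x. x \<in> N \<Longrightarrow> \<ominus>\<^bsub>M\<^esub> x \<in> N" "\<And>a x. \<lbrakk>a \<in> carrier R; x \<in> N\<rbrakk> \<Longrightarrow> a \<odot>\<^bsub>M\<^esub> x \<in> N"
    using assms subgroup.subset[of N "add_monoid M"] subgroup.one_closed[of N "add_monoid M"]
      subgroup.m_closed[of N "add_monoid M"] subgroup.m_inv_closed[of N "add_monoid M"]
    by (auto simp: submodule_def submodule_axioms_def a_inv_def)
  have c: "x \<in> carrier M" if "x \<in> N" for x using N(1) that by blast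
  have "abelian_group (M\<lparr>carrier := N\<rparr>)"
  proof (rule abelian_groupI)
    fix x assume "x \<in> carrier (M\<lparr>carrier := N\<rparr>)"
    then show "\<exists>y\<in>carrier (M\<lparr>carrier := N\<rparr>). y \<oplus>\<^bsub>M\<lparr>carrier := N\<rparr>\<^esub> x = \<zero>\<^bsub>M\<lparr>carrier := N\<rparr>\<^esub>"
      using N c M.l_neg by (intro bexI[of _ "\<ominus>\<^bsub>M\<^esub> x"]) auto
  qed (use N c in \<open>auto simp: M.a_ac\<close>)
  then show ?thesis
    using N c by (simp add: left_module_def left_module_axioms_def ring_axioms
        smult_l_distr smult_r_distr smult_assoc smult_one)
qed

context uq_iso
begin

lemma uq_iso_submodule:
  assumes N: "submodule N (Uq q) M"
  shows "uq_iso scale (\<phi> ` N) \<rho> q (M\<lparr>carrier := N\<rparr>) \<phi>"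
proof -
  have inv: "invariant (\<phi> ` N)" using N by (rule submodule_invariant)
  interpret N: uq_rep scale "\<phi> ` N" \<rho> q using inv by (rule invariant_uq_rep)
  have NM: "N \<subseteq> carrier M"
    using N subgroup.subset[of N "add_monoid M"] by (auto simp: submodule_def)
  have NM': "x \<in> carrier M" if "x \<in> N" for x using NM that by blast
  have "inj_on \<phi> N" using NM' \<phi>_inj by (auto intro!: inj_onI)
  then have bij: "bij_betw \<phi> N (\<phi> ` N)" by (simp add: bij_betw_def)
  show ?thesis
  proof (rule uq_iso.intro[OF N.uq_rep_axioms uq_iso_axioms.intro[OF M.left_module_submodule[OF N]]])
    show "bij_betw \<phi> (carrier (M\<lparr>carrier := N\<rparr>)) (\<phi> ` N)" using bij by simp
    show "\<phi> (x \<oplus>\<^bsub>M\<lparr>carrier := N\<rparr>\<^esub> y) = \<phi> x + \<phi> y"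
      if "x \<in> carrier (M\<lparr>carrier := N\<rparr>)" "y \<in> carrier (M\<lparr>carrier := N\<rparr>)" for x y
      using \<phi>_add[OF NM' NM', of x y] that by simp
    show "\<phi> (cls q p \<odot>\<^bsub>M\<lparr>carrier := N\<rparr>\<^esub> x) = act p (\<phi> x)"
      if "x \<in> carrier (M\<lparr>carrier := N\<rparr>)" for p x
      using \<phi>_cls[OF NM', of x p] that by simp
  qed
qed

end

text \<open>The converse direction: an injection \<open>e\<close> turns a representation on typed
  vectors into a module whose carrier lies in a prescribed type. This is how the models enter the
  types of the two categories.\<close>

definition transport_module :: "('v::ab_group_add \<Rightarrow> 'a) \<Rightarrow> 'v set \<Rightarrow> ('r \<Rightarrow> 'v \<Rightarrow> 'v) \<Rightarrow> ('r, 'a) module" where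
  "transport_module e W s =
     \<lparr>carrier = e ` W, monoid.mult = undefined, one = undefined, ring.zero = e 0,
      add = (\<lambda>x y. e (inv_into W e x + inv_into W e y)),
      module.smult = (\<lambda>u x. e (s u (inv_into W e x)))\<rparr>"

lemma transport_module_simps [simp]:
  "carrier (transport_module e W s) = e ` W" "\<zero>\<^bsub>transport_module e W s\<^esub> = e 0"
  "x \<oplus>\<^bsub>transport_module e W s\<^esub> y = e (inv_into W e x + inv_into W e y)"
  "u \<odot>\<^bsub>transport_module e W s\<^esub> x = e (s u (inv_into W e x))"
  by (simp_all add: transport_module_def)

lemma transport_left_module:
  assumes "ring R" and e: "inj_on e W"
    and W: "0 \<in> W" "\<And>v w. \<lbrakk>v \<in> W; w \<in> W\<rbrakk> \<Longrightarrow> v + w \<in> W" "\<And>v. v \<in> W \<Longrightarrow> - v \<in> W"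
    and s: "\<And>u v. \<lbrakk>u \<in> carrier R; v \<in> W\<rbrakk> \<Longrightarrow> s u v \<in> W"
      "\<And>u u' v. \<lbrakk>u \<in> carrier R; u' \<in> carrier R; v \<in> W\<rbrakk> \<Longrightarrow> s (u \<oplus>\<^bsub>R\<^esub> u') v = s u v + s u' v"
      "\<And>u v w. \<lbrakk>u \<in> carrier R; v \<in> W; w \<in> W\<rbrakk> \<Longrightarrow> s u (v + w) = s u v + s u w"
      "\<And>u u' v. \<lbrakk>u \<in> carrier R; u' \<in> carrier R; v \<in> W\<rbrakk> \<Longrightarrow> s (u \<otimes>\<^bsub>R\<^esub> u') v = s u (s u' v)"
      "\<And>v. v \<in> W \<Longrightarrow> s \<one>\<^bsub>R\<^esub> v = v"
  shows "left_module R (transport_module e W s)"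
proof -
  note [simp] = W s(1) inv_into_f_f[OF e]
  have "abelian_group (transport_module e W s)"
  proof (rule abelian_groupI)
    fix x assume "x \<in> carrier (transport_module e W s)"
    then obtain v where "v \<in> W" "x = e v" by auto
    then show "\<exists>y\<in>carrier (transport_module e W s).
        y \<oplus>\<^bsub>transport_module e W s\<^esub> x = \<zero>\<^bsub>transport_module e W s\<^esub>"
      by (intro bexI[of _ "e (- v)"]) auto
  qed (auto simp: add.assoc add.commute add.left_commute)
  then show ?thesis
    using \<open>ring R\<close> by (auto simp: left_module_def left_module_axioms_def s)
qed

lemma (in uq_rep) uq_iso_transport:
  assumes e: "inj_on e W"
  shows "uq_iso scale W \<rho> q (transport_module e W uact) (inv_into W e)"
proof (intro uq_iso.intro[OF uq_rep_axioms uq_iso_axioms.intro])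
  show "left_module (Uq q) (transport_module e W uact)"
    by (rule transport_left_module)
       (auto simp: Uq_ring e Uq_carrier uact_cls cls_add cls_mult act_add act_mult act_add_right cls_one)
  show "bij_betw (inv_into W e) (carrier (transport_module e W uact)) W"
    using bij_betw_inv_into[of e W "e ` W"] e by (simp add: bij_betw_def)
qed (use e in \<open>auto simp: inv_into_f_f uact_cls\<close>)

section \<open>Annihilation by powers of the central ideal\<close>

context uq_iso
begin

lemma ZC_ring_ring: "ring (ZC_ring q)"
  unfolding ZC_ring_def subalg_gen_def
  by (rule ring.generate_ring_is_ring[OF Uq_ring]) auto

lemma ZC_carrier:
  "scal q c \<in> carrier (ZC_ring q)" "cls q fZ \<in> carrier (ZC_ring q)" "cls q (fCtilde q) \<in> carrier (ZC_ring q)"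
  "\<lbrakk>cls q p \<in> carrier (ZC_ring q); cls q r \<in> carrier (ZC_ring q)\<rbrakk> \<Longrightarrow> cls q (p - r) \<in> carrier (ZC_ring q)"
proof -
  show "scal q c \<in> carrier (ZC_ring q)" "cls q fZ \<in> carrier (ZC_ring q)" "cls q (fCtilde q) \<in> carrier (ZC_ring q)"
    by (auto simp: ZC_ring_def subalg_gen_def intro: generate_ring.incl)
  assume "cls q p \<in> carrier (ZC_ring q)" "cls q r \<in> carrier (ZC_ring q)"
  then have "cls q p \<oplus>\<^bsub>Uq q\<^esub> (\<ominus>\<^bsub>Uq q\<^esub> cls q r) \<in> carrier (ZC_ring q)"
    by (auto simp: ZC_ring_def subalg_gen_def intro: generate_ring.intros)
  then show "cls q (p - r) \<in> carrier (ZC_ring q)" by (simp add: cls_uminus cls_add)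
qed

lemma ZC_generators: "{cls q (fCtilde q - const c), cls q (fZ - const z)} \<subseteq> carrier (ZC_ring q)"
  using ZC_carrier[unfolded scal_def] by simp

text \<open>The \<open>k\<close>-th power of a generator lies in the \<open>k\<close>-th power of
  the ideal. What is extracted is the nilpotency of the central element minus \<open>c\<close>,
  which later restricts the highest weights.\<close>

lemma ZC_power_annihilates:
  assumes "\<forall>a \<in> ZC_ideal q c z [^]\<^bsub>ideals_set (ZC_ring q)\<^esub> (k::nat). \<forall>v\<in>carrier M. a \<odot>\<^bsub>M\<^esub> v = \<zero>\<^bsub>M\<^esub>"
    and v: "v \<in> W"
  shows "act ((fCtilde q - const c) ^ k) v = 0"
proof -
  let ?p = "fCtilde q - const c"
  have "cls q ?p \<in> ZC_ideal q c z"
    using ring.genideal_self[OF ZC_ring_ring ZC_generators] by (auto simp: ZC_ideal_def)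
  then have "cls q (?p ^ k) \<in> ZC_ideal q c z [^]\<^bsub>ideals_set (ZC_ring q)\<^esub> k" for k :: nat
  proof (induction k)
    case 0
    have "cls q 1 \<in> carrier (ZC_ring q)" using ZC_carrier(1)[of 1] by (simp add: scal_def const_simps)
    then show ?case by (simp add: ideals_set_def nat_pow_def)
  next
    case (Suc k)
    have "cls q (?p ^ k) \<otimes>\<^bsub>ZC_ring q\<^esub> cls q ?p \<in>
        ideal_prod (ZC_ring q) (ZC_ideal q c z [^]\<^bsub>ideals_set (ZC_ring q)\<^esub> k) (ZC_ideal q c z)"
      using Suc by (intro ideal_prod.prod)
    then show ?case
      by (simp add: nat_pow_def ideals_set_def ZC_ring_def cls_mult power_commutes)
  qed
  moreover obtain x where "x \<in> carrier M" "\<phi> x = v" using \<phi>_surj[OF v] by blast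
  ultimately show ?thesis
    using assms(1) \<phi>_cls[of x "?p ^ k"] by simp
qed

text \<open>The annihilator of \<open>M\<close> in the central subring is an ideal containing both
  generators, so already the first power acts as zero.\<close>

lemma ZC_scalar_annihilates:
  assumes C: "\<And>v. v \<in> W \<Longrightarrow> act (fCtilde q) v = c *s v" and Z: "\<And>v. v \<in> W \<Longrightarrow> \<rho> gen_Z v = z *s v"
  shows "\<exists>k::nat. \<forall>a \<in> ZC_ideal q c z [^]\<^bsub>ideals_set (ZC_ring q)\<^esub> k. \<forall>v\<in>carrier M. a \<odot>\<^bsub>M\<^esub> v = \<zero>\<^bsub>M\<^esub>"
proof -
  define A where "A = {a \<in> carrier (ZC_ring q). \<forall>v\<in>carrier M. a \<odot>\<^bsub>M\<^esub> v = \<zero>\<^bsub>M\<^esub>}"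
  have carr: "a \<in> carrier (Uq q)" if "a \<in> carrier (ZC_ring q)" for a
    using that unfolding ZC_ring_def by (simp add: subalg_closed[of "{cls q fZ, cls q (fCtilde q)}"])
  have ann: "cls q p \<odot>\<^bsub>M\<^esub> v = \<zero>\<^bsub>M\<^esub> \<longleftrightarrow> act p (\<phi> v) = 0" if "v \<in> carrier M" for p v
    using that \<phi>_eq_0[of "cls q p \<odot>\<^bsub>M\<^esub> v"] by (simp add: \<phi>_cls)
  have A: "cls q p \<in> A \<longleftrightarrow> cls q p \<in> carrier (ZC_ring q) \<and> (\<forall>v\<in>W. act p v = 0)" for p
    unfolding A_def using ann \<phi>_bij by (auto simp: bij_betw_def)
  have cl: "\<exists>p. a = cls q p" if "a \<in> carrier (ZC_ring q)" for a
    using carr[OF that] by (auto simp: Uq_carrier)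
  have ops: "x \<otimes>\<^bsub>ZC_ring q\<^esub> y = x \<otimes>\<^bsub>Uq q\<^esub> y" "x \<oplus>\<^bsub>ZC_ring q\<^esub> y = x \<oplus>\<^bsub>Uq q\<^esub> y" for x y
    by (simp_all add: ZC_ring_def)
  interpret Z: ring "ZC_ring q" by (rule ZC_ring_ring)
  have m: "a \<otimes>\<^bsub>ZC_ring q\<^esub> b \<in> A" "b \<otimes>\<^bsub>ZC_ring q\<^esub> a \<in> A" if ab: "a \<in> A" "b \<in> carrier (ZC_ring q)" for a b
  proof -
    have a: "a \<in> carrier (ZC_ring q)" using ab by (simp add: A_def)
    obtain p r where "a = cls q p" "b = cls q r" using cl[OF a] cl[OF ab(2)] by blast
    with ab show "a \<otimes>\<^bsub>ZC_ring q\<^esub> b \<in> A" "b \<otimes>\<^bsub>ZC_ring q\<^esub> a \<in> A"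
      using Z.m_closed[OF a ab(2)] Z.m_closed[OF ab(2) a]
      by (auto simp: ops cls_mult A act_mult)
  qed
  have p: "a \<oplus>\<^bsub>ZC_ring q\<^esub> b \<in> A" if "a \<in> A" "b \<in> A" for a b
  proof -
    have a: "a \<in> carrier (ZC_ring q)" "b \<in> carrier (ZC_ring q)" using that by (simp_all add: A_def)
    obtain p r where "a = cls q p" "b = cls q r" using cl[OF a(1)] cl[OF a(2)] by blast
    with that show "a \<oplus>\<^bsub>ZC_ring q\<^esub> b \<in> A"
      using Z.a_closed[OF a] by (auto simp: ops cls_add A act_add)
  qed
  have "ideal A (ZC_ring q)"
  proof (rule idealI[OF ZC_ring_ring])
    show "subgroup A (add_monoid (ZC_ring q))"
    proof (rule group.subgroupI[OF Z.a_group])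
      show "A \<subseteq> carrier (add_monoid (ZC_ring q))" by (auto simp: A_def)
      have "cls q 0 \<in> A"
        using ZC_carrier(1)[of 0] by (simp add: A scal_def const_simps)
      then show "A \<noteq> {}" by blast
      fix a assume a: "a \<in> A"
      have "\<ominus>\<^bsub>ZC_ring q\<^esub> \<one>\<^bsub>ZC_ring q\<^esub> \<otimes>\<^bsub>ZC_ring q\<^esub> a = \<ominus>\<^bsub>ZC_ring q\<^esub> a"
        using a by (simp add: A_def Z.l_minus)
      then have "\<ominus>\<^bsub>ZC_ring q\<^esub> a \<in> A"
        using m(2)[OF a, of "\<ominus>\<^bsub>ZC_ring q\<^esub> \<one>\<^bsub>ZC_ring q\<^esub>"] by simp
      then show "inv\<^bsub>add_monoid (ZC_ring q)\<^esub> a \<in> A" by (simp only: a_inv_def)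
    next
      fix a b assume "a \<in> A" "b \<in> A"
      then show "a \<otimes>\<^bsub>add_monoid (ZC_ring q)\<^esub> b \<in> A" using p by simp
    qed
  qed (use m in auto)
  moreover have "{cls q (fCtilde q - const c), cls q (fZ - const z)} \<subseteq> A"
    using ZC_generators[of c z] C Z by (simp add: A act_diff)
  ultimately have sub: "ZC_ideal q c z \<subseteq> A"
    unfolding ZC_ideal_def by (rule ring.genideal_minimal[OF ZC_ring_ring])
  \<comment> \<open>By the recursion for powers, the first power is the product of the unit ideal
    with \<open>ZC_ideal q c z\<close>.\<close>
  have "a \<in> A" if "a \<in> ideal_prod (ZC_ring q) (carrier (ZC_ring q)) (ZC_ideal q c z)" for a
    using that by (induction rule: ideal_prod.induct) (use m p sub in blast)+
  then have "\<forall>a \<in> ZC_ideal q c z [^]\<^bsub>ideals_set (ZC_ring q)\<^esub> (1::nat). \<forall>v\<in>carrier M. a \<odot>\<^bsub>M\<^esub> v = \<zero>\<^bsub>M\<^esub>"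
    by (simp add: nat_pow_def ideals_set_def A_def)
  then show ?thesis by blast
qed

end

section \<open>Sums of highest weight modules\<close>

lemma nat_012:
  assumes "k = 0 \<Longrightarrow> P" "k = Suc 0 \<Longrightarrow> P" "\<And>l. k = Suc (Suc l) \<Longrightarrow> P" shows P
  using assms by (metis not0_implies_Suc)

text \<open>The \<open>q\<close>-integer \<open>1 + q + ... + q^{k-1}\<close>; it governs
  \<open>X Y^k v = - z (qn q k) Y^{k-1} v\<close> for \<open>X v = 0\<close>.\<close>

definition qn :: "complex \<Rightarrow> nat \<Rightarrow> complex" where
  "qn q k = (q ^ k - 1) / (q - 1)"

text \<open>In the notation of the locale \<open>model\<close> below, \<open>E Y^k F'^j v = q^{-k} e_j Y^k F'^{j-1} v + y_k Y^{k-2} F'^j v\<close>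
  for a highest weight vector \<open>v\<close> of weight \<open>\<mu>\<close>, where \<open>e_j = e_coeff q \<mu> j\<close> and \<open>y_k = y_coeff q z k\<close>.\<close>

definition e_coeff :: "complex \<Rightarrow> complex \<Rightarrow> nat \<Rightarrow> complex" where
  "e_coeff q \<mu> j = (q ^ (2 * j) - 1) / (q\<^sup>2 - 1)\<^sup>2 * (q ^ 3 * \<mu> / q ^ (2 * j) - 1 / \<mu>)"

definition y_coeff :: "complex \<Rightarrow> complex \<Rightarrow> nat \<Rightarrow> complex" where
  "y_coeff q z k = - z * q / q ^ k * qn q k * (qn q k - 1) / (1 + q)"

text \<open>The last index numbers the highest weight vectors. A bound \<open>m\<close> instead of a
  finite index type keeps models of all ranks in one type, so that matrices between them can be
  formed.\<close>

definition model_space :: "nat \<Rightarrow> (nat \<times> nat \<times> nat \<Rightarrow> complex) set" where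
  "model_space m = {f. finite {x. f x \<noteq> 0} \<and> (\<forall>k j i. f (k, j, i) \<noteq> 0 \<longrightarrow> i < m)}"

locale generic_q =
  fixes q z :: complex
  assumes q_nz: "q \<noteq> 0" and q_root: "\<And>n::nat. n > 0 \<Longrightarrow> q ^ n \<noteq> 1" and z_nz: "z \<noteq> 0"
begin

lemma q_neq: "q \<noteq> 1" "q \<noteq> -1" "1 + q \<noteq> 0" "q + 1 \<noteq> 0" "q - 1 \<noteq> 0" "q\<^sup>2 \<noteq> 1" "q * q \<noteq> 1" "1 - q \<noteq> 0"
  "q\<^sup>2 - 1 \<noteq> 0" "q - 1 / q \<noteq> 0"
proof -
  show 1: "q \<noteq> 1" using q_root[of 1] by auto
  show 2: "q\<^sup>2 \<noteq> 1" using q_root[of 2] by auto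
  show 3: "q \<noteq> -1" using 2 by auto
  show "1 + q \<noteq> 0" "q + 1 \<noteq> 0" using 3 by (metis add.commute add_eq_0_iff)+
  show "q - 1 \<noteq> 0" "1 - q \<noteq> 0" "q\<^sup>2 - 1 \<noteq> 0" using 1 2 by auto
  show 4: "q * q \<noteq> 1" using 2 by (simp add: power2_eq_square)
  show "q - 1 / q \<noteq> 0" using 4 q_nz by (simp add: field_simps)
qed

lemma qn_nz: "k > 0 \<Longrightarrow> qn q k \<noteq> 0"
  using q_root q_neq by (simp add: qn_def)

lemma qn_Suc: "qn q (Suc k) = qn q k + q ^ k"
proof -
  define t where "t = q - 1"
  have e: "q ^ Suc k - 1 = (q ^ k - 1) + t * q ^ k" by (simp add: t_def algebra_simps)
  have "t \<noteq> 0" using q_neq by (simp add: t_def)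
  then have d: "((q ^ k - 1) + t * q ^ k) / t = (q ^ k - 1) / t + q ^ k"
    by (simp only: add_divide_distrib nonzero_mult_div_cancel_left simp_thms)
  show ?thesis unfolding qn_def t_def[symmetric] e d ..
qed

lemma qn_0 [simp]: "qn q 0 = 0"
  by (simp add: qn_def)

lemma q_power: "q ^ k = 1 + (q - 1) * qn q k"
  using q_neq by (simp add: qn_def)

lemma y_coeff_0 [simp]: "y_coeff q z 0 = 0" "y_coeff q z (Suc 0) = 0"
  using q_neq by (simp_all add: y_coeff_def qn_def)

lemma y_coeff_Suc_Suc: "y_coeff q z (Suc (Suc k)) = - z * qn q (Suc k) * qn q (Suc (Suc k)) / (q ^ k * (1 + q))"
proof -
  have "qn q (Suc (Suc k)) - 1 = q * qn q (Suc k)"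
    using q_neq by (simp add: qn_Suc[of "Suc k"] q_power) (simp add: qn_Suc q_power algebra_simps)
  then show ?thesis using q_nz by (simp add: y_coeff_def)
qed

text \<open>Expanded in powers of \<open>q ^ k\<close>, a form in which shifts of \<open>k\<close>
  are easy to compare.\<close>

lemma y_coeff_eq: "y_coeff q z k = - z * q / ((q - 1)\<^sup>2 * (1 + q)) * (q ^ k - (1 + q) + q / q ^ k)"
proof -
  define Q t s where "Q = q ^ k" and "t = q - 1" and "s = 1 + q"
  have Q: "Q \<noteq> 0" "t \<noteq> 0" "s \<noteq> 0" using q_nz q_neq by (simp_all add: Q_def t_def s_def)
  have "(Q - 1) / t - 1 = (Q - q) / t" using Q by (simp add: t_def field_simps)
  then have "y_coeff q z k = - z * q / Q * ((Q - 1) / t) * ((Q - q) / t) / s"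
    by (simp add: y_coeff_def qn_def Q_def t_def s_def)
  also have "\<dots> = - z * q / (t\<^sup>2 * s) * ((Q - 1) * (Q - q) / Q)"
    by (simp add: power2_eq_square ac_simps)
  also have "(Q - 1) * (Q - q) = (Q - s) * Q + q" by (simp add: s_def algebra_simps)
  also have "((Q - s) * Q + q) / Q = Q - s + q / Q"
    using Q by (simp add: add_divide_distrib)
  finally show ?thesis by (simp add: Q_def t_def s_def)
qed

text \<open>The recursion dictated by \<open>E Y = X + q^{-1} Y E\<close> together with
  \<open>X Y^k v = - z (qn q k) Y^{k-1} v\<close>.\<close>

lemma y_coeff_Suc: "y_coeff q z (Suc k) = y_coeff q z k / q - z * qn q k"
proof -
  define Q t s where "Q = q ^ k" and "t = q - 1" and "s = 1 + q"
  have Q: "Q \<noteq> 0" "t \<noteq> 0" "s \<noteq> 0" using q_nz q_neq by (simp_all add: Q_def t_def s_def)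
  define c R where "c = - z * q / (t\<^sup>2 * s)" and "R = Q - s + q / Q"
  have ct: "c * (t * s / q) = - z / t" using Q q_nz by (simp add: c_def power2_eq_square)
  have "q * (q * Q - s + 1 / Q) = R + t * s * (Q - 1)"
    by (simp add: t_def s_def R_def algebra_simps)
  then have "q * Q - s + 1 / Q = (R + t * s * (Q - 1)) / q"
    using q_nz by (metis nonzero_mult_div_cancel_left)
  then have "c * (q * Q - s + 1 / Q) = c * R / q + (c * (t * s / q)) * (Q - 1)"
    by (simp add: add_divide_distrib distrib_left)
  then show ?thesis
    using q_nz unfolding ct by (simp add: y_coeff_eq qn_def Q_def t_def s_def c_def R_def)
qed

text \<open>Multiplied by \<open>f_coeff \<mu> j\<close>, this is what the \<open>Y^2\<close> part
  of \<open>F\<close> contributes to the diagonal of \<open>E F - F E\<close>.\<close>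

lemma y_coeff_diff: "y_coeff q z (Suc (Suc k)) - y_coeff q z k = - z / (q - 1) * (q * q ^ k - 1 / q ^ k)"
proof -
  define Q t s where "Q = q ^ k" and "t = q - 1" and "s = 1 + q"
  have Q: "Q \<noteq> 0" "t \<noteq> 0" "s \<noteq> 0" using q_nz q_neq by (simp_all add: Q_def t_def s_def)
  have a: "q / (q * (q * Q)) = 1 / (q * Q)" using q_nz by simp
  have "(q * (q * Q) - s + 1 / (q * Q)) - (Q - s + q / Q) = t * s / q * (q * Q - 1 / Q)"
  proof -
    define I where "I = 1 / Q"
    have I: "1 / (q * Q) = I / q" "q / Q = q * I" by (simp_all add: I_def)
    show ?thesis unfolding I I_def[symmetric] using q_nz by (simp add: t_def s_def field_simps)
  qed
  then have "- z * q / (t\<^sup>2 * s) * (q * (q * Q) - s + 1 / (q * Q)) - - z * q / (t\<^sup>2 * s) * (Q - s + q / Q)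
      = - z * q / (t\<^sup>2 * s) * (t * s / q * (q * Q - 1 / Q))"
    by (simp only: right_diff_distrib[symmetric])
  also have "\<dots> = - z / t * (q * Q - 1 / Q)" using Q q_nz by (simp add: power2_eq_square)
  finally show ?thesis
    unfolding y_coeff_eq power_Suc Q_def[symmetric] t_def[symmetric] s_def[symmetric] a .
qed

lemma e_coeff_0 [simp]: "e_coeff q \<mu> 0 = 0"
  by (simp add: e_coeff_def)

text \<open>The increment is the scalar of \<open>(q K - K^{-1}) / (q^2 - 1)\<close> on
  \<open>F'^j v\<close>, a vector of weight \<open>\<mu> / q^{2 j}\<close>; \<open>e_coeff\<close>
  is the closed form of the sum of these increments.\<close>

lemma e_coeff_Suc:
  assumes "\<mu> \<noteq> 0"
  shows "e_coeff q \<mu> (Suc j) = e_coeff q \<mu> j + (q * (\<mu> / q ^ (2 * j)) - q ^ (2 * j) / \<mu>) / (q\<^sup>2 - 1)"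
proof -
  define P r A D where "P = q ^ (2 * j)" and "r = q\<^sup>2 - 1" and "A = \<mu> / P" and "D = 1 / \<mu>"
  have P: "P \<noteq> 0" "q ^ (2 * Suc j) = q\<^sup>2 * P" using q_nz by (simp_all add: P_def power2_eq_square)
  have r: "r \<noteq> 0" using q_neq by (simp add: r_def)
  have A: "q ^ 3 * \<mu> / P = q ^ 3 * A" "q ^ 3 * \<mu> / (q\<^sup>2 * P) = q * A" "P / \<mu> = P * D"
    using P q_nz by (simp_all add: A_def D_def power2_eq_square power3_eq_cube)
  have "(q\<^sup>2 * P - 1) * (q * A - D) = (P - 1) * (q ^ 3 * A - D) + r * (q * A - P * D)"
    by (simp add: r_def algebra_simps power2_eq_square power3_eq_cube)
  then have "(q\<^sup>2 * P - 1) * (q * A - D) / r\<^sup>2 = (P - 1) * (q ^ 3 * A - D) / r\<^sup>2 + (q * A - P * D) / r"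
    using r by (simp add: add_divide_distrib power2_eq_square)
  then show ?thesis
    unfolding e_coeff_def P(2) r_def[symmetric] P_def[symmetric] A A_def[symmetric] D_def[symmetric] by simp
qed

text \<open>The weight of \<open>Y^k F'^j v\<close> for \<open>v\<close> of weight
  \<open>\<mu>\<close>: \<open>Y\<close> divides weights by \<open>q\<close> and \<open>F'\<close>
  divides them by \<open>q^2\<close>.\<close>

definition wt :: "complex \<Rightarrow> nat \<Rightarrow> nat \<Rightarrow> complex" where
  "wt \<mu> k j = \<mu> / q ^ (2 * j + k)"

text \<open>Since \<open>F = F' + Y^2 K^{-1} / ((1 + q) z)\<close>, this is the coefficient of
  \<open>Y^2 F'^j v\<close> in \<open>F F'^j v\<close>, with \<open>K^{-1}\<close> evaluated on
  \<open>F'^j v\<close>. A power of \<open>Y\<close> in front does not change it because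
  \<open>F\<close> and \<open>Y\<close> commute.\<close>

definition f_coeff :: "complex \<Rightarrow> nat \<Rightarrow> complex" where
  "f_coeff \<mu> j = q ^ (2 * j) / ((1 + q) * z * \<mu>)"

lemma wt_simps [simp]:
  "wt \<mu> (Suc k) j = wt \<mu> k j / q" "wt \<mu> k (Suc j) = wt \<mu> k j / q\<^sup>2" "wt \<mu> 0 0 = \<mu>"
  using q_nz by (simp_all add: wt_def power2_eq_square)

lemma f_coeff_Suc: "f_coeff \<mu> (Suc j) = q\<^sup>2 * f_coeff \<mu> j"
  by (simp add: f_coeff_def power2_eq_square)

lemma wt_nz: "\<mu> \<noteq> 0 \<Longrightarrow> wt \<mu> k j \<noteq> 0"
  using q_nz by (simp add: wt_def)

lemma wt_inverse: "1 / wt \<mu> k j = z * (1 + q) * q ^ k * f_coeff \<mu> j"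
  using q_nz z_nz q_neq by (simp add: wt_def f_coeff_def power_add)

text \<open>The coefficient of \<open>Y^k F'^j v\<close> in \<open>E F - F E\<close> applied to this
  vector: the increments of \<open>e_coeff\<close> and \<open>y_coeff\<close> combine to the scalar
  of \<open>(K - K^{-1}) / (q - q^{-1})\<close>.\<close>

lemma ef_coeff:
  assumes "\<mu> \<noteq> 0"
  shows "e_coeff q \<mu> (Suc j) / q ^ k + f_coeff \<mu> j * y_coeff q z (Suc (Suc k))
      = e_coeff q \<mu> j / q ^ k + f_coeff \<mu> j * y_coeff q z k + 1 / (q - 1 / q) * (wt \<mu> k j - 1 / wt \<mu> k j)"
proof -
  define P Q a where "P = q ^ (2 * j)" and "Q = q ^ k" and "a = 1 / ((1 + q) * z)"
  have nz: "P \<noteq> 0" "Q \<noteq> 0" using q_nz by (simp_all add: P_def Q_def)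
  define A B I r where "A = \<mu> / P" and "B = P / \<mu>" and "I = 1 / Q" and "r = 1 / (q\<^sup>2 - 1)"
  have aB: "f_coeff \<mu> j = a * B" by (simp add: f_coeff_def a_def B_def P_def)
  have rs: "a * (z / (q - 1)) = r" "1 / (q - 1 / q) = q * r"
    using q_nz z_nz q_neq by (simp_all add: a_def r_def field_simps power2_eq_square)
  have w: "wt \<mu> k j = A * I" "1 / wt \<mu> k j = B * Q"
    by (simp_all add: wt_def A_def B_def P_def Q_def I_def power_add)
  have "a * B * (y_coeff q z (Suc (Suc k)) - y_coeff q z k) = - (a * (z / (q - 1))) * (B * (q * Q - I))"
    unfolding y_coeff_diff by (simp add: Q_def I_def)
  then have y: "a * B * y_coeff q z (Suc (Suc k)) = a * B * y_coeff q z k - r * (B * (q * Q - I))"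
    unfolding rs(1) by (simp add: right_diff_distrib diff_eq_eq)
  have e: "e_coeff q \<mu> (Suc j) / q ^ k = e_coeff q \<mu> j / q ^ k + r * ((q * A - B) * I)"
    unfolding e_coeff_Suc[OF assms] A_def B_def P_def I_def Q_def r_def by (simp add: add_divide_distrib)
  show ?thesis unfolding aB y e w(2) unfolding w(1) rs(2) by (simp add: algebra_simps)
qed

text \<open>The relation \<open>E X = q X E\<close> in the passage from \<open>Y^{k+3}\<close> to
  \<open>Y^k\<close>.\<close>

lemma y_qn: "y_coeff q z (Suc (Suc k)) * qn q (Suc (Suc (Suc k))) = q * qn q (Suc k) * y_coeff q z (Suc (Suc (Suc k)))"
  unfolding y_coeff_Suc_Suc using q_nz q_neq by simp

lemma powi_eq_1: "q powi n = 1 \<Longrightarrow> n = 0"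
proof (rule ccontr)
  assume e: "q powi n = 1" "n \<noteq> 0"
  then have "q ^ nat \<bar>n\<bar> = 1"
    by (cases "n \<ge> 0") (auto simp: power_int_def field_simps split: if_splits)
  with q_root[of "nat \<bar>n\<bar>"] e show False by simp
qed

text \<open>A zero forces \<open>q^{3 + 2 n - 2 j} = 1\<close>, hence \<open>3 + 2 n = 2 j\<close>,
  which parity forbids.\<close>

lemma e_coeff_nz: "j > 0 \<Longrightarrow> e_coeff q (q powi n) j \<noteq> 0"
proof
  assume j: "j > 0" and z: "e_coeff q (q powi n) j = 0"
  have "q ^ (2 * j) - 1 \<noteq> 0" using q_root[of "2 * j"] j by simp
  then have "q ^ 3 * q powi n / q ^ (2 * j) = 1 / q powi n"
    using z q_neq by (simp add: e_coeff_def)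
  then have "q ^ 3 * (q powi n * q powi n) / q ^ (2 * j) = 1"
    using q_nz by (simp add: field_simps)
  moreover have "q ^ 3 * (q powi n * q powi n) / q ^ (2 * j) = q powi (3 + (n + n) - int (2 * j))"
  proof -
    have "q powi (3 + (n + n) - int (2 * j)) = q powi 3 * q powi (n + n) / q powi int (2 * j)"
      using q_nz by (simp only: power_int_diff power_int_add simp_thms)
    also have "q powi (n + n) = q powi n * q powi n"
      using q_nz by (simp only: power_int_add simp_thms)
    finally show ?thesis by (simp only: power_int_of_nat power_int_numeral)
  qed
  ultimately have "q powi (3 + (n + n) - int (2 * j)) = 1" by simp
  then have "3 + (n + n) - int (2 * j) = 0" by (rule powi_eq_1)
  then show False by presburger
qed

end

section \<open>The model with basis \<open>Y^k F'^j v_i\<close>\<close>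

locale model = generic_q +
  fixes m :: nat and \<mu> :: "nat \<Rightarrow> complex"
  assumes \<mu>_nz: "\<mu> i \<noteq> 0"
begin

text \<open>The value at \<open>(k, j, i)\<close> is the coefficient of \<open>Y^k F'^j v_i\<close>, where \<open>v_i\<close> is a highest
  weight vector of weight \<open>\<mu> i\<close> and \<open>F' = F - Y^2 K^{-1} / ((1 + q) z)\<close> preserves the kernel of \<open>X\<close>.\<close>

fun opm :: "gen \<Rightarrow> (nat \<times> nat \<times> nat \<Rightarrow> complex) \<Rightarrow> nat \<times> nat \<times> nat \<Rightarrow> complex" where
  "opm gen_K f (k, j, i) = wt (\<mu> i) k j * f (k, j, i)"
| "opm gen_Kinv f (k, j, i) = 1 / wt (\<mu> i) k j * f (k, j, i)"
| "opm gen_Z f (k, j, i) = z * f (k, j, i)"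
| "opm gen_X f (k, j, i) = - z * qn q (Suc k) * f (Suc k, j, i)"
| "opm gen_Y f (k, j, i) = (if k = 0 then 0 else f (k - 1, j, i))"
| "opm gen_F f (k, j, i) = (if j = 0 then 0 else f (k, j - 1, i)) +
     (if k < 2 then 0 else f_coeff (\<mu> i) j * f (k - 2, j, i))"
| "opm gen_E f (k, j, i) = e_coeff q (\<mu> i) (Suc j) / q ^ k * f (k, Suc j, i) +
     y_coeff q z (Suc (Suc k)) * f (Suc (Suc k), j, i)"

abbreviation "MW \<equiv> model_space m"

lemma opm_add: "opm g (f + h) = opm g f + opm g h"
proof
  fix x show "opm g (f + h) x = (opm g f + opm g h) x"
    by (cases g; cases x) (simp_all add: algebra_simps)
qed

lemma opm_scale: "opm g (fscale c f) = fscale c (opm g f)"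
proof
  fix x show "opm g (fscale c f) x = fscale c (opm g f) x"
    by (cases g; cases x) (simp_all add: algebra_simps)
qed

lemma opm_closed:
  assumes f: "f \<in> MW" shows "opm g f \<in> MW"
proof -
  let ?S = "{x. f x \<noteq> 0}"
  have fin: "finite ?S" using f by (simp add: model_space_def)
  let ?h = "\<lambda>d (k, j, i). (k + fst d - snd (snd d), j + fst (snd d) - fst (snd (snd d)), i)"
  \<comment> \<open>Every operator reads \<open>f\<close> at finitely many shifted positions;
    \<open>?T\<close> collects where these shifts can reach the support.\<close>
  let ?T = "?S \<union> (\<lambda>(k, j, i). (k - 1, j, i)) ` ?S \<union> (\<lambda>(k, j, i). (k + 1, j, i)) ` ?S \<union>
    (\<lambda>(k, j, i). (k, j + 1, i)) ` ?S \<union> (\<lambda>(k, j, i). (k + 2, j, i)) ` ?S \<union>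
    (\<lambda>(k, j, i). (k, j - 1, i)) ` ?S \<union> (\<lambda>(k, j, i). (k - 2, j, i)) ` ?S"
  have "{x. opm g f x \<noteq> 0} \<subseteq> ?T"
  proof
    fix x assume "x \<in> {x. opm g f x \<noteq> 0}"
    then obtain k j i where x: "x = (k, j, i)" "opm g f (k, j, i) \<noteq> 0" by (cases x) auto
    then have "f (k, j, i) \<noteq> 0 \<or> f (Suc k, j, i) \<noteq> 0 \<or> (k > 0 \<and> f (k - 1, j, i) \<noteq> 0) \<or>
      (j > 0 \<and> f (k, j - 1, i) \<noteq> 0) \<or> (k \<ge> 2 \<and> f (k - 2, j, i) \<noteq> 0) \<or> f (k, Suc j, i) \<noteq> 0 \<or>
      f (Suc (Suc k), j, i) \<noteq> 0"
      by (cases g) (auto split: if_splits)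
    then show "x \<in> ?T" unfolding x(1)
      by (elim disjE) (force simp: image_iff)+
  qed
  then have "finite {x. opm g f x \<noteq> 0}" using fin by (elim finite_subset) auto
  moreover have "i < m" if nz: "opm g f (k, j, i) \<noteq> 0" for k j i
  proof (rule ccontr)
    assume "\<not> i < m"
    then have "f (k, j, i) = 0" for k j using f by (auto simp: model_space_def)
    then have "opm g f (k, j, i) = 0" by (cases g) auto
    with nz show False by simp
  qed
  ultimately show ?thesis by (simp add: model_space_def)
qed

sublocale model_ops: operators fscale MW opm
proof unfold_locales
  show "fspace.subspace MW"
    unfolding fspace.subspace_def
  proof (intro conjI ballI allI)
    show "0 \<in> MW" by (simp add: model_space_def)
    fix f g assume fg: "f \<in> MW" "g \<in> MW"
    have "{x. (f + g) x \<noteq> 0} \<subseteq> {x. f x \<noteq> 0} \<union> {x. g x \<noteq> 0}" by auto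
    then have "finite {x. (f + g) x \<noteq> 0}" by (rule finite_subset) (use fg in \<open>simp add: model_space_def\<close>)
    moreover have "i < m" if "(f + g) (k, j, i) \<noteq> 0" for k j i
      using that fg by (cases "f (k, j, i) = 0") (auto simp: model_space_def)
    ultimately show "f + g \<in> MW" by (simp add: model_space_def)
  next
    fix c f assume f: "f \<in> MW"
    have "{x. fscale c f x \<noteq> 0} \<subseteq> {x. f x \<noteq> 0}" by auto
    then have "finite {x. fscale c f x \<noteq> 0}" by (rule finite_subset) (use f in \<open>simp add: model_space_def\<close>)
    then show "fscale c f \<in> MW" using f by (auto simp: model_space_def)
  qed
qed (simp_all add: opm_closed opm_add opm_scale)

lemmas pq_rules = q_nz z_nz \<mu>_nz q_neq

text \<open>The relations are compared coordinate by coordinate. Small \<open>k\<close> and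
  \<open>j\<close> are treated separately, because the formulas for \<open>Y\<close> and
  \<open>F\<close> shift indices downwards and are cut off there.\<close>

lemma opm_relators:
  assumes r: "r \<in> relators q" and v: "v \<in> MW" shows "model_ops.act r v = 0"
proof
  fix x :: "nat \<times> nat \<times> nat"
  obtain k j i where x: "x = (k, j, i)" by (cases x)
  note [simp] = model_ops.act_simps v model_ops.act_closed pq_rules opm_closed wt_nz
    consider "r = fK * fKinv - 1" | "r = fKinv * fK - 1" | g where "r = fZ * gvar g - gvar g * fZ"
    | "r = fE * fF - fF * fE - const (1 / (q - 1 / q)) * (fK - fKinv)"
    | "r = fK * fE * fKinv - const (q\<^sup>2) * fE"
    | "r = fK * fF * fKinv - const (1 / q\<^sup>2) * fF"
    | "r = fK * fX * fKinv - const q * fX"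
    | "r = fK * fY * fKinv - const (1 / q) * fY"
    | "r = const q * fY * fX - fX * fY - fZ"
    | "r = fE * fX - const q * fX * fE"
    | "r = fE * fY - (fX + const (1 / q) * fY * fE)"
    | "r = fF * fX - (fY * fKinv + fX * fF)"
    | "r = fF * fY - fY * fF"
    using r by (auto simp: relators_def)
  then have "model_ops.act r v (k, j, i) = 0"
  proof cases
    case 1
    show ?thesis unfolding 1 by (simp add: field_simps)
  next
    case 2
    show ?thesis unfolding 2 by (simp add: field_simps)
  next
    case (3 g)
    have "opm gen_Z w = fscale z w" for w by (auto simp: fun_eq_iff)
    then show ?thesis unfolding 3 by (simp add: opm_scale)
  next
    case 4
    \<comment> \<open>\<open>c1\<close> is the diagonal part; \<open>c2\<close> and
      \<open>c3\<close> collect the neighbours \<open>(k - 2, j + 1)\<close> and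
      \<open>(k + 2, j - 1)\<close>, on which \<open>E F\<close> and \<open>F E\<close> have equal
      coefficients.\<close>
    define c1 c2 c3 where "c1 = (e_coeff q (\<mu> i) (Suc j) / q ^ k + f_coeff (\<mu> i) j * y_coeff q z (Suc (Suc k))) * v (k, j, i)"
      and "c2 = (if k < 2 then 0 else e_coeff q (\<mu> i) (Suc j) / q ^ k * (q\<^sup>2 * f_coeff (\<mu> i) j) * v (k - 2, Suc j, i))"
      and "c3 = (if j = 0 then 0 else y_coeff q z (Suc (Suc k)) * v (Suc (Suc k), j - 1, i))"
    have EF: "opm gen_E (opm gen_F v) (k, j, i) = c1 + c2 + c3"
      unfolding c1_def c2_def c3_def by (simp add: f_coeff_Suc distrib_left distrib_right)
    have FE: "opm gen_F (opm gen_E v) (k, j, i) =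
        (e_coeff q (\<mu> i) j / q ^ k + f_coeff (\<mu> i) j * y_coeff q z k) * v (k, j, i) + c2 + c3"
      unfolding c2_def c3_def
      by (rule nat_012[of k]; cases j) (simp_all add: distrib_left distrib_right power2_eq_square)
    have c1: "c1 = (e_coeff q (\<mu> i) j / q ^ k + f_coeff (\<mu> i) j * y_coeff q z k
        + 1 / (q - 1 / q) * (wt (\<mu> i) k j - 1 / wt (\<mu> i) k j)) * v (k, j, i)"
      unfolding c1_def ef_coeff[OF \<mu>_nz] ..
    have "model_ops.act r v (k, j, i) = opm gen_E (opm gen_F v) (k, j, i) - opm gen_F (opm gen_E v) (k, j, i)
        - 1 / (q - 1 / q) * (opm gen_K v (k, j, i) - opm gen_Kinv v (k, j, i))"
      unfolding 4 by (simp del: opm.simps)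
    then show ?thesis by (simp only: EF FE c1 opm.simps(1,2)) (simp add: algebra_simps)
  next
    case 5
    show ?thesis unfolding 5 by (simp add: algebra_simps power2_eq_square)
  next
    case 6
    show ?thesis unfolding 6
      by (rule nat_012[of k]; cases j) (simp_all add: wt_nz f_coeff_Suc field_simps power2_eq_square)
  next
    case 7
    show ?thesis unfolding 7 by (simp add: field_simps power_add power2_eq_square)
  next
    case 8
    show ?thesis unfolding 8 by (cases k) (simp_all add: field_simps power_add power2_eq_square)
  next
    case 9
    show ?thesis unfolding 9 by (cases k) (simp_all add: q_power qn_Suc algebra_simps)
  next
    case 10
    show ?thesis unfolding 10
      using y_qn[of k] by (simp add: algebra_simps)
  next
    case 11
    show ?thesis unfolding 11
      by (cases k) (simp_all add: y_coeff_Suc[of "Suc (Suc _)"] y_coeff_Suc[of "Suc 0"] qn_Suc[of 0] algebra_simps)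
  next
    case 12
    show ?thesis unfolding 12
      by (rule nat_012[of k]; cases j)
        (simp_all add: wt_inverse f_coeff_Suc qn_Suc del: wt_simps, simp_all add: algebra_simps power2_eq_square)
  next
    case 13
    show ?thesis unfolding 13 by (rule nat_012[of k]; cases j; simp add: numeral_2_eq_2 less_Suc_eq)
  qed
  then show "model_ops.act r v x = 0 x" using x by simp
qed

end

lemma finite_support_sum:
  assumes "finite S" "{x. f x \<noteq> 0} \<subseteq> S"
  shows "f = (\<Sum>x\<in>S. fscale (f x) (delta x))"
proof
  fix y
  have "(\<Sum>x\<in>S. fscale (f x) (delta x)) y = (\<Sum>x\<in>S. if y = x then f x else 0)"
    unfolding sum_fun_apply by (intro sum.cong) (auto simp: delta_def)
  also have "\<dots> = f y" using assms by (auto simp: sum.delta')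
  finally show "f y = (\<Sum>x\<in>S. fscale (f x) (delta x)) y" by simp
qed

section \<open>The central element on the model\<close>

context generic_q
begin

text \<open>The sum is the diagonal entry of the central element at \<open>Y^k F'^j v\<close>, after
  its \<open>y_coeff\<close> terms have cancelled. All dependence on \<open>k\<close> and
  \<open>j\<close> drops out, leaving the value at the highest weight vector.\<close>

lemma casimir_diag:
  assumes "\<mu> \<noteq> 0"
  shows "z * ((1 + q) * e_coeff q \<mu> j
    + q * qn q (Suc k) * (wt \<mu> k j - 1 / wt \<mu> k j) * (1 / (q - 1 / q))
    + qn q (Suc k) * qn q (Suc (Suc k)) * (z * f_coeff \<mu> j)
    + (1 + 1 / q) * (1 / (q - 1 / q))\<^sup>2 * (q * wt \<mu> k j + 1 / q * (1 / wt \<mu> k j))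
    + 1 / (q\<^sup>2 - 1) * (1 / wt \<mu> k j)) = ctilde q z \<mu>"
proof -
  define P Q where "P = q ^ (2 * j)" and "Q = q ^ k"
  have nz: "P \<noteq> 0" "Q \<noteq> 0" using q_nz by (simp_all add: P_def Q_def)
  \<comment> \<open>With names for the inverses the claim becomes a polynomial identity modulo
    \<open>R * (q * q - 1) = 1\<close> and \<open>I * Q = 1\<close>; these two rules are applied by
    hand, since general normalisation of fractions would blow up.\<close>
  define A B D I R where "A = \<mu> / P" and "B = P / \<mu>" and "D = 1 / \<mu>" and "I = 1 / Q" and "R = 1 / (q\<^sup>2 - 1)"
  have rel: "R * (q * q - 1) = 1" "I * Q = 1"
    using q_neq nz by (simp_all add: R_def I_def power2_eq_square)
  have w: "1 / wt \<mu> k j = B * Q" "wt \<mu> k j = A * I"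
    by (simp_all add: wt_def A_def B_def P_def Q_def I_def power_add)
  have R: "1 / (q - 1 / q) = q * R" "1 / (q - 1) = (1 + q) * R" "1 / (1 + q) = (q - 1) * R"
    using q_nz q_neq by (simp_all add: R_def field_simps power2_eq_square)
  have zf: "z * f_coeff \<mu> j = B * ((q - 1) * R)"
    unfolding R(3)[symmetric] using z_nz by (simp add: f_coeff_def B_def P_def)
  have qn1: "qn q (Suc k) = (q * Q - 1) * ((1 + q) * R)" "qn q (Suc (Suc k)) = (q * q * Q - 1) * ((1 + q) * R)"
    unfolding R(2)[symmetric] by (simp_all add: qn_def Q_def)
  have e: "e_coeff q \<mu> j = R\<^sup>2 * (q ^ 3 * \<mu> - q ^ 3 * A - B + D)"
  proof -
    have "(P - 1) * (q ^ 3 * A - D) = q ^ 3 * \<mu> - q ^ 3 * A - B + D"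
    proof -
      have "(P - 1) * (q ^ 3 * A - D) = q ^ 3 * (P * A) - q ^ 3 * A - P * D + D" by (simp add: algebra_simps)
      moreover have "P * A = \<mu>" "P * D = B" using nz by (simp_all add: A_def B_def D_def)
      ultimately show ?thesis by simp
    qed
    then have "e_coeff q \<mu> j = (q ^ 3 * \<mu> - q ^ 3 * A - B + D) / (q\<^sup>2 - 1)\<^sup>2"
      unfolding e_coeff_def P_def[symmetric] D_def[symmetric] times_divide_eq_right[symmetric] A_def[symmetric]
      by simp
    then show ?thesis by (simp add: R_def power_divide)
  qed
  have c: "ctilde q z \<mu> = z * (q * R)\<^sup>2 * ((q + q\<^sup>2) * \<mu> + (1 / q + 1 / q\<^sup>2) * D)"
    unfolding ctilde_def R(1)[symmetric] D_def by (simp add: power_divide)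
  have c': "\<dots> = z * R\<^sup>2 * (1 + q) * (q ^ 3 * \<mu> + D)"
    using q_nz by (simp add: field_simps power2_eq_square power3_eq_cube)
  have k3: "(q * Q - 1) * ((1 + q) * R) * ((q * q * Q - 1) * ((1 + q) * R)) * (B * ((q - 1) * R))
      = (q * Q - 1) * (q * q * Q - 1) * (1 + q) * R\<^sup>2 * B * (R * (q * q - 1))"
    by (simp add: algebra_simps power2_eq_square)
  have k5: "R * (B * Q) = R\<^sup>2 * (q * q - 1) * (B * Q)"
    using arg_cong[OF rel(1), of "\<lambda>x. R * (B * Q) * x"] by (simp add: power2_eq_square algebra_simps)
  have k4: "(1 + 1 / q) * (q * R)\<^sup>2 * (q * (A * I) + 1 / q * (B * Q)) = R\<^sup>2 * (1 + q) * (q * q * A * I + B * Q)"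
    using q_nz by (simp add: field_simps power2_eq_square)
  have br: "(q ^ 3 * \<mu> - q ^ 3 * A - B + D) + q * q * (q * Q - 1) * (A * I - B * Q)
      + (q * Q - 1) * (q * q * Q - 1) * B + (q * q * A * I + B * Q) + (q - 1) * (B * Q)
      = q ^ 3 * \<mu> + D + q * q * q * A * (I * Q - 1)"
    by (simp add: algebra_simps power3_eq_cube)
  have "(1 + q) * e_coeff q \<mu> j
    + q * qn q (Suc k) * (wt \<mu> k j - 1 / wt \<mu> k j) * (1 / (q - 1 / q))
    + qn q (Suc k) * qn q (Suc (Suc k)) * (z * f_coeff \<mu> j)
    + (1 + 1 / q) * (1 / (q - 1 / q))\<^sup>2 * (q * wt \<mu> k j + 1 / q * (1 / wt \<mu> k j))
    + R * (1 / wt \<mu> k j)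
    = R\<^sup>2 * (1 + q) * ((q ^ 3 * \<mu> - q ^ 3 * A - B + D) + q * q * (q * Q - 1) * (A * I - B * Q)
      + (q * Q - 1) * (q * q * Q - 1) * B + (q * q * A * I + B * Q) + (q - 1) * (B * Q))"
    unfolding w(1) unfolding w(2) R(1) zf qn1 e k3 rel(1) k4 k5
    by (simp add: algebra_simps power2_eq_square)
  also have "\<dots> = R\<^sup>2 * (1 + q) * (q ^ 3 * \<mu> + D)" unfolding br rel by simp
  finally show ?thesis unfolding c c' R_def[symmetric] by simp
qed

end

context model
begin

sublocale model_rep: uq_rep fscale MW opm q
  by unfold_locales (rule opm_relators)

lemma opm_EF_FE:
  "opm gen_E (opm gen_F v) (k, j, i) = opm gen_F (opm gen_E v) (k, j, i)
    + 1 / (q - 1 / q) * (wt (\<mu> i) k j - 1 / wt (\<mu> i) k j) * v (k, j, i)" if "v \<in> MW"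
proof -
  have "model_ops.act (fE * fF - fF * fE - const (1 / (q - 1 / q)) * (fK - fKinv)) v (k, j, i) = 0"
    using opm_relators[OF _ that] by (simp add: relators_def)
  then show ?thesis
    using that by (simp add: model_ops.act_simps opm_closed del: opm.simps(3-)) (simp add: algebra_simps)
qed

text \<open>The off-diagonal parts of the summands cancel and the diagonal is
  \<open>casimir_diag\<close>. Hence the element acts on each summand of the model by the scalar of
  its highest weight.\<close>

lemma casimir_model:
  assumes v: "v \<in> MW"
  shows "model_ops.act (fCtilde q) v (k, j, i) = ctilde q z (\<mu> i) * v (k, j, i)"
proof -
  define w w' where "w = wt (\<mu> i) k j" and "w' = 1 / wt (\<mu> i) k j"
  define c2 c3 where "c2 = (if k < 2 then 0 else e_coeff q (\<mu> i) (Suc j) / q ^ k * (q\<^sup>2 * f_coeff (\<mu> i) j) * v (k - 2, Suc j, i))"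
      and "c3 = (if j = 0 then 0 else y_coeff q z (Suc (Suc k)) * v (Suc (Suc k), j - 1, i))"
  define d where "d = e_coeff q (\<mu> i) j / q ^ k + f_coeff (\<mu> i) j * y_coeff q z k"
  have FE: "opm gen_F (opm gen_E v) (k, j, i) = d * v (k, j, i) + c2 + c3"
    unfolding c2_def c3_def d_def
    by (rule nat_012[of k]; cases j) (simp_all add: distrib_left distrib_right power2_eq_square q_nz)
  have EF: "opm gen_E (opm gen_F v) (k, j, i) = d * v (k, j, i) + c2 + c3 + 1 / (q - 1 / q) * (w - w') * v (k, j, i)"
    unfolding opm_EF_FE[OF v] FE w_def w'_def ..
  define c4 where "c4 = (if j = 0 then 0 else v (Suc (Suc k), j - 1, i))"
  have c3: "c3 = y_coeff q z (Suc (Suc k)) * c4" by (simp add: c3_def c4_def)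
  have XXF: "opm gen_X (opm gen_X (opm gen_F v)) (k, j, i)
      = z\<^sup>2 * qn q (Suc k) * qn q (Suc (Suc k)) * (c4 + f_coeff (\<mu> i) j * v (k, j, i))"
    by (simp add: c4_def power2_eq_square)
  have w'f: "w' = z * (1 + q) * q ^ k * f_coeff (\<mu> i) j" unfolding w'_def by (rule wt_inverse)
  have YYE: "opm gen_Y (opm gen_Y (opm gen_E (opm gen_Kinv v))) (k, j, i)
      = z * (1 + q) * q ^ k * c2 + y_coeff q z k * w' * v (k, j, i)"
    unfolding c2_def w'f
    by (rule nat_012[of k]) (simp_all add: wt_inverse f_coeff_Suc q_nz power2_eq_square del: wt_simps)
  have XY: "opm gen_X (opm gen_Y f) (k, j, i) = - z * qn q (Suc k) * f (k, j, i)" for f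
    by simp
  have act: "model_ops.act (fCtilde q) v (k, j, i) =
     z * ((1 + 1 / q) * (opm gen_F (opm gen_E v) (k, j, i) + 1 / (q - 1 / q)\<^sup>2 * (q * (w * v (k, j, i)) + 1 / q * (w' * v (k, j, i))))
       + 1 / (q\<^sup>2 - 1) * (w' * v (k, j, i)))
     + opm gen_X (opm gen_X (opm gen_F v)) (k, j, i) - opm gen_Y (opm gen_Y (opm gen_E (opm gen_Kinv v))) (k, j, i)
     + (- z * qn q (Suc k) * (1 / q * opm gen_F (opm gen_E v) (k, j, i) - q * opm gen_E (opm gen_F v) (k, j, i)))"
  proof -
    note [simp] = model_ops.act_simps v opm_closed
    note [simp del] = opm.simps
    have 1: "model_ops.act (fZ * (const (1 + 1 / q) * fC q + const (1 / (q\<^sup>2 - 1)) * fKinv)) v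
      = opm gen_Z (fscale (1 + 1 / q) (opm gen_F (opm gen_E v) + fscale (1 / (q - 1 / q)\<^sup>2)
          (fscale q (opm gen_K v) + fscale (1 / q) (opm gen_Kinv v))) + fscale (1 / (q\<^sup>2 - 1)) (opm gen_Kinv v))"
      unfolding fC_def by simp
    have 2: "model_ops.act (fX\<^sup>2 * fF) v = opm gen_X (opm gen_X (opm gen_F v))"
      "model_ops.act (fY\<^sup>2 * fE * fKinv) v = opm gen_Y (opm gen_Y (opm gen_E (opm gen_Kinv v)))"
      by (simp_all add: power2_eq_square)
    have 3: "model_ops.act (fX * fY * (const (1 / q) * fF * fE - const q * fE * fF)) v
      = opm gen_X (opm gen_Y (fscale (1 / q) (opm gen_F (opm gen_E v)) - fscale q (opm gen_E (opm gen_F v))))"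
      by simp
    show ?thesis
      unfolding fCtilde_def model_ops.act_add model_ops.act_diff 1 2 3 plus_fun_apply minus_apply XY
        fscale_apply opm.simps(1,2,3) w_def w'_def ..
  qed
  \<comment> \<open>The total factor of \<open>F E\<close>, collected from \<open>Z C\<close> and
    from \<open>X Y (q^{-1} F E - q E F)\<close>. With this value the neighbour \<open>c2\<close> is
    cancelled by \<open>Y^2 E K^{-1}\<close>.\<close>
  have a2: "z * (1 + 1 / q) + z * qn q (Suc k) * (q - 1 / q) = z * (1 + q) * q ^ k"
  proof -
    have "qn q (Suc k) * (q - 1 / q) = (1 + 1 / q) * (q ^ Suc k - 1)"
      using q_nz by (simp add: q_power[of "Suc k"] field_simps del: power_Suc)
    then have "z * qn q (Suc k) * (q - 1 / q) = z * (1 + 1 / q) * (q ^ Suc k - 1)" by (simp add: ac_simps)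
    also have "\<dots> = z * ((1 + 1 / q) * q ^ Suc k) - z * (1 + 1 / q)"
      by (simp only: right_diff_distrib mult.assoc mult_1_right)
    also have "(1 + 1 / q) * q ^ Suc k = (1 + q) * q ^ k" using q_nz by (simp add: distrib_right)
    finally show ?thesis by (simp add: mult.assoc)
  qed
  \<comment> \<open>This cancels the other neighbour, \<open>c4\<close>, between \<open>F E\<close>
    and \<open>X^2 F\<close>.\<close>
  have a3: "z * (1 + q) * q ^ k * y_coeff q z (Suc (Suc k)) + z\<^sup>2 * qn q (Suc k) * qn q (Suc (Suc k)) = 0"
    using q_nz q_neq by (simp add: y_coeff_Suc_Suc power2_eq_square)
  have a1: "z * (1 + q) * q ^ k * d = z * (1 + q) * e_coeff q (\<mu> i) j + w' * y_coeff q z k"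
    unfolding d_def w'f using q_nz by (simp add: algebra_simps)
  have "model_ops.act (fCtilde q) v (k, j, i)
    = (z * (1 + 1 / q) + z * qn q (Suc k) * (q - 1 / q)) * (d * v (k, j, i) + c2 + c3)
      + z * (1 + 1 / q) * (1 / (q - 1 / q)\<^sup>2) * (q * w + 1 / q * w') * v (k, j, i)
      + z * (1 / (q\<^sup>2 - 1)) * w' * v (k, j, i)
      + z\<^sup>2 * qn q (Suc k) * qn q (Suc (Suc k)) * (c4 + f_coeff (\<mu> i) j * v (k, j, i))
      - (z * (1 + q) * q ^ k * c2 + y_coeff q z k * w' * v (k, j, i))
      + z * qn q (Suc k) * q * (1 / (q - 1 / q)) * (w - w') * v (k, j, i)"
    unfolding act FE EF XXF YYE by (simp only: distrib_left distrib_right left_diff_distrib right_diff_distrib) (simp add: ac_simps)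
  also have "\<dots> = (z * (1 + q) * q ^ k * y_coeff q z (Suc (Suc k)) + z\<^sup>2 * qn q (Suc k) * qn q (Suc (Suc k))) * c4
     + (z * (1 + q) * q ^ k * d + z * (1 + 1 / q) * (1 / (q - 1 / q)\<^sup>2) * (q * w + 1 / q * w')
      + z * (1 / (q\<^sup>2 - 1)) * w' + z\<^sup>2 * qn q (Suc k) * qn q (Suc (Suc k)) * f_coeff (\<mu> i) j
      - y_coeff q z k * w' + z * qn q (Suc k) * q * (1 / (q - 1 / q)) * (w - w')) * v (k, j, i)"
    unfolding a2 c3 by (simp only: distrib_left distrib_right left_diff_distrib right_diff_distrib) (simp add: ac_simps)
  also have "\<dots> = ctilde q z (\<mu> i) * v (k, j, i)"
    unfolding a3 a1 casimir_diag[OF \<mu>_nz, symmetric, of i j k] w'_def[symmetric] unfolding w_def[symmetric]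
    by (simp add: power2_eq_square algebra_simps diff_divide_distrib)
  finally show ?thesis .
qed

section \<open>Basis vectors, category O conditions and highest weight vectors of the model\<close>

lemma delta_MW [simp]: "i < m \<Longrightarrow> delta (k, j, i) \<in> MW"
  by (auto simp: model_space_def delta_def)

lemma opm_delta:
  "opm gen_K (delta (k, j, i)) = fscale (wt (\<mu> i) k j) (delta (k, j, i))"
  "opm gen_Kinv (delta (k, j, i)) = fscale (1 / wt (\<mu> i) k j) (delta (k, j, i))"
  "opm gen_Z (delta (k, j, i)) = fscale z (delta (k, j, i))"
  "opm gen_X (delta (k, j, i)) = fscale (- z * qn q k) (delta (k - 1, j, i))"
  "opm gen_Y (delta (k, j, i)) = delta (Suc k, j, i)"
  "opm gen_F (delta (k, j, i)) = delta (k, Suc j, i) + fscale (f_coeff (\<mu> i) j) (delta (Suc (Suc k), j, i))"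
  "opm gen_E (delta (k, j, i)) = fscale (e_coeff q (\<mu> i) j / q ^ k) (delta (k, j - 1, i))
     + fscale (y_coeff q z k) (delta (k - 2, j, i))"
proof -
  show "opm gen_F (delta (k, j, i)) = delta (k, Suc j, i) + fscale (f_coeff (\<mu> i) j) (delta (Suc (Suc k), j, i))"
  proof
    fix x :: "nat \<times> nat \<times> nat" obtain k' j' i' where "x = (k', j', i')" by (cases x)
    then show "opm gen_F (delta (k, j, i)) x
        = (delta (k, Suc j, i) + fscale (f_coeff (\<mu> i) j) (delta (Suc (Suc k), j, i))) x"
      by (rule_tac nat_012[of k']; cases j') (auto simp: delta_def)
  qed
  show "opm gen_E (delta (k, j, i)) = fscale (e_coeff q (\<mu> i) j / q ^ k) (delta (k, j - 1, i))
     + fscale (y_coeff q z k) (delta (k - 2, j, i))"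
  proof
    fix x :: "nat \<times> nat \<times> nat" obtain k' j' i' where "x = (k', j', i')" by (cases x)
    then show "opm gen_E (delta (k, j, i)) x
      = (fscale (e_coeff q (\<mu> i) j / q ^ k) (delta (k, j - 1, i)) + fscale (y_coeff q z k) (delta (k - 2, j, i))) x"
      by (rule_tac nat_012[of k]; cases j) (auto simp: delta_def)
  qed
  show "opm gen_X (delta (k, j, i)) = fscale (- z * qn q k) (delta (k - 1, j, i))"
  proof
    fix x :: "nat \<times> nat \<times> nat" obtain k' j' i' where "x = (k', j', i')" by (cases x)
    then show "opm gen_X (delta (k, j, i)) x = fscale (- z * qn q k) (delta (k - 1, j, i)) x"
      by (cases k) (auto simp: delta_def)
  qed
qed (auto simp: fun_eq_iff delta_def)

text \<open>The degree \<open>k + 2 j\<close> measures how far a weight lies below the top; a bound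
  on it leaves finitely many basis vectors.\<close>

definition deltas :: "nat \<Rightarrow> (nat \<times> nat \<times> nat \<Rightarrow> complex) set" where
  "deltas N = delta ` {(k, j, i). k + 2 * j \<le> N \<and> i < m}"

lemma finite_deltas: "finite (deltas N)"
proof -
  have "{(k, j, i). k + 2 * j \<le> N \<and> i < m} \<subseteq> {..N} \<times> {..N} \<times> {..<m}" by auto
  then show ?thesis unfolding deltas_def by (meson finite_imageI finite_subset finite_SigmaI finite_atMost finite_lessThan)
qed

lemma deltas_MW: "deltas N \<subseteq> MW"
  by (auto simp: deltas_def)

lemma support_bound:
  assumes "f \<in> MW" obtains N where "\<And>k j i. f (k, j, i) \<noteq> 0 \<Longrightarrow> k + 2 * j \<le> N"
proof -
  have "finite ((\<lambda>(k, j, i). k + 2 * j) ` {x. f x \<noteq> 0})" (is "finite ?A")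
    using assms by (simp add: model_space_def)
  moreover have "k + 2 * j \<in> ?A" if "f (k, j, i) \<noteq> 0" for k j i using that by force
  ultimately have "k + 2 * j \<le> Max ?A" if "f (k, j, i) \<noteq> 0" for k j i using that by simp
  then show ?thesis using that by blast
qed

lemma span_deltas:
  assumes "f \<in> MW" "\<And>k j i. f (k, j, i) \<noteq> 0 \<Longrightarrow> k + 2 * j \<le> N"
  shows "f \<in> fspace.span (deltas N)"
proof -
  let ?S = "{(k, j, i). k + 2 * j \<le> N \<and> i < m}"
  have "?S \<subseteq> {..N} \<times> {..N} \<times> {..<m}" by auto
  then have "finite ?S" by (meson finite_subset finite_SigmaI finite_atMost finite_lessThan)
  moreover have "{x. f x \<noteq> 0} \<subseteq> ?S" using assms by (auto simp: model_space_def)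
  ultimately have "f = (\<Sum>x\<in>?S. fscale (f x) (delta x))" by (rule finite_support_sum)
  also have "\<dots> \<in> fspace.span (deltas N)"
    by (intro fspace.span_sum fspace.span_scale fspace.span_base) (auto simp: deltas_def)
  finally show ?thesis .
qed

lemma MW_deltas: "f \<in> MW \<Longrightarrow> \<exists>N. f \<in> fspace.span (deltas N)"
  using support_bound span_deltas by metis

lemma model_weighty: "model_rep.weighty"
  unfolding model_rep.weighty_def
proof
  fix f assume "f \<in> MW"
  then obtain N where N: "f \<in> fspace.span (deltas N)" using MW_deltas by blast
  have "deltas N \<subseteq> {v. \<exists>\<nu>. model_rep.wvec \<nu> v}"
    by (auto simp: deltas_def model_rep.wvec_def opm_delta)
  with N show "f \<in> fspace.span {v. \<exists>\<nu>. model_rep.wvec \<nu> v}"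
    using fspace.span_mono by blast
qed

text \<open>\<open>X\<close> lowers the degree \<open>k + 2 j\<close> by one and \<open>E\<close>
  lowers it by two, so the span of \<open>deltas N\<close> is stable under both. Truncated
  subtraction never raises the degree.\<close>

lemma model_loc_fin: "model_rep.loc_fin"
  unfolding model_rep.loc_fin_def
proof
  fix f assume "f \<in> MW"
  then obtain N where N: "f \<in> fspace.span (deltas N)" using MW_deltas by blast
  have sub: "fspace.span (deltas N) \<subseteq> MW"
    using deltas_MW model_ops.subspace_W by (rule fspace.span_minimal)
  have d: "delta (k, j, i) \<in> fspace.span (deltas N)" if "k + 2 * j \<le> N" "i < m" for k j i
    using that by (intro fspace.span_base) (auto simp: deltas_def)
  let ?S = "{x \<in> MW. opm gen_E x \<in> fspace.span (deltas N) \<and> opm gen_X x \<in> fspace.span (deltas N)}"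
  have "fspace.subspace ?S"
    unfolding fspace.subspace_def
    by (auto simp: opm_add opm_scale fspace.span_zero intro: fspace.span_add fspace.span_scale)
  moreover have "deltas N \<subseteq> ?S"
  proof
    fix x assume "x \<in> deltas N"
    then obtain k j i where x: "x = delta (k, j, i)" "k + 2 * j \<le> N" "i < m" by (auto simp: deltas_def)
    have "opm gen_E x \<in> fspace.span (deltas N)" "opm gen_X x \<in> fspace.span (deltas N)"
      unfolding x(1) opm_delta using x(2,3)
      by (intro fspace.span_add fspace.span_scale d; simp)+
    then show "x \<in> ?S" using x by simp
  qed
  ultimately have cl: "fspace.span (deltas N) \<subseteq> ?S" by (rule fspace.span_minimal[rotated])
  show "\<exists>B. finite B \<and> B \<subseteq> MW \<and> f \<in> fspace.span B \<and>
     (\<forall>x\<in>fspace.span B. opm gen_E x \<in> fspace.span B \<and> opm gen_X x \<in> fspace.span B)"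
    using N finite_deltas deltas_MW cl by (intro exI[of _ "deltas N"]) auto
qed

lemma model_generated:
  assumes N: "model_ops.invariant N" and g: "\<And>i. i < m \<Longrightarrow> delta (0, 0, i) \<in> N"
  shows "N = MW"
proof
  have sub: "fspace.subspace N" and op: "\<And>g v. v \<in> N \<Longrightarrow> opm g v \<in> N"
    using N by (auto simp: model_ops.invariant_def)
  have Y: "delta (Suc k, j, i) \<in> N" if "delta (k, j, i) \<in> N" for k j i
    using op[OF that, of gen_Y] by (simp add: opm_delta)
  have j: "delta (0, j, i) \<in> N" if "i < m" for j i
  proof (induction j)
    case (Suc j)
    \<comment> \<open>\<open>F'\<close> is recovered from \<open>F\<close> by removing the
      \<open>Y^2\<close> part, which already lies in \<open>N\<close>.\<close>
    have "opm gen_F (delta (0, j, i)) - fscale (f_coeff (\<mu> i) j) (delta (Suc (Suc 0), j, i)) \<in> N"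
      using Suc by (intro fspace.subspace_diff[OF sub] fspace.subspace_scale[OF sub] op Y)
    then show ?case by (simp add: opm_delta)
  qed (rule g[OF that])
  have d: "delta (k, j, i) \<in> N" if "i < m" for k j i
    by (induction k) (auto intro: j that Y)
  show "MW \<subseteq> N"
  proof
    fix f assume "f \<in> MW"
    then obtain n where n: "f \<in> fspace.span (deltas n)" using MW_deltas by blast
    have "deltas n \<subseteq> N" using d by (auto simp: deltas_def)
    then show "f \<in> N" using n fspace.span_minimal[OF _ sub] by blast
  qed
  show "N \<subseteq> MW" using N by (simp add: model_ops.invariant_def)
qed

lemma model_fin_gen: "model_rep.fin_gen"
  unfolding model_rep.fin_gen_def
  by (rule exI[of _ "(\<lambda>i. delta (0, 0, i)) ` {..<m}"]) (auto intro!: model_generated)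

lemma model_weights:
  assumes "model_rep.wvec \<nu> f" "f \<noteq> 0"
  obtains k j i where "i < m" "\<nu> = wt (\<mu> i) k j"
proof -
  obtain k j i where x: "f (k, j, i) \<noteq> 0" using assms(2) by (auto simp: fun_eq_iff)
  have "opm gen_K f (k, j, i) = \<nu> * f (k, j, i)"
    using assms(1) by (simp add: model_rep.wvec_def del: opm.simps)
  moreover have "f \<in> MW" using assms(1) by (rule model_rep.wvec_W)
  then have "i < m" using x by (auto simp: model_space_def)
  ultimately show ?thesis using x that by auto
qed

lemma nilpotent_last:
  assumes "v \<in> N" "v \<noteq> 0" "\<And>w. w \<in> N \<Longrightarrow> T w \<in> N" "(T ^^ n) v = 0"
  obtains w where "w \<in> N" "w \<noteq> 0" "T w = 0"
proof -
  have N: "(T ^^ k) v \<in> N" for k using assms(1,3) by (induction k) auto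
  have "\<exists>k. (T ^^ k) v \<noteq> 0 \<and> (T ^^ Suc k) v = 0"
  proof (rule ccontr)
    assume "\<not> ?thesis"
    then have "(T ^^ k) v \<noteq> 0" for k using assms(2) by (induction k) auto
    with assms(4) show False by blast
  qed
  then show ?thesis using N that by (metis comp_apply funpow.simps(2))
qed

text \<open>\<open>X\<close>, and after it \<open>E\<close>, act nilpotently for reasons of degree.
  As \<open>E X = q X E\<close>, the kernel of \<open>X\<close> is stable under \<open>E\<close>, so
  the last nonzero image under \<open>E\<close> is killed by both.\<close>

lemma model_hw_exists:
  assumes N: "model_ops.invariant N" and f: "f \<in> N" "f \<noteq> 0"
  obtains g where "g \<in> N" "g \<noteq> 0" "opm gen_X g = 0" "opm gen_E g = 0"
proof -
  have op: "\<And>g v. v \<in> N \<Longrightarrow> opm g v \<in> N" and NM: "N \<subseteq> MW"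
    using N by (auto simp: model_ops.invariant_def)
  obtain M where M: "\<And>k j i. f (k, j, i) \<noteq> 0 \<Longrightarrow> k + 2 * j \<le> M"
    using support_bound[of f] f NM by blast
  have "k + n + 2 * j \<le> M" if "(opm gen_X ^^ n) f (k, j, i) \<noteq> 0" for n k j i
    using that
  proof (induction n arbitrary: k)
    case (Suc n)
    then have "(opm gen_X ^^ n) f (Suc k, j, i) \<noteq> 0" by auto
    then show ?case using Suc.IH by fastforce
  qed (use M in auto)
  then have "(opm gen_X ^^ Suc M) f (k, j, i) = 0" for k j i by fastforce
  then have "(opm gen_X ^^ Suc M) f = 0" by (auto simp: fun_eq_iff)
  then obtain g where g: "g \<in> N" "g \<noteq> 0" "opm gen_X g = 0"
    using nilpotent_last[OF f, of "opm gen_X"] op by blast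
  obtain L where L: "\<And>k j i. g (k, j, i) \<noteq> 0 \<Longrightarrow> k + 2 * j \<le> L"
    using support_bound[of g] g NM by blast
  have "k + 2 * n + 2 * j \<le> L" if "(opm gen_E ^^ n) g (k, j, i) \<noteq> 0" for n k j i
    using that
  proof (induction n arbitrary: k j)
    case (Suc n)
    then have "(opm gen_E ^^ n) g (k, Suc j, i) \<noteq> 0 \<or> (opm gen_E ^^ n) g (Suc (Suc k), j, i) \<noteq> 0" by auto
    then show ?case using Suc.IH[of k "Suc j"] Suc.IH[of "Suc (Suc k)" j] by auto
  qed (use L in auto)
  then have "(opm gen_E ^^ Suc L) g (k, j, i) = 0" for k j i by fastforce
  then have E: "(opm gen_E ^^ Suc L) g = 0" by (auto simp: fun_eq_iff)
  have "opm gen_E w \<in> N \<inter> {w. opm gen_X w = 0}" if w: "w \<in> N \<inter> {w. opm gen_X w = 0}" for w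
  proof -
    have "w \<in> MW" using w NM by blast
    then have "model_ops.act (fE * fX - const q * fX * fE) w = 0"
      by (intro opm_relators) (simp_all add: relators_def)
    then have "fscale q (opm gen_X (opm gen_E w)) = 0"
      using w \<open>w \<in> MW\<close> by (simp add: model_ops.act_simps opm_closed)
    then show ?thesis using w op q_nz by (simp del: fscale_def)
  qed
  then show ?thesis
    using nilpotent_last[of g "N \<inter> {w. opm gen_X w = 0}" "opm gen_E", OF _ g(2) _ E] g that by blast
qed

text \<open>\<open>X g = 0\<close> leaves only \<open>k = 0\<close> because \<open>qn\<close> does
  not vanish at positive arguments; then \<open>E g = 0\<close> leaves only \<open>j = 0\<close>
  because \<open>e_coeff\<close> does not vanish.\<close>

lemma model_hw:
  assumes g: "opm gen_X g = 0" "opm gen_E g = 0" and nz: "\<And>j i. e_coeff q (\<mu> i) (Suc j) \<noteq> 0"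
    and kj: "(k, j) \<noteq> (0, 0)"
  shows "g (k, j, i) = 0"
proof -
  have X: "g (Suc k, j, i) = 0" for k j i
    using fun_cong[OF g(1), of "(k, j, i)"] z_nz qn_nz[of "Suc k"] by simp
  have "g (0, Suc j, i) = 0" for j i
    using fun_cong[OF g(2), of "(0, j, i)"] nz[of i j] X by simp
  with X kj show ?thesis by (cases k; cases j) auto
qed

end

section \<open>Highest weight vectors\<close>

context uq_rep
begin

text \<open>\<open>g\<close> assigns weights, and its injectivity makes them distinct; the claim is
  \<open>wvec_components\<close> for the zero subspace.\<close>

lemma wvec_independent:
  assumes S: "\<And>v. v \<in> S \<Longrightarrow> v \<noteq> 0 \<and> wvec (g v) v" and inj: "inj_on g S"
  shows "independent S"
  unfolding independent_explicit_finite_subsets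
proof (intro allI impI ballI)
  fix T u v assume T: "T \<subseteq> S" "finite T" "(\<Sum>v\<in>T. u v *s v) = 0" "v \<in> T"
  have injT: "inj_on g T" using inj T(1) by (rule inj_on_subset)
  define f where "f \<mu> = u (inv_into T g \<mu>) *s inv_into T g \<mu>" for \<mu>
  have f: "f (g w) = u w *s w" if "w \<in> T" for w using that injT by (simp add: f_def)
  have "(\<Sum>\<mu>\<in>g ` T. f \<mu>) = 0"
    using T(3) f by (simp add: sum.reindex[OF injT])
  then have "\<forall>\<mu>\<in>g ` T. f \<mu> \<in> {0}"
    using T(1,2) S f by (intro wvec_components) (auto intro!: wvec_scale simp: subset_iff)
  then have "u v *s v = 0" using f T(4) by auto
  then show "u v = 0" using S T by auto
qed

end

locale charge_rep = uq_rep scale W \<rho> q + generic_q q z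
  for scale :: "complex \<Rightarrow> 'v::ab_group_add \<Rightarrow> 'v" (infixr "*s" 75) and W \<rho> q z +
  assumes Z_act: "v \<in> W \<Longrightarrow> \<rho> gen_Z v = z *s v"
begin

abbreviation "oE \<equiv> \<rho> gen_E"
abbreviation "oF \<equiv> \<rho> gen_F"
abbreviation "oK \<equiv> \<rho> gen_K"
abbreviation "oK' \<equiv> \<rho> gen_Kinv"
abbreviation "oX \<equiv> \<rho> gen_X"
abbreviation "oY \<equiv> \<rho> gen_Y"

lemma relations:
  assumes v: "v \<in> W"
  shows "oX (oY v) = q *s oY (oX v) - z *s v"
    and "q *s oX (oE v) = oE (oX v)"
    and "oE (oY v) = oX v + (1 / q) *s oY (oE v)"
    and "oX (oF v) = oF (oX v) - oY (oK' v)"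
    and "oF (oY v) = oY (oF v)"
    and "oE (oF v) = oF (oE v) + (1 / (q - 1 / q)) *s (oK v - oK' v)"
    and "oK (oE (oK' v)) = q\<^sup>2 *s oE v" "oK (oF (oK' v)) = (1 / q\<^sup>2) *s oF v"
    and "oK (oX (oK' v)) = q *s oX v" "oK (oY (oK' v)) = (1 / q) *s oY v"
proof -
  note r = relators_zero[OF _ v]
  note [simp] = relators_def act_simps v Z_act
  show "oX (oY v) = q *s oY (oX v) - z *s v"
    using r[of "const q * fY * fX - fX * fY - fZ"] by (simp add: algebra_simps)
  show "q *s oX (oE v) = oE (oX v)"
    using r[of "fE * fX - const q * fX * fE"] by simp
  show "oE (oY v) = oX v + (1 / q) *s oY (oE v)"
    using r[of "fE * fY - (fX + const (1 / q) * fY * fE)"] by (simp add: algebra_simps)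
  show "oX (oF v) = oF (oX v) - oY (oK' v)"
    using r[of "fF * fX - (fY * fKinv + fX * fF)"] by (simp add: algebra_simps)
  show "oF (oY v) = oY (oF v)"
    using r[of "fF * fY - fY * fF"] by simp
  show "oE (oF v) = oF (oE v) + (1 / (q - 1 / q)) *s (oK v - oK' v)"
    using r[of "fE * fF - fF * fE - const (1 / (q - 1 / q)) * (fK - fKinv)"] by (simp add: algebra_simps)
  show "oK (oE (oK' v)) = q\<^sup>2 *s oE v" using r[of "fK * fE * fKinv - const (q\<^sup>2) * fE"] by simp
  show "oK (oF (oK' v)) = (1 / q\<^sup>2) *s oF v" using r[of "fK * fF * fKinv - const (1 / q\<^sup>2) * fF"] by simp
  show "oK (oX (oK' v)) = q *s oX v" using r[of "fK * fX * fKinv - const q * fX"] by simp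
  show "oK (oY (oK' v)) = (1 / q) *s oY v" using r[of "fK * fY * fKinv - const (1 / q) * fY"] by simp
qed

lemma wvec_Kinv: "wvec \<mu> v \<Longrightarrow> oK' v = (1 / \<mu>) *s v"
proof (cases "v = 0")
  case False
  assume v: "wvec \<mu> v"
  then have "oK' (\<mu> *s v) = v" using K_inv(2)[of v] by (simp add: wvec_def)
  then have "\<mu> *s oK' v = v" using v by (simp add: \<rho>_scale wvec_def)
  then show ?thesis using wvec_nonzero[OF v False]
    by (metis nonzero_divide_eq_eq scale_one scale_scale mult.commute times_divide_eq_left mult_1)
qed simp

lemma wvec_op:
  assumes v: "wvec \<mu> v"
  shows "wvec (q\<^sup>2 * \<mu>) (oE v)" "wvec (\<mu> / q\<^sup>2) (oF v)" "wvec (q * \<mu>) (oX v)" "wvec (\<mu> / q) (oY v)"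
proof -
  \<comment> \<open>A relation \<open>K g K^{-1} = c g\<close> multiplies weights by
    \<open>c\<close>; the four claims are instances of it.\<close>
  have "wvec (c * \<mu>) (\<rho> g v)" if "oK (\<rho> g (oK' v)) = c *s \<rho> g v" for g c
  proof (cases "v = 0")
    case False
    then have m: "\<mu> \<noteq> 0" using v wvec_nonzero by blast
    have vW: "v \<in> W" using v by blast
    have "(1 / \<mu>) *s oK (\<rho> g v) = c *s \<rho> g v"
      using that vW by (simp add: wvec_Kinv[OF v] \<rho>_scale)
    then have "\<mu> *s ((1 / \<mu>) *s oK (\<rho> g v)) = \<mu> *s (c *s \<rho> g v)" by simp
    then show ?thesis using m vW by (simp add: wvec_def mult.commute)
  qed simp
  from this[OF relations(7)] this[OF relations(8)] this[OF relations(9)] this[OF relations(10)]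
  show "wvec (q\<^sup>2 * \<mu>) (oE v)" "wvec (\<mu> / q\<^sup>2) (oF v)" "wvec (q * \<mu>) (oX v)" "wvec (\<mu> / q) (oY v)"
    using v by (auto simp: wvec_W)
qed

text \<open>The operator \<open>F'\<close>. Written with \<open>K^{-1}\<close> instead of a weight,
  it makes sense on all of \<open>W\<close>.\<close>

definition Fp :: "'v \<Rightarrow> 'v" where
  "Fp v = oF v - (1 / ((1 + q) * z)) *s oY (oY (oK' v))"

lemma Fp_W [simp]: "v \<in> W \<Longrightarrow> Fp v \<in> W"
  by (simp add: Fp_def)

lemma Fp_scale: "v \<in> W \<Longrightarrow> Fp (c *s v) = c *s Fp v"
  by (simp add: Fp_def \<rho>_scale scale_right_diff_distrib mult.commute)

lemma Fp_wvec: "wvec \<mu> v \<Longrightarrow> Fp v = oF v - f_coeff \<mu> 0 *s oY (oY v)"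
  by (simp add: Fp_def wvec_Kinv \<rho>_scale wvec_W f_coeff_def)

lemma wvec_Fp: "wvec \<mu> v \<Longrightarrow> wvec (\<mu> / q\<^sup>2) (Fp v)"
proof -
  assume v: "wvec \<mu> v"
  have "\<mu> / q / q = \<mu> / q\<^sup>2" by (simp add: power2_eq_square)
  then have "wvec (\<mu> / q\<^sup>2) (f_coeff \<mu> 0 *s oY (oY v))"
    using wvec_scale[OF wvec_op(4)[OF wvec_op(4)[OF v]]] by metis
  then show ?thesis unfolding Fp_wvec[OF v] by (rule wvec_diff[OF wvec_op(2)[OF v]])
qed

lemma X_YY: "v \<in> W \<Longrightarrow> oX v = 0 \<Longrightarrow> oX (oY (oY v)) = (- (1 + q) * z) *s oY v"
  by (simp add: relations \<rho>_linear algebra_simps)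

text \<open>\<open>X F v\<close> contributes \<open>- \<mu>^{-1} Y v\<close> and, by
  \<open>X_YY\<close>, the correction contributes the opposite; the constant in \<open>Fp\<close> is
  chosen for this.\<close>

lemma X_Fp:
  assumes v: "wvec \<mu> v" and oX: "oX v = 0" and m: "\<mu> \<noteq> 0"
  shows "oX (Fp v) = 0"
proof -
  have vW: "v \<in> W" using v by blast
  have "f_coeff \<mu> 0 * (- (1 + q) * z) = - (1 / \<mu>)"
  proof -
    have "1 / (s * z * \<mu>) * (- s * z) = - (1 / \<mu>)" if "s \<noteq> 0" for s
      using that z_nz m by (simp add: field_simps)
    from this[OF q_neq(3)] show ?thesis by (simp add: f_coeff_def)
  qed
  then have "f_coeff \<mu> 0 *s oX (oY (oY v)) = (- (1 / \<mu>)) *s oY v"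
    using X_YY[OF vW oX] by simp
  then show ?thesis
    using vW by (simp add: Fp_wvec[OF v] \<rho>_linear relations(4) oX wvec_Kinv[OF v])
qed

text \<open>Moving \<open>E\<close> through \<open>Y^2\<close> leaves an extra \<open>- z v\<close>
  when \<open>X v = 0\<close>. This term turns \<open>(K - K^{-1}) / (q - q^{-1})\<close> into
  \<open>(q K - K^{-1}) / (q^2 - 1)\<close>.\<close>

lemma E_Fp:
  assumes v: "wvec \<mu> v" and oX: "oX v = 0" and m: "\<mu> \<noteq> 0"
  shows "oE (Fp v) = Fp (oE v) + ((q * \<mu> - 1 / \<mu>) / (q\<^sup>2 - 1)) *s v"
proof -
  have vW: "v \<in> W" and Kv: "oK v = \<mu> *s v" using v by (auto simp: wvec_def)
  have YY: "oE (oY (oY v)) = (1 / q\<^sup>2) *s oY (oY (oE v)) - z *s v"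
    using vW by (simp add: relations(3) relations(1) oX \<rho>_linear power2_eq_square algebra_simps)
  have Ev: "Fp (oE v) = oF (oE v) - f_coeff (q\<^sup>2 * \<mu>) 0 *s oY (oY (oE v))"
    by (rule Fp_wvec[OF wvec_op(1)[OF v]])
  \<comment> \<open>\<open>E v\<close> has weight \<open>q^2 \<mu>\<close>; the resulting factor
    \<open>q^{-2}\<close> matches the one that appears when \<open>E\<close> passes
    \<open>Y^2\<close>.\<close>
  have f: "f_coeff (q\<^sup>2 * \<mu>) 0 = f_coeff \<mu> 0 * (1 / q\<^sup>2)" by (simp add: f_coeff_def)
  have fz: "f_coeff \<mu> 0 * z = (q - 1) / ((q\<^sup>2 - 1) * \<mu>)"
  proof -
    have "q\<^sup>2 - 1 = (q - 1) * (1 + q)" by (simp add: power2_eq_square algebra_simps)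
    then show ?thesis using z_nz q_neq m by (simp add: f_coeff_def)
  qed
  have qq: "1 / (q - 1 / q) = q / (q\<^sup>2 - 1)"
    using q_nz q_neq by (simp add: field_simps power2_eq_square)
  have c: "1 / (q - 1 / q) * (\<mu> - 1 / \<mu>) + f_coeff \<mu> 0 * z = (q * \<mu> - 1 / \<mu>) / (q\<^sup>2 - 1)"
  proof -
    have "q * (\<mu> - 1 / \<mu>) + (q - 1) * (1 / \<mu>) = q * \<mu> - 1 / \<mu>"
      by (simp add: algebra_simps diff_divide_distrib)
    then have "(q * \<mu> - 1 / \<mu>) / (q\<^sup>2 - 1) = (q * (\<mu> - 1 / \<mu>) + (q - 1) * (1 / \<mu>)) / (q\<^sup>2 - 1)" by simp
    then show ?thesis unfolding qq fz by (simp add: add_divide_distrib)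
  qed
  have "oE (Fp v) = oE (oF v) - f_coeff \<mu> 0 *s oE (oY (oY v))"
    using vW by (simp add: Fp_wvec[OF v] \<rho>_linear)
  also have "\<dots> = oF (oE v) - (f_coeff \<mu> 0 * (1 / q\<^sup>2)) *s oY (oY (oE v))
      + (1 / (q - 1 / q) * (\<mu> - 1 / \<mu>) + f_coeff \<mu> 0 * z) *s v"
    unfolding relations(6)[OF vW] YY Kv wvec_Kinv[OF v]
    by (simp only: scale_left_distrib scale_left_diff_distrib scale_right_diff_distrib scale_right_distrib
        scale_scale right_diff_distrib distrib_left mult.assoc) (simp add: algebra_simps)
  finally show ?thesis unfolding c Ev f by simp
qed

definition hw :: "complex \<Rightarrow> 'v \<Rightarrow> bool" where
  "hw \<mu> h \<longleftrightarrow> wvec \<mu> h \<and> oX h = 0 \<and> oE h = 0"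

definition pbw :: "nat \<Rightarrow> nat \<Rightarrow> 'v \<Rightarrow> 'v" where
  "pbw k j h = (oY ^^ k) ((Fp ^^ j) h)"

lemma pbw_0_0 [simp]: "pbw 0 0 h = h"
  by (simp add: pbw_def)

lemma pbw_Suc: "pbw (Suc k) j h = oY (pbw k j h)"
  by (simp add: pbw_def)

lemma pbw_0_Suc: "pbw 0 (Suc j) h = Fp (pbw 0 j h)"
  by (simp add: pbw_def)

text \<open>The three facts need a joint induction: the step applies \<open>E_Fp\<close>, which asks
  for a weight vector killed by \<open>X\<close>.\<close>

lemma pbw_0:
  assumes h: "hw \<mu> h" and m: "\<mu> \<noteq> 0"
  shows "wvec (wt \<mu> 0 j) (pbw 0 j h) \<and> oX (pbw 0 j h) = 0 \<and> oE (pbw 0 j h) = e_coeff q \<mu> j *s pbw 0 (j - 1) h"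
proof (induction j)
  case 0
  then show ?case using h by (simp add: hw_def)
next
  case (Suc j)
  let ?u = "pbw 0 j h"
  have u: "wvec (wt \<mu> 0 j) ?u" "oX ?u = 0" "oE ?u = e_coeff q \<mu> j *s pbw 0 (j - 1) h" using Suc by auto
  have w: "wt \<mu> 0 j \<noteq> 0" using m by (rule wt_nz)
  have FpE: "Fp (oE ?u) = e_coeff q \<mu> j *s ?u"
  proof (cases j)
    case 0
    then have "oE ?u = 0" using u(3) by simp
    then show ?thesis using 0 by (simp add: Fp_def)
  next
    case (Suc i)
    have "pbw 0 i h \<in> W" using h by (induction i) (auto simp: pbw_0_Suc hw_def wvec_W)
    then have "Fp (e_coeff q \<mu> j *s pbw 0 i h) = e_coeff q \<mu> j *s pbw 0 (Suc i) h"
      by (simp only: Fp_scale pbw_0_Suc)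
    then show ?thesis using u(3) Suc by (simp only: diff_Suc_1)
  qed
  have "(q * wt \<mu> 0 j - 1 / wt \<mu> 0 j) / (q\<^sup>2 - 1) = e_coeff q \<mu> (Suc j) - e_coeff q \<mu> j"
    using e_coeff_Suc[OF m, of j] by (simp add: wt_def)
  then have "oE (Fp ?u) = e_coeff q \<mu> (Suc j) *s ?u"
    using E_Fp[OF u(1,2) w] unfolding FpE by (simp add: scale_left_diff_distrib)
  then show ?case
    using wvec_Fp[OF u(1)] X_Fp[OF u(1,2) w] by (simp add: pbw_0_Suc)
qed

lemma pbw_W: "hw \<mu> h \<Longrightarrow> pbw k j h \<in> W"
proof -
  assume h: "hw \<mu> h"
  have "pbw 0 j h \<in> W" using h by (induction j) (auto simp: pbw_0_Suc hw_def wvec_W)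
  then show ?thesis by (induction k) (auto simp: pbw_Suc)
qed

text \<open>The formulas agree with \<open>opm_delta\<close>. So the operators of the model reflect
  what happens above any highest weight vector, and the canonical map below is a
  homomorphism.\<close>

lemma pbw_op:
  assumes h: "hw \<mu> h" and m: "\<mu> \<noteq> 0"
  shows "oK (pbw k j h) = wt \<mu> k j *s pbw k j h"
    "oK' (pbw k j h) = (1 / wt \<mu> k j) *s pbw k j h"
    "oX (pbw k j h) = (- z * qn q k) *s pbw (k - 1) j h"
    "oF (pbw k j h) = pbw k (Suc j) h + f_coeff \<mu> j *s pbw (Suc (Suc k)) j h"
    "oE (pbw k j h) = (e_coeff q \<mu> j / q ^ k) *s pbw k (j - 1) h + y_coeff q z k *s pbw (k - 2) j h"
proof -
  note [simp] = pbw_W[OF h]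
  have w: "wvec (wt \<mu> k j) (pbw k j h)" for k
    by (induction k) (use pbw_0[OF h m] wvec_op(4) in \<open>auto simp: pbw_Suc\<close>)
  then show "oK (pbw k j h) = wt \<mu> k j *s pbw k j h" "oK' (pbw k j h) = (1 / wt \<mu> k j) *s pbw k j h"
    by (simp_all add: wvec_def wvec_Kinv[OF w])
  show oX: "oX (pbw k j h) = (- z * qn q k) *s pbw (k - 1) j h" for k
  proof (induction k)
    case 0
    then show ?case using pbw_0[OF h m] by simp
  next
    case (Suc k)
    have "oX (pbw (Suc k) j h) = (q * (- z * qn q k)) *s oY (pbw (k - 1) j h) - z *s pbw k j h"
      by (simp add: pbw_Suc relations Suc \<rho>_linear)
    also have "(q * (- z * qn q k)) *s oY (pbw (k - 1) j h) = (q * (- z * qn q k)) *s pbw k j h"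
      by (cases k) (simp_all add: pbw_Suc)
    also have "\<dots> - z *s pbw k j h = (q * (- z * qn q k) - z) *s pbw k j h"
      by (simp add: scale_left_diff_distrib)
    also have "q * (- z * qn q k) - z = - z * qn q (Suc k)"
      by (simp add: qn_Suc q_power algebra_simps)
    finally show ?case by simp
  qed
  show "oF (pbw k j h) = pbw k (Suc j) h + f_coeff \<mu> j *s pbw (Suc (Suc k)) j h"
  proof (induction k)
    case 0
    have "f_coeff (wt \<mu> 0 j) 0 = f_coeff \<mu> j" by (simp add: f_coeff_def wt_def)
    then show ?case using Fp_wvec[OF w[of 0]] by (simp add: pbw_0_Suc pbw_Suc algebra_simps)
  next
    case (Suc k)
    have "oF (pbw (Suc k) j h) = oY (oF (pbw k j h))" by (simp add: pbw_Suc relations)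
    then show ?case unfolding Suc by (simp add: \<rho>_linear pbw_Suc)
  qed
  show "oE (pbw k j h) = (e_coeff q \<mu> j / q ^ k) *s pbw k (j - 1) h + y_coeff q z k *s pbw (k - 2) j h"
  proof (induction k)
    case 0
    then show ?case using pbw_0[OF h m] by simp
  next
    case (Suc k)
    have y: "y_coeff q z k *s oY (pbw (k - 2) j h) = y_coeff q z k *s pbw (k - 1) j h"
      by (rule nat_012[of k]) (simp_all add: pbw_Suc)
    have "oE (pbw (Suc k) j h) = oX (pbw k j h) + (1 / q) *s oY (oE (pbw k j h))"
      by (simp add: pbw_Suc relations)
    also have "\<dots> = (- z * qn q k) *s pbw (k - 1) j h
        + (1 / q) *s ((e_coeff q \<mu> j / q ^ k) *s pbw (Suc k) (j - 1) h + y_coeff q z k *s pbw (k - 1) j h)"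
      unfolding oX Suc using y by (simp add: \<rho>_linear pbw_Suc)
    also have "\<dots> = (e_coeff q \<mu> j / q ^ Suc k) *s pbw (Suc k) (j - 1) h
        + (y_coeff q z k / q - z * qn q k) *s pbw (k - 1) j h"
      by (simp add: scale_right_distrib scale_left_diff_distrib mult.commute)
    also have "y_coeff q z k / q - z * qn q k = y_coeff q z (Suc k)" by (simp add: y_coeff_Suc)
    finally show ?case by simp
  qed
qed

text \<open>The vectors \<open>g^n v\<close> have pairwise distinct weights
  \<open>q^{s n} \<mu>\<close>. If none of them vanished they would be independent, yet they all lie
  in one finite-dimensional span.\<close>

lemma nilpotent:
  assumes lf: loc_fin and v: "wvec \<mu> v" and g: "g = gen_E \<or> g = gen_X"
  shows "\<exists>n. (\<rho> g ^^ n) v = 0"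
proof (rule ccontr)
  assume nz: "\<not> ?thesis"
  then have m: "\<mu> \<noteq> 0" using wvec_nonzero[OF v] by (metis funpow_0)
  \<comment> \<open>\<open>s\<close> is 2 for \<open>E\<close> and 1 for \<open>X\<close>.\<close>
  obtain s :: nat where s: "s > 0" "\<And>\<nu> w. wvec \<nu> w \<Longrightarrow> wvec (q ^ s * \<nu>) (\<rho> g w)"
    using g wvec_op(1,3) by (metis One_nat_def less_numeral_extra(1) pos2 power_one_right)
  have w: "wvec (q ^ (s * n) * \<mu>) ((\<rho> g ^^ n) v)" for n
    by (induction n) (use v s(2) in \<open>auto simp: power_add mult.assoc dest: s(2)\<close>)
  obtain B where B: "finite B" "B \<subseteq> W" "v \<in> span B" "\<And>x. x \<in> span B \<Longrightarrow> \<rho> g x \<in> span B"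
    using lf v g unfolding loc_fin_def by (metis wvec_W)
  have sp: "(\<rho> g ^^ n) v \<in> span B" for n by (induction n) (auto intro: B)
  have inj: "q ^ (s * n) * \<mu> = q ^ (s * n') * \<mu> \<Longrightarrow> n = n'" for n n'
  proof -
    assume "q ^ (s * n) * \<mu> = q ^ (s * n') * \<mu>"
    then have "q ^ (s * n) = q ^ (s * n')" using m by simp
    moreover have "q powi (int (s * n) - int (s * n')) = q ^ (s * n) / q ^ (s * n')"
      by (subst power_int_diff) (use q_nz in \<open>simp_all only: power_int_of_nat simp_thms\<close>)
    ultimately have "q powi (int (s * n) - int (s * n')) = 1" using q_nz by simp
    then have "int (s * n) - int (s * n') = 0" by (rule powi_eq_1)
    then show "n = n'" using s(1) by simp
  qed
  let ?S = "range (\<lambda>n. (\<rho> g ^^ n) v)"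
  have injS: "inj (\<lambda>n. (\<rho> g ^^ n) v)"
  proof (rule injI)
    fix n n' assume e: "(\<rho> g ^^ n) v = (\<rho> g ^^ n') v"
    have "(q ^ (s * n) * \<mu>) *s (\<rho> g ^^ n) v = (q ^ (s * n') * \<mu>) *s (\<rho> g ^^ n) v"
      using w[of n] w[of n'] e by (simp add: wvec_def)
    then have "q ^ (s * n) * \<mu> = q ^ (s * n') * \<mu>" using nz by (simp only: scale_cancel_right) blast
    then show "n = n'" by (rule inj)
  qed
  have "independent ?S"
  proof (rule wvec_independent)
    show "u \<noteq> 0 \<and> wvec (q ^ (s * inv_into UNIV (\<lambda>n. (\<rho> g ^^ n) v) u) * \<mu>) u" if "u \<in> ?S" for u
      using that w nz by (auto simp: inv_f_f[OF injS])
    show "inj_on (\<lambda>u. q ^ (s * inv_into UNIV (\<lambda>n. (\<rho> g ^^ n) v) u) * \<mu>) ?S"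
    proof (rule inj_onI)
      fix u u' assume "u \<in> ?S" "u' \<in> ?S"
        and e: "q ^ (s * inv_into UNIV (\<lambda>n. (\<rho> g ^^ n) v) u) * \<mu> = q ^ (s * inv_into UNIV (\<lambda>n. (\<rho> g ^^ n) v) u') * \<mu>"
      then obtain n n' where "u = (\<rho> g ^^ n) v" "u' = (\<rho> g ^^ n') v" by blast
      then show "u = u'" using inj[OF e] by (simp add: inv_f_f[OF injS])
    qed
  qed
  then have "finite ?S" using independent_span_bound[OF B(1)] sp by blast
  then show False using injS by (simp add: finite_image_iff)
qed

lemma invariant_Fp: "invariant N \<Longrightarrow> v \<in> N \<Longrightarrow> Fp v \<in> N"
  by (simp add: Fp_def invariant_def subspace_diff subspace_scale)

lemma invariant_funpow_Fp: "invariant N \<Longrightarrow> v \<in> N \<Longrightarrow> (Fp ^^ n) v \<in> N"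
  by (induction n) (auto intro: invariant_Fp)

lemma invariant_funpow: "invariant N \<Longrightarrow> v \<in> N \<Longrightarrow> (\<rho> g ^^ n) v \<in> N"
  by (induction n) (auto simp: invariant_def)

lemma funpow_linear:
  "\<lbrakk>v \<in> W; w \<in> W\<rbrakk> \<Longrightarrow> (\<rho> g ^^ n) (v - w) = (\<rho> g ^^ n) v - (\<rho> g ^^ n) w"
  "v \<in> W \<Longrightarrow> (\<rho> g ^^ n) (c *s v) = c *s (\<rho> g ^^ n) v"
  "v \<in> W \<Longrightarrow> (\<rho> g ^^ n) v \<in> W"
proof -
  show c: "v \<in> W \<Longrightarrow> (\<rho> g ^^ n) v \<in> W" for v n by (induction n) auto
  show "\<lbrakk>v \<in> W; w \<in> W\<rbrakk> \<Longrightarrow> (\<rho> g ^^ n) (v - w) = (\<rho> g ^^ n) v - (\<rho> g ^^ n) w"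
    by (induction n) (auto simp: \<rho>_diff c)
  show "v \<in> W \<Longrightarrow> (\<rho> g ^^ n) (c *s v) = c *s (\<rho> g ^^ n) v"
    by (induction n) (auto simp: \<rho>_scale c)
qed

lemma wvec_funpow:
  assumes v: "wvec (q powi l) v" and g: "g = gen_E \<or> g = gen_X"
  shows "\<exists>l'. wvec (q powi l') ((\<rho> g ^^ n) v)"
proof (induction n)
  case 0
  then show ?case using v by auto
next
  case (Suc n)
  then obtain l' where l': "wvec (q powi l') ((\<rho> g ^^ n) v)" by blast
  have "q\<^sup>2 * q powi l' = q powi (2 + l')" "q * q powi l' = q powi (1 + l')" "q powi l' / q = q powi (l' - 1)"
    using q_nz by (simp_all add: power_int_add power_int_diff)
  then show ?case using wvec_op(1,3)[OF l'] g by auto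
qed

text \<open>The constant is a product of values of \<open>e_coeff\<close>, none of which vanishes at
  an integral power of \<open>q\<close>.\<close>

lemma E_pow_Fp_pow:
  assumes h: "hw (q powi l) h"
  shows "\<exists>c. c \<noteq> 0 \<and> (oE ^^ n) ((Fp ^^ n) h) = c *s h"
proof (induction n)
  case 0
  show ?case by (rule exI[of _ 1]) simp
next
  case (Suc n)
  then obtain c where c: "c \<noteq> 0" "(oE ^^ n) ((Fp ^^ n) h) = c *s h" by blast
  have "(oE ^^ Suc n) ((Fp ^^ Suc n) h) = (oE ^^ n) (oE (pbw 0 (Suc n) h))"
    by (simp add: funpow_swap1 pbw_def)
  also have "\<dots> = (oE ^^ n) (e_coeff q (q powi l) (Suc n) *s (Fp ^^ n) h)"
    using pbw_0[OF h, of "Suc n"] q_nz by (simp add: pbw_def)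
  also have "\<dots> = (e_coeff q (q powi l) (Suc n) * c) *s h"
    using pbw_W[OF h, of 0 n] c by (simp add: funpow_linear pbw_def)
  finally show ?case using c(1) e_coeff_nz[of "Suc n" l]
    by (intro exI[of _ "e_coeff q (q powi l) (Suc n) * c"]) simp
qed

text \<open>The constant is \<open>(- z)^n\<close> times the \<open>q\<close>-factorial of
  \<open>n\<close>.\<close>

lemma X_pow_Y_pow:
  assumes h: "h \<in> W" "oX h = 0"
  shows "\<exists>c. c \<noteq> 0 \<and> (oX ^^ n) ((oY ^^ n) h) = c *s h"
proof -
  have XY: "oX ((oY ^^ n) h) = (- z * qn q n) *s (oY ^^ (n - 1)) h" for n
  proof (induction n)
    case (Suc n)
    have "oX ((oY ^^ Suc n) h) = (q * (- z * qn q n)) *s oY ((oY ^^ (n - 1)) h) - z *s (oY ^^ n) h"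
      using h by (simp add: relations funpow_linear Suc \<rho>_linear)
    also have "(q * (- z * qn q n)) *s oY ((oY ^^ (n - 1)) h) = (q * (- z * qn q n)) *s (oY ^^ n) h"
      by (cases n) simp_all
    also have "\<dots> - z *s (oY ^^ n) h = (q * (- z * qn q n) - z) *s (oY ^^ n) h"
      by (simp add: scale_left_diff_distrib)
    also have "q * (- z * qn q n) - z = - z * qn q (Suc n)"
      by (simp add: qn_Suc q_power algebra_simps)
    finally show ?case by simp
  qed (use h in simp)
  show ?thesis
  proof (induction n)
    case 0
    show ?case by (rule exI[of _ 1]) simp
  next
    case (Suc n)
    then obtain c where c: "c \<noteq> 0" "(oX ^^ n) ((oY ^^ n) h) = c *s h" by blast
    have "(oX ^^ Suc n) ((oY ^^ Suc n) h) = (oX ^^ n) (oX ((oY ^^ Suc n) h))" by (simp add: funpow_swap1)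
    also have "\<dots> = (- z * qn q (Suc n)) *s (oX ^^ n) ((oY ^^ n) h)"
      unfolding XY diff_Suc_1 by (rule funpow_linear(2)) (simp add: h funpow_linear)
    also have "\<dots> = (- z * qn q (Suc n) * c) *s h" unfolding c(2) by simp
    finally show ?case using c(1) z_nz qn_nz[of "Suc n"]
      by (intro exI[of _ "- z * qn q (Suc n) * c"]) simp
  qed
qed

text \<open>Integral weights avoid the zeros of \<open>e_coeff\<close>, so a weight vector differs from \<open>oY^k F'^j h\<close>
  with \<open>h\<close> its last nonzero image under powers of \<open>oX\<close> and \<open>oE\<close> by a vector killed earlier.\<close>

lemma generated_by_hw:
  assumes weighty loc_fin and int: "\<And>\<mu> v. wvec \<mu> v \<Longrightarrow> v \<noteq> 0 \<Longrightarrow> \<exists>l::int. \<mu> = q powi l"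
    and N: "invariant N" and hwN: "\<And>l h. hw (q powi l) h \<Longrightarrow> h \<in> N"
  shows "N = W"
proof -
  have sub: "subspace N" and NW: "N \<subseteq> W" using N by (auto simp: invariant_def)
  \<comment> \<open>Vectors killed by \<open>X\<close>, by induction on the order of nilpotency
    under \<open>E\<close>.\<close>
  have A: "v \<in> N" if "wvec (q powi l) v" "oX v = 0" "(oE ^^ n) v = 0" for n l v
    using that
  proof (induction n arbitrary: l v)
    case 0
    then show ?case using sub by (simp add: subspace_0)
  next
    case (Suc n)
    define h where "h = (oE ^^ n) v"
    have vW: "v \<in> W" using Suc.prems(1) by blast
    have "oX ((oE ^^ k) v) = 0" for k
    proof (induction k)
      case (Suc k)
      have "q *s oX (oE ((oE ^^ k) v)) = 0"
        using Suc relations(2)[of "(oE ^^ k) v"] vW by (simp add: funpow_linear)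
      then show ?case using q_nz by simp
    qed (use Suc.prems in simp)
    moreover obtain l' where "wvec (q powi l') h"
      using wvec_funpow[OF Suc.prems(1), of gen_E n] by (auto simp: h_def)
    moreover have "oE h = 0" using Suc.prems(3) by (simp add: h_def)
    ultimately have h: "hw (q powi l') h" by (simp add: hw_def h_def)
    obtain c where c: "c \<noteq> 0" "(oE ^^ n) ((Fp ^^ n) h) = c *s h" using E_pow_Fp_pow[OF h] by blast
    have FhW: "(Fp ^^ n) h \<in> W" using pbw_W[OF h, of 0 n] by (simp add: pbw_def)
    \<comment> \<open>Normalised so that \<open>E^n u = E^n v\<close>; hence \<open>E^n\<close>
      kills \<open>v - u\<close>.\<close>
    define u where "u = (1 / c) *s (Fp ^^ n) h"
    have uN: "u \<in> N" unfolding u_def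
      by (intro subspace_scale[OF sub] invariant_funpow_Fp[OF N] hwN[OF h])
    have Eu: "(oE ^^ n) u = h" using c FhW by (simp add: u_def funpow_linear)
    show ?case
    proof (cases "h = 0")
      case True
      then show ?thesis using Suc.IH[OF Suc.prems(1,2)] by (simp add: h_def)
    next
      case False
      have wu: "wvec (wt (q powi l') 0 n) u" "oX u = 0"
        using pbw_0[OF h, of n] q_nz FhW by (auto simp: u_def pbw_def wvec_scale \<rho>_scale)
      \<comment> \<open>The induction hypothesis asks \<open>v - u\<close> to be a weight vector, so
        \<open>u\<close> must have the weight of \<open>v\<close>. Both are compared with the weight
        of \<open>h\<close>, which is well determined as \<open>h\<close> is nonzero.\<close>
      have "wvec (q powi l) u"
      proof -
        have "wvec (q ^ (2 * n) * q powi l) h"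
          unfolding h_def using Suc.prems(1)
        proof (induction n)
          case (Suc n)
          then show ?case using wvec_op(1)[of "q ^ (2 * n) * q powi l" "(oE ^^ n) v"]
            by (simp add: power2_eq_square mult.assoc)
        qed simp
        moreover have "wvec (q powi l') h" using h by (simp add: hw_def)
        ultimately have "(q ^ (2 * n) * q powi l) *s h = (q powi l') *s h" by (simp add: wvec_def)
        then have "q ^ (2 * n) * q powi l = q powi l'" using False by simp
        then have "wt (q powi l') 0 n = q powi l" using q_nz by (simp add: wt_def field_simps)
        then show ?thesis using wu by simp
      qed
      then have "v - u \<in> N"
        using Suc.prems wu(2) NW uN vW Eu
        by (intro Suc.IH[of l]) (auto simp: wvec_diff \<rho>_diff funpow_linear subset_iff h_def)
      then show ?thesis using uN subspace_add[OF sub, of "v - u" u] by simp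
    qed
  qed
  have A': "v \<in> N" if "wvec \<mu> v" "oX v = 0" for \<mu> v
  proof (cases "v = 0")
    case False
    have "\<exists>l::int. \<mu> = q powi l" using that(1) False by (rule int)
    then obtain l where "\<mu> = q powi l" by blast
    then show ?thesis using A[of l v] nilpotent[OF \<open>loc_fin\<close> that(1), of gen_E] that by blast
  qed (simp add: subspace_0 sub)
  \<comment> \<open>The general case, by induction on the order of nilpotency under
    \<open>X\<close>, with \<open>Y^n h\<close> in the role of \<open>F'^n h\<close>.\<close>
  have B: "v \<in> N" if "wvec \<mu> v" "(oX ^^ n) v = 0" for n \<mu> v
    using that
  proof (induction n arbitrary: v)
    case 0
    then show ?case using sub by (simp add: subspace_0)
  next
    case (Suc n)
    define h where "h = (oX ^^ n) v"
    have vW: "v \<in> W" using Suc.prems(1) by blast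
    have w: "wvec (q ^ n * \<mu>) h" unfolding h_def using Suc.prems(1)
    proof (induction n)
      case (Suc n)
      then show ?case using wvec_op(3)[of "q ^ n * \<mu>" "(oX ^^ n) v"] by (simp add: mult.assoc)
    qed simp
    have oX: "oX h = 0" using Suc.prems(2) by (simp add: h_def)
    have hN: "h \<in> N" using A'[OF w oX] .
    obtain c where c: "c \<noteq> 0" "(oX ^^ n) ((oY ^^ n) h) = c *s h" using X_pow_Y_pow[OF _ oX] w by blast
    have hW: "h \<in> W" using w by blast
    define u where "u = (1 / c) *s (oY ^^ n) h"
    have uN: "u \<in> N" unfolding u_def
      by (intro subspace_scale[OF sub] invariant_funpow[OF N] hN)
    have Xu: "(oX ^^ n) u = h" using c hW by (simp add: u_def funpow_linear)
    have "wvec (q ^ n * \<mu> / q ^ n) ((oY ^^ n) h)"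
    proof -
      have "wvec (q ^ n * \<mu> / q ^ k) ((oY ^^ k) h)" for k
      proof (induction k)
        case (Suc k)
        then show ?case using wvec_op(4)[of "q ^ n * \<mu> / q ^ k" "(oY ^^ k) h"] by (simp add: mult.commute)
      qed (use w in simp)
      then show ?thesis .
    qed
    then have "wvec \<mu> u" using q_nz by (simp add: u_def wvec_scale)
    then have "v - u \<in> N"
      using Suc.prems NW uN vW Xu
      by (intro Suc.IH) (auto simp: wvec_diff funpow_linear subset_iff h_def)
    then show ?case using uN subspace_add[OF sub, of "v - u" u] by simp
  qed
  have "{v. \<exists>\<mu>. wvec \<mu> v} \<subseteq> N"
    using B nilpotent[OF \<open>loc_fin\<close>, of _ _ gen_X] by blast
  then have "W \<subseteq> N" using \<open>weighty\<close> span_minimal[OF _ sub] unfolding weighty_def by blast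
  with NW show ?thesis by blast
qed

end

section \<open>The canonical map from a model into a representation\<close>

locale hw_family = charge_rep scale W \<rho> q z + model q z m \<mu>
  for scale :: "complex \<Rightarrow> 'v::ab_group_add \<Rightarrow> 'v" (infixr "*s" 75) and W \<rho> q z m \<mu> +
  fixes h :: "nat \<Rightarrow> 'v"
  assumes hw_h: "i < m \<Longrightarrow> hw (\<mu> i) (h i)"
begin

definition pb :: "nat \<times> nat \<times> nat \<Rightarrow> 'v" where
  "pb = (\<lambda>(k, j, i). pbw k j (h i))"

definition \<Phi> :: "(nat \<times> nat \<times> nat \<Rightarrow> complex) \<Rightarrow> 'v" where
  "\<Phi> f = (\<Sum>x | f x \<noteq> 0. f x *s pb x)"

lemma \<Phi>_superset: "\<lbrakk>finite S; {x. f x \<noteq> 0} \<subseteq> S\<rbrakk> \<Longrightarrow> \<Phi> f = (\<Sum>x\<in>S. f x *s pb x)"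
  unfolding \<Phi>_def by (rule sum.mono_neutral_left) auto

lemma MW_finite: "f \<in> MW \<Longrightarrow> finite {x. f x \<noteq> 0}"
  by (simp add: model_space_def)

lemma \<Phi>_add:
  assumes "f \<in> MW" "g \<in> MW" shows "\<Phi> (f + g) = \<Phi> f + \<Phi> g"
proof -
  let ?S = "{x. f x \<noteq> 0} \<union> {x. g x \<noteq> 0}"
  have S: "finite ?S" using assms by (simp add: MW_finite)
  have "\<Phi> (f + g) = (\<Sum>x\<in>?S. (f + g) x *s pb x)" using S by (rule \<Phi>_superset) auto
  also have "\<dots> = (\<Sum>x\<in>?S. f x *s pb x) + (\<Sum>x\<in>?S. g x *s pb x)"
    by (simp add: scale_left_distrib sum.distrib)
  finally show ?thesis using \<Phi>_superset[OF S, of f] \<Phi>_superset[OF S, of g] by auto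
qed

lemma \<Phi>_scale:
  assumes "f \<in> MW" shows "\<Phi> (fscale c f) = c *s \<Phi> f"
proof -
  let ?S = "{x. f x \<noteq> 0}"
  have "\<Phi> (fscale c f) = (\<Sum>x\<in>?S. fscale c f x *s pb x)"
    using MW_finite[OF assms] by (rule \<Phi>_superset) auto
  then show ?thesis unfolding \<Phi>_def by (simp add: scale_sum_right)
qed

lemma \<Phi>_0 [simp]: "\<Phi> 0 = 0"
  by (simp add: \<Phi>_def)

lemma \<Phi>_delta [simp]: "\<Phi> (delta x) = pb x"
  using \<Phi>_superset[of "{x}" "delta x"] by (auto simp: delta_def)

lemma pb_W: "i < m \<Longrightarrow> pb (k, j, i) \<in> W"
  using pbw_W[OF hw_h] by (simp add: pb_def)

lemma \<Phi>_W: "f \<in> MW \<Longrightarrow> \<Phi> f \<in> W"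
  unfolding \<Phi>_def by (intro W_sum W_scale) (auto simp: model_space_def intro: pb_W)

lemma MW_subspace_induct:
  assumes "fspace.subspace A" "\<And>k j i. i < m \<Longrightarrow> delta (k, j, i) \<in> A" "f \<in> MW"
  shows "f \<in> A"
proof -
  obtain n where n: "f \<in> fspace.span (deltas n)" using MW_deltas[OF assms(3)] by blast
  have "deltas n \<subseteq> A" using assms(2) by (auto simp: deltas_def)
  then show ?thesis using n fspace.span_minimal[OF _ assms(1)] by blast
qed

lemma \<Phi>_op:
  assumes f: "f \<in> MW" shows "\<Phi> (opm g f) = \<rho> g (\<Phi> f)"
proof -
  let ?A = "{f \<in> MW. \<Phi> (opm g f) = \<rho> g (\<Phi> f)}"
  have "fspace.subspace ?A"
    unfolding fspace.subspace_def
    by (auto simp: opm_add opm_scale \<Phi>_add \<Phi>_scale opm_closed \<rho>_add \<rho>_scale \<Phi>_W)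
  moreover have "delta (k, j, i) \<in> ?A" if i: "i < m" for k j i
  proof -
    note [simp] = \<Phi>_add \<Phi>_scale i
    note op = pbw_op[OF hw_h[OF i] \<mu>_nz, of k j]
    have "\<Phi> (opm g (delta (k, j, i))) = \<rho> g (\<Phi> (delta (k, j, i)))"
    proof (cases g)
      case gen_Z
      then show ?thesis using pb_W[OF i] by (simp add: opm_delta Z_act)
    next
      case gen_X
      then show ?thesis
        using op(3) by (simp only: opm_delta \<Phi>_scale[OF delta_MW[OF i]] \<Phi>_delta pb_def prod.case)
    next
      case gen_Y
      then show ?thesis by (simp add: opm_delta pb_def pbw_Suc)
    qed (simp_all only: opm_delta, simp_all add: pb_def op)
    then show ?thesis by simp
  qed
  ultimately have "f \<in> ?A" using f by (rule MW_subspace_induct)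
  then show ?thesis by simp
qed

lemma \<Phi>_act: "f \<in> MW \<Longrightarrow> \<Phi> (model_ops.act p f) = act p (\<Phi> f)"
  by (rule act_intertwine[OF model_ops.operators_axioms operators_axioms])
    (rule \<Phi>_W \<Phi>_add \<Phi>_scale \<Phi>_op | assumption)+

text \<open>The kernel is invariant, so if nonzero it contains a vector killed by \<open>X\<close>
  and \<open>E\<close>; by \<open>model_hw\<close> this is a linear relation among the
  \<open>h i\<close>. Thus independence of the \<open>h i\<close> alone gives injectivity, and
  generation gives surjectivity.\<close>

lemma model_iso:
  assumes indep: "\<And>c. (\<Sum>i<m. c i *s h i) = 0 \<Longrightarrow> \<forall>i<m. c i = 0"
    and gen: "\<And>N. invariant N \<Longrightarrow> (\<And>i. i < m \<Longrightarrow> h i \<in> N) \<Longrightarrow> N = W"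
    and int: "\<And>i. \<exists>l::int. \<mu> i = q powi l"
    and M: "uq_iso scale W \<rho> q M \<phi>"
  shows "uq_iso fscale MW opm q M (\<lambda>x. inv_into MW \<Phi> (\<phi> x))"
proof -
  have nz: "e_coeff q (\<mu> i) (Suc j) \<noteq> 0" for i j
    using int[of i] e_coeff_nz[of "Suc j"] by auto
  have h: "pb (0, 0, i) = h i" for i by (simp add: pb_def)
  have ker: "f = 0" if f: "f \<in> MW" "\<Phi> f = 0" for f
  proof (rule ccontr)
    assume "f \<noteq> 0"
    have "model_ops.invariant {f \<in> MW. \<Phi> f = 0}"
      unfolding model_ops.invariant_def fspace.subspace_def
      by (auto simp: \<Phi>_add \<Phi>_scale \<Phi>_op opm_closed)
    then obtain g where g: "g \<in> MW" "\<Phi> g = 0" "g \<noteq> 0" "opm gen_X g = 0" "opm gen_E g = 0"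
      using model_hw_exists[of "{f \<in> MW. \<Phi> f = 0}" f] f \<open>f \<noteq> 0\<close> by blast
    have g0: "g (k, j, i) = 0" if "(k, j) \<noteq> (0, 0)" for k j i
      using model_hw[OF g(4,5) nz that] .
    have sub: "{x. g x \<noteq> 0} \<subseteq> (\<lambda>i. (0, 0, i)) ` {..<m}"
    proof
      fix x assume x: "x \<in> {x. g x \<noteq> 0}"
      obtain k j i where kji: "x = (k, j, i)" by (cases x)
      have "i < m" using g(1) x kji by (auto simp: model_space_def)
      moreover have "(k, j) = (0, 0)" using g0 x kji by blast
      ultimately show "x \<in> (\<lambda>i. (0, 0, i)) ` {..<m}" using kji by auto
    qed
    have "\<Phi> g = (\<Sum>x\<in>(\<lambda>i. (0, 0, i)) ` {..<m}. g x *s pb x)"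
      by (rule \<Phi>_superset[OF _ sub]) simp
    also have "\<dots> = (\<Sum>i<m. g (0, 0, i) *s h i)"
      by (subst sum.reindex) (auto simp: inj_on_def h)
    finally have "\<forall>i<m. g (0, 0, i) = 0" using g(2) by (intro indep) simp
    with sub have "g = 0" by (auto simp: fun_eq_iff)
    with g(3) show False by simp
  qed
  have inj: "inj_on \<Phi> MW"
  proof (rule inj_onI)
    fix f g assume fg: "f \<in> MW" "g \<in> MW" "\<Phi> f = \<Phi> g"
    have "\<Phi> (f - g) + \<Phi> g = \<Phi> f" using fg \<Phi>_add[of "f - g" g] by simp
    then have "\<Phi> (f - g) = 0" using fg by simp
    then have "f - g = 0" using fg by (intro ker) auto
    then show "f = g" by simp
  qed
  have "invariant (\<Phi> ` MW)"
    unfolding invariant_def subspace_def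
  proof (intro conjI ballI allI)
    show "0 \<in> \<Phi> ` MW" using \<Phi>_0 by (metis image_eqI model_ops.W_zero)
    show "x + y \<in> \<Phi> ` MW" if "x \<in> \<Phi> ` MW" "y \<in> \<Phi> ` MW" for x y
      using that by (auto simp flip: \<Phi>_add)
    show "c *s x \<in> \<Phi> ` MW" if "x \<in> \<Phi> ` MW" for c x
      using that by (auto simp flip: \<Phi>_scale)
    show "\<rho> g x \<in> \<Phi> ` MW" if "x \<in> \<Phi> ` MW" for g x
      using that by (auto simp: opm_closed simp flip: \<Phi>_op)
    show "\<Phi> ` MW \<subseteq> W" using \<Phi>_W by auto
  qed
  moreover have "h i \<in> \<Phi> ` MW" if "i < m" for i
    using that \<Phi>_delta[of "(0, 0, i)"] h[of i] by (metis delta_MW image_eqI)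
  ultimately have surj: "\<Phi> ` MW = W" by (rule gen)
  interpret M: uq_iso scale W \<rho> q M \<phi> by (rule M)
  define \<Psi> where "\<Psi> = inv_into MW \<Phi>"
  have \<Psi>: "\<Psi> v \<in> MW" "\<Phi> (\<Psi> v) = v" if "v \<in> W" for v
    using that surj by (auto simp: \<Psi>_def inv_into_into f_inv_into_f)
  have \<Psi>I: "\<Psi> v = f" if "f \<in> MW" "\<Phi> f = v" for f v
    using that inj by (auto simp: \<Psi>_def)
  have bij: "bij_betw \<Psi> W MW"
    using bij_betw_inv_into[of \<Phi> MW W] inj surj by (simp add: bij_betw_def \<Psi>_def)
  have "uq_iso fscale MW opm q M (\<lambda>x. \<Psi> (\<phi> x))"
  proof (rule uq_iso.intro[OF model_rep.uq_rep_axioms uq_iso_axioms.intro[OF M.left_module_M]])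
    show "bij_betw (\<lambda>x. \<Psi> (\<phi> x)) (carrier M) MW"
      using bij_betw_trans[OF M.\<phi>_bij bij] by (simp add: comp_def)
    show "\<Psi> (\<phi> (x \<oplus>\<^bsub>M\<^esub> y)) = \<Psi> (\<phi> x) + \<Psi> (\<phi> y)" if "x \<in> carrier M" "y \<in> carrier M" for x y
      using that by (intro \<Psi>I) (simp_all add: \<Psi> \<Phi>_add M.\<phi>_add)
    show "\<Psi> (\<phi> (cls q p \<odot>\<^bsub>M\<^esub> x)) = model_ops.act p (\<Psi> (\<phi> x))" if "x \<in> carrier M" for p x
      using that by (intro \<Psi>I) (simp_all add: \<Psi> \<Phi>_act M.\<phi>_cls)
  qed
  then show ?thesis by (simp add: \<Psi>_def)
qed

end

section \<open>Finite sets of highest weight vectors that generate\<close>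

context charge_rep
begin

text \<open>Carried over from the model of rank one along the canonical map.\<close>

lemma casimir_hw:
  assumes h: "hw \<mu> h" and m: "\<mu> \<noteq> 0"
  shows "act (fCtilde q) h = ctilde q z \<mu> *s h"
proof -
  interpret hw_family scale W \<rho> q z 1 "\<lambda>_. \<mu>" "\<lambda>_. h"
    by unfold_locales (use assms in auto)
  have d: "delta (0, 0, 0) \<in> MW" by (rule delta_MW) simp
  have "model_ops.act (fCtilde q) (delta (0, 0, 0)) = fscale (ctilde q z \<mu>) (delta (0, 0, 0))"
  proof
    fix x :: "nat \<times> nat \<times> nat"
    obtain k j i where "x = (k, j, i)" by (cases x)
    then show "model_ops.act (fCtilde q) (delta (0, 0, 0)) x = fscale (ctilde q z \<mu>) (delta (0, 0, 0)) x"
      using casimir_model[OF d, of k j i] by simp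
  qed
  then have "act (fCtilde q) (\<Phi> (delta (0, 0, 0))) = ctilde q z \<mu> *s \<Phi> (delta (0, 0, 0))"
    using \<Phi>_act[OF d, of "fCtilde q"] \<Phi>_scale[OF d] by simp
  then show ?thesis by (simp add: pb_def)
qed

definition inv_span :: "'v set \<Rightarrow> 'v set" where
  "inv_span H = span {act p h | p h. h \<in> H}"

lemma inv_span_superset: "H \<subseteq> inv_span H"
proof
  fix h assume "h \<in> H"
  then have "h \<in> {act p h | p h. h \<in> H}" by (intro CollectI exI[of _ 1] exI[of _ h]) simp
  then show "h \<in> inv_span H" unfolding inv_span_def by (rule span_base)
qed

lemma inv_span_invariant:
  assumes H: "H \<subseteq> W" shows "invariant (inv_span H)"
proof -
  have HW: "{act p h | p h. h \<in> H} \<subseteq> W" using H by auto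
  have sub: "subspace {v \<in> W. \<rho> g v \<in> inv_span H}" for g
    unfolding subspace_def inv_span_def
    by (auto simp: \<rho>_add \<rho>_scale span_zero span_add span_scale)
  have "{act p h | p h. h \<in> H} \<subseteq> {v \<in> W. \<rho> g v \<in> inv_span H}" for g
  proof
    fix v assume "v \<in> {act p h | p h. h \<in> H}"
    then obtain p h where v: "h \<in> H" "v = act p h" by blast
    then have "\<rho> g v = act (gvar g * p) h" using H by (simp add: act_mult subset_iff)
    then have "\<rho> g v \<in> {act p h | p h. h \<in> H}" using v(1) by blast
    then show "v \<in> {v \<in> W. \<rho> g v \<in> inv_span H}"
      using v H by (auto simp: inv_span_def intro: span_base)
  qed
  then have "inv_span H \<subseteq> {v \<in> W. \<rho> g v \<in> inv_span H}" for g
    unfolding inv_span_def[of H] by (intro span_minimal sub[unfolded inv_span_def])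
       (simp add: inv_span_def)
  then show ?thesis
    using HW span_subset_W by (auto simp: invariant_def inv_span_def)
qed

text \<open>Each of finitely many generators involves only finitely many highest weight vectors, so
  finitely many of these generate the module. Passing to a maximal independent subset keeps the span
  and therefore the generated submodule.\<close>

lemma exists_hw_basis:
  assumes weighty loc_fin fin_gen
    and int: "\<And>\<mu> v. wvec \<mu> v \<Longrightarrow> v \<noteq> 0 \<Longrightarrow> \<exists>l::int. \<mu> = q powi l"
  shows "\<exists>H. finite H \<and> independent H \<and> (\<forall>h\<in>H. \<exists>l::int. hw (q powi l) h) \<and>
    (\<forall>N. invariant N \<longrightarrow> H \<subseteq> N \<longrightarrow> N = W)"
proof -
  define A where "A = {h. \<exists>l::int. hw (q powi l) h}"
  have AW: "A \<subseteq> W" by (auto simp: A_def hw_def)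
  have W: "inv_span A = W"
    using assms(1,2) int inv_span_invariant[OF AW]
    by (rule generated_by_hw) (use inv_span_superset[of A] in \<open>auto simp: A_def\<close>)
  obtain S where S: "finite S" "S \<subseteq> W" "\<And>N. invariant N \<Longrightarrow> S \<subseteq> N \<Longrightarrow> N = W"
    using assms(3) by (auto simp: fin_gen_def)
  have "\<exists>H. finite H \<and> H \<subseteq> A \<and> s \<in> inv_span H" if "s \<in> S" for s
  proof -
    have "s \<in> span {act p h | p h. h \<in> A}" using that S(2) W by (auto simp: inv_span_def)
    then obtain t r where t: "finite t" "t \<subseteq> {act p h | p h. h \<in> A}" "s = (\<Sum>a\<in>t. r a *s a)"
      by (auto simp: span_explicit)
    have "\<forall>a\<in>t. \<exists>h\<in>A. \<exists>p. a = act p h" using t(2) by blast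
    then obtain f where f: "\<And>a. a \<in> t \<Longrightarrow> f a \<in> A \<and> (\<exists>p. a = act p (f a))" by metis
    have "s \<in> inv_span (f ` t)"
      unfolding t(3) inv_span_def using f by (intro span_sum span_scale span_base) blast
    then show ?thesis using t(1) f by (intro exI[of _ "f ` t"]) auto
  qed
  then obtain f where f: "\<And>s. s \<in> S \<Longrightarrow> finite (f s) \<and> f s \<subseteq> A \<and> s \<in> inv_span (f s)" by metis
  define H0 where "H0 = (\<Union>s\<in>S. f s)"
  have H0: "finite H0" "H0 \<subseteq> A" using f S(1) by (auto simp: H0_def)
  \<comment> \<open>Chosen inside \<open>H0\<close>, so that its members are still highest weight
    vectors; an arbitrary basis of the span could mix weights.\<close>
  obtain H where H: "H \<subseteq> H0" "independent H" "H0 \<subseteq> span H"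
    using maximal_independent_subset by blast
  have "N = W" if N: "invariant N" "H \<subseteq> N" for N
  proof (rule S(3)[OF N(1)])
    have sub: "subspace N" using N by (simp add: invariant_def)
    have "H0 \<subseteq> N" using H(3) span_minimal[OF N(2) sub] by blast
    then have "{act p h | p h. h \<in> f s} \<subseteq> N" if "s \<in> S" for s
      using that invariant_act[OF N(1)] by (auto simp: H0_def)
    then have "inv_span (f s) \<subseteq> N" if "s \<in> S" for s
      unfolding inv_span_def using that by (intro span_minimal sub)
    then show "S \<subseteq> N" using f by blast
  qed
  moreover have "finite H" using H(1) H0(1) by (rule finite_subset)
  moreover have "\<forall>h\<in>H. \<exists>l::int. hw (q powi l) h" using H(1) H0(2) by (auto simp: A_def)
  ultimately show ?thesis using H(2) by blast
qed

end

section \<open>Weights with a given value of the central element\<close>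

context generic_q
begin

lemma powi_inj: "q powi a = q powi b \<Longrightarrow> a = b"
proof -
  assume e: "q powi a = q powi b"
  have "q powi (a - b) = q powi a / q powi b" using q_nz by (simp add: power_int_diff)
  then have "a - b = 0" using e q_nz by (intro powi_eq_1) simp
  then show ?thesis by simp
qed

lemma ctilde_alt: "ctilde q z x = z / (q - 1 / q)\<^sup>2 * ((1 + q) / q\<^sup>2) * (q ^ 3 * x + 1 / x)"
proof -
  have "1 / q + 1 / q\<^sup>2 = (1 + q) / q\<^sup>2" "q + q\<^sup>2 = (1 + q) / q\<^sup>2 * q ^ 3"
    using q_nz by (simp_all add: field_simps power2_eq_square power3_eq_cube)
  then have "(q + q\<^sup>2) * x + (1 / q + 1 / q\<^sup>2) * (1 / x) = (1 + q) / q\<^sup>2 * (q ^ 3 * x + 1 / x)"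
    by (simp only: distrib_left mult.assoc)
  then show ?thesis by (simp add: ctilde_def)
qed

text \<open>For weights \<open>a\<close> and \<open>b\<close>, clearing denominators gives
  \<open>(a - b) (q^3 a b - 1) = 0\<close>.\<close>

lemma ctilde_eq:
  assumes "ctilde q z (q powi l) = ctilde q z (q powi n)"
  shows "l = n \<or> l = - n - 3"
proof -
  define a b where "a = q powi l" and "b = q powi n"
  have nz: "a \<noteq> 0" "b \<noteq> 0" using q_nz by (simp_all add: a_def b_def)
  define d where "d = z / (q - 1 / q)\<^sup>2 * ((1 + q) / q\<^sup>2)"
  have "d \<noteq> 0" using q_nz z_nz q_neq by (simp add: d_def)
  moreover have "d * (q ^ 3 * a + 1 / a) = d * (q ^ 3 * b + 1 / b)"
    using assms unfolding ctilde_alt a_def b_def d_def .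
  ultimately have "q ^ 3 * a + 1 / a = q ^ 3 * b + 1 / b" by simp
  then have "(q ^ 3 * a + 1 / a) * (a * b) = (q ^ 3 * b + 1 / b) * (a * b)" by simp
  moreover have "(q ^ 3 * a + 1 / a) * (a * b) = q ^ 3 * a * a * b + b"
    "(q ^ 3 * b + 1 / b) * (a * b) = q ^ 3 * a * b * b + a"
    using nz by (simp_all add: distrib_left distrib_right ac_simps)
  ultimately have "(a - b) * (q ^ 3 * a * b - 1) = 0"
    by (simp add: algebra_simps)
  then consider "a = b" | "q ^ 3 * a * b = 1" by auto
  then show ?thesis
  proof cases
    case 1
    then show ?thesis using powi_inj by (simp add: a_def b_def)
  next
    case 2
    have "q powi (3 + l + n) = q powi 3 * q powi l * q powi n"
      using q_nz by (simp only: power_int_add simp_thms)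
    then have "q powi (3 + l + n) = 1" using 2 by (simp add: a_def b_def)
    then have "3 + l + n = 0" by (rule powi_eq_1)
    then show ?thesis by simp
  qed
qed

text \<open>Replacing \<open>x\<close> by \<open>1 / (q^3 x)\<close> exchanges the two summands of
  \<open>q^3 x + 1 / x\<close>.\<close>

lemma ctilde_sym: "ctilde q z (q powi (- n - 3)) = ctilde q z (q powi n)"
proof -
  define b where "b = q powi n"
  have b: "b \<noteq> 0" using q_nz by (simp add: b_def)
  have "q powi (- n - 3) = q powi (- n) / q powi 3" using q_nz by (simp only: power_int_diff simp_thms)
  then have a: "q powi (- n - 3) = 1 / (b * q ^ 3)" by (simp add: power_int_minus b_def field_simps)
  have "q ^ 3 * (1 / (b * q ^ 3)) + 1 / (1 / (b * q ^ 3)) = q ^ 3 * b + 1 / b"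
    using b q_nz by simp
  then show ?thesis unfolding ctilde_alt a b_def[symmetric] by simp
qed

text \<open>The letter \<open>True\<close> stands for the weight \<open>q^n\<close>,
  \<open>False\<close> for \<open>q^{-n-3}\<close>. Indices beyond the word receive a value too,
  since \<open>model\<close> asks for a nonzero weight at every index.\<close>

definition bweight :: "int \<Rightarrow> bool list \<Rightarrow> nat \<Rightarrow> complex" where
  "bweight n w i = (if i < length w \<and> w ! i then q powi n else q powi (- n - 3))"

lemma bweight_int: "\<exists>l::int. bweight n w i = q powi l"
  unfolding bweight_def by auto

lemma bweight_nz: "bweight n w i \<noteq> 0"
  using q_nz by (simp add: bweight_def)

lemma model_bweight: "model q z (bweight n w)"
  by unfold_locales (rule bweight_nz)

end

text \<open>On a highest weight vector the central element acts by the scalar of its weight.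
  Nilpotency of the difference to the scalar of the block makes the two scalars equal, so
  \<open>ctilde_eq\<close> leaves two possible weights.\<close>

lemma (in charge_rep) block_iso:
  assumes "weighty" "loc_fin" "fin_gen"
    and int: "\<And>\<mu> v. wvec \<mu> v \<Longrightarrow> v \<noteq> 0 \<Longrightarrow> \<exists>l::int. \<mu> = q powi l"
    and nil: "\<exists>k::nat. \<forall>v\<in>W. act ((fCtilde q - const (ctilde q z (q powi n))) ^ k) v = 0"
    and M: "uq_iso scale W \<rho> q M \<phi>"
  shows "\<exists>w \<psi>. uq_iso fscale (model_space (length w)) (model.opm q z (bweight n w)) q M \<psi>"
proof -
  have "\<exists>H. finite H \<and> independent H \<and> (\<forall>h\<in>H. \<exists>l::int. hw (q powi l) h) \<and>
      (\<forall>N. invariant N \<longrightarrow> H \<subseteq> N \<longrightarrow> N = W)"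
    using assms(1-3) by (rule exists_hw_basis) (rule int)
  then obtain H where A: "finite H \<and> independent H \<and> (\<forall>h\<in>H. \<exists>l::int. hw (q powi l) h) \<and>
      (\<forall>N. invariant N \<longrightarrow> H \<subseteq> N \<longrightarrow> N = W)" by (elim exE)
  have H: "finite H" "independent H" "\<And>h. h \<in> H \<Longrightarrow> \<exists>l::int. hw (q powi l) h"
    using A by (simp_all only: simp_thms)
  have gen: "N = W" if "invariant N" "H \<subseteq> N" for N
    using A that by (simp only: simp_thms)
  obtain hs where hs: "set hs = H" "distinct hs" using finite_distinct_list[OF H(1)] by blast
  \<comment> \<open>The word records which of the two weights a vector has: whatever is not of
    weight \<open>q^n\<close> turns out to be of weight \<open>q^{-n-3}\<close>.\<close>
  define w where "w = map (hw (q powi n)) hs"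
  let ?\<mu> = "bweight n w"
  have len: "length w = length hs" by (simp add: w_def)
  have hwi: "hw (?\<mu> i) (hs ! i)" if i: "i < length w" for i
  proof -
    have hH: "hs ! i \<in> H" using i hs len by auto
    then obtain l where l: "hw (q powi l) (hs ! i)" using H(3) by blast
    have h0: "hs ! i \<noteq> 0" using H(2) hH dependent_zero[of H] by auto
    have hW: "hs ! i \<in> W" using l by (auto simp: hw_def)
    obtain k where "act ((fCtilde q - const (ctilde q z (q powi n))) ^ k) (hs ! i) = 0"
      using nil hW by blast
    moreover have "act ((fCtilde q - const c) ^ k) (hs ! i) = (ctilde q z (q powi l) - c) ^ k *s (hs ! i)" for c k
    proof (induction k)
      case (Suc k)
      have "act ((fCtilde q - const c) ^ Suc k) (hs ! i)
          = act (fCtilde q - const c) (act ((fCtilde q - const c) ^ k) (hs ! i))"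
        using hW by (simp add: act_mult)
      also have "\<dots> = (ctilde q z (q powi l) - c) ^ k *s act (fCtilde q - const c) (hs ! i)"
        unfolding Suc using hW by (rule act_scale_right)
      also have "act (fCtilde q - const c) (hs ! i) = (ctilde q z (q powi l) - c) *s (hs ! i)"
        using casimir_hw[OF l] q_nz by (simp add: act_diff scale_left_diff_distrib)
      finally show ?case by (simp add: mult.commute)
    qed simp
    ultimately have "ctilde q z (q powi l) = ctilde q z (q powi n)" using h0 by auto
    then have "l = n \<or> l = - n - 3" by (rule ctilde_eq)
    then show ?thesis using l i by (auto simp: bweight_def w_def)
  qed
  interpret hw_family scale W \<rho> q z "length w" ?\<mu> "\<lambda>i. hs ! i"
    by unfold_locales (simp_all add: hwi bweight_nz)
  have "uq_iso fscale MW opm q M (\<lambda>x. inv_into MW \<Phi> (\<phi> x))"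
  proof (rule model_iso[OF _ _ bweight_int M])
    fix c assume c: "(\<Sum>i<length w. c i *s hs ! i) = 0"
    have inj: "inj_on ((!) hs) {..<length w}" using hs(2) len by (auto simp: inj_on_def nth_eq_iff_index_eq)
    have im: "(!) hs ` {..<length w} = H" using hs(1) len by (auto simp: set_conv_nth)
    define u where "u h = c (inv_into {..<length w} ((!) hs) h)" for h
    have u: "u (hs ! i) = c i" if "i < length w" for i
      using that inj by (simp add: u_def)
    have "(\<Sum>h\<in>(!) hs ` {..<length w}. u h *s h) = 0"
      using c u by (subst sum.reindex[OF inj]) simp
    then have "\<forall>h\<in>H. u h = 0"
      using H(1,2) unfolding im independent_explicit_finite_subsets by blast
    then show "\<forall>i<length w. c i = 0" using u im by auto
  next
    fix N assume "invariant N" "\<And>i. i < length w \<Longrightarrow> hs ! i \<in> N"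
    then show "N = W" using gen hs(1) len by (metis in_set_conv_nth subsetI)
  qed
  then show ?thesis by blast
qed

section \<open>Matrices and module categories\<close>

text \<open>The models consist of coefficient functions, while the target types are only known to
  contain the complex numbers. A number is coded by a set of naturals, and countably many such sets
  are coded by a single one.\<close>

lemma inj_countable_functions: "\<exists>e :: ('x::countable \<Rightarrow> complex) \<Rightarrow> complex. inj e"
proof -
  obtain f :: "real \<Rightarrow> nat set" where f: "inj f"
    using nat_sets_eqpoll_reals by (auto simp: eqpoll_def dest: bij_betw_inv_into bij_betw_imp_inj_on)
  obtain g :: "nat set \<Rightarrow> real" where g: "inj g"
    using nat_sets_eqpoll_reals by (auto simp: eqpoll_def dest: bij_betw_imp_inj_on)
  \<comment> \<open>The real part occupies the even positions, the imaginary part the odd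
    ones.\<close>
  define c where "c x n = (if even n then n div 2 \<in> f (Re x) else n div 2 \<in> f (Im x))" for x n
  have c: "x = y" if "\<And>n. c x n = c y n" for x y
  proof -
    have "f (Re x) = f (Re y)" using that[of "2 * _"] by (auto simp: c_def)
    moreover have "f (Im x) = f (Im y)" using that[of "2 * _ + 1"] by (auto simp: c_def)
    ultimately show ?thesis using f by (simp add: complex_eq_iff inj_eq)
  qed
  define e where "e h = complex_of_real (g {prod_encode (to_nat x, n) | x n. c (h x) n})" for h :: "'x \<Rightarrow> complex"
  have "inj e"
  proof (rule injI)
    fix h h' assume "e h = e h'"
    then have "{prod_encode (to_nat x, n) | x n. c (h x) n} = {prod_encode (to_nat x, n) | x n. c (h' x) n}"
      using g by (simp add: e_def inj_eq)
    then have "c (h x) n = c (h' x) n" for x n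
      by (auto simp: set_eq_iff prod_encode_eq dest!: spec[of _ "prod_encode (to_nat x, n)"])
    then show "h = h'" using c by (intro ext) blast
  qed
  then show ?thesis by blast
qed

text \<open>A word over \<open>bool\<close> stands for a direct sum of simple modules of two kinds, one summand for
  each letter.\<close>

definition mat_cat :: "(bool list, nat \<Rightarrow> nat \<Rightarrow> complex) category" where
  "mat_cat = \<lparr>Obj = UNIV,
     Hom = (\<lambda>v w. {A. \<forall>i j. A i j \<noteq> 0 \<longrightarrow> i < length w \<and> j < length v \<and> w ! i = v ! j}),
     Idn = (\<lambda>v i j. if i = j \<and> i < length v then 1 else 0),
     Cmp = (\<lambda>u v w B A i k. \<Sum>j<length v. B i j * A j k)\<rparr>"

lemma mat_cat_simps [simp]:
  "Obj mat_cat = UNIV"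
  "A \<in> Hom mat_cat v w \<longleftrightarrow> (\<forall>i j. A i j \<noteq> 0 \<longrightarrow> i < length w \<and> j < length v \<and> w ! i = v ! j)"
  "Idn mat_cat v = (\<lambda>i j. if i = j \<and> i < length v then 1 else 0)"
  "Cmp mat_cat u v w B A = (\<lambda>i k. \<Sum>j<length v. B i j * A j k)"
  by (simp_all add: mat_cat_def)

lemma is_category_mat_cat: "is_category mat_cat"
  unfolding is_category_def
proof (intro conjI ballI)
  fix u v w A B assume A: "A \<in> Hom mat_cat u v" and B: "B \<in> Hom mat_cat v w"
  show "Cmp mat_cat u v w B A \<in> Hom mat_cat u w"
    unfolding mat_cat_simps
  proof (intro allI impI)
    fix i k assume "(\<Sum>j<length v. B i j * A j k) \<noteq> 0"
    then obtain j where "B i j * A j k \<noteq> 0" by (meson sum.not_neutral_contains_not_neutral)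
    then show "i < length w \<and> k < length u \<and> w ! i = u ! k" using A B by auto
  qed
next
  fix v w A assume A: "A \<in> Hom mat_cat v w"
  have "(\<Sum>j<length v. A i j * (if j = k \<and> j < length v then 1 else 0)) = A i k" for i k
  proof -
    have "(\<Sum>j<length v. A i j * (if j = k \<and> j < length v then 1 else 0)) = (\<Sum>j<length v. if j = k then A i j else 0)"
      by (intro sum.cong) auto
    also have "\<dots> = A i k" using A by (auto simp: sum.delta)
    finally show ?thesis .
  qed
  then show "Cmp mat_cat v v w A (Idn mat_cat v) = A" by (simp add: fun_eq_iff)
  have "(\<Sum>j<length w. (if i = j \<and> i < length w then 1 else 0) * A j k) = A i k" for i k
  proof -
    have "(\<Sum>j<length w. (if i = j \<and> i < length w then 1 else 0) * A j k) = (\<Sum>j<length w. if i = j then A j k else 0)"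
      by (intro sum.cong) auto
    also have "\<dots> = A i k" using A by (auto simp: sum.delta')
    finally show ?thesis .
  qed
  then show "Cmp mat_cat v w w (Idn mat_cat w) A = A" by (simp add: fun_eq_iff)
next
  fix t u v w A B D assume "A \<in> Hom mat_cat t u" "B \<in> Hom mat_cat u v" "D \<in> Hom mat_cat v w"
  show "Cmp mat_cat t v w D (Cmp mat_cat t u v B A) = Cmp mat_cat t u w (Cmp mat_cat u v w D B) A"
  proof (intro ext)
    fix i l
    have "(\<Sum>j<length v. D i j * (\<Sum>k<length u. B j k * A k l)) = (\<Sum>j<length v. \<Sum>k<length u. D i j * B j k * A k l)"
      by (simp add: sum_distrib_left mult.assoc)
    also have "\<dots> = (\<Sum>k<length u. \<Sum>j<length v. D i j * B j k * A k l)" by (rule sum.swap)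
    finally show "Cmp mat_cat t v w D (Cmp mat_cat t u v B A) i l = Cmp mat_cat t u w (Cmp mat_cat u v w D B) A i l"
      by (simp add: sum_distrib_right)
  qed
qed simp_all

lemma left_hom_bij_iso_arrow:
  assumes M: "left_module R M" and h: "h \<in> left_hom R M N" and bij: "bij_betw h (carrier M) (carrier N)"
  shows "iso_arrow (left_mod_cat R P) M N h"
proof -
  interpret left_module R M by fact
  let ?g = "\<lambda>y\<in>carrier N. inv_into (carrier M) h y"
  have g: "?g (h x) = x" if "x \<in> carrier M" for x
    using that bij by (auto simp: bij_betw_def)
  have hg: "?g y \<in> carrier M" "h (?g y) = y" if "y \<in> carrier N" for y
    using that bij by (auto simp: bij_betw_def inv_into_into f_inv_into_f)
  have gI: "?g y = x" if "x \<in> carrier M" "h x = y" for x y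
    using g that by blast
  have "?g \<in> left_hom R N M"
    unfolding left_hom_def
  proof (intro CollectI conjI ballI)
    show "?g \<in> carrier N \<rightarrow>\<^sub>E carrier M" using hg by auto
    fix x y assume x: "x \<in> carrier N" "y \<in> carrier N"
    show "?g (x \<oplus>\<^bsub>N\<^esub> y) = ?g x \<oplus>\<^bsub>M\<^esub> ?g y"
      using x hg h by (intro gI) (auto simp: left_hom_def simp del: restrict_apply)
  next
    fix a x assume x: "a \<in> carrier R" "x \<in> carrier N"
    show "?g (a \<odot>\<^bsub>N\<^esub> x) = a \<odot>\<^bsub>M\<^esub> ?g x"
      using x hg h by (intro gI) (auto simp: left_hom_def smult_closed simp del: restrict_apply)
  qed
  moreover have "compose (carrier M) ?g h = (\<lambda>x\<in>carrier M. x)"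
    using g by (auto simp: compose_def fun_eq_iff simp del: restrict_apply) (auto simp: restrict_def)
  moreover have "compose (carrier N) h ?g = (\<lambda>x\<in>carrier N. x)"
    using hg by (auto simp: compose_def fun_eq_iff simp del: restrict_apply) (auto simp: restrict_def)
  ultimately show ?thesis
    unfolding iso_arrow_def left_mod_cat_def using h by auto
qed

type_synonym coeffs = "nat \<times> nat \<times> nat \<Rightarrow> complex"

text \<open>Only the index \<open>i\<close> of the summand is mixed. The algebra moves
  \<open>k\<close> and \<open>j\<close>, so its action commutes with the matrix as soon as nonzero
  entries join equal letters.\<close>

definition mat_map :: "bool list \<Rightarrow> (nat \<Rightarrow> nat \<Rightarrow> complex) \<Rightarrow> coeffs \<Rightarrow> coeffs" where
  "mat_map v A f = (\<lambda>(k, j, i). \<Sum>i'<length v. A i i' * f (k, j, i'))"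

lemma mat_map_add: "mat_map v A (f + g) = mat_map v A f + mat_map v A g"
  by (simp add: mat_map_def fun_eq_iff sum.distrib distrib_left)

lemma mat_map_scale: "mat_map v A (fscale c f) = fscale c (mat_map v A f)"
  by (simp add: mat_map_def fun_eq_iff sum_distrib_left mult.left_commute)

lemma mat_map_model_space:
  assumes A: "A \<in> Hom mat_cat v w" and f: "f \<in> model_space (length v)"
  shows "mat_map v A f \<in> model_space (length w)"
proof -
  have nz: "\<exists>i'. A i i' \<noteq> 0 \<and> f (k, j, i') \<noteq> 0" if "mat_map v A f (k, j, i) \<noteq> 0" for k j i
  proof (rule ccontr)
    assume "\<not> ?thesis"
    then have "A i i' * f (k, j, i') = 0" for i' by auto
    with that show False by (simp add: mat_map_def)
  qed
  let ?S = "(\<lambda>((k, j, _), i). (k, j, i)) ` ({x. f x \<noteq> 0} \<times> {..<length w})"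
  have "{x. mat_map v A f x \<noteq> 0} \<subseteq> ?S"
  proof
    fix x assume x: "x \<in> {x. mat_map v A f x \<noteq> 0}"
    obtain k j i where kji: "x = (k, j, i)" by (cases x)
    then obtain i' where i': "A i i' \<noteq> 0" "f (k, j, i') \<noteq> 0" using nz x by blast
    then have "((k, j, i'), i) \<in> {x. f x \<noteq> 0} \<times> {..<length w}" using A by auto
    then show "x \<in> ?S" using kji by force
  qed
  moreover have "finite ?S" using f by (simp add: model_space_def)
  ultimately have "finite {x. mat_map v A f x \<noteq> 0}" by (rule finite_subset)
  then show ?thesis using nz A by (fastforce simp: model_space_def)
qed

lemma mat_map_delta:
  "i < length v \<Longrightarrow> mat_map v A (delta (0, 0, i)) (k, j, i') = (if k = 0 \<and> j = 0 then A i' i else 0)"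
proof -
  assume i: "i < length v"
  have "mat_map v A (delta (0, 0, i)) (k, j, i') = (\<Sum>l<length v. if l = i then (if k = 0 \<and> j = 0 then A i' l else 0) else 0)"
    unfolding mat_map_def prod.case by (intro sum.cong) (auto simp: delta_def)
  then show ?thesis using i by (simp add: sum.delta)
qed

text \<open>What the block and the modules over \<open>CC\<close> have in common, enough to compare
  both with \<open>mat_cat\<close>. The condition \<open>hom_delta\<close> plays the part of Schur's
  lemma: a generator is sent to a combination of generators with the same letter.\<close>

locale matrix_modules =
  fixes R :: "'r ring" and V :: "bool list \<Rightarrow> coeffs set" and s :: "bool list \<Rightarrow> 'r \<Rightarrow> coeffs \<Rightarrow> coeffs"
    and e :: "coeffs \<Rightarrow> 'a" and P :: "('r, 'a) module \<Rightarrow> bool"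
  assumes inj_e: "inj e"
    and module: "left_module R (transport_module e (V w) (s w))"
    and V_add: "\<lbrakk>f \<in> V w; g \<in> V w\<rbrakk> \<Longrightarrow> f + g \<in> V w"
    and V_s: "\<lbrakk>u \<in> carrier R; f \<in> V w\<rbrakk> \<Longrightarrow> s w u f \<in> V w"
    and V_delta: "i < length w \<Longrightarrow> delta (0, 0, i) \<in> V w"
    and scalar: "\<exists>u\<in>carrier R. \<forall>w. \<forall>f\<in>V w. s w u f = fscale c f"
    and mat: "\<lbrakk>A \<in> Hom mat_cat v w; f \<in> V v\<rbrakk> \<Longrightarrow> mat_map v A f \<in> V w"
      "\<lbrakk>A \<in> Hom mat_cat v w; f \<in> V v; u \<in> carrier R\<rbrakk> \<Longrightarrow> mat_map v A (s v u f) = s w u (mat_map v A f)"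
    and hom_delta: "\<lbrakk>T \<in> V v \<rightarrow> V w; \<And>f g. \<lbrakk>f \<in> V v; g \<in> V v\<rbrakk> \<Longrightarrow> T (f + g) = T f + T g;
        \<And>u f. \<lbrakk>u \<in> carrier R; f \<in> V v\<rbrakk> \<Longrightarrow> T (s v u f) = s w u (T f);
        i < length v; T (delta (0, 0, i)) (k, j, i') \<noteq> 0\<rbrakk>
        \<Longrightarrow> k = 0 \<and> j = 0 \<and> i' < length w \<and> w ! i' = v ! i"
    and gen: "\<lbrakk>N \<subseteq> V v; 0 \<in> N; \<And>f g. \<lbrakk>f \<in> N; g \<in> N\<rbrakk> \<Longrightarrow> f + g \<in> N;
        \<And>u f. \<lbrakk>u \<in> carrier R; f \<in> N\<rbrakk> \<Longrightarrow> s v u f \<in> N;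
        \<And>i. i < length v \<Longrightarrow> delta (0, 0, i) \<in> N\<rbrakk> \<Longrightarrow> V v \<subseteq> N"
    and P: "P (transport_module e (V w) (s w))"
    and ex: "\<lbrakk>left_module R M; P M\<rbrakk> \<Longrightarrow> \<exists>w \<psi>. bij_betw \<psi> (carrier M) (V w) \<and>
        (\<forall>x\<in>carrier M. \<forall>y\<in>carrier M. \<psi> (x \<oplus>\<^bsub>M\<^esub> y) = \<psi> x + \<psi> y) \<and>
        (\<forall>u\<in>carrier R. \<forall>x\<in>carrier M. \<psi> (u \<odot>\<^bsub>M\<^esub> x) = s w u (\<psi> x))"
begin

abbreviation "S w \<equiv> transport_module e (V w) (s w)"

text \<open>Conjugation by \<open>e\<close>: homomorphisms between transported modules are studied
  as maps of coefficient functions.\<close>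

definition D :: "('a \<Rightarrow> 'a) \<Rightarrow> coeffs \<Rightarrow> coeffs" where
  "D f x = the_inv e (f (e x))"

lemma inv_e [simp]: "x \<in> V w \<Longrightarrow> inv_into (V w) e (e x) = x"
  using inj_e by (meson inj_on_subset inv_into_f_f subset_UNIV)

lemma D_hom:
  assumes f: "f \<in> left_hom R (S v) (S w)"
  shows "D f \<in> V v \<rightarrow> V w"
    and "x \<in> V v \<Longrightarrow> f (e x) = e (D f x)"
    and "\<lbrakk>x \<in> V v; y \<in> V v\<rbrakk> \<Longrightarrow> D f (x + y) = D f x + D f y"
    and "\<lbrakk>u \<in> carrier R; x \<in> V v\<rbrakk> \<Longrightarrow> D f (s v u x) = s w u (D f x)"
proof -
  have D: "f (e x) = e (D f x) \<and> D f x \<in> V w" if "x \<in> V v" for x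
  proof -
    have "f (e x) \<in> e ` V w" using f that by (auto simp: left_hom_def)
    then show ?thesis by (auto simp: D_def the_inv_f_f[OF inj_e])
  qed
  show "D f \<in> V v \<rightarrow> V w" "x \<in> V v \<Longrightarrow> f (e x) = e (D f x)" using D by auto
  have DI: "D f x = y" if "f (e x) = e y" for x y
    using that by (simp add: D_def the_inv_f_f[OF inj_e])
  show "D f (x + y) = D f x + D f y" if "x \<in> V v" "y \<in> V v"
  proof (rule DI)
    have "f (e x \<oplus>\<^bsub>S v\<^esub> e y) = f (e x) \<oplus>\<^bsub>S w\<^esub> f (e y)" using f that by (auto simp: left_hom_def)
    then show "f (e (x + y)) = e (D f x + D f y)" using that D by simp
  qed
  show "D f (s v u x) = s w u (D f x)" if "u \<in> carrier R" "x \<in> V v"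
  proof (rule DI)
    have "f (u \<odot>\<^bsub>S v\<^esub> e x) = u \<odot>\<^bsub>S w\<^esub> f (e x)" using f that by (auto simp: left_hom_def)
    then show "f (e (s v u x)) = e (s w u (D f x))" using that D by simp
  qed
qed

definition mat_of :: "bool list \<Rightarrow> bool list \<Rightarrow> ('a \<Rightarrow> 'a) \<Rightarrow> nat \<Rightarrow> nat \<Rightarrow> complex" where
  "mat_of v w f = (\<lambda>i' i. if i < length v then D f (delta (0, 0, i)) (0, 0, i') else 0)"

lemma D_delta:
  assumes f: "f \<in> left_hom R (S v) (S w)" and i: "i < length v"
  shows "D f (delta (0, 0, i)) (k, j, i') = (if k = 0 \<and> j = 0 then mat_of v w f i' i else 0)"
  using hom_delta[OF D_hom(1,3,4)[OF f] i, of k j i'] i by (auto simp: mat_of_def)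

lemma mat_of_hom:
  assumes f: "f \<in> left_hom R (S v) (S w)" shows "mat_of v w f \<in> Hom mat_cat v w"
proof -
  have "i' < length w \<and> i < length v \<and> w ! i' = v ! i" if "mat_of v w f i' i \<noteq> 0" for i' i
    using that hom_delta[OF D_hom(1,3,4)[OF f], of i 0 0 i'] by (auto simp: mat_of_def split: if_splits)
  then show ?thesis by simp
qed

lemma left_hom_ext:
  assumes f: "f \<in> left_hom R (S v) (S w)" and g: "g \<in> left_hom R (S v) (S w)"
    and D: "\<And>x. x \<in> V v \<Longrightarrow> D f x = D g x"
  shows "f = g"
proof (rule extensionalityI[of f "e ` V v"])
  show "f \<in> extensional (e ` V v)" "g \<in> extensional (e ` V v)"
    using f g by (auto simp: left_hom_def PiE_def)
  fix y assume "y \<in> e ` V v"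
  then show "f y = g y" using D D_hom(2)[OF f] D_hom(2)[OF g] by auto
qed

lemma D_scale:
  assumes f: "f \<in> left_hom R (S v) (S w)" and x: "x \<in> V v"
  shows "D f (fscale c x) = fscale c (D f x)"
proof -
  obtain u where u: "u \<in> carrier R" "\<And>w f. f \<in> V w \<Longrightarrow> s w u f = fscale c f" using scalar by blast
  have "D f x \<in> V w" using D_hom(1)[OF f] x by blast
  then show ?thesis using D_hom(4)[OF f u(1) x] u(2) x by simp
qed

lemma V_0: "f \<in> V w \<Longrightarrow> 0 \<in> V w"
proof -
  assume f: "f \<in> V w"
  obtain r where r: "r \<in> carrier R" "\<And>w f. f \<in> V w \<Longrightarrow> s w r f = fscale 0 f" using scalar by blast
  have "s w r f \<in> V w" using r(1) f by (rule V_s)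
  then show ?thesis unfolding r(2)[OF f] by simp
qed

lemma D_0:
  assumes f: "f \<in> left_hom R (S v) (S w)" and x: "x \<in> V v"
  shows "D f 0 = 0"
  using D_scale[OF f x, of 0] by simp

text \<open>Injective because a homomorphism is determined on the generators, by \<open>gen\<close>;
  surjective because every block matrix acts through \<open>mat_map\<close>.\<close>

lemma mat_of_bij: "bij_betw (mat_of v w) (left_hom R (S v) (S w)) (Hom mat_cat v w)"
proof (rule bij_betw_imageI)
  show "inj_on (mat_of v w) (left_hom R (S v) (S w))"
  proof (rule inj_onI)
    fix f g assume f: "f \<in> left_hom R (S v) (S w)" and g: "g \<in> left_hom R (S v) (S w)"
      and e: "mat_of v w f = mat_of v w g"
    have "D f (delta (0, 0, i)) = D g (delta (0, 0, i))" if "i < length v" for i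
    proof
      fix x :: "nat \<times> nat \<times> nat"
      show "D f (delta (0, 0, i)) x = D g (delta (0, 0, i)) x"
        using D_delta[OF f that] D_delta[OF g that] e by (cases x) simp
    qed
    then have "delta (0, 0, i) \<in> {x \<in> V v. D f x = D g x}" if "i < length v" for i
      using V_delta that by blast
    moreover have "x + y \<in> {x \<in> V v. D f x = D g x}"
      if "x \<in> {x \<in> V v. D f x = D g x}" "y \<in> {x \<in> V v. D f x = D g x}" for x y
      using that V_add[of x v y] D_hom(3)[OF f, of x y] D_hom(3)[OF g, of x y] by simp
    moreover have "s v u x \<in> {x \<in> V v. D f x = D g x}"
      if "u \<in> carrier R" "x \<in> {x \<in> V v. D f x = D g x}" for u x
      using that V_s[of u x v] D_hom(4)[OF f, of u x] D_hom(4)[OF g, of u x] by simp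
    moreover have "0 \<in> {x \<in> V v. D f x = D g x}" if x: "x \<in> V v" for x
      using V_0[OF x] D_0[OF f x] D_0[OF g x] by simp
    ultimately have D: "D f x = D g x" if x: "x \<in> V v" for x
      using gen[of "{x \<in> V v. D f x = D g x}" v] x by blast
    show "f = g" by (rule left_hom_ext[OF f g D])
  qed
  show "mat_of v w ` left_hom R (S v) (S w) = Hom mat_cat v w"
  proof (intro equalityI subsetI)
    fix A assume "A \<in> mat_of v w ` left_hom R (S v) (S w)"
    then show "A \<in> Hom mat_cat v w" using mat_of_hom by blast
  next
    fix A assume A: "A \<in> Hom mat_cat v w"
    define f where "f = (\<lambda>y\<in>e ` V v. e (mat_map v A (inv_into (V v) e y)))"
    have fe: "f (e x) = e (mat_map v A x)" if "x \<in> V v" for x using that by (simp add: f_def)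
    have f: "f \<in> left_hom R (S v) (S w)"
      unfolding left_hom_def
    proof (intro CollectI conjI ballI)
      show "f \<in> carrier (S v) \<rightarrow>\<^sub>E carrier (S w)" using mat(1)[OF A] by (auto simp: f_def)
      fix x' y' assume "x' \<in> carrier (S v)" "y' \<in> carrier (S v)"
      then obtain x y where x: "x \<in> V v" "x' = e x" "y \<in> V v" "y' = e y" by auto
      show "f (x' \<oplus>\<^bsub>S v\<^esub> y') = f x' \<oplus>\<^bsub>S w\<^esub> f y'"
        using x(1,3) mat(1)[OF A] unfolding x(2,4) by (simp add: fe V_add mat_map_add)
    next
      fix u x' assume u: "u \<in> carrier R" and "x' \<in> carrier (S v)"
      then obtain x where x: "x \<in> V v" "x' = e x" by auto
      show "f (u \<odot>\<^bsub>S v\<^esub> x') = u \<odot>\<^bsub>S w\<^esub> f x'"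
        unfolding x(2) using x(1) u mat(1)[OF A x(1)] mat(2)[OF A x(1) u] by (simp add: fe V_s)
    qed
    have Df: "D f x = mat_map v A x" if "x \<in> V v" for x
      using fe[OF that] by (simp add: D_def the_inv_f_f[OF inj_e])
    have "mat_of v w f = A"
    proof (intro ext)
      fix i' i show "mat_of v w f i' i = A i' i"
        using A by (cases "i < length v") (auto simp: mat_of_def Df V_delta mat_map_delta)
    qed
    with f show "A \<in> mat_of v w ` left_hom R (S v) (S w)" by blast
  qed
qed

lemma presented: "presented_by mat_cat (left_mod_cat R P)"
proof (rule presented_byI[where S = S and \<Phi> = mat_of])
  show "is_category mat_cat" by (rule is_category_mat_cat)
  show "is_category (left_mod_cat R P)" by (rule left_mod_cat_is_category)
  show "S w \<in> Obj (left_mod_cat R P)" for w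
    by (simp add: left_mod_cat_def module P)
  show "bij_betw (mat_of v w) (Hom (left_mod_cat R P) (S v) (S w)) (Hom mat_cat v w)" for v w
    using mat_of_bij by (simp add: left_mod_cat_def)
  show "mat_of v v (Idn (left_mod_cat R P) (S v)) = Idn mat_cat v" for v
  proof -
    have "D (\<lambda>x\<in>carrier (S v). x) (delta (0, 0, i)) = delta (0, 0, i)" if "i < length v" for i
      using V_delta[OF that] by (simp add: D_def the_inv_f_f[OF inj_e])
    then show ?thesis by (auto simp: mat_of_def left_mod_cat_def fun_eq_iff delta_def)
  qed
next
  fix M assume "M \<in> Obj (left_mod_cat R P)"
  then have M: "left_module R M" "P M" by (simp_all add: left_mod_cat_def)
  interpret left_module R M by (rule M(1))
  obtain w \<psi> where \<psi>: "bij_betw \<psi> (carrier M) (V w)"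
      "\<And>x y. \<lbrakk>x \<in> carrier M; y \<in> carrier M\<rbrakk> \<Longrightarrow> \<psi> (x \<oplus>\<^bsub>M\<^esub> y) = \<psi> x + \<psi> y"
      "\<And>u x. \<lbrakk>u \<in> carrier R; x \<in> carrier M\<rbrakk> \<Longrightarrow> \<psi> (u \<odot>\<^bsub>M\<^esub> x) = s w u (\<psi> x)"
    using ex[OF M] by blast
  have V: "\<psi> x \<in> V w" if "x \<in> carrier M" for x using \<psi>(1) that bij_betwE by blast
  have "(\<lambda>x\<in>carrier M. e (\<psi> x)) \<in> left_hom R M (S w)"
    unfolding left_hom_def by (auto simp: V \<psi> smult_closed)
  moreover have "bij_betw (\<lambda>x\<in>carrier M. e (\<psi> x)) (carrier M) (carrier (S w))"
  proof -
    have "bij_betw e (V w) (e ` V w)" using inj_e by (meson bij_betw_imageI inj_on_subset subset_UNIV)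
    then have "bij_betw (\<lambda>x. e (\<psi> x)) (carrier M) (e ` V w)"
      using bij_betw_trans[OF \<psi>(1)] by (fastforce simp: comp_def)
    then show ?thesis by (subst bij_betw_cong[of _ _ "\<lambda>x. e (\<psi> x)"]) auto
  qed
  ultimately have "iso_arrow (left_mod_cat R P) M (S w) (\<lambda>x\<in>carrier M. e (\<psi> x))"
    by (rule left_hom_bij_iso_arrow[OF M(1)])
  then show "\<exists>i\<in>Obj mat_cat. \<exists>f. iso_arrow (left_mod_cat R P) M (S i) f" by auto
next
  fix u v w f g
  assume "f \<in> Hom (left_mod_cat R P) (S u) (S v)" "g \<in> Hom (left_mod_cat R P) (S v) (S w)"
  then have f: "f \<in> left_hom R (S u) (S v)" and g: "g \<in> left_hom R (S v) (S w)"
    by (simp_all add: left_mod_cat_def)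
  show "mat_of u w (Cmp (left_mod_cat R P) (S u) (S v) (S w) g f) = Cmp mat_cat u v w (mat_of v w g) (mat_of u v f)"
  proof (intro ext)
    fix i k
    show "mat_of u w (Cmp (left_mod_cat R P) (S u) (S v) (S w) g f) i k
        = Cmp mat_cat u v w (mat_of v w g) (mat_of u v f) i k"
    proof (cases "k < length u")
      case True
      have Df: "D f (delta (0, 0, k)) \<in> V v" using D_hom(1)[OF f] V_delta[OF True] by blast
      have "D f (delta (0, 0, k)) = (\<Sum>x\<in>(\<lambda>j. (0, 0, j)) ` {..<length v}. fscale (D f (delta (0, 0, k)) x) (delta x))"
      proof (rule finite_support_sum)
        show "{x. D f (delta (0, 0, k)) x \<noteq> 0} \<subseteq> (\<lambda>j. (0, 0, j)) ` {..<length v}"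
          using hom_delta[OF D_hom(1,3,4)[OF f] True] by auto
      qed simp
      also have "\<dots> = (\<Sum>j<length v. fscale (mat_of u v f j k) (delta (0, 0, j)))"
        using True by (subst sum.reindex) (auto simp: inj_on_def mat_of_def)
      finally have Dd: "D f (delta (0, 0, k)) = (\<Sum>j<length v. fscale (mat_of u v f j k) (delta (0, 0, j)))" .
      have Vs: "fscale c x \<in> V v" if "x \<in> V v" for c x
        using scalar[of c] V_s that by metis
      \<comment> \<open>\<open>D g\<close> is known to be additive only on \<open>V v\<close>, so
        membership of the partial sums is carried through the induction.\<close>
      define Q where "Q J \<longleftrightarrow> D g (\<Sum>j\<in>J. fscale (mat_of u v f j k) (delta (0, 0, j)))
          = (\<Sum>j\<in>J. fscale (mat_of u v f j k) (D g (delta (0, 0, j))))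
          \<and> (\<Sum>j\<in>J. fscale (mat_of u v f j k) (delta (0, 0, j))) \<in> V v" for J
      have sum: "Q J" if "finite J" "J \<subseteq> {..<length v}" for J
        using that
      proof (induction J rule: finite_induct)
        case empty
        show ?case unfolding Q_def using V_0[OF Df] D_0[OF g Df] by simp
      next
        case (insert j J)
        then show ?case unfolding Q_def using V_delta D_hom(3)[OF g] D_scale[OF g] V_add Vs by simp
      qed
      have "compose (e ` V u) g f (e (delta (0, 0, k))) = e (D g (D f (delta (0, 0, k))))"
        using V_delta[OF True] D_hom(2)[OF f] D_hom(2)[OF g Df] by (simp add: compose_def)
      then have "D (compose (e ` V u) g f) (delta (0, 0, k)) = D g (D f (delta (0, 0, k)))"
        by (simp add: D_def[of "compose _ _ _"] the_inv_f_f[OF inj_e])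
      also have "\<dots> = (\<Sum>j<length v. fscale (mat_of u v f j k) (D g (delta (0, 0, j))))" (is "_ = ?r")
        unfolding Dd using sum[of "{..<length v}"] by (simp add: Q_def)
      finally have "D (compose (e ` V u) g f) (delta (0, 0, k)) (0, 0, i) = ?r (0, 0, i)" by simp
      also have "?r (0, 0, i) = (\<Sum>j<length v. mat_of v w g i j * mat_of u v f j k)"
        unfolding sum_fun_apply by (intro sum.cong) (auto simp: mat_of_def)
      finally show ?thesis using True by (simp add: mat_of_def[of u w] left_mod_cat_def)
    next
      case False
      then show ?thesis by (simp add: mat_of_def[of u])
    qed
  qed
qed

end

section \<open>Verma modules and the block\<close>

lemma delta_nz: "delta x \<noteq> 0"
proof
  assume "delta x = 0"
  then have "delta x x = 0" by simp
  then show False by (simp add: delta_def)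
qed

context generic_q
begin

text \<open>Both admissible weights have the same central scalar by \<open>ctilde_sym\<close>, so
  the central element acts as one scalar on the whole sum.\<close>

lemma model_in_block:
  assumes M: "uq_iso fscale (model_space (length w)) (model.opm q z (bweight n w)) q M \<phi>"
  shows "in_O_block q (qpowers q) (ctilde q z (q powi n)) z M" and "central_charge q z M"
proof -
  interpret model q z "length w" "bweight n w" by (rule model_bweight)
  interpret uq_iso fscale MW opm q M \<phi> by (rule M)
  have Z: "opm gen_Z v = fscale z v" for v by (auto simp: fun_eq_iff)
  have C: "model_ops.act (fCtilde q) v = fscale (ctilde q z (q powi n)) v" if "v \<in> MW" for v
  proof
    fix x :: "nat \<times> nat \<times> nat"
    obtain k j i where "x = (k, j, i)" by (cases x)
    then show "model_ops.act (fCtilde q) v x = fscale (ctilde q z (q powi n)) v x"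
      using casimir_model[OF that, of k j i] ctilde_sym[of n] by (simp add: bweight_def)
  qed
  have wtq: "wt (bweight n w i) k j \<in> qpowers q" for i k j
  proof -
    obtain l :: int where "bweight n w i = q powi l" using bweight_int by blast
    then have "wt (bweight n w i) k j = q powi (l - int (2 * j + k))"
      using q_nz by (simp only: wt_def power_int_diff power_int_of_nat simp_thms)
    then show ?thesis by (simp add: qpowers_def)
  qed
  have "supp q M \<subseteq> qpowers q"
    unfolding supp_subset_iff using model_weights wtq by metis
  then show "in_O_block q (qpowers q) (ctilde q z (q powi n)) z M"
    unfolding in_O_block_def in_cat_O_iff
    using model_fin_gen model_weighty model_loc_fin ZC_scalar_annihilates[OF C Z] by simp
  show "central_charge q z M" unfolding central_charge_iff using Z by simp
qed

lemma block_model: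
  fixes M :: "(uq, 'a) module"
  assumes "left_module (Uq q) M" and B: "in_O_block q (qpowers q) (ctilde q z (q powi n)) z M"
    and Z: "central_charge q z M"
  shows "\<exists>w \<psi>. uq_iso fscale (model_space (length w)) (model.opm q z (bweight n w)) q M \<psi>"
proof -
  obtain W \<rho> and \<phi> :: "'a \<Rightarrow> ('a \<Rightarrow> complex) \<Rightarrow> complex" where M: "uq_iso fscale W \<rho> q M \<phi>"
    using left_module_uq_iso[OF assms(1)] by blast
  interpret uq_iso fscale W \<rho> q M \<phi> by (rule M)
  interpret charge_rep fscale W \<rho> q z
    by unfold_locales (use Z in \<open>simp add: central_charge_iff\<close>)
  obtain k where "\<forall>a \<in> ZC_ideal q (ctilde q z (q powi n)) z [^]\<^bsub>ideals_set (ZC_ring q)\<^esub> (k::nat).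
      \<forall>v\<in>carrier M. a \<odot>\<^bsub>M\<^esub> v = \<zero>\<^bsub>M\<^esub>"
    using B by (auto simp: in_O_block_def)
  then have "\<forall>v\<in>W. act ((fCtilde q - const (ctilde q z (q powi n))) ^ k) v = 0"
    using ZC_power_annihilates by blast
  moreover have "\<exists>l::int. \<mu> = q powi l" if "wvec \<mu> v" "v \<noteq> 0" for \<mu> v
  proof -
    have "\<mu> \<in> qpowers q"
      using B that by (auto simp: in_O_block_def supp_subset_iff)
    then show ?thesis by (auto simp: qpowers_def)
  qed
  moreover have "fin_gen \<and> weighty \<and> loc_fin" using B by (simp add: in_O_block_def in_cat_O_iff)
  ultimately show ?thesis using M by (intro block_iso) blast+
qed

end

section \<open>Verma modules are models of rank one, hence simple\<close>

lemma (in left_module) quotient_left_module: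
  assumes N: "submodule N R M" shows "left_module R (quotient_module M N)"
proof -
  interpret N: abelian_subgroup N M
    using N by (intro abelian_subgroupI3) (auto simp: additive_subgroup_def submodule_def M.abelian_group_axioms)
  let ?Q = "quotient_module M N"
  have c: "carrier ?Q = {N +>\<^bsub>M\<^esub> x | x. x \<in> carrier M}"
    by (auto simp: quotient_module_def A_RCOSETS_def')
  have a: "(N +>\<^bsub>M\<^esub> x) \<oplus>\<^bsub>?Q\<^esub> (N +>\<^bsub>M\<^esub> y) = N +>\<^bsub>M\<^esub> (x \<oplus>\<^bsub>M\<^esub> y)" if "x \<in> carrier M" "y \<in> carrier M" for x y
    using N.a_rcos_sum[OF that] by (simp add: quotient_module_def)
  have z: "\<zero>\<^bsub>?Q\<^esub> = N +>\<^bsub>M\<^esub> \<zero>\<^bsub>M\<^esub>"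
    using M.a_coset_add_zero N.a_subset by (simp add: quotient_module_def)
  note s = quotient_smult[OF N]
  have "abelian_group ?Q"
  proof (rule abelian_groupI)
    fix A assume "A \<in> carrier ?Q"
    then obtain x where x: "x \<in> carrier M" "A = N +>\<^bsub>M\<^esub> x" by (auto simp: c)
    then have "(N +>\<^bsub>M\<^esub> (\<ominus>\<^bsub>M\<^esub> x)) \<oplus>\<^bsub>?Q\<^esub> A = \<zero>\<^bsub>?Q\<^esub>" using a by (simp add: z M.l_neg)
    moreover have "N +>\<^bsub>M\<^esub> (\<ominus>\<^bsub>M\<^esub> x) \<in> carrier ?Q" using x by (auto simp: c)
    ultimately show "\<exists>B\<in>carrier ?Q. B \<oplus>\<^bsub>?Q\<^esub> A = \<zero>\<^bsub>?Q\<^esub>" by blast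
  next
    fix A B assume "A \<in> carrier ?Q" "B \<in> carrier ?Q"
    then obtain x y where x: "x \<in> carrier M" "A = N +>\<^bsub>M\<^esub> x" "y \<in> carrier M" "B = N +>\<^bsub>M\<^esub> y" by (auto simp: c)
    then have "A \<oplus>\<^bsub>?Q\<^esub> B = N +>\<^bsub>M\<^esub> (x \<oplus>\<^bsub>M\<^esub> y)" "B \<oplus>\<^bsub>?Q\<^esub> A = N +>\<^bsub>M\<^esub> (y \<oplus>\<^bsub>M\<^esub> x)" using a by simp_all
    then show "A \<oplus>\<^bsub>?Q\<^esub> B \<in> carrier ?Q" "A \<oplus>\<^bsub>?Q\<^esub> B = B \<oplus>\<^bsub>?Q\<^esub> A" using x by (auto simp: c M.a_comm)
  qed (auto simp: c a z M.a_assoc)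
  then show ?thesis
    unfolding left_module_def left_module_axioms_def c
    by (auto simp: ring_axioms s a smult_closed smult_l_distr smult_r_distr smult_assoc smult_one)
qed

context generic_q
begin

text \<open>The class of the unit is a highest weight vector that generates the quotient, so
  \<open>model_iso\<close> in rank one applies once this class is known to be nonzero. The model
  itself supplies the proof of that.\<close>

lemma verma_model:
  "\<exists>\<psi>. uq_iso fscale (model_space (length [b])) (model.opm q z (bweight n [b])) q
     (verma q (bweight n [b] 0) z) \<psi>"
proof -
  define \<mu> where "\<mu> = bweight n [b] 0"
  let ?G = "{cls q fE, cls q fX, cls q (fK - const \<mu>), cls q (fZ - const z)}"
  let ?L = "left_regular (Uq q)"
  have L: "left_module (Uq q) ?L" by (rule left_regular_left_module[OF Uq_ring])
  interpret L: left_module "Uq q" ?L by (rule L)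
  define J where "J = submodule_gen (Uq q) ?L ?G"
  have Lc: "carrier ?L = carrier (Uq q)" "\<And>x y. x \<odot>\<^bsub>?L\<^esub> y = x \<otimes>\<^bsub>Uq q\<^esub> y" "\<And>x y. x \<oplus>\<^bsub>?L\<^esub> y = x \<oplus>\<^bsub>Uq q\<^esub> y"
    by (simp_all add: left_regular_def)
  have J: "submodule J (Uq q) ?L"
    unfolding J_def by (rule L.submodule_gen_submodule) (simp add: Lc)
  have GJ: "?G \<subseteq> J" by (auto simp: J_def submodule_gen_def)
  interpret J: abelian_subgroup J ?L
    using J by (intro abelian_subgroupI3) (auto simp: additive_subgroup_def submodule_def L.M.abelian_group_axioms)
  let ?M = "verma q \<mu> z"
  have M_eq: "?M = quotient_module ?L J" by (simp add: verma_def J_def)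
  have lm: "left_module (Uq q) ?M" unfolding M_eq by (rule L.quotient_left_module[OF J])
  let ?c = "\<lambda>x. J +>\<^bsub>?L\<^esub> x"
  have Mc: "carrier ?M = {?c (cls q p) | p. True}"
    unfolding M_eq by (auto simp: quotient_module_def A_RCOSETS_def' Lc Uq_carrier)
  have Ms: "cls q p \<odot>\<^bsub>?M\<^esub> ?c (cls q r) = ?c (cls q (p * r))" for p r
    unfolding M_eq using L.quotient_smult[OF J, of "cls q p" "cls q r"] by (simp add: Lc cls_mult)
  have M0: "\<zero>\<^bsub>?M\<^esub> = J" by (simp add: M_eq quotient_module_def)
  have zero_iff: "?c (cls q p) = J \<longleftrightarrow> cls q p \<in> J" for p
    using J.a_rcos_const[of "cls q p"] J.a_rcos_self[of "cls q p"] by (auto simp: Lc)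
  obtain W \<rho> and \<phi> :: "uq set \<Rightarrow> (uq set \<Rightarrow> complex) \<Rightarrow> complex" where M: "uq_iso fscale W \<rho> q ?M \<phi>"
    using left_module_uq_iso[OF lm] by blast
  interpret uq_iso fscale W \<rho> q ?M \<phi> by (rule M)
  define v where "v = \<phi> (?c (cls q 1))"
  have cc: "?c (cls q p) \<in> carrier ?M" for p using Mc by blast
  have \<phi>c: "\<phi> (?c (cls q p)) = act p v" for p
    using \<phi>_cls[OF cc[of 1], of p] Ms[of p 1] by (simp add: v_def)
  have vW: "v \<in> W" using cc by (simp add: v_def)
  have kill: "act p v = 0" if "cls q p \<in> J" for p
    using \<phi>c[of p] that zero_iff[of p] M0 \<phi>_zero by simp
  have W_act: "\<exists>p. w = act p v" if "w \<in> W" for w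
    using \<phi>_surj[OF that] \<phi>c Mc by auto
  have E: "\<rho> gen_E v = 0" and X: "\<rho> gen_X v = 0" and K: "\<rho> gen_K v = fscale \<mu> v"
    and Z: "\<rho> gen_Z v = fscale z v"
    using kill[of fE] kill[of fX] kill[of "fK - const \<mu>"] kill[of "fZ - const z"] GJ
    by (simp_all add: act_diff)
  have Zc: "\<rho> gen_Z (\<rho> g w) = \<rho> g (\<rho> gen_Z w)" if "w \<in> W" for g w
  proof -
    have "fZ * gvar g - gvar g * fZ \<in> relators q" by (auto simp: relators_def)
    from relators_zero[OF this that] show ?thesis using that by (simp add: act_diff act_mult)
  qed
  \<comment> \<open>\<open>Z\<close> is central and acts by \<open>z\<close> on the generating
    vector, hence everywhere.\<close>
  have "\<rho> gen_Z w = fscale z w" if w: "w \<in> W" for w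
  proof -
    obtain p where p: "w = act p v" using W_act[OF w] by blast
    have "\<rho> gen_Z (act p v) = act p (\<rho> gen_Z v)"
      by (rule act_intertwine[OF operators_axioms operators_axioms]) (rule \<rho>_add \<rho>_scale \<rho>_closed Zc vW | assumption)+
    then show ?thesis using vW by (simp add: p Z act_scale_right)
  qed
  then interpret charge_rep fscale W \<rho> q z by unfold_locales
  have v0: "v \<noteq> 0"
  proof
    assume "v = 0"
    then have "?c (cls q 1) = J" using \<phi>_eq_0[OF cc[of 1]] M0 by (simp add: v_def)
    then have one: "cls q 1 \<in> J" by (simp add: zero_iff)
    interpret m: model q z "length [b]" "bweight n [b]" by (rule model_bweight)
    have d: "delta (0, 0, 0) \<in> m.MW" by (rule m.delta_MW) simp
    \<comment> \<open>The annihilator of the top vector of the model: a left ideal that contains the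
      generators of \<open>J\<close> but not the unit.\<close>
    let ?A = "{u \<in> carrier (Uq q). m.model_rep.uact u (delta (0, 0, 0)) = 0}"
    have A: "cls q p \<in> ?A \<longleftrightarrow> m.model_ops.act p (delta (0, 0, 0)) = 0" for p
      using d by (simp add: m.model_rep.uact_cls)
    have "submodule ?A (Uq q) ?L"
      unfolding submodule_def submodule_axioms_def
    proof (intro conjI allI impI)
      show "subgroup ?A (add_monoid ?L)"
      proof (rule group.subgroupI[OF L.M.a_group])
        show "?A \<subseteq> carrier (add_monoid ?L)" by (auto simp: Lc)
        have "cls q 0 \<in> ?A" unfolding A by simp
        then show "?A \<noteq> {}" by blast
      next
        fix a assume a: "a \<in> ?A"
        then obtain p where p: "a = cls q p" by (auto simp: Uq_carrier)
        have "cls q (- p) \<oplus>\<^bsub>?L\<^esub> cls q p = \<zero>\<^bsub>?L\<^esub>"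
          by (simp add: Lc cls_add) (simp add: left_regular_def cls_zero)
        then have "\<ominus>\<^bsub>?L\<^esub> a = cls q (- p)"
          unfolding p by (intro L.M.minus_equality) (simp_all add: Lc)
        moreover have "cls q (- p) \<in> ?A"
          using a m.model_ops.act_diff[of 0 p] unfolding p A by simp
        ultimately show "inv\<^bsub>add_monoid ?L\<^esub> a \<in> ?A" by (simp only: a_inv_def)
      next
        fix a a' assume a: "a \<in> ?A" "a' \<in> ?A"
        then obtain p r where p: "a = cls q p" "a' = cls q r" by (auto simp: Uq_carrier)
        have "cls q (p + r) \<in> ?A" using a unfolding p A by (simp add: m.model_ops.act_add)
        then show "a \<otimes>\<^bsub>add_monoid ?L\<^esub> a' \<in> ?A" by (simp add: p Lc cls_add)
      qed
      fix a x assume a: "a \<in> carrier (Uq q)" "x \<in> ?A"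
      then obtain p r where p: "a = cls q p" "x = cls q r" by (auto simp: Uq_carrier)
      have "cls q (p * r) \<in> ?A" using a d unfolding p A by (simp add: m.model_ops.act_mult)
      then show "a \<odot>\<^bsub>?L\<^esub> x \<in> ?A" by (simp add: p Lc cls_mult)
    qed
    moreover have "?G \<subseteq> ?A"
      unfolding insert_subset A
      by (simp add: m.model_ops.act_diff m.opm_delta \<mu>_def)
    ultimately have "J \<subseteq> ?A" unfolding J_def submodule_gen_def by blast
    with one have "delta (0, 0, 0) = (0 :: coeffs)" unfolding subset_iff using A[of 1] by auto
    with delta_nz show False by (rule notE)
  qed
  have h: "hw \<mu> v" using vW E X K by (simp add: hw_def wvec_def)
  interpret hw_family fscale W \<rho> q z "length [b]" "bweight n [b]" "\<lambda>_. v"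
    by unfold_locales (use h in \<open>simp_all add: bweight_nz \<mu>_def\<close>)
  have "uq_iso fscale MW opm q ?M (\<lambda>x. inv_into MW \<Phi> (\<phi> x))"
  proof (rule model_iso[OF _ _ bweight_int M])
    fix c assume "(\<Sum>i<length [b]. fscale (c i) v) = 0"
    then have "fscale (c 0) v = 0" by simp
    then show "\<forall>i<length [b]. c i = 0" using v0 by (simp only: fspace.scale_eq_0_iff) simp
  next
    fix N assume N: "invariant N" "\<And>i. i < length [b] \<Longrightarrow> v \<in> N"
    have "w \<in> N" if "w \<in> W" for w using W_act[OF that] invariant_act[OF N(1)] N(2)[of 0] by auto
    then show "N = W" using N(1) by (auto simp: invariant_def)
  qed
  then show ?thesis unfolding \<mu>_def by blast
qed

text \<open>A nonzero submodule contains a vector killed by \<open>X\<close> and \<open>E\<close>;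
  in rank one this is a multiple of the top vector, which generates everything.\<close>

lemma model_simple:
  assumes M: "uq_iso fscale (model_space (length [b])) (model.opm q z (bweight n [b])) q M \<psi>"
  shows "simple_left_module (Uq q) M"
proof -
  interpret model q z "length [b]" "bweight n [b]" by (rule model_bweight)
  interpret uq_iso fscale MW opm q M \<psi> by (rule M)
  have d: "delta (0, 0, 0) \<in> MW" by (rule delta_MW) simp
  have "carrier M \<noteq> {\<zero>\<^bsub>M\<^esub>}"
  proof
    assume "carrier M = {\<zero>\<^bsub>M\<^esub>}"
    then have "delta (0, 0, 0) = (0 :: coeffs)" using \<phi>_surj[OF d] by auto
    with delta_nz show False by (rule notE)
  qed
  moreover have "N = {\<zero>\<^bsub>M\<^esub>} \<or> N = carrier M" if N: "submodule N (Uq q) M" for N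
  proof -
    have NM: "N \<subseteq> carrier M" "\<zero>\<^bsub>M\<^esub> \<in> N"
      using N subgroup.subset[of N "add_monoid M"] subgroup.one_closed[of N "add_monoid M"]
      by (auto simp: submodule_def)
    have inv: "model_ops.invariant (\<psi> ` N)" using N by (rule submodule_invariant)
    show ?thesis
    proof (cases "N = {\<zero>\<^bsub>M\<^esub>}")
      case False
      then obtain x where x: "x \<in> N" "x \<noteq> \<zero>\<^bsub>M\<^esub>" using NM by blast
      then have "\<psi> x \<in> \<psi> ` N" "\<psi> x \<noteq> 0" using \<phi>_eq_0 NM by auto
      then obtain g where g: "g \<in> \<psi> ` N" "g \<noteq> 0" "opm gen_X g = 0" "opm gen_E g = 0"
        using model_hw_exists[OF inv] by blast
      have nz: "e_coeff q (bweight n [b] i) (Suc j) \<noteq> 0" for i j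
        using bweight_int[of n "[b]" i] e_coeff_nz[of "Suc j"] by auto
      have gMW: "g \<in> MW" using g(1) inv unfolding model_ops.invariant_def by blast
      have "g x = fscale (g (0, 0, 0)) (delta (0, 0, 0)) x" for x
      proof -
        obtain k j i where x: "x = (k, j, i)" by (cases x)
        show ?thesis
        proof (cases "(k, j) = (0, 0)")
          case True
          then show ?thesis using gMW x by (cases "i = 0") (auto simp: delta_def model_space_def)
        next
          case False
          then show ?thesis using model_hw[OF g(3,4) nz False, of i] x by (auto simp: delta_def)
        qed
      qed
      then have gd: "g = fscale (g (0, 0, 0)) (delta (0, 0, 0))" by (rule ext)
      then have c: "g (0, 0, 0) \<noteq> 0" using g(2) by (metis fspace.scale_zero_left)
      have "fspace.subspace (\<psi> ` N)" using inv unfolding model_ops.invariant_def by (rule conjunct1)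
      then have "fscale (1 / g (0, 0, 0)) g \<in> \<psi> ` N" using g(1) by (rule fspace.subspace_scale)
      then have "delta (0, 0, 0) \<in> \<psi> ` N"
        using c by (subst (asm) gd) (simp only: fspace.scale_scale, simp)
      then have "\<psi> ` N = MW" using inv by (intro model_generated) auto
      then have "\<psi> ` N = \<psi> ` carrier M" using \<phi>_bij by (simp add: bij_betw_def)
      then show ?thesis
        using \<phi>_bij inj_on_image_eq_iff[of \<psi> "carrier M" N "carrier M"] NM by (simp add: bij_betw_def)
    qed simp
  qed
  ultimately show ?thesis using left_module_M by (simp add: simple_left_module_def)
qed

end

section \<open>From simple modules to simple objects of the block\<close>

lemma (in left_module) smult_zero_right: "a \<in> carrier R \<Longrightarrow> a \<odot>\<^bsub>M\<^esub> \<zero>\<^bsub>M\<^esub> = \<zero>\<^bsub>M\<^esub>"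
  using smult_r_distr[of a "\<zero>\<^bsub>M\<^esub>" "\<zero>\<^bsub>M\<^esub>"] smult_closed[of a "\<zero>\<^bsub>M\<^esub>"]
  by (simp add: M.add.r_cancel_one')

lemma zero_left_hom:
  assumes "left_module R A" "left_module R M"
  shows "(\<lambda>x\<in>carrier A. \<zero>\<^bsub>M\<^esub>) \<in> left_hom R A M"
proof -
  interpret A: left_module R A by fact
  interpret M: left_module R M by fact
  show ?thesis by (auto simp: left_hom_def A.smult_closed M.smult_zero_right)
qed

lemma left_hom_zero:
  assumes "left_module R A" "left_module R M" and f: "f \<in> left_hom R A M"
  shows "f \<zero>\<^bsub>A\<^esub> = \<zero>\<^bsub>M\<^esub>"
proof -
  interpret A: left_module R A by fact
  interpret M: left_module R M by fact
  have "f \<zero>\<^bsub>A\<^esub> \<in> carrier M" using f by (auto simp: left_hom_def)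
  moreover have "f (\<zero>\<^bsub>A\<^esub> \<oplus>\<^bsub>A\<^esub> \<zero>\<^bsub>A\<^esub>) = f \<zero>\<^bsub>A\<^esub> \<oplus>\<^bsub>M\<^esub> f \<zero>\<^bsub>A\<^esub>"
    using f A.M.zero_closed unfolding left_hom_def by blast
  ultimately show ?thesis by (simp add: M.M.add.r_cancel_one')
qed

lemma left_hom_image_submodule:
  assumes "left_module R A" "left_module R M" and f: "f \<in> left_hom R A M"
  shows "submodule (f ` carrier A) R M"
proof -
  interpret A: left_module R A by fact
  interpret M: left_module R M by fact
  have c: "f x \<in> carrier M" if "x \<in> carrier A" for x using f that by (auto simp: left_hom_def)
  have a: "f x \<oplus>\<^bsub>M\<^esub> f y = f (x \<oplus>\<^bsub>A\<^esub> y)" if "x \<in> carrier A" "y \<in> carrier A" for x y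
    using f that by (auto simp: left_hom_def)
  have s: "r \<odot>\<^bsub>M\<^esub> f x = f (r \<odot>\<^bsub>A\<^esub> x)" if "r \<in> carrier R" "x \<in> carrier A" for r x
    using f that by (auto simp: left_hom_def)
  have "subgroup (f ` carrier A) (add_monoid M)"
  proof (rule group.subgroupI[OF M.M.a_group])
    show "f ` carrier A \<subseteq> carrier (add_monoid M)" using c by auto
    show "f ` carrier A \<noteq> {}" using A.M.zero_closed by blast
  next
    fix y assume "y \<in> f ` carrier A"
    then obtain x where x: "x \<in> carrier A" "y = f x" by blast
    have "f (\<ominus>\<^bsub>A\<^esub> x) \<oplus>\<^bsub>M\<^esub> y = \<zero>\<^bsub>M\<^esub>"
      using x a[of "\<ominus>\<^bsub>A\<^esub> x" x] left_hom_zero[OF assms] by (simp add: A.M.l_neg)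
    then have "\<ominus>\<^bsub>M\<^esub> y = f (\<ominus>\<^bsub>A\<^esub> x)"
      using x c by (intro M.M.minus_equality) simp_all
    then show "inv\<^bsub>add_monoid M\<^esub> y \<in> f ` carrier A" using x by (simp flip: a_inv_def)
  next
    fix y y' assume "y \<in> f ` carrier A" "y' \<in> f ` carrier A"
    then show "y \<otimes>\<^bsub>add_monoid M\<^esub> y' \<in> f ` carrier A" using a by auto
  qed
  then show ?thesis
    using s A.smult_closed by (auto simp: submodule_def submodule_axioms_def)
qed

lemma zero_object_trivial:
  fixes A :: "('r, 'a) module"
  assumes "left_module R A" "P A" "carrier A = {\<zero>\<^bsub>A\<^esub>}"
  shows "zero_object (left_mod_cat R P) A"
proof -
  have "\<exists>!f. f \<in> left_hom R A B" if B: "left_module R B" for B :: "('r, 'a) module"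
  proof (rule ex1I[where P = "\<lambda>f. f \<in> left_hom R A B", OF zero_left_hom[OF assms(1) B]])
    fix f assume f: "f \<in> left_hom R A B"
    show "f = (\<lambda>x\<in>carrier A. \<zero>\<^bsub>B\<^esub>)"
      using f left_hom_zero[OF assms(1) B f] assms(3)
      by (intro extensionalityI[of f "carrier A"]) (auto simp: left_hom_def PiE_def)
  qed
  moreover have "\<exists>!f. f \<in> left_hom R B A" if B: "left_module R B" for B :: "('r, 'a) module"
  proof (rule ex1I[where P = "\<lambda>f. f \<in> left_hom R B A", OF zero_left_hom[OF B assms(1)]])
    fix f assume f: "f \<in> left_hom R B A"
    show "f = (\<lambda>x\<in>carrier B. \<zero>\<^bsub>A\<^esub>)"
      using f assms(3)
      by (intro extensionalityI[of f "carrier B"]) (auto simp: left_hom_def PiE_def)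
  qed
  ultimately show ?thesis using assms by (simp add: zero_object_def left_mod_cat_def)
qed

text \<open>For a cyclic submodule finite generation holds by construction; weights, local
  finiteness and annihilation by the central ideal are inherited.\<close>

lemma (in uq_iso) in_O_block_submodule:
  assumes B: "in_O_block q \<xi> c z M" and x: "x \<in> carrier M"
  defines "N \<equiv> submodule_gen (Uq q) M {x}"
  shows "in_O_block q \<xi> c z (M\<lparr>carrier := N\<rparr>)"
proof -
  have N: "submodule N (Uq q) M" unfolding N_def by (rule M.submodule_gen_submodule) (simp add: x)
  have inv: "invariant (\<phi> ` N)" using N by (rule submodule_invariant)
  interpret N: uq_iso scale "\<phi> ` N" \<rho> q "M\<lparr>carrier := N\<rparr>" \<phi> using N by (rule uq_iso_submodule)
  have xN: "x \<in> N" by (auto simp: N_def submodule_gen_def)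
  have NM: "N \<subseteq> carrier M"
    using N subgroup.subset[of N "add_monoid M"] by (auto simp: submodule_def)
  have NW: "\<phi> ` N \<subseteq> W" using NM by auto
  have wv: "N.wvec \<mu> v \<longleftrightarrow> wvec \<mu> v \<and> v \<in> \<phi> ` N" for \<mu> v
    using NW by (auto simp: N.wvec_def wvec_def)
  have "N.fin_gen"
    unfolding N.fin_gen_def
  proof (intro exI conjI allI impI)
    fix N' assume N': "N.invariant N'" "{\<phi> x} \<subseteq> N'"
    then have "invariant N'" using NW by (auto simp: N.invariant_def invariant_def)
    then have "submodule {y \<in> carrier M. \<phi> y \<in> N'} (Uq q) M" by (rule invariant_submodule)
    then have "N \<subseteq> {y \<in> carrier M. \<phi> y \<in> N'}" using N'(2) x by (auto simp: N_def submodule_gen_def)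
    then show "N' = \<phi> ` N" using N'(1) by (auto simp: N.invariant_def)
  qed (use xN in auto)
  moreover have "N.weighty"
  proof -
    have "weighty" using B by (simp add: in_O_block_def in_cat_O_iff)
    from weighty_invariant[OF this inv] have "\<phi> ` N \<subseteq> span {v. (\<exists>\<mu>. wvec \<mu> v) \<and> v \<in> \<phi> ` N}" by blast
    then show ?thesis unfolding N.weighty_def wv by simp
  qed
  moreover have "N.loc_fin"
    unfolding N.loc_fin_def
  proof
    fix v assume v: "v \<in> \<phi> ` N"
    have "loc_fin" using B by (simp add: in_O_block_def in_cat_O_iff)
    moreover have "v \<in> W" using v NW by (rule subsetD[rotated])
    ultimately obtain B' where B': "finite B'" "v \<in> span B'"
        "\<forall>y\<in>span B'. \<rho> gen_E y \<in> span B' \<and> \<rho> gen_X y \<in> span B'"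
      unfolding loc_fin_def by metis
    \<comment> \<open>The finite-dimensional stable span is cut down to the submodule, which is
      stable as well.\<close>
    have T: "subspace (span B' \<inter> \<phi> ` N)"
      using inv unfolding invariant_def by (intro subspace_inter subspace_span) (rule conjunct1)
    obtain D where D: "finite D" "D \<subseteq> span B' \<inter> \<phi> ` N" "span B' \<inter> \<phi> ` N = span D"
      by (rule subspace_of_span_finite[OF T Int_lower1 B'(1)])
    then show "\<exists>B. finite B \<and> B \<subseteq> \<phi> ` N \<and> v \<in> span B \<and> (\<forall>x\<in>span B. \<rho> gen_E x \<in> span B \<and> \<rho> gen_X x \<in> span B)"
      using v B' inv D(1,2) unfolding D(3)[symmetric] invariant_def
      by (intro exI[of _ D]) (simp add: D(3)[symmetric])
  qed
  moreover have "supp q (M\<lparr>carrier := N\<rparr>) \<subseteq> \<xi>"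
    using B unfolding N.supp_subset_iff in_O_block_def supp_subset_iff wv by blast
  moreover have "\<exists>k::nat. \<forall>a \<in> ZC_ideal q c z [^]\<^bsub>ideals_set (ZC_ring q)\<^esub> k. \<forall>v\<in>N. a \<odot>\<^bsub>M\<^esub> v = \<zero>\<^bsub>M\<^esub>"
    using B NM unfolding in_O_block_def by (meson subsetD)
  ultimately show ?thesis
    unfolding in_O_block_def N.in_cat_O_iff by simp
qed

text \<open>The point is that monomorphisms of the block are injective maps. A kernel is not visibly
  finitely generated, so the mono property is tested on the cyclic submodule of a single kernel
  element, comparing inclusion and zero map.\<close>

lemma simple_object_O_block:
  fixes M :: "(uq, 'a) module"
  assumes S: "simple_left_module (Uq q) M" and B: "in_O_block q \<xi> c z M"
  shows "simple_object (O_block q \<xi> c z) M"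
proof -
  have M: "left_module (Uq q) M" using S by (simp add: simple_left_module_def)
  interpret M: left_module "Uq q" M by (rule M)
  have "\<not> zero_object (O_block q \<xi> c z) M"
  proof
    assume "zero_object (O_block q \<xi> c z) M"
    then have "\<exists>!f. f \<in> left_hom (Uq q) M M"
      using M B by (simp add: zero_object_def O_block_def left_mod_cat_def)
    moreover have "(\<lambda>x\<in>carrier M. x) \<in> left_hom (Uq q) M M" by (auto simp: left_hom_def M.smult_closed)
    ultimately have e: "(\<lambda>x\<in>carrier M. x) = (\<lambda>x\<in>carrier M. \<zero>\<^bsub>M\<^esub>)"
      using zero_left_hom[OF M M] by blast
    have "x = \<zero>\<^bsub>M\<^esub>" if "x \<in> carrier M" for x using fun_cong[OF e, of x] that by simp
    then have "carrier M = {\<zero>\<^bsub>M\<^esub>}" by auto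
    then show False using S by (simp add: simple_left_module_def)
  qed
  moreover have "zero_object (O_block q \<xi> c z) A \<or> iso_arrow (O_block q \<xi> c z) A M f"
    if A: "A \<in> Obj (O_block q \<xi> c z)" and f: "mono_arrow (O_block q \<xi> c z) A M f" for A f
  proof -
    have lA: "left_module (Uq q) A" and BA: "in_O_block q \<xi> c z A"
      using A by (simp_all add: O_block_def left_mod_cat_def)
    interpret A: left_module "Uq q" A by (rule lA)
    have fh: "f \<in> left_hom (Uq q) A M"
      using f by (simp add: mono_arrow_def O_block_def left_mod_cat_def)
    have fc: "f x \<in> carrier M" if "x \<in> carrier A" for x using fh that by (auto simp: left_hom_def)
    have fa: "f (x \<oplus>\<^bsub>A\<^esub> y) = f x \<oplus>\<^bsub>M\<^esub> f y" if "x \<in> carrier A" "y \<in> carrier A" for x y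
      using fh that by (auto simp: left_hom_def)
    have mono: "g = h" if "left_module (Uq q) D" "in_O_block q \<xi> c z D" "g \<in> left_hom (Uq q) D A"
          "h \<in> left_hom (Uq q) D A" "compose (carrier D) f g = compose (carrier D) f h" for D :: "(uq, 'a) module" and g h
      using f that by (simp add: mono_arrow_def O_block_def left_mod_cat_def)
    have f0: "f \<zero>\<^bsub>A\<^esub> = \<zero>\<^bsub>M\<^esub>" by (rule left_hom_zero[OF lA M fh])
    have ker: "x = \<zero>\<^bsub>A\<^esub>" if x: "x \<in> carrier A" "f x = \<zero>\<^bsub>M\<^esub>" for x
    proof -
      obtain W \<rho> and \<phi> :: "'a \<Rightarrow> ('a \<Rightarrow> complex) \<Rightarrow> complex" where i: "uq_iso fscale W \<rho> q A \<phi>"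
        using left_module_uq_iso[OF lA] by blast
      interpret uq_iso fscale W \<rho> q A \<phi> by (rule i)
      define N where "N = submodule_gen (Uq q) A {x}"
      let ?D = "A\<lparr>carrier := N\<rparr>"
      have N: "submodule N (Uq q) A" unfolding N_def by (rule A.submodule_gen_submodule) (simp add: x)
      have D: "left_module (Uq q) ?D" using N by (rule A.left_module_submodule)
      have BD: "in_O_block q \<xi> c z ?D" unfolding N_def by (rule in_O_block_submodule[OF BA x(1)])
      have NA: "N \<subseteq> carrier A"
        using N subgroup.subset[of N "add_monoid A"] by (auto simp: submodule_def)
      let ?k = "{y \<in> carrier A. f y = \<zero>\<^bsub>M\<^esub>}"
      have "subgroup ?k (add_monoid A)"
      proof (rule group.subgroupI[OF A.M.a_group])
        show "?k \<noteq> {}" using f0 A.M.zero_closed by blast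
        fix y assume y: "y \<in> ?k"
        have "f (\<ominus>\<^bsub>A\<^esub> y) \<in> carrier M" using y by (simp add: fc)
        then have "f (\<ominus>\<^bsub>A\<^esub> y) = \<zero>\<^bsub>M\<^esub>" using y fa[of "\<ominus>\<^bsub>A\<^esub> y" y] f0 by (simp add: A.M.l_neg)
        then show "inv\<^bsub>add_monoid A\<^esub> y \<in> ?k" using y by (simp flip: a_inv_def)
      qed (auto simp: fa)
      moreover have "a \<odot>\<^bsub>A\<^esub> y \<in> ?k" if "a \<in> carrier (Uq q)" "y \<in> ?k" for a y
        using fh that by (auto simp: left_hom_def A.smult_closed M.smult_zero_right)
      ultimately have "submodule ?k (Uq q) A" by (auto simp: submodule_def submodule_axioms_def)
      then have Nk: "N \<subseteq> ?k" using x by (auto simp: N_def submodule_gen_def)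
      have 1: "(\<lambda>y\<in>N. y) \<in> left_hom (Uq q) ?D A"
        using NA D left_module.smult_closed[OF D] abelian_groupE(1)[of ?D]
        by (auto simp: left_hom_def left_module_def)
      have 2: "(\<lambda>y\<in>N. \<zero>\<^bsub>A\<^esub>) \<in> left_hom (Uq q) ?D A" using zero_left_hom[OF D lA] by simp
      have "compose (carrier ?D) f (\<lambda>y\<in>N. y) = compose (carrier ?D) f (\<lambda>y\<in>N. \<zero>\<^bsub>A\<^esub>)"
        using Nk f0 by (auto simp: compose_def fun_eq_iff)
      then have "(\<lambda>y\<in>N. y) = (\<lambda>y\<in>N. \<zero>\<^bsub>A\<^esub>)" by (rule mono[OF D BD 1 2])
      moreover have "x \<in> N" by (auto simp: N_def submodule_gen_def)
      ultimately show ?thesis by (metis restrict_apply')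
    qed
    have inj: "inj_on f (carrier A)"
    proof (rule inj_onI)
      fix x y assume x: "x \<in> carrier A" "y \<in> carrier A" "f x = f y"
      have "f (x \<oplus>\<^bsub>A\<^esub> \<ominus>\<^bsub>A\<^esub> y) = \<zero>\<^bsub>M\<^esub>"
        using fa[of x "\<ominus>\<^bsub>A\<^esub> y"] fa[of y "\<ominus>\<^bsub>A\<^esub> y"] x f0 by (simp add: A.M.r_neg)
      then have "x \<oplus>\<^bsub>A\<^esub> \<ominus>\<^bsub>A\<^esub> y = \<zero>\<^bsub>A\<^esub>" using x by (intro ker) simp_all
      then show "x = y" using x A.M.minus_unique[of "\<ominus>\<^bsub>A\<^esub> y" x y] A.M.r_neg A.M.l_neg A.M.a_comm
        by (metis A.M.a_inv_closed A.M.minus_equality A.M.minus_minus)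
    qed
    show ?thesis
    proof (cases "f ` carrier A = {\<zero>\<^bsub>M\<^esub>}")
      case True
      then have "carrier A = {\<zero>\<^bsub>A\<^esub>}" using ker A.M.zero_closed by auto
      then show ?thesis unfolding O_block_def using zero_object_trivial[OF lA, of "in_O_block q \<xi> c z"] BA by blast
    next
      case False
      then have "f ` carrier A = carrier M"
        using S left_hom_image_submodule[OF lA M fh] unfolding simple_left_module_def by blast
      with inj have "bij_betw f (carrier A) (carrier M)" by (simp add: bij_betw_def)
      then show ?thesis unfolding O_block_def by (intro disjI2 left_hom_bij_iso_arrow[OF lA fh])
    qed
  qed
  ultimately show ?thesis
    using M B by (simp add: simple_object_def) (simp add: O_block_def left_mod_cat_def)
qed

section \<open>The block in terms of matrices\<close>

context generic_q
begin

text \<open>A homomorphism sends a generator to a vector of equal weight killed by \<open>X\<close>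
  and \<open>E\<close>. By \<open>model_hw\<close> such vectors are combinations of generators, and
  equality of weights leaves those with the same letter.\<close>

lemma block_presented:
  fixes e :: "coeffs \<Rightarrow> 'a"
  assumes e: "inj e"
  shows "presented_by mat_cat (O_block_charge q (qpowers q) (ctilde q z (q powi n)) z
    :: ((uq, 'a) module, 'a \<Rightarrow> 'a) category)"
proof -
  define V :: "bool list \<Rightarrow> coeffs set" where "V w = model_space (length w)" for w
  define op where "op w = model.opm q z (bweight n w)" for w
  define s where "s w = uq_rep.uact fscale (op w) q" for w
  define P :: "(uq, 'a) module \<Rightarrow> bool"
    where "P M \<longleftrightarrow> in_O_block q (qpowers q) (ctilde q z (q powi n)) z M \<and> central_charge q z M" for M
  have md: "model q z (bweight n w)" for w by (rule model_bweight)
  have rep: "uq_rep fscale (V w) (op w) q" for w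
  proof -
    interpret model q z "length w" "bweight n w" by (rule md)
    show ?thesis unfolding V_def op_def by (rule model_rep.uq_rep_axioms)
  qed
  then have ops: "operators fscale (V w) (op w)" for w by (simp add: uq_rep_def)
  have s: "s w (cls q p) f = operators.act fscale (op w) p f" if f: "f \<in> V w" for w p f
    using uq_rep.uact_cls[OF rep f] by (simp add: s_def)
  have iso: "uq_iso fscale (V w) (op w) q (transport_module e (V w) (s w)) (inv_into (V w) e)" for w
    unfolding s_def by (rule uq_rep.uq_iso_transport[OF rep inj_on_subset[OF e subset_UNIV]])
  have sg: "s w (cls q (gvar g)) f = op w g f" and sc: "s w (scal q c) f = fscale c f"
    if f: "f \<in> V w" for w g c f
    using s[OF f] operators.act_gvar[OF ops] operators.act_const[OF ops] by (simp_all add: scal_def)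
  \<comment> \<open>\<open>n\<close> differs from \<open>-n - 3\<close> by parity, so the weight of
    a generator determines its letter.\<close>
  have bw: "w ! i' = v ! i" if "bweight n w i' = bweight n v i" "i' < length w" "i < length v" for v w i i'
  proof -
    have "n \<noteq> - n - 3" by presburger
    then show ?thesis using that powi_inj[of n "- n - 3"] powi_inj[of "- n - 3" n]
      by (auto simp: bweight_def split: if_splits)
  qed
  have "matrix_modules (Uq q) V s e P"
  proof (rule matrix_modules.intro)
    show "inj e" by (rule e)
    show "left_module (Uq q) (transport_module e (V w) (s w))" for w
      by (rule uq_iso.left_module_M[OF iso])
    show "f + g \<in> V w" if "f \<in> V w" "g \<in> V w" for f g w
      using fspace.subspace_add[OF operators.subspace_W[OF ops] that] .
    show "s w u f \<in> V w" if u: "u \<in> carrier (Uq q)" and f: "f \<in> V w" for w u f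
    proof -
      obtain p where "u = cls q p" using u by (auto simp: Uq_carrier)
      then show ?thesis using s[OF f] operators.act_closed[OF ops f] by simp
    qed
    show "delta (0, 0, i) \<in> V w" if "i < length w" for i w
      using that unfolding V_def by (rule model.delta_MW[OF md])
    show "\<exists>u\<in>carrier (Uq q). \<forall>w. \<forall>f\<in>V w. s w u f = fscale c f" for c
      using sc by (intro bexI[of _ "scal q c"]) auto
    show "mat_map v A f \<in> V w" if "A \<in> Hom mat_cat v w" "f \<in> V v" for v w A f
      using that unfolding V_def by (rule mat_map_model_space)
    show "mat_map v A (s v u f) = s w u (mat_map v A f)"
      if A: "A \<in> Hom mat_cat v w" and f: "f \<in> V v" and u: "u \<in> carrier (Uq q)" for v w A f u
    proof -
      have AV: "mat_map v A h \<in> V w" if "h \<in> V v" for h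
        using A that unfolding V_def by (rule mat_map_model_space)
      have Aop: "mat_map v A (op v g h) = op w g (mat_map v A h)" for g h
      proof
        fix x :: "nat \<times> nat \<times> nat"
        obtain k j i where x: "x = (k, j, i)" by (cases x)
        \<comment> \<open>A nonzero entry joins equal letters and hence equal weights, so all
          structure constants may be taken at the target index \<open>i\<close>.\<close>
        have b: "A i i' = 0 \<or> bweight n v i' = bweight n w i" for i'
          using A by (auto simp: bweight_def)
        have eq: "A i i' * op v g h (k, j, i') = (case g of
            gen_K \<Rightarrow> wt (bweight n w i) k j * (A i i' * h (k, j, i'))
          | gen_Kinv \<Rightarrow> 1 / wt (bweight n w i) k j * (A i i' * h (k, j, i'))
          | gen_Z \<Rightarrow> z * (A i i' * h (k, j, i'))
          | gen_X \<Rightarrow> - z * qn q (Suc k) * (A i i' * h (Suc k, j, i'))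
          | gen_Y \<Rightarrow> (if k = 0 then 0 else A i i' * h (k - 1, j, i'))
          | gen_F \<Rightarrow> (if j = 0 then 0 else A i i' * h (k, j - 1, i')) +
              (if k < 2 then 0 else f_coeff (bweight n w i) j * (A i i' * h (k - 2, j, i')))
          | gen_E \<Rightarrow> e_coeff q (bweight n w i) (Suc j) / q ^ k * (A i i' * h (k, Suc j, i')) +
              y_coeff q z (Suc (Suc k)) * (A i i' * h (Suc (Suc k), j, i')))" for i'
          using b[of i'] unfolding op_def
          by (cases g; elim disjE) (simp_all add: model.opm.simps[OF md] algebra_simps)
        show "mat_map v A (op v g h) x = op w g (mat_map v A h) x"
          unfolding x mat_map_def prod.case eq unfolding op_def
          by (cases g) (simp_all add: model.opm.simps[OF md] sum_distrib_left sum.distrib)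
      qed
      obtain p where p: "u = cls q p" using u by (auto simp: Uq_carrier)
      show ?thesis unfolding p s[OF f] s[OF AV[OF f]]
        by (rule act_intertwine[OF ops ops AV mat_map_add mat_map_scale Aop f])
    qed
    show "P (transport_module e (V w) (s w))" for w
      using model_in_block[of w n, folded V_def op_def, OF iso] by (simp add: P_def)
    show "\<exists>w \<psi>. bij_betw \<psi> (carrier M) (V w) \<and>
        (\<forall>x\<in>carrier M. \<forall>y\<in>carrier M. \<psi> (x \<oplus>\<^bsub>M\<^esub> y) = \<psi> x + \<psi> y) \<and>
        (\<forall>u\<in>carrier (Uq q). \<forall>x\<in>carrier M. \<psi> (u \<odot>\<^bsub>M\<^esub> x) = s w u (\<psi> x))"
      if M: "left_module (Uq q) M" "P M" for M
    proof -
      obtain w \<psi> where "uq_iso fscale (model_space (length w)) (model.opm q z (bweight n w)) q M \<psi>"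
        using block_model[OF M(1)] M(2) unfolding P_def by blast
      then interpret uq_iso fscale "V w" "op w" q M \<psi> by (simp add: V_def op_def)
      show ?thesis
        using \<phi>_bij \<phi>_add \<phi>_cls s by (intro exI[of _ w] exI[of _ \<psi>]) (auto simp: Uq_carrier)
    qed
    show "V v \<subseteq> N" if N: "N \<subseteq> V v" "0 \<in> N" "\<And>f g. \<lbrakk>f \<in> N; g \<in> N\<rbrakk> \<Longrightarrow> f + g \<in> N"
        "\<And>u f. \<lbrakk>u \<in> carrier (Uq q); f \<in> N\<rbrakk> \<Longrightarrow> s v u f \<in> N"
        "\<And>i. i < length v \<Longrightarrow> delta (0, 0, i) \<in> N" for v N
    proof -
      interpret model q z "length v" "bweight n v" by (rule md)
      have NV: "f \<in> V v" if "f \<in> N" for f using N(1) that by blast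
      have "fscale c f \<in> N" "op v g f \<in> N" if f: "f \<in> N" for c g f
        using N(4)[OF scal_closed f, of c] N(4)[OF cls_closed f, of "gvar g"]
        unfolding sc[OF NV[OF f]] sg[OF NV[OF f]] .
      then have "model_ops.invariant N"
        unfolding model_ops.invariant_def fspace.subspace_def using N(1-3) V_def op_def by auto
      then show ?thesis using model_generated N(5) unfolding V_def by blast
    qed
  next
    fix T v w
    assume T: "T \<in> V v \<rightarrow> V w" "\<And>f g. \<lbrakk>f \<in> V v; g \<in> V v\<rbrakk> \<Longrightarrow> T (f + g) = T f + T g"
      and Ts: "\<And>u f. \<lbrakk>u \<in> carrier (Uq q); f \<in> V v\<rbrakk> \<Longrightarrow> T (s v u f) = s w u (T f)"
    have TV: "T f \<in> V w" if "f \<in> V v" for f using T(1) that by blast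
    have Top: "T (op v g f) = op w g (T f)" and Tsc: "T (fscale c f) = fscale c (T f)"
      if f: "f \<in> V v" for g c f
      using Ts[OF cls_closed f, of "gvar g"] Ts[OF scal_closed f, of c]
      unfolding sg[OF f] sg[OF TV[OF f]] sc[OF f] sc[OF TV[OF f]] by simp_all
    fix i k j i' assume i: "i < length v" and nz: "T (delta (0, 0, i)) (k, j, i') \<noteq> 0"
    let ?d = "delta (0, 0, i) :: coeffs"
    interpret v: model q z "length v" "bweight n v" by (rule md)
    interpret w: model q z "length w" "bweight n w" by (rule md)
    have d: "?d \<in> V v" using i unfolding V_def by (rule v.delta_MW)
    have "T (fscale 0 ?d) = fscale 0 (T ?d)" using d by (rule Tsc)
    then have T0: "T 0 = 0" by simp
    have "op v gen_X ?d = 0" "op v gen_E ?d = 0" "op v gen_K ?d = fscale (bweight n v i) ?d"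
      unfolding op_def by (simp_all add: v.opm_delta)
    then have g: "op w gen_X (T ?d) = 0" "op w gen_E (T ?d) = 0"
        "op w gen_K (T ?d) = fscale (bweight n v i) (T ?d)"
      using Top[OF d] Tsc[OF d] T0 by metis+
    have ec: "e_coeff q (bweight n w i) (Suc j) \<noteq> 0" for i j
      using bweight_int[of n w i] e_coeff_nz[of "Suc j"] by auto
    have kj: "k = 0 \<and> j = 0"
    proof (rule ccontr)
      assume "\<not> (k = 0 \<and> j = 0)"
      then have "(k, j) \<noteq> (0, 0)" by simp
      from w.model_hw[OF g(1,2)[unfolded op_def] ec this] nz show False by blast
    qed
    have i': "i' < length w" using TV[OF d] nz by (auto simp: V_def model_space_def)
    have "bweight n w i' = bweight n v i"
      using fun_cong[OF g(3)[unfolded op_def], of "(0, 0, i')"] nz kj by simp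
    then show "k = 0 \<and> j = 0 \<and> i' < length w \<and> w ! i' = v ! i" using bw i i' kj by blast
  qed
  then show ?thesis
    using matrix_modules.presented unfolding O_block_charge_def P_def by blast
qed

end

section \<open>Modules over the sum of two copies of the complex numbers\<close>

lemma CC_simps [simp]:
  "carrier CC = UNIV" "u \<otimes>\<^bsub>CC\<^esub> v = (fst u * fst v, snd u * snd v)" "\<one>\<^bsub>CC\<^esub> = (1, 1)"
  "u \<oplus>\<^bsub>CC\<^esub> v = (fst u + fst v, snd u + snd v)" "\<zero>\<^bsub>CC\<^esub> = (0, 0)"
  by (auto simp: CC_def RDirProd_def DirProd_def ring_of_type_algebra_def monoid.defs split: prod.splits)

lemma CC_ring: "ring CC"
  unfolding CC_def by (intro RDirProd_ring field.is_ring ring_from_type_algebra)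

text \<open>The type of coefficient functions is that of the models, now concentrated at
  \<open>k = j = 0\<close>; so \<open>mat_map\<close> and \<open>matrix_modules\<close> serve both
  sides.\<close>

definition bspace :: "bool list \<Rightarrow> coeffs set" where
  "bspace w = {f. \<forall>k j i. f (k, j, i) \<noteq> 0 \<longrightarrow> k = 0 \<and> j = 0 \<and> i < length w}"

text \<open>The first factor acts on the summands with letter \<open>True\<close>, the second on
  those with letter \<open>False\<close>.\<close>

definition bsmult :: "bool list \<Rightarrow> complex \<times> complex \<Rightarrow> coeffs \<Rightarrow> coeffs" where
  "bsmult w u f = (\<lambda>(k, j, i). (if w ! i then fst u else snd u) * f (k, j, i))"

lemma bsmult_scalar: "bsmult w (c, c) f = fscale c f"
  by (auto simp: bsmult_def fun_eq_iff)

lemma bspace_sum: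
  assumes f: "f \<in> bspace w"
  shows "f = (\<Sum>i<length w. fscale (f (0, 0, i)) (delta (0, 0, i)))"
proof -
  have "f = (\<Sum>x\<in>(\<lambda>i. (0, 0, i)) ` {..<length w}. fscale (f x) (delta x))"
    using f by (intro finite_support_sum) (auto simp: bspace_def)
  then show ?thesis by (subst (asm) sum.reindex) (auto simp: inj_on_def)
qed

lemma bspace_subspace: "fspace.subspace (bspace w)"
  by (auto simp: fspace.subspace_def bspace_def) (metis add_0)+

lemma bspace_module:
  assumes "inj e" shows "left_module CC (transport_module e (bspace w) (bsmult w))"
proof (rule transport_left_module[OF CC_ring])
  show "inj_on e (bspace w)" using assms by (rule inj_on_subset) simp
  show "- v \<in> bspace w" if "v \<in> bspace w" for v using that by (rule fspace.subspace_neg[OF bspace_subspace])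
  show "v + v' \<in> bspace w" if "v \<in> bspace w" "v' \<in> bspace w" for v v'
    using that by (rule fspace.subspace_add[OF bspace_subspace])
  show "0 \<in> bspace w" by (rule fspace.subspace_0[OF bspace_subspace])
qed (auto simp: bspace_def bsmult_def fun_eq_iff algebra_simps)

lemma transport_module_finsum:
  assumes "left_module R (transport_module e W s)" and e: "inj_on e W"
    and W: "0 \<in> W" "\<And>v w. \<lbrakk>v \<in> W; w \<in> W\<rbrakk> \<Longrightarrow> v + w \<in> W"
    and A: "finite A" "\<And>i. i \<in> A \<Longrightarrow> f i \<in> W"
  shows "(\<Oplus>\<^bsub>transport_module e W s\<^esub>i\<in>A. e (f i)) = e (sum f A) \<and> sum f A \<in> W"
proof -
  interpret left_module R "transport_module e W s" by fact
  have "e 0 = \<zero>\<^bsub>transport_module e W s\<^esub>" by simp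
  show ?thesis using A
  proof (induction A rule: finite_induct)
    case (insert i A)
    have "(\<lambda>i. e (f i)) \<in> A \<rightarrow> carrier (transport_module e W s)" "e (f i) \<in> carrier (transport_module e W s)"
      using insert by auto
    then show ?case using insert W(2) by (simp add: M.finsum_insert inv_into_f_f[OF e])
  qed (simp add: W(1))
qed

text \<open>The idempotents \<open>(1, 0)\<close> and \<open>(0, 1)\<close> split the module. A
  basis chosen inside the union of their images provides coordinates, and its members are labelled
  by the image in which they lie.\<close>

lemma CC_module_coordinates:
  assumes "left_module CC M" "fin_dim CC_scal M (carrier M)"
  shows "\<exists>w \<psi>. bij_betw \<psi> (carrier M) (bspace w) \<and>
        (\<forall>x\<in>carrier M. \<forall>y\<in>carrier M. \<psi> (x \<oplus>\<^bsub>M\<^esub> y) = \<psi> x + \<psi> y) \<and>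
        (\<forall>u\<in>carrier CC. \<forall>x\<in>carrier M. \<psi> (u \<odot>\<^bsub>M\<^esub> x) = bsmult w u (\<psi> x))"
proof -
  interpret left_module CC M by fact
  interpret complex_space M "\<lambda>c x. (c, c) \<odot>\<^bsub>M\<^esub> x"
  proof unfold_locales
    fix c d x y
    assume x: "x \<in> carrier M"
    show "(c, c) \<odot>\<^bsub>M\<^esub> x \<in> carrier M" using x by (simp add: smult_closed)
    show "(c + d, c + d) \<odot>\<^bsub>M\<^esub> x = (c, c) \<odot>\<^bsub>M\<^esub> x \<oplus>\<^bsub>M\<^esub> (d, d) \<odot>\<^bsub>M\<^esub> x"
      using x smult_l_distr[of "(c, c)" "(d, d)" x] by simp
    show "(c * d, c * d) \<odot>\<^bsub>M\<^esub> x = (c, c) \<odot>\<^bsub>M\<^esub> ((d, d) \<odot>\<^bsub>M\<^esub> x)"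
      using x smult_assoc[of "(c, c)" "(d, d)" x] by simp
    show "(1, 1) \<odot>\<^bsub>M\<^esub> x = x" using x smult_one[of x] by simp
    assume y: "y \<in> carrier M"
    show "(c, c) \<odot>\<^bsub>M\<^esub> (x \<oplus>\<^bsub>M\<^esub> y) = (c, c) \<odot>\<^bsub>M\<^esub> x \<oplus>\<^bsub>M\<^esub> (c, c) \<odot>\<^bsub>M\<^esub> y"
      using x y by (simp add: smult_r_distr)
  qed
  obtain \<phi> :: "'a \<Rightarrow> ('a \<Rightarrow> complex) \<Rightarrow> complex" where inj: "inj_on \<phi> (carrier M)"
    and add: "\<And>x y. \<lbrakk>x \<in> carrier M; y \<in> carrier M\<rbrakk> \<Longrightarrow> \<phi> (x \<oplus>\<^bsub>M\<^esub> y) = \<phi> x + \<phi> y"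
    and scale: "\<And>c x. x \<in> carrier M \<Longrightarrow> \<phi> ((c, c) \<odot>\<^bsub>M\<^esub> x) = fscale c (\<phi> x)"
    using function_space_embedding by blast
  have zero: "\<phi> \<zero>\<^bsub>M\<^esub> = 0"
    using add[of "\<zero>\<^bsub>M\<^esub>" "\<zero>\<^bsub>M\<^esub>"] by simp
  define W where "W = \<phi> ` carrier M"
  have W: "fspace.subspace W"
  proof (rule fspace.subspaceI)
    show "0 \<in> W" unfolding W_def zero[symmetric] by simp
    show "x + y \<in> W" if xW: "x \<in> W" and yW: "y \<in> W" for x y
    proof -
      obtain x' where "x = \<phi> x'" "x' \<in> carrier M" using xW unfolding W_def by (rule imageE)
      moreover obtain y' where "y = \<phi> y'" "y' \<in> carrier M" using yW unfolding W_def by (rule imageE)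
      ultimately show ?thesis unfolding W_def using add[of x' y', symmetric] by (simp only:) (rule imageI, simp)
    qed
    show "fscale c x \<in> W" if xW: "x \<in> W" for c x
    proof -
      obtain x' where "x = \<phi> x'" "x' \<in> carrier M" using xW unfolding W_def by (rule imageE)
      then show ?thesis unfolding W_def using scale[of x' c, symmetric] by (simp only:) (rule imageI, simp)
    qed
  qed
  define H0 where "H0 b = \<phi> ` (\<lambda>x. (if b then (1, 0) else (0, 1)) \<odot>\<^bsub>M\<^esub> x) ` carrier M" for b
  have HW: "H0 b \<subseteq> W" for b by (auto simp: H0_def W_def smult_closed)
  obtain H where H: "H \<subseteq> H0 True \<union> H0 False" "fspace.independent H" "H0 True \<union> H0 False \<subseteq> fspace.span H"
    using fspace.maximal_independent_subset by blast
  have spanH: "fspace.span H = W"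
  proof
    show "fspace.span H \<subseteq> W" using H(1) HW by (intro fspace.span_minimal[OF _ W]) blast
    show "W \<subseteq> fspace.span H"
    proof
      fix v assume "v \<in> W"
      then obtain x where x: "x \<in> carrier M" "v = \<phi> x" by (auto simp: W_def)
      have "x = (1, 0) \<odot>\<^bsub>M\<^esub> x \<oplus>\<^bsub>M\<^esub> (0, 1) \<odot>\<^bsub>M\<^esub> x"
        using smult_l_distr[of "(1, 0)" "(0, 1)" x] smult_one[of x] x by simp
      then have "v = \<phi> ((1, 0) \<odot>\<^bsub>M\<^esub> x) + \<phi> ((0, 1) \<odot>\<^bsub>M\<^esub> x)"
        using x add[of "(1, 0) \<odot>\<^bsub>M\<^esub> x" "(0, 1) \<odot>\<^bsub>M\<^esub> x"] by (simp add: smult_closed)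
      moreover have "\<phi> ((1, 0) \<odot>\<^bsub>M\<^esub> x) \<in> H0 True" "\<phi> ((0, 1) \<odot>\<^bsub>M\<^esub> x) \<in> H0 False"
        using x by (auto simp: H0_def)
      ultimately show "v \<in> fspace.span H" using H(3) fspace.span_add by blast
    qed
  qed
  obtain B where B: "finite B" "B \<subseteq> carrier M"
    and fd: "carrier M = {(\<Oplus>\<^bsub>M\<^esub>b\<in>B. CC_scal (c b) \<odot>\<^bsub>M\<^esub> b) | c. True}"
    using assms(2) unfolding fin_dim_def by blast
  have "W \<subseteq> fspace.span (\<phi> ` B)"
  proof
    fix v assume "v \<in> W"
    then obtain c where v: "v = \<phi> (\<Oplus>\<^bsub>M\<^esub>b\<in>B. CC_scal (c b) \<odot>\<^bsub>M\<^esub> b)" unfolding W_def by (subst (asm) fd) blast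
    define Q where "Q D \<longleftrightarrow> \<phi> (\<Oplus>\<^bsub>M\<^esub>b\<in>D. CC_scal (c b) \<odot>\<^bsub>M\<^esub> b) \<in> fspace.span (\<phi> ` B)" for D
    have "Q D" if "finite D" "D \<subseteq> B" for D
      using that
    proof (induction D rule: finite_induct)
      case empty
      show ?case by (simp add: Q_def zero fspace.span_zero)
    next
      case (insert b D)
      then have b: "b \<in> carrier M" "(\<lambda>b. CC_scal (c b) \<odot>\<^bsub>M\<^esub> b) \<in> D \<rightarrow> carrier M"
        using B by (auto simp: smult_closed)
      have "\<phi> b \<in> fspace.span (\<phi> ` B)" "\<phi> (\<Oplus>\<^bsub>M\<^esub>b\<in>D. CC_scal (c b) \<odot>\<^bsub>M\<^esub> b) \<in> fspace.span (\<phi> ` B)"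
        using insert unfolding Q_def by (auto intro: fspace.span_base)
      then have "fscale (c b) (\<phi> b) + \<phi> (\<Oplus>\<^bsub>M\<^esub>b\<in>D. CC_scal (c b) \<odot>\<^bsub>M\<^esub> b) \<in> fspace.span (\<phi> ` B)"
        by (intro fspace.span_add fspace.span_scale)
      then show ?case
        using insert b unfolding Q_def
        by (simp add: M.finsum_insert add smult_closed M.finsum_closed scale CC_scal_def)
    qed
    then show "v \<in> fspace.span (\<phi> ` B)" using B(1) unfolding v Q_def by blast
  qed
  moreover have "H \<subseteq> W" using H(1) HW by blast
  ultimately have "finite H"
    using fspace.independent_span_bound[OF finite_imageI[OF B(1)] H(2)] by blast
  then obtain hs where hs: "set hs = H" "distinct hs" using finite_distinct_list by blast
  define w where "w = map (\<lambda>h. h \<in> H0 True) hs"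
  have len: "length w = length hs" by (simp add: w_def)
  have hbij: "bij_betw ((!) hs) {..<length w} H" using bij_betw_nth[OF hs(2)] hs(1) len by simp
  have hH: "hs ! i \<in> H" if "i < length w" for i using hs(1) that len by auto
  have hw: "hs ! i \<in> H0 (w ! i)" if "i < length w" for i
    using hH[OF that] H(1) that len by (cases "hs ! i \<in> H0 True") (auto simp: w_def)
  define \<Phi> :: "coeffs \<Rightarrow> ('a \<Rightarrow> complex) \<Rightarrow> complex"
    where "\<Phi> f = (\<Sum>i<length w. fscale (f (0, 0, i)) (hs ! i))" for f
  have \<Phi>_add: "\<Phi> (f + g) = \<Phi> f + \<Phi> g" for f g
    unfolding \<Phi>_def by (simp add: fspace.scale_left_distrib sum.distrib del: fscale_def)
  have \<Phi>_diff: "\<Phi> (f - g) = \<Phi> f - \<Phi> g" for f g :: coeffs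
    using \<Phi>_add[of "f - g" g] by (simp add: algebra_simps)
  have \<Phi>0: "f = 0" if f: "f \<in> bspace w" "\<Phi> f = 0" for f :: coeffs
  proof -
    define u where "u h = f (0, 0, inv_into {..<length w} ((!) hs) h)" for h
    have u: "u (hs ! i) = f (0, 0, i)" if "i < length w" for i
      using that hbij by (simp add: u_def bij_betw_def inv_into_f_f)
    have "\<Phi> f = (\<Sum>i<length w. fscale (u (hs ! i)) (hs ! i))"
      unfolding \<Phi>_def by (intro sum.cong) (simp_all only: u lessThan_iff)
    also have "\<dots> = (\<Sum>h\<in>H. fscale (u h) h)" by (rule sum.reindex_bij_betw[OF hbij])
    finally have "(\<Sum>h\<in>H. fscale (u h) h) = 0" using f(2) by (simp only:)
    then have "u h = 0" if "h \<in> H" for h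
      using that fspace.independentD[OF H(2) \<open>finite H\<close> subset_refl] by blast
    then have "f (0, 0, i) = 0" if "i < length w" for i using u[OF that] hH[OF that] by simp
    then have "f x = 0" for x using f(1) by (cases x) (auto simp: bspace_def)
    then show ?thesis by (simp add: fun_eq_iff)
  qed
  have \<Phi>_inj: "inj_on \<Phi> (bspace w)"
  proof (rule inj_onI)
    fix f g assume f: "f \<in> bspace w" "g \<in> bspace w" "\<Phi> f = \<Phi> g"
    have "f - g \<in> bspace w" using f(1,2) by (rule fspace.subspace_diff[OF bspace_subspace])
    moreover have "\<Phi> (f - g) = 0" unfolding \<Phi>_diff f(3) by (rule diff_self)
    ultimately have "f - g = 0" by (rule \<Phi>0)
    then show "f = g" by (simp only: right_minus_eq)
  qed
  have \<Phi>_surj: "\<Phi> ` bspace w = W"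
  proof
    show "\<Phi> ` bspace w \<subseteq> W"
      unfolding \<Phi>_def using \<open>H \<subseteq> W\<close> hH
      by (intro image_subsetI fspace.subspace_sum[OF W] fspace.subspace_scale[OF W]) auto
    show "W \<subseteq> \<Phi> ` bspace w"
    proof
      fix v assume "v \<in> W"
      then obtain u where v: "v = (\<Sum>h\<in>H. fscale (u h) h)"
        using spanH fspace.span_finite[OF \<open>finite H\<close>] by blast
      define f :: coeffs where "f = (\<lambda>(k, j, i). if k = 0 \<and> j = 0 \<and> i < length w then u (hs ! i) else 0)"
      have "v = (\<Sum>i<length w. fscale (u (hs ! i)) (hs ! i))"
        unfolding v by (rule sum.reindex_bij_betw[OF hbij, symmetric])
      also have "\<dots> = \<Phi> f" unfolding \<Phi>_def by (intro sum.cong) (auto simp: f_def)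
      finally have "v = \<Phi> f" .
      moreover have "f \<in> bspace w" by (auto simp: f_def bspace_def)
      ultimately show "v \<in> \<Phi> ` bspace w" using imageI[of f "bspace w" \<Phi>] by (simp only:)
    qed
  qed
  have act: "\<phi> (u \<odot>\<^bsub>M\<^esub> x) = \<Phi> (bsmult w u f)" if x: "x \<in> carrier M" "\<phi> x = \<Phi> f" for u x and f :: coeffs
  proof -
    define l where "l i = (if w ! i then fst u else snd u)" for i
    have "\<exists>y\<in>carrier M. hs ! i = \<phi> y \<and> \<phi> (u \<odot>\<^bsub>M\<^esub> y) = fscale (l i) (hs ! i)" if i: "i < length w" for i
    proof -
      let ?e = "if w ! i then (1, 0) else (0, 1)"
      obtain y where y: "y \<in> carrier M" "hs ! i = \<phi> (?e \<odot>\<^bsub>M\<^esub> y)"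
        using hw[OF i] by (auto simp: H0_def)
      have c: "?e \<odot>\<^bsub>M\<^esub> y \<in> carrier M" using y by (intro smult_closed) simp_all
      have "u \<otimes>\<^bsub>CC\<^esub> ?e = (l i, l i) \<otimes>\<^bsub>CC\<^esub> ?e" by (simp add: l_def)
      then have "u \<odot>\<^bsub>M\<^esub> (?e \<odot>\<^bsub>M\<^esub> y) = (l i, l i) \<odot>\<^bsub>M\<^esub> (?e \<odot>\<^bsub>M\<^esub> y)"
        using y(1) smult_assoc[of u ?e y] smult_assoc[of "(l i, l i)" ?e y] by (simp only: CC_simps(1) UNIV_I)
      then have "\<phi> (u \<odot>\<^bsub>M\<^esub> (?e \<odot>\<^bsub>M\<^esub> y)) = fscale (l i) (hs ! i)" using scale[OF c] y(2) by (simp only:)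
      then show ?thesis using c y(2) by blast
    qed
    then obtain Y where Y: "\<And>i. i < length w \<Longrightarrow> Y i \<in> carrier M" "\<And>i. i < length w \<Longrightarrow> hs ! i = \<phi> (Y i)"
        "\<And>i. i < length w \<Longrightarrow> \<phi> (u \<odot>\<^bsub>M\<^esub> Y i) = fscale (l i) (hs ! i)" by metis
    \<comment> \<open>The action of \<open>u\<close> is defined on \<open>M\<close>, not on function
      values. Partial sums therefore come with a preimage \<open>y\<close> in \<open>M\<close> and
      with the value of \<open>\<phi>\<close> at \<open>u y\<close>.\<close>
    define Q where "Q n \<longleftrightarrow> (\<exists>y\<in>carrier M. \<phi> y = (\<Sum>i<n. fscale (f (0, 0, i)) (hs ! i)) \<and>
      \<phi> (u \<odot>\<^bsub>M\<^esub> y) = (\<Sum>i<n. fscale (bsmult w u f (0, 0, i)) (hs ! i)))" for n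
    have "Q n" if "n \<le> length w" for n using that
    proof (induction n)
      case 0
      show ?case unfolding Q_def
        by (rule bexI[of _ "\<zero>\<^bsub>M\<^esub>"]) (simp_all add: zero smult_zero_right)
    next
      case (Suc n)
      then obtain y where y: "y \<in> carrier M" "\<phi> y = (\<Sum>i<n. fscale (f (0, 0, i)) (hs ! i))"
          "\<phi> (u \<odot>\<^bsub>M\<^esub> y) = (\<Sum>i<n. fscale (bsmult w u f (0, 0, i)) (hs ! i))"
        unfolding Q_def by auto
      have n: "n < length w" using Suc by simp
      let ?c = "f (0, 0, n)"
      have c: "(?c, ?c) \<odot>\<^bsub>M\<^esub> Y n \<in> carrier M" "u \<odot>\<^bsub>M\<^esub> Y n \<in> carrier M" "u \<odot>\<^bsub>M\<^esub> y \<in> carrier M"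
          "u \<odot>\<^bsub>M\<^esub> ((?c, ?c) \<odot>\<^bsub>M\<^esub> Y n) \<in> carrier M"
        using Y(1)[OF n] y(1) by (simp_all add: smult_closed)
      have "u \<otimes>\<^bsub>CC\<^esub> (?c, ?c) = (?c, ?c) \<otimes>\<^bsub>CC\<^esub> u" by simp
      then have "u \<odot>\<^bsub>M\<^esub> ((?c, ?c) \<odot>\<^bsub>M\<^esub> Y n) = (?c, ?c) \<odot>\<^bsub>M\<^esub> (u \<odot>\<^bsub>M\<^esub> Y n)"
        using Y(1)[OF n] smult_assoc[of u "(?c, ?c)" "Y n"] smult_assoc[of "(?c, ?c)" u "Y n"]
        by (simp only: CC_simps(1) UNIV_I)
      then have "\<phi> (u \<odot>\<^bsub>M\<^esub> ((?c, ?c) \<odot>\<^bsub>M\<^esub> Y n)) = fscale ?c (fscale (l n) (hs ! n))"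
        using scale[OF c(2)] Y(3)[OF n] by (simp only:)
      also have "\<dots> = fscale (bsmult w u f (0, 0, n)) (hs ! n)"
        by (simp add: fspace.scale_scale bsmult_def l_def mult.commute del: fscale_def)
      finally have 1: "\<phi> (u \<odot>\<^bsub>M\<^esub> ((?c, ?c) \<odot>\<^bsub>M\<^esub> Y n)) = fscale (bsmult w u f (0, 0, n)) (hs ! n)" .
      have 2: "\<phi> ((?c, ?c) \<odot>\<^bsub>M\<^esub> Y n) = fscale ?c (hs ! n)"
        using scale[OF Y(1)[OF n]] Y(2)[OF n] by (simp only:)
      have "u \<odot>\<^bsub>M\<^esub> (y \<oplus>\<^bsub>M\<^esub> (?c, ?c) \<odot>\<^bsub>M\<^esub> Y n) = u \<odot>\<^bsub>M\<^esub> y \<oplus>\<^bsub>M\<^esub> u \<odot>\<^bsub>M\<^esub> ((?c, ?c) \<odot>\<^bsub>M\<^esub> Y n)"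
        using y(1) c(1) by (simp add: smult_r_distr)
      then show ?case
        unfolding Q_def sum.lessThan_Suc
        using add[OF y(1) c(1)] add[OF c(3,4)] y c(1) 1 2
        by (intro bexI[of _ "y \<oplus>\<^bsub>M\<^esub> (?c, ?c) \<odot>\<^bsub>M\<^esub> Y n"]) (simp_all only: M.a_closed simp_thms)
    qed
    then obtain y where y: "y \<in> carrier M" "\<phi> y = \<Phi> f" "\<phi> (u \<odot>\<^bsub>M\<^esub> y) = \<Phi> (bsmult w u f)"
      unfolding Q_def \<Phi>_def by blast
    then have "y = x" using x inj by (simp add: inj_on_def)
    then show ?thesis using y by simp
  qed
  have b: "bij_betw \<Phi> (bspace w) W" using \<Phi>_inj \<Phi>_surj by (simp add: bij_betw_def)
  define \<psi> where "\<psi> = inv_into (bspace w) \<Phi> \<circ> \<phi>"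
  have "bij_betw \<psi> (carrier M) (bspace w)"
    unfolding \<psi>_def using inj
    by (intro bij_betw_trans[OF _ bij_betw_inv_into[OF b]]) (simp add: bij_betw_def W_def)
  moreover have \<psi>: "\<psi> x \<in> bspace w" "\<Phi> (\<psi> x) = \<phi> x" if "x \<in> carrier M" for x
  proof -
    have "\<phi> x \<in> \<Phi> ` bspace w" using that \<Phi>_surj by (simp add: W_def)
    then show "\<psi> x \<in> bspace w" "\<Phi> (\<psi> x) = \<phi> x" by (simp_all add: \<psi>_def inv_into_into f_inv_into_f)
  qed
  have \<psi>I: "\<psi> x = f" if "\<phi> x = \<Phi> f" "f \<in> bspace w" for x and f :: coeffs
    using that inv_into_f_f[OF \<Phi>_inj] by (simp add: \<psi>_def)
  have "\<psi> (x \<oplus>\<^bsub>M\<^esub> y) = \<psi> x + \<psi> y" if "x \<in> carrier M" "y \<in> carrier M" for x y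
  proof (rule \<psi>I)
    show "\<phi> (x \<oplus>\<^bsub>M\<^esub> y) = \<Phi> (\<psi> x + \<psi> y)"
      unfolding \<Phi>_add \<psi>(2)[OF that(1)] \<psi>(2)[OF that(2)] using that by (rule add)
    show "\<psi> x + \<psi> y \<in> bspace w"
      using \<psi>(1)[OF that(1)] \<psi>(1)[OF that(2)] by (rule fspace.subspace_add[OF bspace_subspace])
  qed
  moreover have "\<psi> (u \<odot>\<^bsub>M\<^esub> x) = bsmult w u (\<psi> x)" if "x \<in> carrier M" for u x
  proof (rule \<psi>I)
    show "\<phi> (u \<odot>\<^bsub>M\<^esub> x) = \<Phi> (bsmult w u (\<psi> x))" using that \<psi>(2)[OF that, symmetric] by (rule act)
    show "bsmult w u (\<psi> x) \<in> bspace w" using \<psi>(1)[OF that] by (auto simp: bspace_def bsmult_def)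
  qed
  ultimately show ?thesis by blast
qed

lemma bspace_fin_dim:
  assumes e: "inj e"
  defines "T w \<equiv> transport_module e (bspace w) (bsmult w)"
  shows "fin_dim CC_scal (T w) (carrier (T w))"
proof -
  have lm: "left_module CC (T w)" unfolding T_def by (rule bspace_module[OF e])
  have e': "inj_on e (bspace w)" using e by (rule inj_on_subset) simp
  have Tc: "carrier (T w) = e ` bspace w" by (simp add: T_def)
  have T: "CC_scal c \<odot>\<^bsub>T w\<^esub> e f = e (fscale c f)" if "f \<in> bspace w" for c f
    unfolding T_def CC_scal_def transport_module_simps inv_into_f_f[OF e' that] bsmult_scalar ..
  interpret left_module CC "T w" by (rule lm)
  define d where "d i = (delta (0, 0, i) :: coeffs)" for i :: nat
  have d: "d i \<in> bspace w" "fscale c (d i) \<in> bspace w" if "i < length w" for i c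
    using that by (auto simp: bspace_def delta_def d_def)
  have "d i \<noteq> d i'" if "i \<noteq> i'" for i i'
  proof
    assume "d i = d i'"
    from fun_cong[OF this, of "(0, 0, i)"] that show False by (simp add: d_def delta_def)
  qed
  then have inj: "inj_on (\<lambda>i. e (d i)) {..<length w}"
    using injD[OF e] by (intro inj_onI) metis
  let ?B = "(\<lambda>i. e (d i)) ` {..<length w}"
  have fs: "(\<Oplus>\<^bsub>T w\<^esub>b\<in>?B. CC_scal (c b) \<odot>\<^bsub>T w\<^esub> b) = e (\<Sum>i<length w. fscale (c (e (d i))) (d i))
      \<and> (\<Sum>i<length w. fscale (c (e (d i))) (d i)) \<in> bspace w" for c
  proof -
    have "(\<Oplus>\<^bsub>T w\<^esub>b\<in>?B. CC_scal (c b) \<odot>\<^bsub>T w\<^esub> b)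
      = (\<Oplus>\<^bsub>T w\<^esub>i\<in>{..<length w}. CC_scal (c (e (d i))) \<odot>\<^bsub>T w\<^esub> e (d i))"
      using d T Tc by (intro M.finsum_reindex[OF _ inj]) auto
    also have "\<dots> = (\<Oplus>\<^bsub>T w\<^esub>i\<in>{..<length w}. e (fscale (c (e (d i))) (d i)))"
      using d T Tc by (intro M.finsum_cong') auto
    finally show ?thesis
      using transport_module_finsum[OF lm[unfolded T_def] e' fspace.subspace_0[OF bspace_subspace]
        fspace.subspace_add[OF bspace_subspace], of "{..<length w}" "\<lambda>i. fscale (c (e (d i))) (d i)"] d(2)
      by (simp only: T_def finite_lessThan lessThan_iff simp_thms)
  qed
  have "carrier (T w) = {(\<Oplus>\<^bsub>T w\<^esub>b\<in>?B. CC_scal (c b) \<odot>\<^bsub>T w\<^esub> b) | c. True}" (is "_ = ?R")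
  proof
    show "?R \<subseteq> carrier (T w)" using fs Tc by auto
    show "carrier (T w) \<subseteq> ?R"
    proof
      fix y assume "y \<in> carrier (T w)"
      then obtain f where f: "f \<in> bspace w" "y = e f" by (auto simp: T_def)
      define c where "c b = f (0, 0, inv_into {..<length w} (\<lambda>i. e (d i)) b)" for b
      have "f = (\<Sum>i<length w. fscale (f (0, 0, i)) (d i))" unfolding d_def by (rule bspace_sum[OF f(1)])
      also have "\<dots> = (\<Sum>i<length w. fscale (c (e (d i))) (d i))"
        by (intro sum.cong) (simp_all add: c_def inv_into_f_f[OF inj])
      finally have "y = (\<Oplus>\<^bsub>T w\<^esub>b\<in>?B. CC_scal (c b) \<odot>\<^bsub>T w\<^esub> b)"
        using conjunct1[OF fs[of c]] f(2) by (simp only:)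
      then show "y \<in> ?R" unfolding mem_Collect_eq by (intro exI[of _ c] conjI TrueI)
    qed
  qed
  moreover have "?B \<subseteq> carrier (T w)" using d(1) by (auto simp: T_def)
  ultimately show ?thesis
    unfolding fin_dim_def by (intro exI[of _ ?B] conjI finite_imageI finite_lessThan)
qed

lemma CC_presented:
  fixes e :: "coeffs \<Rightarrow> 'a"
  assumes e: "inj e"
  shows "presented_by mat_cat (fd_left_mod_cat CC CC_scal :: ((complex \<times> complex, 'a) module, 'a \<Rightarrow> 'a) category)"
proof -
  have "matrix_modules CC bspace bsmult e (\<lambda>M. fin_dim CC_scal M (carrier M))"
  proof (rule matrix_modules.intro)
    show "inj e" by (rule e)
    show lm: "left_module CC (transport_module e (bspace w) (bsmult w))" for w
      by (rule bspace_module[OF e])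
    show "f + g \<in> bspace w" if "f \<in> bspace w" "g \<in> bspace w" for f g w
      using that by (rule fspace.subspace_add[OF bspace_subspace])
    show "bsmult w u f \<in> bspace w" if "f \<in> bspace w" for w u f
      using that by (auto simp: bspace_def bsmult_def)
    show d: "delta (0, 0, i) \<in> bspace w" if "i < length w" for i w
      using that by (auto simp: bspace_def delta_def)
    show "\<exists>u\<in>carrier CC. \<forall>w. \<forall>f\<in>bspace w. bsmult w u f = fscale c f" for c
      using bsmult_scalar[of _ c] by (intro bexI[of _ "(c, c)"]) simp_all
    show "mat_map v A f \<in> bspace w" if A: "A \<in> Hom mat_cat v w" and f: "f \<in> bspace v" for v w A f
    proof -
      have "k = 0 \<and> j = 0 \<and> i < length w" if "mat_map v A f (k, j, i) \<noteq> 0" for k j i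
      proof -
        obtain i' where "A i i' * f (k, j, i') \<noteq> 0"
          using \<open>mat_map v A f (k, j, i) \<noteq> 0\<close> by (auto simp: mat_map_def elim: sum.not_neutral_contains_not_neutral)
        then show ?thesis using A f by (auto simp: bspace_def)
      qed
      then show ?thesis by (simp add: bspace_def)
    qed
    show "mat_map v A (bsmult v u f) = bsmult w u (mat_map v A f)" if A: "A \<in> Hom mat_cat v w" for v w A f u
    proof -
      have "A i i' * bsmult v u f (k, j, i') = (if w ! i then fst u else snd u) * (A i i' * f (k, j, i'))" for k j i i'
        using A by (cases "A i i' = 0") (auto simp: bsmult_def)
      then have "mat_map v A (bsmult v u f) x = bsmult w u (mat_map v A f) x" for x
        by (cases x) (simp only: mat_map_def prod.case bsmult_def[of w] sum_distrib_left)
      then show ?thesis by (rule ext)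
    qed
    show "fin_dim CC_scal (transport_module e (bspace w) (bsmult w)) (carrier (transport_module e (bspace w) (bsmult w)))" for w
      by (rule bspace_fin_dim[OF e])
    show "\<exists>w \<psi>. bij_betw \<psi> (carrier M) (bspace w) \<and>
        (\<forall>x\<in>carrier M. \<forall>y\<in>carrier M. \<psi> (x \<oplus>\<^bsub>M\<^esub> y) = \<psi> x + \<psi> y) \<and>
        (\<forall>u\<in>carrier CC. \<forall>x\<in>carrier M. \<psi> (u \<odot>\<^bsub>M\<^esub> x) = bsmult w u (\<psi> x))"
      if "left_module CC M" "fin_dim CC_scal M (carrier M)" for M :: "(complex \<times> complex, 'a) module"
      using that by (rule CC_module_coordinates)
    show "bspace v \<subseteq> N" if N: "N \<subseteq> bspace v" "0 \<in> N" "\<And>f g. \<lbrakk>f \<in> N; g \<in> N\<rbrakk> \<Longrightarrow> f + g \<in> N"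
        "\<And>u f. \<lbrakk>u \<in> carrier CC; f \<in> N\<rbrakk> \<Longrightarrow> bsmult v u f \<in> N"
        "\<And>i. i < length v \<Longrightarrow> delta (0, 0, i) \<in> N" for v N
    proof
      fix f assume f: "f \<in> bspace v"
      have "fspace.subspace N"
        unfolding fspace.subspace_def bsmult_scalar[of v, symmetric] using N(2-4) by simp
      then have "(\<Sum>i<length v. fscale (f (0, 0, i)) (delta (0, 0, i))) \<in> N"
        using N(5) by (intro fspace.subspace_sum fspace.subspace_scale) auto
      then show "f \<in> N" by (subst bspace_sum[OF f])
    qed
  next
    fix T v w
    assume T: "T \<in> bspace v \<rightarrow> bspace w" "\<And>f g. \<lbrakk>f \<in> bspace v; g \<in> bspace v\<rbrakk> \<Longrightarrow> T (f + g) = T f + T g"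
      and Ts: "\<And>u f. \<lbrakk>u \<in> carrier CC; f \<in> bspace v\<rbrakk> \<Longrightarrow> T (bsmult v u f) = bsmult w u (T f)"
    fix i k j i' assume i: "i < length v" and nz: "T (delta (0, 0, i)) (k, j, i') \<noteq> 0"
    let ?d = "delta (0, 0, i) :: coeffs"
    have dv: "?d \<in> bspace v" using i by (auto simp: bspace_def delta_def)
    then have "T ?d \<in> bspace w" using T(1) by blast
    then have kj: "k = 0 \<and> j = 0 \<and> i' < length w" using nz by (simp add: bspace_def)
    \<comment> \<open>The idempotent that fixes the generator \<open>?d\<close>. It kills every
      coordinate with the other letter, so the image of \<open>?d\<close> is supported on the letter
      of \<open>?d\<close>.\<close>
    let ?u = "if v ! i then (1, 0) else (0, 1) :: complex \<times> complex"
    have "bsmult v ?u ?d = ?d" by (auto simp: bsmult_def delta_def fun_eq_iff)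
    then have "T ?d = bsmult w ?u (T ?d)" using Ts[OF _ dv, of ?u] by simp
    then have "T ?d (k, j, i') = (if w ! i' then fst ?u else snd ?u) * T ?d (k, j, i')"
      unfolding bsmult_def by (subst (asm) fun_eq_iff) (drule spec[of _ "(k, j, i')"], simp)
    then have "(if w ! i' then fst ?u else snd ?u) \<noteq> 0" using nz by auto
    then have "w ! i' = v ! i" by (auto split: if_splits)
    then show "k = 0 \<and> j = 0 \<and> i' < length w \<and> w ! i' = v ! i" using kj by simp
  qed
  then show ?thesis unfolding fd_left_mod_cat_def by (rule matrix_modules.presented)
qed

theorem proposition13:
  fixes q z :: complex
    and emb1 :: "complex \<Rightarrow> 'a" and emb2 :: "complex \<Rightarrow> 'b"
  assumes q_nonzero: "q \<noteq> 0"
    and q_not_root_of_unity: "\<forall>n::nat. n > 0 \<longrightarrow> q ^ n \<noteq> 1"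
    and z_nonzero: "z \<noteq> 0"
    and universes: "inj emb1" "inj emb2"
  shows
    "(\<forall>n::int. simple_left_module (Uq q) (verma q (q powi n) z)) \<and>
     (\<forall>n::int.
        simple_object (O_block q (qpowers q) (ctilde q z (q powi n)) z)
          (verma q (q powi n) z) \<and>
        simple_object (O_block q (qpowers q) (ctilde q z (q powi n)) z)
          (verma q (q powi (- n - 3)) z)) \<and>
     (\<forall>n::int.
        equivalent_categories
          (O_block_charge q (qpowers q) (ctilde q z (q powi n)) z
             :: ((uq, 'a) module, 'a \<Rightarrow> 'a) category)
          (fd_left_mod_cat CC CC_scal
             :: ((complex \<times> complex, 'b) module, 'b \<Rightarrow> 'b) category))"
proof -
  interpret generic_q q z
    by unfold_locales (use q_nonzero q_not_root_of_unity z_nonzero in simp_all)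
  have verma: "simple_left_module (Uq q) (verma q (bweight n [b] 0) z) \<and>
      in_O_block q (qpowers q) (ctilde q z (q powi n)) z (verma q (bweight n [b] 0) z)" for n b
  proof -
    obtain \<psi> where "uq_iso fscale (model_space (length [b])) (model.opm q z (bweight n [b])) q
        (verma q (bweight n [b] 0) z) \<psi>"
      using verma_model by blast
    then show ?thesis by (intro conjI model_simple model_in_block)
  qed
  \<comment> \<open>The two Verma modules correspond to the two words of length one.\<close>
  have t: "bweight n [True] 0 = q powi n" and f: "bweight n [False] 0 = q powi (- n - 3)" for n
    by (simp_all add: bweight_def)
  \<comment> \<open>Composed with the given injections, this places the models into any type that
    contains the complex numbers.\<close>
  obtain i :: "coeffs \<Rightarrow> complex" where i: "inj i" using inj_countable_functions by blast
  have "equivalent_categories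
      (O_block_charge q (qpowers q) (ctilde q z (q powi n)) z :: ((uq, 'a) module, 'a \<Rightarrow> 'a) category)
      (fd_left_mod_cat CC CC_scal :: ((complex \<times> complex, 'b) module, 'b \<Rightarrow> 'b) category)" for n
    by (rule presented_by_equivalent[OF block_presented CC_presented])
       (rule inj_compose[OF universes(1) i] inj_compose[OF universes(2) i])+
  moreover have s: "simple_object (O_block q (qpowers q) (ctilde q z (q powi n)) z) (verma q (bweight n [b] 0) z)" for n b
    using verma[of n b] by (intro simple_object_O_block) simp_all
  moreover have "simple_left_module (Uq q) (verma q (q powi n) z)" for n
    using verma[of n True] unfolding t by (rule conjunct1)
  ultimately show ?thesis using s[of _ True, unfolded t] s[of _ False, unfolded f] by blast
qed

end
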